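(* Let $H$ be a real self-adjoint operator in $\mathcal H$. Suppose $H$ has an eigenvalue $\lambda_0$ of finite multiplicity which is embedded in the continuous spectrum of $H$ and isolated in $\sigma_{pp}(H)$, with corresponding eigenspace contained in $\bigcap_{s\ge 0}\mathcal H_s$. Let $k\ge 1$ be an integer and suppose that $\overline H=H+P_0$ satisfies the $C^k$ limiting absorption hypothesis near $\lambda_0$ with threshold $s_1\ge 0$. Fix $s>s_1$, let $\delta_1>0$ be the corresponding number in that hypothesis, and let $X_s$ be a perturbation space. Suppose: (a) the multiplicity of the continuous spectrum of $H$ at every $\lambda\in(\lambda_0-\delta_1,\lambda_0+\delta_1)$ is equal to $m<\infty$; (b) $\lambda_0$ is a simple eigenvalue of $H$ with real normalized eigenvector $\varphi_0$, and the complex linear span of $\{\delta(\overline H-\lambda_0)W\varphi_0 : W\in X_s\}$ is $\operatorname{Ran}\delta(\overline H-\lambda_0)$; (c) $\dim X_s\ge m$. For $\delta>0$ let $$\mathcal M_{\delta,s}:=\{W\in X_s : \text{there exists } \lambda\in(\lambda_0-\delta,\lambda_0+\delta)\text{ such that }\lambda\text{ is an eigenvalue of }H+W\}.$$ Then there exist a number $\delta>0$ and a neighborhood $\mathcal O$ of $0$ in $X_s$ such that $\mathcal M_{\delta,s}\cap\mathcal O$ is a $C^k$ manifold in $X_s$ of codimension $m$. Moreover, if $W\in\mathcal M_{\delta,s}\cap\mathcal O$, then $H+W$ has exactly one eigenvalue in the interval $(\lambda_0-\delta,\lambda_0+\delta)$, and it is simple.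
   Context: Setting. $\mathcal H$ is a complex Hilbert space with an antiunitary involution $C$: $C$ is conjugate-linear, $C^2=I$ and $\langle Cf,Cg\rangle=\overline{\langle f,g\rangle}$. A vector $f$ is real if $Cf=f$; an operator $T$ is real if $TC=CT$. A scale of Hilbert spaces $\mathcal H_s$, $s\in\mathbb R$, is given with $\mathcal H_0=\mathcal H$; the dual of $\mathcal H_s$ is $\mathcal H_{-s}$ via the inner product of $\mathcal H$ (the pairing is also written $\langle\cdot,\cdot\rangle$); $\mathcal H_s$ is continuously embedded in $\mathcal H_t$ for $s\ge t$, and dense in it for $s>t$; $\|f\|_{\mathcal H}\le\|f\|_{\mathcal H_s}$ for $s>0$; and $C:\mathcal H_s\to\mathcal H_s$ is bounded for every $s$. $\mathcal L(X,Y)$ denotes bounded linear operators. $\sigma_{pp}(H)$ is the set of eigenvalues of $H$. The continuous spectrum $\sigma_c(H)$ is the spectrum of $H$ restricted to the orthogonal complement of the closed span of its eigenvectors. $P_0$ is the orthogonal projection in $\mathcal H$ onto the eigenspace of $H$ for $\lambda_0$, and $\overline H:=H+P_0$. $C^k$ limiting absorption hypothesis with threshold $s_1\ge0$: for any $s>s_1$ there is $\delta_1>0$ such that the norm limits $(\overline H-\lambda\pm i0)^{-1}:=\lim_{\epsilon\downarrow0}(\overline H-\lambda\pm i\epsilon)^{-1}$ exist in $\mathcal L(\mathcal H_s,\mathcal H_{-s})$ and are $C^k$ in $\lambda$ in the norm topology for $\lambda\in(\lambda_0-\delta_1,\lambda_0+\delta_1)$. $\delta(\overline H-\lambda):=\frac1{2\pi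 i}\left((\overline H-\lambda-i0)^{-1}-(\overline H-\lambda+i0)^{-1}\right)\in\mathcal L(\mathcal H_s,\mathcal H_{-s})$. The multiplicity of the continuous spectrum of $H$ at $\lambda$ is by definition $\dim\operatorname{Ran}\delta(\overline H-\lambda)$. Perturbation space $X_s$: a real Banach space whose elements are bounded self-adjoint operators on $\mathcal H$, with $X_s\subset\{W\in\mathcal L(\mathcal H_{-s},\mathcal H_s): W\text{ is real and self-adjoint on }\mathcal H\}$, the inclusion being continuous. A $C^k$ manifold of codimension $m$ in a real Banach space $X$ is a subset which near each of its points is the graph of a $C^k$ map from an open subset of a closed subspace of codimension $m$ into an $m$-dimensional complement. *)

theory Defs
  imports "HOL-Analysis.Analysis"
begin

class complex_vector = ab_group_add +
  fixes scaleC :: "complex \<Rightarrow> 'a \<Rightarrow> 'a"  (infixr "*\<^sub>C" 75)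
  assumes scaleC_add_right: "a *\<^sub>C (x + y) = a *\<^sub>C x + a *\<^sub>C y"
    and scaleC_add_left: "(a + b) *\<^sub>C x = a *\<^sub>C x + b *\<^sub>C x"
    and scaleC_scaleC: "a *\<^sub>C b *\<^sub>C x = (a * b) *\<^sub>C x"
    and scaleC_one: "1 *\<^sub>C x = x"

global_interpretation complex_vector: vector_space "scaleC :: complex \<Rightarrow> 'a \<Rightarrow> 'a::complex_vector"
  by unfold_locales (fact scaleC_add_right scaleC_add_left scaleC_scaleC scaleC_one)+

abbreviation csubspace :: "'a::complex_vector set \<Rightarrow> bool"
  where "csubspace \<equiv> complex_vector.subspace"

abbreviation cspan :: "'a::complex_vector set \<Rightarrow> 'a set"
  where "cspan \<equiv> complex_vector.span"

(* A relation instead of the function dim, which is 0 on infinite-dimensional spaces. *)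
definition has_cdim :: "'a::complex_vector set \<Rightarrow> nat \<Rightarrow> bool"
  where "has_cdim V n \<longleftrightarrow>
    (\<exists>B. finite B \<and> card B = n \<and> \<not> complex_vector.dependent B \<and> cspan B = V)"

definition has_rdim :: "'a::real_vector set \<Rightarrow> nat \<Rightarrow> bool"
  where "has_rdim V n \<longleftrightarrow> (\<exists>B. finite B \<and> card B = n \<and> independent B \<and> span B = V)"


section \<open>Hilbert spaces as subspaces of an ambient complex vector space\<close>

text \<open>
  All the spaces of a scale live in one ambient complex vector space without topology (for
  instance the union of the scale), so that the embeddings of the scale are inclusions.
  Operators are functions on the ambient type, of which only the values on the relevant
  space or domain matter.
\<close>

record 'a hspace =
  vecs :: "'a set"
  hip :: "'a \<Rightarrow> 'a \<Rightarrow> complex"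

definition hnorm :: "('a, 'm) hspace_scheme \<Rightarrow> 'a \<Rightarrow> real"
  where "hnorm X f = sqrt (Re (hip X f f))"

(* The inner product is linear in its first argument. *)
definition hilbert_space :: "('a::complex_vector, 'm) hspace_scheme \<Rightarrow> bool"
  where "hilbert_space X \<longleftrightarrow>
    csubspace (vecs X) \<and>
    (\<forall>f\<in>vecs X. \<forall>g\<in>vecs X. \<forall>h\<in>vecs X. hip X (f + g) h = hip X f h + hip X g h) \<and>
    (\<forall>c. \<forall>f\<in>vecs X. \<forall>g\<in>vecs X. hip X (c *\<^sub>C f) g = c * hip X f g) \<and>
    (\<forall>f\<in>vecs X. \<forall>g\<in>vecs X. hip X g f = cnj (hip X f g)) \<and>
    (\<forall>f\<in>vecs X. f \<noteq> 0 \<longrightarrow> Re (hip X f f) > 0) \<and>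
    (\<forall>\<sigma> :: nat \<Rightarrow> 'a. range \<sigma> \<subseteq> vecs X \<longrightarrow>
       (\<forall>e>0. \<exists>N. \<forall>i\<ge>N. \<forall>j\<ge>N. hnorm X (\<sigma> i - \<sigma> j) < e) \<longrightarrow>
       (\<exists>f\<in>vecs X. (\<lambda>i. hnorm X (\<sigma> i - f)) \<longlonglongrightarrow> 0))"

definition hclosure :: "('a::complex_vector, 'm) hspace_scheme \<Rightarrow> 'a set \<Rightarrow> 'a set"
  where "hclosure X A = {f \<in> vecs X. \<forall>e>0. \<exists>g\<in>A. hnorm X (f - g) < e}"

definition dense_in :: "('a::complex_vector, 'm) hspace_scheme \<Rightarrow> 'a set \<Rightarrow> bool"
  where "dense_in X A \<longleftrightarrow> A \<subseteq> vecs X \<and> hclosure X A = vecs X"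

definition orth_compl :: "('a, 'm) hspace_scheme \<Rightarrow> 'a set \<Rightarrow> 'a set"
  where "orth_compl X A = {g \<in> vecs X. \<forall>f\<in>A. hip X f g = 0}"

definition orth_proj :: "('a::complex_vector, 'm) hspace_scheme \<Rightarrow> 'a set \<Rightarrow> 'a \<Rightarrow> 'a"
  where "orth_proj X E f = (THE g. g \<in> E \<and> (\<forall>h\<in>E. hip X (f - g) h = 0))"

definition clinear_on :: "'a::complex_vector set \<Rightarrow> ('a \<Rightarrow> 'a) \<Rightarrow> bool"
  where "clinear_on D T \<longleftrightarrow>
    (\<forall>f\<in>D. \<forall>g\<in>D. T (f + g) = T f + T g) \<and> (\<forall>c. \<forall>f\<in>D. T (c *\<^sub>C f) = c *\<^sub>C T f)"

definition bounded_ops ::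
    "('a::complex_vector, 'm) hspace_scheme \<Rightarrow> ('a, 'm) hspace_scheme \<Rightarrow> ('a \<Rightarrow> 'a) set"
  where "bounded_ops X Y = {T. clinear_on (vecs X) T \<and> T ` vecs X \<subseteq> vecs Y \<and>
    (\<exists>K. \<forall>f\<in>vecs X. hnorm Y (T f) \<le> K * hnorm X f)}"

definition opnorm ::
    "('a, 'm) hspace_scheme \<Rightarrow> ('a, 'm) hspace_scheme \<Rightarrow> ('a \<Rightarrow> 'a) \<Rightarrow> real"
  where "opnorm X Y T = (SUP f\<in>{f \<in> vecs X. hnorm X f \<le> 1}. hnorm Y (T f))"


section \<open>Unbounded operators and their spectra\<close>

text \<open>An unbounded operator is given by its domain \<open>D\<close> and a function \<open>T\<close>.\<close>

definition adjoint_graph ::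
    "('a, 'm) hspace_scheme \<Rightarrow> 'a set \<Rightarrow> ('a \<Rightarrow> 'a) \<Rightarrow> ('a \<times> 'a) set"
  where "adjoint_graph X D T =
    {(g, h). g \<in> vecs X \<and> h \<in> vecs X \<and> (\<forall>f\<in>D. hip X (T f) g = hip X f h)}"

definition self_adjoint ::
    "('a::complex_vector, 'm) hspace_scheme \<Rightarrow> 'a set \<Rightarrow> ('a \<Rightarrow> 'a) \<Rightarrow> bool"
  where "self_adjoint X D T \<longleftrightarrow>
    csubspace D \<and> dense_in X D \<and> clinear_on D T \<and> T ` D \<subseteq> vecs X \<and>
    adjoint_graph X D T = (\<lambda>f. (f, T f)) ` D"

(* T C = C T, including equality of the domains of the two products. *)
definition real_op ::
    "('a, 'm) hspace_scheme \<Rightarrow> ('a \<Rightarrow> 'a) \<Rightarrow> 'a set \<Rightarrow> ('a \<Rightarrow> 'a) \<Rightarrow> bool"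
  where "real_op X C D T \<longleftrightarrow>
    (\<forall>f\<in>vecs X. C f \<in> D \<longleftrightarrow> f \<in> D) \<and> (\<forall>f\<in>D. T (C f) = C (T f))"

definition resolvent :: "'a::complex_vector set \<Rightarrow> ('a \<Rightarrow> 'a) \<Rightarrow> complex \<Rightarrow> 'a \<Rightarrow> 'a"
  where "resolvent D T z = the_inv_into D (\<lambda>f. T f - z *\<^sub>C f)"

definition spectrum ::
    "('a::complex_vector, 'm) hspace_scheme \<Rightarrow> 'a set \<Rightarrow> ('a \<Rightarrow> 'a) \<Rightarrow> complex set"
  where "spectrum X D T =
    {z. \<not> (bij_betw (\<lambda>f. T f - z *\<^sub>C f) D (vecs X) \<and> resolvent D T z \<in> bounded_ops X X)}"

definition eigenspace :: "'a::complex_vector set \<Rightarrow> ('a \<Rightarrow> 'a) \<Rightarrow> complex \<Rightarrow> 'a set"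
  where "eigenspace D T z = {f \<in> D. T f = z *\<^sub>C f}"

definition point_spectrum :: "'a::complex_vector set \<Rightarrow> ('a \<Rightarrow> 'a) \<Rightarrow> complex set"
  where "point_spectrum D T = {z. \<exists>f\<in>eigenspace D T z. f \<noteq> 0}"

definition simple_eigenvalue :: "'a::complex_vector set \<Rightarrow> ('a \<Rightarrow> 'a) \<Rightarrow> complex \<Rightarrow> bool"
  where "simple_eigenvalue D T z \<longleftrightarrow> has_cdim (eigenspace D T z) 1"

definition continuous_subspace ::
    "('a::complex_vector, 'm) hspace_scheme \<Rightarrow> 'a set \<Rightarrow> ('a \<Rightarrow> 'a) \<Rightarrow> 'a set"
  where "continuous_subspace X D T = orth_compl X (hclosure X (cspan (\<Union>z. eigenspace D T z)))"

definition continuous_spectrum ::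
    "('a::complex_vector, 'm) hspace_scheme \<Rightarrow> 'a set \<Rightarrow> ('a \<Rightarrow> 'a) \<Rightarrow> complex set"
  where "continuous_spectrum X D T =
    spectrum (X\<lparr>vecs := continuous_subspace X D T\<rparr>) (D \<inter> continuous_subspace X D T) T"


section \<open>Scales of Hilbert spaces with an antiunitary involution\<close>

text \<open>
  The map \<open>pair\<close> is the extension of the inner product of the central space \<open>S 0\<close> to the
  products of \<open>S s\<close> and \<open>S (- s)\<close>. The duality is required up to equivalence of norms only.
\<close>

locale hilbert_scale =
  fixes S :: "real \<Rightarrow> 'a::complex_vector hspace"
    and pair :: "'a \<Rightarrow> 'a \<Rightarrow> complex"
    and C :: "'a \<Rightarrow> 'a"
  assumes hilbert: "hilbert_space (S s)"
    and embedded: "t \<le> s \<Longrightarrow> vecs (S s) \<subseteq> vecs (S t)"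
    and embedding_bounded: "t \<le> s \<Longrightarrow> \<exists>K. \<forall>f\<in>vecs (S s). hnorm (S t) f \<le> K * hnorm (S s) f"
    and embedding_dense: "t < s \<Longrightarrow> dense_in (S t) (vecs (S s))"
    and hnorm_0_le: "0 < s \<Longrightarrow> f \<in> vecs (S s) \<Longrightarrow> hnorm (S 0) f \<le> hnorm (S s) f"
    and pair_eq_hip: "f \<in> vecs (S 0) \<Longrightarrow> g \<in> vecs (S 0) \<Longrightarrow> pair f g = hip (S 0) f g"
    and pair_add_left: "f \<in> vecs (S s) \<Longrightarrow> f' \<in> vecs (S s) \<Longrightarrow> g \<in> vecs (S (- s)) \<Longrightarrow>
          pair (f + f') g = pair f g + pair f' g"
    and pair_scale_left: "f \<in> vecs (S s) \<Longrightarrow> g \<in> vecs (S (- s)) \<Longrightarrow>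
          pair (c *\<^sub>C f) g = c * pair f g"
    and pair_add_right: "f \<in> vecs (S s) \<Longrightarrow> g \<in> vecs (S (- s)) \<Longrightarrow> g' \<in> vecs (S (- s)) \<Longrightarrow>
          pair f (g + g') = pair f g + pair f g'"
    and pair_scale_right: "f \<in> vecs (S s) \<Longrightarrow> g \<in> vecs (S (- s)) \<Longrightarrow>
          pair f (c *\<^sub>C g) = cnj c * pair f g"
    and pair_bounded: "\<exists>K. \<forall>f\<in>vecs (S s). \<forall>g\<in>vecs (S (- s)).
          cmod (pair f g) \<le> K * hnorm (S s) f * hnorm (S (- s)) g"
    and dual: "(\<And>f g. f \<in> vecs (S s) \<Longrightarrow> g \<in> vecs (S s) \<Longrightarrow> l (f + g) = l f + l g) \<Longrightarrow>
          (\<And>c f. f \<in> vecs (S s) \<Longrightarrow> l (c *\<^sub>C f) = c * l f) \<Longrightarrow>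
          (\<And>f. f \<in> vecs (S s) \<Longrightarrow> cmod (l f) \<le> K * hnorm (S s) f) \<Longrightarrow>
          \<exists>!g. g \<in> vecs (S (- s)) \<and> (\<forall>f\<in>vecs (S s). l f = pair f g)"
    and conj_closed: "f \<in> vecs (S s) \<Longrightarrow> C f \<in> vecs (S s)"
    and conj_add: "f \<in> vecs (S s) \<Longrightarrow> g \<in> vecs (S s) \<Longrightarrow> C (f + g) = C f + C g"
    and conj_scale: "f \<in> vecs (S s) \<Longrightarrow> C (c *\<^sub>C f) = cnj c *\<^sub>C C f"
    and conj_bounded: "\<exists>K. \<forall>f\<in>vecs (S s). hnorm (S s) (C f) \<le> K * hnorm (S s) f"
    and conj_involution: "f \<in> vecs (S 0) \<Longrightarrow> C (C f) = f"
    and conj_antiunitary: "f \<in> vecs (S 0) \<Longrightarrow> g \<in> vecs (S 0) \<Longrightarrow>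
          hip (S 0) (C f) (C g) = cnj (hip (S 0) f g)"


section \<open>Limiting absorption\<close>

definition Ck_op ::
    "('a::complex_vector, 'm) hspace_scheme \<Rightarrow> ('a, 'm) hspace_scheme \<Rightarrow> nat \<Rightarrow> real set \<Rightarrow>
     (real \<Rightarrow> 'a \<Rightarrow> 'a) \<Rightarrow> bool"
  where "Ck_op X Y k I F \<longleftrightarrow>
    (\<exists>G :: nat \<Rightarrow> real \<Rightarrow> 'a \<Rightarrow> 'a.
       (\<forall>lam\<in>I. \<forall>f\<in>vecs X. G 0 lam f = F lam f) \<and>
       (\<forall>j\<le>k. \<forall>lam\<in>I. G j lam \<in> bounded_ops X Y \<and>
          ((\<lambda>\<mu>. opnorm X Y (\<lambda>f. G j \<mu> f - G j lam f)) \<longlongrightarrow> 0) (at lam within I)) \<and>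
       (\<forall>j<k. \<forall>lam\<in>I.
          ((\<lambda>\<mu>. opnorm X Y (\<lambda>f. of_real (1 / (\<mu> - lam)) *\<^sub>C (G j \<mu> f - G j lam f) - G (Suc j) lam f))
             \<longlongrightarrow> 0) (at lam within I)))"

(* With sg = 1 or sg = -1, R is the norm limit of the inverse of T - lam + sg * i * \<epsilon>
   as \<epsilon> tends to 0 from above. *)
definition boundary_limit ::
    "('a::complex_vector, 'm) hspace_scheme \<Rightarrow> ('a, 'm) hspace_scheme \<Rightarrow> 'a set \<Rightarrow> ('a \<Rightarrow> 'a) \<Rightarrow>
     real \<Rightarrow> real \<Rightarrow> ('a \<Rightarrow> 'a) \<Rightarrow> bool"
  where "boundary_limit X Y D T sg lam R \<longleftrightarrow> R \<in> bounded_ops X Y \<and>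
    ((\<lambda>\<epsilon>. opnorm X Y (\<lambda>f. resolvent D T (of_real lam - of_real (sg * \<epsilon>) * \<i>) f - R f))
       \<longlongrightarrow> 0) (at_right 0)"

(* The limit is unique only as a function on vecs X, hence SOME. *)
definition boundary_resolvent ::
    "('a::complex_vector, 'm) hspace_scheme \<Rightarrow> ('a, 'm) hspace_scheme \<Rightarrow> 'a set \<Rightarrow> ('a \<Rightarrow> 'a) \<Rightarrow>
     real \<Rightarrow> real \<Rightarrow> 'a \<Rightarrow> 'a"
  where "boundary_resolvent X Y D T sg lam = (SOME R. boundary_limit X Y D T sg lam R)"

definition limiting_absorption ::
    "nat \<Rightarrow> (real \<Rightarrow> 'a::complex_vector hspace) \<Rightarrow> 'a set \<Rightarrow> ('a \<Rightarrow> 'a) \<Rightarrow> real \<Rightarrow> real \<Rightarrow> real \<Rightarrow> bool"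
  where "limiting_absorption k S D T lam\<^sub>0 s \<delta>\<^sub>1 \<longleftrightarrow>
    (\<forall>sg\<in>{1, -1}.
       (\<forall>lam\<in>{lam\<^sub>0 - \<delta>\<^sub>1<..<lam\<^sub>0 + \<delta>\<^sub>1}. \<exists>R. boundary_limit (S s) (S (- s)) D T sg lam R) \<and>
       Ck_op (S s) (S (- s)) k {lam\<^sub>0 - \<delta>\<^sub>1<..<lam\<^sub>0 + \<delta>\<^sub>1}
         (boundary_resolvent (S s) (S (- s)) D T sg))"

definition spectral_delta ::
    "(real \<Rightarrow> 'a::complex_vector hspace) \<Rightarrow> 'a set \<Rightarrow> ('a \<Rightarrow> 'a) \<Rightarrow> real \<Rightarrow> real \<Rightarrow> 'a \<Rightarrow> 'a"
  where "spectral_delta S D T s lam f = (1 / (2 * of_real pi * \<i>)) *\<^sub>C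
    (boundary_resolvent (S s) (S (- s)) D T (-1) lam f - boundary_resolvent (S s) (S (- s)) D T 1 lam f)"


section \<open>Perturbation spaces and manifolds in Banach spaces\<close>

text \<open>
  A Banach space of operators is given as a Banach space type together with an injective
  linear map \<open>\<iota>\<close> that assigns to each element the operator it stands for.
\<close>

definition perturbation_space ::
    "(real \<Rightarrow> 'a::complex_vector hspace) \<Rightarrow> ('a \<Rightarrow> 'a) \<Rightarrow> real \<Rightarrow> ('x::banach \<Rightarrow> 'a \<Rightarrow> 'a) \<Rightarrow> bool"
  where "perturbation_space S C s \<iota> \<longleftrightarrow>
    (\<forall>W. \<iota> W \<in> bounded_ops (S 0) (S 0) \<and> self_adjoint (S 0) (vecs (S 0)) (\<iota> W) \<and>
         real_op (S 0) C (vecs (S 0)) (\<iota> W) \<and> \<iota> W \<in> bounded_ops (S (- s)) (S s)) \<and>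
    (\<forall>V W. \<forall>f\<in>vecs (S (- s)). \<iota> (V + W) f = \<iota> V f + \<iota> W f) \<and>
    (\<forall>a W. \<forall>f\<in>vecs (S (- s)). \<iota> (a *\<^sub>R W) f = of_real a *\<^sub>C \<iota> W f) \<and>
    (\<forall>V W. (\<forall>f\<in>vecs (S 0). \<iota> V f = \<iota> W f) \<longrightarrow> V = W) \<and>
    (\<exists>K. \<forall>W. opnorm (S (- s)) (S s) (\<iota> W) \<le> K * norm W)"

definition bounded_multilinear_on ::
    "'a::real_normed_vector set \<Rightarrow> nat \<Rightarrow> ('a list \<Rightarrow> 'b::real_normed_vector) \<Rightarrow> bool"
  where "bounded_multilinear_on Y j A \<longleftrightarrow>
    (\<forall>vs\<in>lists Y. length vs = j \<longrightarrow> (\<forall>i<j.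
       (\<forall>u\<in>Y. \<forall>v\<in>Y. A (vs[i := u + v]) = A (vs[i := u]) + A (vs[i := v])) \<and>
       (\<forall>a. \<forall>u\<in>Y. A (vs[i := a *\<^sub>R u]) = a *\<^sub>R A (vs[i := u])))) \<and>
    (\<exists>K. \<forall>vs\<in>lists Y. length vs = j \<longrightarrow> norm (A vs) \<le> K * prod_list (map norm vs))"

text \<open>
  \<open>Ck_on k Y V g\<close>: the map \<open>g\<close> is of class \<open>C\<^sup>k\<close> on the relatively open subset \<open>V\<close> of the subspace
  \<open>Y\<close>. Here \<open>G j x\<close> is the \<open>j\<close>-th Frechet derivative of \<open>g\<close> at \<open>x\<close>, as a bounded \<open>j\<close>-linear map on
  \<open>Y\<close>; the direction of the last differentiation is the head of the argument list.
\<close>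

definition Ck_on ::
    "nat \<Rightarrow> 'a::real_normed_vector set \<Rightarrow> 'a set \<Rightarrow> ('a \<Rightarrow> 'b::real_normed_vector) \<Rightarrow> bool"
  where "Ck_on k Y V g \<longleftrightarrow>
    (\<exists>G :: nat \<Rightarrow> 'a \<Rightarrow> 'a list \<Rightarrow> 'b.
       (\<forall>x\<in>V. G 0 x [] = g x) \<and>
       (\<forall>j\<le>k. \<forall>x\<in>V. bounded_multilinear_on Y j (G j x) \<and>
          (\<forall>e>0. \<exists>d>0. \<forall>y\<in>V. norm (y - x) < d \<longrightarrow>
             (\<forall>vs\<in>lists Y. length vs = j \<longrightarrow>
                norm (G j y vs - G j x vs) \<le> e * prod_list (map norm vs)))) \<and>
       (\<forall>j<k. \<forall>x\<in>V.
          (\<forall>e>0. \<exists>d>0. \<forall>y\<in>V. norm (y - x) < d \<longrightarrow>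
             (\<forall>vs\<in>lists Y. length vs = j \<longrightarrow>
                norm (G j y vs - G j x vs - G (Suc j) x ((y - x) # vs))
                  \<le> e * norm (y - x) * prod_list (map norm vs)))))"

definition Ck_manifold :: "nat \<Rightarrow> nat \<Rightarrow> 'x::banach set \<Rightarrow> bool"
  where "Ck_manifold k m M \<longleftrightarrow>
    (\<forall>p\<in>M. \<exists>Y Z U V g.
       subspace Y \<and> closed Y \<and> has_rdim Z m \<and> Y \<inter> Z = {0} \<and> (\<forall>x. \<exists>y\<in>Y. \<exists>z\<in>Z. x = y + z) \<and>
       open U \<and> p \<in> U \<and> openin (top_of_set Y) V \<and> g ` V \<subseteq> Z \<and> Ck_on k Y V g \<and>
       M \<inter> U = (\<lambda>y. y + g y) ` V)"

definition persistence_set ::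
    "'a::complex_vector set \<Rightarrow> ('a \<Rightarrow> 'a) \<Rightarrow> ('x::banach \<Rightarrow> 'a \<Rightarrow> 'a) \<Rightarrow> real \<Rightarrow> real \<Rightarrow> 'x set"
  where "persistence_set D H \<iota> lam\<^sub>0 \<delta> =
    {W. \<exists>lam\<in>{lam\<^sub>0 - \<delta><..<lam\<^sub>0 + \<delta>}. complex_of_real lam \<in> point_spectrum D (\<lambda>f. H f + \<iota> W f)}"

end

theory Submission
  imports Defs "HOL-Complex_Analysis.Complex_Analysis" "HOL-Library.Function_Algebras"
begin

text \<open>
  Write \<open>R\<^sub>0(\<lambda>)\<close> for the mean of the two boundary values of the resolvent of \<open>H + P\<^sub>0\<close> at \<open>\<lambda>\<close>
  and \<open>\<delta>(\<lambda>)\<close> for the spectral density. For \<open>\<lambda>\<close> near \<open>\<lambda>\<^sub>0\<close> and small \<open>W\<close>, the number \<open>\<lambda>\<close> is an eigenvalue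
  of \<open>H + W\<close> if and only if the real vector \<open>g = (1 + W R\<^sub>0(\<lambda>))\<^sup>-\<^sup>1 \<phi>\<^sub>0\<close> satisfies \<open>\<delta>(\<lambda>) g = 0\<close> and
  \<open>\<langle>R\<^sub>0(\<lambda>) g, \<phi>\<^sub>0\<rangle> = 1\<close>, and then \<open>R\<^sub>0(\<lambda>) g\<close> spans the eigenspace. The point is that \<open>R\<^sub>0(\<lambda>) g\<close> lies in
  the domain of \<open>H\<close> if \<open>\<delta>(\<lambda>) g = 0\<close>: since \<open>\<delta>\<close> has constant rank, \<open>\<langle>\<delta>(x) g, g\<rangle> = O((x - \<lambda>)\<^sup>2)\<close>, and the
  Poisson formula for \<open>Im \<langle>R(z) g, g\<rangle> = \<epsilon> \<parallel>R(z) g\<parallel>\<^sup>2\<close> turns this into a bound for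
  \<open>\<parallel>R(\<lambda> + i\<epsilon>) g\<parallel>\<close> in \<open>\<H>\<close> that is uniform in \<open>\<epsilon>\<close>.

  By constant rank, \<open>\<delta>(\<lambda>) g = 0\<close> amounts to the \<open>m\<close> real equations \<open>\<langle>\<delta>(\<lambda>) g, z\<^sub>j \<phi>\<^sub>0\<rangle> = 0\<close>, where the
  \<open>z\<^sub>j\<close> are orthonormal in \<open>X\<^sub>s\<close> for the form \<open>\<langle>\<delta>(\<lambda>\<^sub>0) V \<phi>\<^sub>0, W \<phi>\<^sub>0\<rangle>\<close>. Together with the normalization
  these are \<open>m + 1\<close> equations of class \<open>C\<^sup>k\<close> in \<open>(\<lambda>, W)\<close> whose derivative at \<open>(\<lambda>\<^sub>0, 0)\<close> is triangular in
  the directions \<open>(1, 0)\<close> and \<open>(0, z\<^sub>j)\<close>. They determine \<open>\<lambda>\<close> and the \<open>z\<^sub>j\<close>-components of \<open>W\<close> as functions of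
  the component of \<open>W\<close> orthogonal to all \<open>z\<^sub>j\<close>.
\<close>

section \<open>Hilbert spaces and resolvents of self-adjoint operators\<close>

text \<open>With \<open>T = H + P\<close>, where \<open>P\<close> projects onto the eigenspace,
  \<open>(H + W - l) u = 0\<close> reads \<open>(T - l) u = c \<phi> - W u\<close>. The right side
  lies in \<open>Vp\<close> although \<open>u\<close> is only known to lie in the Hilbert space,
  because \<open>W\<close> maps \<open>Vm\<close> into \<open>Vp\<close>; this makes the boundary
  values of the resolvent applicable. The converse direction is the obstacle: a vector obtained as a
  boundary value lies a priori only in \<open>Vm\<close>. For \<open>k = 1\<close>, smoothness alone
  says of a nonnegative function that vanishes at \<open>l\<close> only that it is
  \<open>o(\<bar>x - l\<bar>)\<close>, and this does not make its quotient by the square of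
  \<open>x - l\<close> integrable, which the uniform bound of the resolvent vectors requires. Hence
  the quadratic decay has to be extracted from the constancy of the rank. Reality decides the
  codimension. The vanishing of the density is \<open>m\<close> complex conditions; as the mean and
  the jump of the boundary values commute with \<open>C\<close>, they are \<open>m\<close> real
  conditions for the real vector \<open>g\<close>. The spaces of the scale are subsets of one type,
  so the differential calculus is set up for carrier sets with a norm function.\<close>

locale hilb =
  fixes X :: "'a::complex_vector hspace"
  assumes hilbert_space: "hilbert_space X"
begin

abbreviation ip :: "'a \<Rightarrow> 'a \<Rightarrow> complex" where "ip \<equiv> hip X"
abbreviation nrm :: "'a \<Rightarrow> real" where "nrm \<equiv> hnorm X"

lemmas hs = hilbert_space[unfolded hilbert_space_def]

lemma csubspace_vecs: "csubspace (vecs X)"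
  using hs[THEN conjunct1] .

lemma vecs_0 [simp, intro]: "0 \<in> vecs X"
  and vecs_add [simp, intro]: "f \<in> vecs X \<Longrightarrow> g \<in> vecs X \<Longrightarrow> f + g \<in> vecs X"
  and vecs_diff [simp, intro]: "f \<in> vecs X \<Longrightarrow> g \<in> vecs X \<Longrightarrow> f - g \<in> vecs X"
  and vecs_minus [simp, intro]: "f \<in> vecs X \<Longrightarrow> - f \<in> vecs X"
  and vecs_scale [simp, intro]: "f \<in> vecs X \<Longrightarrow> c *\<^sub>C f \<in> vecs X"
  using complex_vector.subspace_0[OF csubspace_vecs] complex_vector.subspace_add[OF csubspace_vecs]
    complex_vector.subspace_diff[OF csubspace_vecs] complex_vector.subspace_neg[OF csubspace_vecs]
    complex_vector.subspace_scale[OF csubspace_vecs]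
  by simp_all

lemma ip_add_left: "f \<in> vecs X \<Longrightarrow> g \<in> vecs X \<Longrightarrow> h \<in> vecs X \<Longrightarrow> ip (f + g) h = ip f h + ip g h"
  and ip_scale_left: "f \<in> vecs X \<Longrightarrow> g \<in> vecs X \<Longrightarrow> ip (c *\<^sub>C f) g = c * ip f g"
  and ip_cnj: "f \<in> vecs X \<Longrightarrow> g \<in> vecs X \<Longrightarrow> ip g f = cnj (ip f g)"
  and ip_pos: "f \<in> vecs X \<Longrightarrow> f \<noteq> 0 \<Longrightarrow> Re (ip f f) > 0"
  using hs[THEN conjunct2, THEN conjunct1] hs[THEN conjunct2, THEN conjunct2, THEN conjunct1]
    hs[THEN conjunct2, THEN conjunct2, THEN conjunct2, THEN conjunct1]
    hs[THEN conjunct2, THEN conjunct2, THEN conjunct2, THEN conjunct2, THEN conjunct1]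
  by blast+

lemma complete:
  assumes "range \<sigma> \<subseteq> vecs X" "\<And>e. e > 0 \<Longrightarrow> \<exists>N. \<forall>i\<ge>N. \<forall>j\<ge>N. nrm (\<sigma> i - \<sigma> j) < e"
  obtains f where "f \<in> vecs X" "(\<lambda>i. nrm (\<sigma> i - f)) \<longlonglongrightarrow> 0"
proof -
  have "range \<sigma> \<subseteq> vecs X \<longrightarrow> (\<forall>e>0. \<exists>N. \<forall>i\<ge>N. \<forall>j\<ge>N. hnorm X (\<sigma> i - \<sigma> j) < e) \<longrightarrow>
      (\<exists>f\<in>vecs X. (\<lambda>i. hnorm X (\<sigma> i - f)) \<longlonglongrightarrow> 0)"
    using hs[THEN conjunct2, THEN conjunct2, THEN conjunct2, THEN conjunct2, THEN conjunct2] by (rule spec)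
  then have "\<exists>f\<in>vecs X. (\<lambda>i. hnorm X (\<sigma> i - f)) \<longlonglongrightarrow> 0"
    using assms by simp
  then show thesis using that by blast
qed

lemma ip_add_right: "f \<in> vecs X \<Longrightarrow> g \<in> vecs X \<Longrightarrow> h \<in> vecs X \<Longrightarrow> ip h (f + g) = ip h f + ip h g"
  using ip_cnj[of "f + g" h] ip_cnj[of f h] ip_cnj[of g h] by (simp add: ip_add_left)

lemma ip_scale_right: "f \<in> vecs X \<Longrightarrow> g \<in> vecs X \<Longrightarrow> ip g (c *\<^sub>C f) = cnj c * ip g f"
  using ip_cnj[of "c *\<^sub>C f" g] ip_cnj[of f g] by (simp add: ip_scale_left)

lemma ip_0_left [simp]: "f \<in> vecs X \<Longrightarrow> ip 0 f = 0"
  using ip_scale_left[of 0 f 0] by simp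

lemma ip_0_right [simp]: "f \<in> vecs X \<Longrightarrow> ip f 0 = 0"
  using ip_cnj[of 0 f] by simp

lemma ip_minus_left: "f \<in> vecs X \<Longrightarrow> g \<in> vecs X \<Longrightarrow> ip (- f) g = - ip f g"
  using ip_scale_left[of f g "-1"] by simp

lemma ip_minus_right: "f \<in> vecs X \<Longrightarrow> g \<in> vecs X \<Longrightarrow> ip g (- f) = - ip g f"
  using ip_scale_right[of f g "-1"] by simp

lemma ip_diff_left: "f \<in> vecs X \<Longrightarrow> g \<in> vecs X \<Longrightarrow> h \<in> vecs X \<Longrightarrow> ip (f - g) h = ip f h - ip g h"
  using ip_add_left[of f "-g" h] by (simp add: ip_minus_left)

lemma ip_diff_right: "f \<in> vecs X \<Longrightarrow> g \<in> vecs X \<Longrightarrow> h \<in> vecs X \<Longrightarrow> ip h (f - g) = ip h f - ip h g"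
  using ip_add_right[of f "-g" h] by (simp add: ip_minus_right)

lemmas ip_simps = ip_add_left ip_add_right ip_diff_left ip_diff_right ip_scale_left ip_scale_right
  ip_minus_left ip_minus_right

lemma ip_self_nonneg: "f \<in> vecs X \<Longrightarrow> Re (ip f f) \<ge> 0"
  using ip_pos[of f] by (cases "f = 0") auto

lemma ip_self: "f \<in> vecs X \<Longrightarrow> ip f f = of_real ((nrm f)\<^sup>2)"
  using ip_cnj[of f f] ip_self_nonneg[of f] by (simp add: hnorm_def complex_eq_iff)

lemma nrm_nonneg [simp]: "f \<in> vecs X \<Longrightarrow> nrm f \<ge> 0"
  by (simp add: hnorm_def ip_self_nonneg)

lemma nrm_0 [simp]: "nrm 0 = 0"
  by (simp add: hnorm_def)

lemma nrm_eq_0: "f \<in> vecs X \<Longrightarrow> nrm f = 0 \<longleftrightarrow> f = 0"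
  using ip_pos[of f] ip_self_nonneg[of f] by (cases "f = 0") (simp_all add: hnorm_def)

lemma nrm_scale: "f \<in> vecs X \<Longrightarrow> nrm (c *\<^sub>C f) = cmod c * nrm f"
proof -
  assume f: "f \<in> vecs X"
  have "ip (c *\<^sub>C f) (c *\<^sub>C f) = (c * cnj c) * of_real ((nrm f)\<^sup>2)"
    using f ip_self[OF f] by (simp add: ip_scale_left ip_scale_right)
  also have "\<dots> = of_real ((cmod c * nrm f)\<^sup>2)"
    by (simp add: complex_norm_square[symmetric] power_mult_distrib del: of_real_power)
  finally have "Re (ip (c *\<^sub>C f) (c *\<^sub>C f)) = (cmod c * nrm f)\<^sup>2"
    by (simp only: Re_complex_of_real)
  then show ?thesis using f by (simp add: hnorm_def[of X "c *\<^sub>C f"] abs_mult)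
qed

lemma nrm_minus [simp]: "f \<in> vecs X \<Longrightarrow> nrm (- f) = nrm f"
  using nrm_scale[of f "-1"] by simp

lemma nrm_minus_commute: "f \<in> vecs X \<Longrightarrow> g \<in> vecs X \<Longrightarrow> nrm (f - g) = nrm (g - f)"
  using nrm_minus[of "f - g"] by simp

lemma nrm_add_sq: "f \<in> vecs X \<Longrightarrow> g \<in> vecs X \<Longrightarrow>
    (nrm (f + g))\<^sup>2 = (nrm f)\<^sup>2 + 2 * Re (ip f g) + (nrm g)\<^sup>2"
  using ip_self[of "f + g"] ip_self[of f] ip_self[of g] ip_cnj[of f g]
  by (simp add: ip_simps complex_eq_iff)

lemma nrm_diff_sq: "f \<in> vecs X \<Longrightarrow> g \<in> vecs X \<Longrightarrow>
    (nrm (f - g))\<^sup>2 = (nrm f)\<^sup>2 - 2 * Re (ip f g) + (nrm g)\<^sup>2"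
  using nrm_add_sq[of f "- g"] by (simp add: ip_minus_right)

lemma Cauchy_Schwarz:
  assumes "f \<in> vecs X" "g \<in> vecs X" shows "cmod (ip f g) \<le> nrm f * nrm g"
proof (cases "g = 0")
  case False
  let ?c = "ip f g" and ?n = "(nrm g)\<^sup>2"
  have n: "?n > 0" using False assms nrm_eq_0[of g] by simp
  have "0 \<le> (nrm (of_real ?n *\<^sub>C f - ?c *\<^sub>C g))\<^sup>2" by simp
  also have "\<dots> = ?n\<^sup>2 * (nrm f)\<^sup>2 - 2 * Re (of_real ?n * (cnj ?c * ?c)) + (cmod ?c)\<^sup>2 * ?n"
    using assms n by (simp add: nrm_diff_sq nrm_scale ip_simps power_mult_distrib norm_power algebra_simps)
  also have "cnj ?c * ?c = of_real ((cmod ?c)\<^sup>2)"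
    by (metis complex_norm_square mult.commute)
  also have "?n\<^sup>2 * (nrm f)\<^sup>2 - 2 * Re (of_real ?n * of_real ((cmod ?c)\<^sup>2)) + (cmod ?c)\<^sup>2 * ?n
      = ?n * (?n * (nrm f)\<^sup>2 - (cmod ?c)\<^sup>2)"
    by (simp add: algebra_simps power2_eq_square)
  finally have "(cmod ?c)\<^sup>2 \<le> (nrm f * nrm g)\<^sup>2"
    using n by (simp add: zero_le_mult_iff power_mult_distrib mult.commute)
  then show ?thesis by (rule power2_le_imp_le) (simp add: assms)
qed (use assms in simp)

lemma nrm_triangle: "f \<in> vecs X \<Longrightarrow> g \<in> vecs X \<Longrightarrow> nrm (f + g) \<le> nrm f + nrm g"
proof -
  assume fg: "f \<in> vecs X" "g \<in> vecs X"
  have "Re (ip f g) \<le> nrm f * nrm g"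
    using Cauchy_Schwarz[OF fg] complex_Re_le_cmod order_trans by blast
  then have "(nrm (f + g))\<^sup>2 \<le> (nrm f + nrm g)\<^sup>2"
    using fg by (simp add: nrm_add_sq power2_sum)
  then show ?thesis by (rule power2_le_imp_le) (simp add: fg)
qed

lemma nrm_triangle_diff: "f \<in> vecs X \<Longrightarrow> g \<in> vecs X \<Longrightarrow> nrm (f - g) \<le> nrm f + nrm g"
  using nrm_triangle[of f "- g"] by simp

lemma nrm_triangle_sub: "f \<in> vecs X \<Longrightarrow> g \<in> vecs X \<Longrightarrow> h \<in> vecs X \<Longrightarrow> nrm (f - h) \<le> nrm (f - g) + nrm (g - h)"
  using nrm_triangle[of "f - g" "g - h"] by simp

text \<open>The filter is arbitrary because limits along sequences and limits for \<epsilon> tending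
  to 0 from above both occur.\<close>

lemma limit_unique:
  assumes "\<And>i. \<sigma> i \<in> vecs X" "f \<in> vecs X" "g \<in> vecs X" "F \<noteq> bot"
    and "((\<lambda>i. nrm (\<sigma> i - f)) \<longlongrightarrow> 0) F" "((\<lambda>i. nrm (\<sigma> i - g)) \<longlongrightarrow> 0) F"
  shows "f = g"
proof -
  have "((\<lambda>i. nrm (\<sigma> i - f) + nrm (\<sigma> i - g)) \<longlongrightarrow> 0) F"
    using tendsto_add[OF assms(5,6)] by simp
  moreover have "nrm (f - g) \<le> nrm (\<sigma> i - f) + nrm (\<sigma> i - g)" for i
    using nrm_triangle_sub[of f "\<sigma> i" g] assms(1-3) nrm_minus_commute[of f "\<sigma> i"] by simp
  ultimately have "nrm (f - g) \<le> 0"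
    using tendsto_lowerbound assms(4) by (metis (mono_tags, lifting) always_eventually)
  then have "nrm (f - g) = 0"
    by (intro antisym nrm_nonneg) (use assms(2,3) in simp_all)
  then show ?thesis using nrm_eq_0[of "f - g"] assms(2,3) by simp
qed

lemma tendsto_ip_left:
  assumes "\<And>i. \<sigma> i \<in> vecs X" "f \<in> vecs X" "g \<in> vecs X"
    and "((\<lambda>i. nrm (\<sigma> i - f)) \<longlongrightarrow> 0) F"
  shows "((\<lambda>i. ip (\<sigma> i) g) \<longlongrightarrow> ip f g) F"
proof -
  have "((\<lambda>i. nrm (\<sigma> i - f) * nrm g) \<longlongrightarrow> 0) F"
    using tendsto_mult_right[OF assms(4), of "nrm g"] by simp
  then have "((\<lambda>i. ip (\<sigma> i) g - ip f g) \<longlongrightarrow> 0) F"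
    by (rule Lim_null_comparison[rotated])
      (use assms Cauchy_Schwarz[of "_ - f" g] in \<open>simp add: ip_diff_left[symmetric]\<close>)
  then show ?thesis by (simp add: LIM_zero_iff)
qed

text \<open>The minimizing sequence for the distance to \<open>M\<close> is Cauchy by the parallelogram law.\<close>

lemma orthogonal_vector_exists:
  assumes M: "csubspace M" "M \<subseteq> vecs X"
    and closed: "\<And>\<sigma> f. (\<And>i::nat. \<sigma> i \<in> M) \<Longrightarrow> f \<in> vecs X \<Longrightarrow> (\<lambda>i. nrm (\<sigma> i - f)) \<longlonglongrightarrow> 0 \<Longrightarrow> f \<in> M"
    and "M \<noteq> vecs X"
  obtains g where "g \<in> vecs X" "g \<noteq> 0" "\<And>f. f \<in> M \<Longrightarrow> ip f g = 0"
proof -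
  obtain h where h: "h \<in> vecs X" "h \<notin> M" using assms by blast
  have M0: "0 \<in> M" and Madd: "\<And>f g. f \<in> M \<Longrightarrow> g \<in> M \<Longrightarrow> f + g \<in> M"
    and Msc: "\<And>c f. f \<in> M \<Longrightarrow> c *\<^sub>C f \<in> M"
    using M(1) by (auto simp: complex_vector.subspace_def)
  define d where "d = (INF f\<in>M. (nrm (h - f))\<^sup>2)"
  have bdd: "bdd_below ((\<lambda>f. (nrm (h - f))\<^sup>2) ` M)"
    by (rule bdd_belowI[of _ 0]) auto
  have d_le: "d \<le> (nrm (h - f))\<^sup>2" if "f \<in> M" for f
    unfolding d_def by (rule cINF_lower[OF bdd that])
  have "\<exists>f\<in>M. (nrm (h - f))\<^sup>2 < d + 1 / real (Suc n)" for n
  proof (rule ccontr)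
    assume "\<not> ?thesis"
    then have "d + 1 / real (Suc n) \<le> d"
      unfolding d_def using M0 by (intro cINF_greatest) (auto simp: not_less)
    then show False by simp
  qed
  then obtain \<sigma> where \<sigma>: "\<And>n. \<sigma> n \<in> M" "\<And>n. (nrm (h - \<sigma> n))\<^sup>2 < d + 1 / real (Suc n)"
    by metis
  have \<sigma>X: "\<sigma> n \<in> vecs X" for n using \<sigma>(1) M(2) by blast
  have par: "(nrm (\<sigma> i - \<sigma> j))\<^sup>2 \<le> 2 / real (Suc i) + 2 / real (Suc j)" for i j
  proof -
    let ?a = "h - \<sigma> i" and ?b = "h - \<sigma> j"
    let ?m = "(1/2) *\<^sub>C (\<sigma> i + \<sigma> j)"
    have ab: "?a \<in> vecs X" "?b \<in> vecs X" using h \<sigma>X by auto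
    have "(nrm (?a - ?b))\<^sup>2 + (nrm (?a + ?b))\<^sup>2 = 2 * (nrm ?a)\<^sup>2 + 2 * (nrm ?b)\<^sup>2"
      using nrm_add_sq[OF ab] nrm_diff_sq[OF ab] by simp
    moreover have "?a - ?b = - (\<sigma> i - \<sigma> j)" by simp
    then have "nrm (?a - ?b) = nrm (\<sigma> i - \<sigma> j)"
      using nrm_minus[of "\<sigma> i - \<sigma> j"] \<sigma>X by simp
    moreover have "?a + ?b = 2 *\<^sub>C (h - ?m)"
    proof -
      have two: "2 *\<^sub>C x = x + x" for x :: 'a
        using complex_vector.scale_left_distrib[of 1 1 x] by simp
      have "2 *\<^sub>C ?m = \<sigma> i + \<sigma> j" by simp
      then show ?thesis by (simp add: complex_vector.scale_right_diff_distrib two[of h])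
    qed
    then have "nrm (?a + ?b) = 2 * nrm (h - ?m)"
      using h \<sigma>X by (simp add: nrm_scale)
    moreover have "d \<le> (nrm (h - ?m))\<^sup>2"
      using d_le[of ?m] \<sigma>(1) Madd Msc by blast
    ultimately show ?thesis using \<sigma>(2)[of i] \<sigma>(2)[of j] by (simp add: power_mult_distrib)
  qed
  have cauchy: "\<exists>N. \<forall>i\<ge>N. \<forall>j\<ge>N. nrm (\<sigma> i - \<sigma> j) < e" if "e > 0" for e
  proof -
    obtain N where N: "real N > 4 / e\<^sup>2" using reals_Archimedean2 by blast
    have "nrm (\<sigma> i - \<sigma> j) < e" if "i \<ge> N" "j \<ge> N" for i j
    proof -
      have "4 / e\<^sup>2 > 0" using \<open>e > 0\<close> by simp
      then have N0: "real N > 0" using N by linarith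
      have "2 / real (Suc i) \<le> 2 / real N" "2 / real (Suc j) \<le> 2 / real N"
        using that N0 by (auto intro!: divide_left_mono)
      then have "(nrm (\<sigma> i - \<sigma> j))\<^sup>2 \<le> 4 / real N" using par[of i j] by simp
      also have "\<dots> < e\<^sup>2" using N N0 \<open>e > 0\<close> by (simp add: field_simps)
      finally show ?thesis using \<open>e > 0\<close> by (simp add: power2_less_imp_less)
    qed
    then show ?thesis by blast
  qed
  obtain p where p: "p \<in> vecs X" "(\<lambda>i. nrm (\<sigma> i - p)) \<longlonglongrightarrow> 0"
    using complete[of \<sigma>] \<sigma>X cauchy by blast
  have pM: "p \<in> M" using closed[of \<sigma> p] \<sigma> p by blast
  define g where "g = h - p"
  have gX: "g \<in> vecs X" and g0: "g \<noteq> 0" using h p pM by (auto simp: g_def)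
  have "(\<lambda>n. (nrm (\<sigma> n - p) + sqrt (d + 1 / real (Suc n)))) \<longlonglongrightarrow> 0 + sqrt (d + 0)"
    by (intro tendsto_intros p LIMSEQ_Suc[OF lim_1_over_n])
  moreover have "nrm g \<le> nrm (\<sigma> n - p) + sqrt (d + 1 / real (Suc n))" for n
  proof -
    have "nrm (h - \<sigma> n) \<le> sqrt (d + 1 / real (Suc n))"
      using \<sigma>(2)[of n] by (simp add: real_le_rsqrt)
    then show ?thesis using nrm_triangle_sub[of h "\<sigma> n" p] h p \<sigma>X by (simp add: g_def)
  qed
  ultimately have "nrm g \<le> 0 + sqrt (d + 0)"
    by (intro LIMSEQ_le_const) auto
  then have "nrm g \<le> sqrt d" by simp
  moreover have d0: "d \<ge> 0" unfolding d_def using M0 by (intro cINF_greatest) auto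
  ultimately have gd: "(nrm g)\<^sup>2 \<le> d"
    using gX by (metis nrm_nonneg power_mono real_sqrt_pow2)
  have "ip f g = 0" if f: "f \<in> M" for f
  proof (rule ccontr)
    assume nz: "ip f g \<noteq> 0"
    have fX: "f \<in> vecs X" using f M by blast
    then have n: "(nrm f)\<^sup>2 > 0" using nz nrm_eq_0[of f] gX by force
    \<comment> \<open>\<open>c *\<^sub>C f\<close> is the component of \<open>g\<close> along
      \<open>f\<close>. Unless \<open>c\<close> is 0, subtracting it gives a point of
      \<open>M\<close> closer to \<open>h\<close> than the distance allows.\<close>
    define c where "c = ip g f / of_real ((nrm f)\<^sup>2)"
    have "d \<le> (nrm (g - c *\<^sub>C f))\<^sup>2"
      using d_le[of "p + c *\<^sub>C f"] pM f Madd Msc by (simp add: g_def algebra_simps)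
    also have "\<dots> = (nrm g)\<^sup>2 - 2 * Re (cnj c * ip g f) + (cmod c)\<^sup>2 * (nrm f)\<^sup>2"
      using fX gX by (simp add: nrm_diff_sq ip_simps nrm_scale power_mult_distrib)
    also have "ip g f = c * of_real ((nrm f)\<^sup>2)" using n by (simp add: c_def)
    also have "cnj c * (c * of_real ((nrm f)\<^sup>2)) = of_real ((cmod c)\<^sup>2 * (nrm f)\<^sup>2)"
      by (metis complex_norm_square mult.assoc mult.commute of_real_mult)
    finally have "(cmod c)\<^sup>2 * (nrm f)\<^sup>2 \<le> 0" using gd by simp
    moreover have "c \<noteq> 0" using nz n ip_cnj[of f g] fX gX by (auto simp: c_def)
    ultimately show False using n by (simp add: mult_le_0_iff)
  qed
  then show ?thesis using that gX g0 by blast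
qed

end

lemma clinear_onD:
  assumes "clinear_on D T"
  shows "f \<in> D \<Longrightarrow> g \<in> D \<Longrightarrow> T (f + g) = T f + T g" "f \<in> D \<Longrightarrow> T (c *\<^sub>C f) = c *\<^sub>C T f"
  using assms by (simp_all add: clinear_on_def)

lemma clinear_on_diff:
  assumes "clinear_on D T" "csubspace D" "f \<in> D" "g \<in> D"
  shows "T (f - g) = T f - T g"
proof -
  have "(-1) *\<^sub>C g \<in> D" using assms complex_vector.subspace_scale by blast
  then have "T (f + (-1) *\<^sub>C g) = T f + (-1) *\<^sub>C T g"
    using assms clinear_onD by metis
  then show ?thesis by simp
qed

section \<open>Self-adjoint operators and their resolvents\<close>

locale sa_op = hilb X for X :: "'a::complex_vector hspace" +
  fixes D :: "'a set" and T :: "'a \<Rightarrow> 'a"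
  assumes self_adjoint: "self_adjoint X D T"
begin

lemma csubspace_D: "csubspace D" and dense_D: "dense_in X D" and clinear_T: "clinear_on D T"
  and T_in: "f \<in> D \<Longrightarrow> T f \<in> vecs X"
  and adj: "adjoint_graph X D T = (\<lambda>f. (f, T f)) ` D"
  using self_adjoint by (auto simp: self_adjoint_def)

lemma D_in [simp, intro]: "f \<in> D \<Longrightarrow> f \<in> vecs X"
  using dense_D by (auto simp: dense_in_def)

lemma T_in' [simp, intro]: "f \<in> D \<Longrightarrow> T f \<in> vecs X" by (rule T_in)

lemma D_add [simp, intro]: "f \<in> D \<Longrightarrow> g \<in> D \<Longrightarrow> f + g \<in> D"
  and D_diff [simp, intro]: "f \<in> D \<Longrightarrow> g \<in> D \<Longrightarrow> f - g \<in> D"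
  and D_scale [simp, intro]: "f \<in> D \<Longrightarrow> c *\<^sub>C f \<in> D"
  and D_0 [simp, intro]: "0 \<in> D"
  using csubspace_D complex_vector.subspace_add complex_vector.subspace_diff
    complex_vector.subspace_scale complex_vector.subspace_0 by blast+

lemma T_add: "f \<in> D \<Longrightarrow> g \<in> D \<Longrightarrow> T (f + g) = T f + T g"
  and T_scale: "f \<in> D \<Longrightarrow> T (c *\<^sub>C f) = c *\<^sub>C T f"
  and T_diff: "f \<in> D \<Longrightarrow> g \<in> D \<Longrightarrow> T (f - g) = T f - T g"
  using clinear_onD[OF clinear_T] clinear_on_diff[OF clinear_T csubspace_D] by simp_all

text \<open>Self-adjointness enters through the inclusion of the domain of the adjoint in
  \<open>D\<close>: a vector that solves an equation weakly belongs to \<open>D\<close>.\<close>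

lemma adjointI:
  assumes "g \<in> vecs X" "h \<in> vecs X" "\<And>f. f \<in> D \<Longrightarrow> ip (T f) g = ip f h"
  shows "g \<in> D" "T g = h"
proof -
  have "(g, h) \<in> adjoint_graph X D T" using assms by (simp add: adjoint_graph_def)
  then show "g \<in> D" "T g = h" unfolding adj by auto
qed

lemma symmetric: "f \<in> D \<Longrightarrow> g \<in> D \<Longrightarrow> ip (T f) g = ip f (T g)"
proof -
  assume "f \<in> D" "g \<in> D"
  then have "(g, T g) \<in> adjoint_graph X D T" unfolding adj by auto
  then show ?thesis using \<open>f \<in> D\<close> by (simp add: adjoint_graph_def)
qed

lemma ip_T_self_real: "f \<in> D \<Longrightarrow> Im (ip (T f) f) = 0"
proof -
  assume f: "f \<in> D"
  then have "ip (T f) f = cnj (ip (T f) f)"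
    using symmetric[OF f f] ip_cnj[of "T f" f] by simp
  then show ?thesis by (simp add: complex_eq_iff)
qed

text \<open>The relation that defines the adjoint passes to the limit, and the adjoint is
  \<open>T\<close> itself.\<close>

lemma closed_graph:
  assumes "F \<noteq> bot" "\<And>i. \<sigma> i \<in> D" "f \<in> vecs X" "h \<in> vecs X"
    "((\<lambda>i. nrm (\<sigma> i - f)) \<longlongrightarrow> 0) F" "((\<lambda>i. nrm (T (\<sigma> i) - h)) \<longlongrightarrow> 0) F"
  shows "f \<in> D" "T f = h"
proof -
  have "ip (T g) f = ip g h" if g: "g \<in> D" for g
  proof -
    have "((\<lambda>i. ip (\<sigma> i) (T g)) \<longlongrightarrow> ip f (T g)) F"
      using assms g by (intro tendsto_ip_left) auto
    moreover have "((\<lambda>i. ip (T (\<sigma> i)) g) \<longlongrightarrow> ip h g) F"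
      using assms g by (intro tendsto_ip_left) auto
    moreover have "(\<lambda>i. ip (\<sigma> i) (T g)) = (\<lambda>i. ip (T (\<sigma> i)) g)"
      using symmetric assms(2) g by auto
    ultimately have "ip f (T g) = ip h g"
      using tendsto_unique[OF assms(1)] by metis
    then show ?thesis using assms g ip_cnj[of f "T g"] ip_cnj[of h g] by simp
  qed
  then show "f \<in> D" "T f = h" using adjointI[of f h] assms by auto
qed

text \<open>\<open>T\<close> contributes nothing to the imaginary part of the inner product of
  \<open>T f - z f\<close> with \<open>f\<close>; what remains there is \<open>- Im z\<close> times
  the squared norm.\<close>

lemma shift_bound:
  assumes f: "f \<in> D" shows "\<bar>Im z\<bar> * nrm f \<le> nrm (T f - z *\<^sub>C f)"
proof (cases "f = 0")
  case False
  have "Im (ip (T f - z *\<^sub>C f) f) = - Im z * (nrm f)\<^sup>2"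
    using f ip_T_self_real[OF f] ip_self[of f] by (simp add: ip_simps)
  then have "\<bar>Im z\<bar> * (nrm f)\<^sup>2 \<le> cmod (ip (T f - z *\<^sub>C f) f)"
    using abs_Im_le_cmod[of "ip (T f - z *\<^sub>C f) f"] by (simp add: abs_mult)
  also have "\<dots> \<le> nrm (T f - z *\<^sub>C f) * nrm f" using f by (intro Cauchy_Schwarz) auto
  finally have "\<bar>Im z\<bar> * nrm f * nrm f \<le> nrm (T f - z *\<^sub>C f) * nrm f"
    by (simp add: power2_eq_square mult.assoc)
  moreover have "nrm f > 0" using False nrm_eq_0[OF D_in[OF f]] nrm_nonneg[OF D_in[OF f]] by linarith
  ultimately show ?thesis by (simp only: mult_le_cancel_right_pos)
qed (use f in \<open>simp add: T_scale[of 0 0, simplified]\<close>)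

lemma T_0: "T 0 = 0" using T_scale[of 0 0] by simp

lemma shift_diff: "f \<in> D \<Longrightarrow> g \<in> D \<Longrightarrow> (T f - z *\<^sub>C f) - (T g - z *\<^sub>C g) = T (f - g) - z *\<^sub>C (f - g)"
  by (simp add: T_diff complex_vector.scale_right_diff_distrib)

lemma shift_inj: assumes "Im z \<noteq> 0" shows "inj_on (\<lambda>f. T f - z *\<^sub>C f) D"
proof (rule inj_onI)
  fix f g assume fg: "f \<in> D" "g \<in> D" "T f - z *\<^sub>C f = T g - z *\<^sub>C g"
  have "\<bar>Im z\<bar> * nrm (f - g) \<le> 0"
    using shift_bound[of "f - g" z] shift_diff[of f g z] fg by simp
  then have "nrm (f - g) = 0"
    using assms nrm_nonneg[of "f - g"] fg by (smt (verit) D_in mult_pos_pos vecs_diff)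
  then show "f = g" using nrm_eq_0[of "f - g"] fg by simp
qed

text \<open>The range is closed by \<open>shift_bound\<close>, and a nonzero vector orthogonal to it
  would be an eigenvector of \<open>T\<close> for the nonreal number \<open>cnj z\<close>, which
  \<open>shift_bound\<close> excludes as well.\<close>

lemma shift_surj: assumes z: "Im z \<noteq> 0" shows "(\<lambda>f. T f - z *\<^sub>C f) ` D = vecs X"
proof (rule ccontr)
  let ?M = "(\<lambda>f. T f - z *\<^sub>C f) ` D"
  assume ne: "?M \<noteq> vecs X"
  have sub: "csubspace ?M"
    unfolding complex_vector.subspace_def
  proof (intro conjI ballI allI)
    show "0 \<in> ?M" using T_0 by (force intro!: image_eqI[of _ _ 0])
  next
    fix a b assume "a \<in> ?M" "b \<in> ?M"
    then obtain f g where "f \<in> D" "g \<in> D" "a = T f - z *\<^sub>C f" "b = T g - z *\<^sub>C g" by auto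
    then show "a + b \<in> ?M"
      by (intro image_eqI[of _ _ "f + g"]) (auto simp: T_add complex_vector.scale_right_distrib)
  next
    fix c a assume "a \<in> ?M"
    then obtain f where "f \<in> D" "a = T f - z *\<^sub>C f" by auto
    then show "c *\<^sub>C a \<in> ?M"
      by (intro image_eqI[of _ _ "c *\<^sub>C f"])
        (auto simp: T_scale complex_vector.scale_right_diff_distrib mult.commute)
  qed
  have closed: "h \<in> ?M" if \<sigma>: "\<And>i::nat. \<sigma> i \<in> ?M" and h: "h \<in> vecs X" and lim: "(\<lambda>i. nrm (\<sigma> i - h)) \<longlonglongrightarrow> 0" for \<sigma> h
  proof -
    obtain \<tau> where \<tau>: "\<And>i. \<tau> i \<in> D" "\<And>i. \<sigma> i = T (\<tau> i) - z *\<^sub>C \<tau> i"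
      using \<sigma> unfolding image_iff by metis
    have \<sigma>X: "\<sigma> i \<in> vecs X" for i using \<tau> by simp
    have bound: "nrm (\<tau> i - \<tau> j) \<le> (nrm (\<sigma> i - h) + nrm (\<sigma> j - h)) / \<bar>Im z\<bar>" for i j
    proof -
      have "\<bar>Im z\<bar> * nrm (\<tau> i - \<tau> j) \<le> nrm (\<sigma> i - \<sigma> j)"
        using shift_bound[of "\<tau> i - \<tau> j" z] shift_diff[of "\<tau> i" "\<tau> j" z] \<tau> by simp
      also have "\<dots> \<le> nrm (\<sigma> i - h) + nrm (\<sigma> j - h)"
        using nrm_triangle_sub[of "\<sigma> i" h "\<sigma> j"] nrm_minus_commute[of h "\<sigma> j"] \<sigma>X h by simp
      finally show ?thesis using z by (simp add: field_simps)
    qed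
    have "\<exists>N. \<forall>i\<ge>N. \<forall>j\<ge>N. nrm (\<tau> i - \<tau> j) < e" if "e > 0" for e
    proof -
      have "\<bar>Im z\<bar> * e / 2 > 0" using z that by simp
      then obtain N where N: "\<And>i. i \<ge> N \<Longrightarrow> nrm (\<sigma> i - h) < \<bar>Im z\<bar> * e / 2"
        using LIMSEQ_D[OF lim] \<sigma>X h by (metis (no_types, lifting) abs_of_nonneg diff_zero nrm_nonneg real_norm_def vecs_diff)
      have "nrm (\<tau> i - \<tau> j) < e" if "i \<ge> N" "j \<ge> N" for i j
      proof -
        have "(nrm (\<sigma> i - h) + nrm (\<sigma> j - h)) / \<bar>Im z\<bar> < e"
          using N[OF that(1)] N[OF that(2)] z by (simp add: field_simps)
        then show ?thesis using bound[of i j] by linarith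
      qed
      then show ?thesis by blast
    qed
    moreover have "range \<tau> \<subseteq> vecs X" using \<tau> by auto
    ultimately obtain f where f: "f \<in> vecs X" "(\<lambda>i. nrm (\<tau> i - f)) \<longlonglongrightarrow> 0" using complete by metis
    have *: "(\<lambda>i. nrm (\<sigma> i - h) + cmod z * nrm (\<tau> i - f)) \<longlonglongrightarrow> 0 + cmod z * 0"
      by (intro tendsto_intros lim f)
    have "(\<lambda>i. nrm (T (\<tau> i) - (h + z *\<^sub>C f))) \<longlonglongrightarrow> 0"
    proof (rule tendsto_sandwich[OF _ _ tendsto_const])
      show "(\<lambda>i. nrm (\<sigma> i - h) + cmod z * nrm (\<tau> i - f)) \<longlonglongrightarrow> 0" using * by simp
      have "nrm (T (\<tau> i) - (h + z *\<^sub>C f)) \<le> nrm (\<sigma> i - h) + cmod z * nrm (\<tau> i - f)" for i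
      proof -
        have eq: "T (\<tau> i) - (h + z *\<^sub>C f) = (\<sigma> i - h) + z *\<^sub>C (\<tau> i - f)"
          by (simp add: \<tau> complex_vector.scale_right_diff_distrib)
        show ?thesis unfolding eq
          using nrm_triangle[of "\<sigma> i - h" "z *\<^sub>C (\<tau> i - f)"] \<sigma>X h \<tau>(1) f by (simp add: nrm_scale)
      qed
      then show "\<forall>\<^sub>F i in sequentially. nrm (T (\<tau> i) - (h + z *\<^sub>C f)) \<le> nrm (\<sigma> i - h) + cmod z * nrm (\<tau> i - f)"
        by simp
    qed (use \<tau> f h in auto)
    then have "f \<in> D" "T f = h + z *\<^sub>C f"
      using closed_graph[of sequentially \<tau> f "h + z *\<^sub>C f"] \<tau> f h by auto
    then show ?thesis by (intro image_eqI[of _ _ f]) auto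
  qed
  have MX: "?M \<subseteq> vecs X" by auto
  obtain g where g: "g \<in> vecs X" "g \<noteq> 0" "\<And>f. f \<in> ?M \<Longrightarrow> ip f g = 0"
    by (rule orthogonal_vector_exists[OF sub MX _ ne], erule (2) closed) blast
  have "ip (T f) g = ip f (cnj z *\<^sub>C g)" if "f \<in> D" for f
  proof -
    have "ip (T f - z *\<^sub>C f) g = 0" using g(3) that by blast
    then show ?thesis using that g(1) by (simp add: ip_simps)
  qed
  then have gD: "g \<in> D" "T g = cnj z *\<^sub>C g" using adjointI[of g "cnj z *\<^sub>C g"] g by auto
  then have "\<bar>Im (cnj z)\<bar> * nrm g \<le> 0" using shift_bound[of g "cnj z"] by simp
  then have "nrm g \<le> 0" using z by (simp add: mult_le_0_iff)
  then have "nrm g = 0" using nrm_nonneg[OF g(1)] by linarith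
  then show False using nrm_eq_0 g by blast
qed

abbreviation Res :: "complex \<Rightarrow> 'a \<Rightarrow> 'a" where "Res z \<equiv> resolvent D T z"

context
  fixes z :: complex assumes z: "Im z \<noteq> 0"
begin

lemma Res_in_D: "f \<in> vecs X \<Longrightarrow> Res z f \<in> D"
  unfolding resolvent_def
  using the_inv_into_into[OF shift_inj[OF z], of f D] shift_surj[OF z] by simp

lemma Res_in: "f \<in> vecs X \<Longrightarrow> Res z f \<in> vecs X"
  using Res_in_D by blast

lemma shift_Res: "f \<in> vecs X \<Longrightarrow> T (Res z f) - z *\<^sub>C Res z f = f"
  unfolding resolvent_def
  using f_the_inv_into_f[OF shift_inj[OF z], of f] shift_surj[OF z] by simp

lemma T_Res: "f \<in> vecs X \<Longrightarrow> T (Res z f) = f + z *\<^sub>C Res z f"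
  using shift_Res[of f] by (metis diff_add_cancel)

lemma Res_shift: "f \<in> D \<Longrightarrow> Res z (T f - z *\<^sub>C f) = f"
  unfolding resolvent_def using the_inv_into_f_f[OF shift_inj[OF z]] by simp

lemma Res_eqI: "f \<in> D \<Longrightarrow> T f - z *\<^sub>C f = h \<Longrightarrow> Res z h = f"
  using Res_shift by blast

lemma Res_add: "f \<in> vecs X \<Longrightarrow> g \<in> vecs X \<Longrightarrow> Res z (f + g) = Res z f + Res z g"
  by (rule Res_eqI) (auto simp: Res_in_D T_add T_Res complex_vector.scale_right_distrib)

lemma Res_scale: "f \<in> vecs X \<Longrightarrow> Res z (c *\<^sub>C f) = c *\<^sub>C Res z f"
  by (rule Res_eqI) (auto simp: Res_in_D T_scale T_Res complex_vector.scale_right_distrib mult.commute)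

lemma Res_diff: "f \<in> vecs X \<Longrightarrow> g \<in> vecs X \<Longrightarrow> Res z (f - g) = Res z f - Res z g"
  by (rule Res_eqI) (auto simp: Res_in_D T_diff T_Res complex_vector.scale_right_diff_distrib)

lemma Res_bound: "f \<in> vecs X \<Longrightarrow> nrm (Res z f) \<le> nrm f / \<bar>Im z\<bar>"
  using shift_bound[OF Res_in_D, of f z] shift_Res[of f] z by (simp add: field_simps)

end

lemma Res_adjoint:
  assumes "Im z \<noteq> 0" "f \<in> vecs X" "g \<in> vecs X"
  shows "ip (Res z f) g = ip f (Res (cnj z) g)"
proof -
  have z': "Im (cnj z) \<noteq> 0" using assms by simp
  have D: "Res z f \<in> D" "Res (cnj z) g \<in> D" using Res_in_D assms z' by blast+
  have "ip (Res z f) g = ip (Res z f) (T (Res (cnj z) g) - cnj z *\<^sub>C Res (cnj z) g)"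
    using shift_Res[OF z'] assms by simp
  also have "\<dots> = ip (T (Res z f) - z *\<^sub>C Res z f) (Res (cnj z) g)"
    using D by (simp add: ip_simps symmetric)
  finally show ?thesis using shift_Res[OF assms(1)] assms by simp
qed

lemma Res_identity:
  assumes "Im z \<noteq> 0" "Im w \<noteq> 0" "f \<in> vecs X"
  shows "Res z f - Res w f = (z - w) *\<^sub>C Res z (Res w f)"
proof -
  have D: "Res z f \<in> D" "Res w f \<in> D" "Res z (Res w f) \<in> D" "Res w f \<in> vecs X"
    using Res_in_D Res_in assms by blast+
  have "Res z f = Res w f + (z - w) *\<^sub>C Res z (Res w f)"
  proof (rule Res_eqI[OF assms(1)])
    show "Res w f + (z - w) *\<^sub>C Res z (Res w f) \<in> D" using D by auto
    show "T (Res w f + (z - w) *\<^sub>C Res z (Res w f)) - z *\<^sub>C (Res w f + (z - w) *\<^sub>C Res z (Res w f)) = f"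
      using D assms
      by (simp add: T_add T_scale T_Res complex_vector.scale_right_distrib mult.commute)
        (simp add: complex_vector.scale_left_diff_distrib)
  qed
  then show ?thesis by simp
qed

text \<open>The resolvent identity at \<open>z\<close> and \<open>cnj w\<close>, read in inner
  products. For \<open>w = z\<close> it yields \<open>Im_ip_Res\<close>, for two points on a
  vertical line \<open>Res_vertical_distance\<close>.\<close>

lemma ip_Res_Res:
  assumes "Im z \<noteq> 0" "Im w \<noteq> 0" "f \<in> vecs X" "g \<in> vecs X"
  shows "(z - cnj w) * ip (Res z f) (Res w g) = ip (Res z f) g - ip f (Res w g)"
proof -
  have w': "Im (cnj w) \<noteq> 0" using assms by simp
  have "(z - cnj w) * ip (Res z f) (Res w g) = (z - cnj w) * ip (Res (cnj w) (Res z f)) g"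
    using Res_adjoint[OF w', of "Res z f" g] assms Res_in by simp
  also have "\<dots> = - ip (Res (cnj w) f - Res z f) g"
    unfolding Res_identity[OF w' assms(1,3)]
    using Res_in[OF w' Res_in[OF assms(1,3)]] assms
    by (simp add: ip_scale_left) (simp add: algebra_simps)
  also have "\<dots> = ip (Res z f) g - ip f (Res w g)"
    using Res_adjoint[OF w', of f g] assms Res_in[OF w'] Res_in[OF assms(1)] by (simp add: ip_simps)
  finally show ?thesis .
qed

lemma Im_ip_Res: "Im z \<noteq> 0 \<Longrightarrow> f \<in> vecs X \<Longrightarrow> Im (ip (Res z f) f) = Im z * (nrm (Res z f))\<^sup>2"
proof -
  assume a: "Im z \<noteq> 0" "f \<in> vecs X"
  have "(z - cnj z) * of_real ((nrm (Res z f))\<^sup>2) = ip (Res z f) f - cnj (ip (Res z f) f)"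
    using ip_Res_Res[OF a(1) a(1) a(2) a(2)] ip_self[of "Res z f"] Res_in[OF a] ip_cnj[of "Res z f" f] a by simp
  then show ?thesis by (simp add: complex_eq_iff)
qed

lemma Res_difference_bound:
  assumes "Im z \<noteq> 0" "Im w \<noteq> 0" "f \<in> vecs X"
  shows "nrm (Res w f - Res z f) \<le> cmod (w - z) * nrm f / (\<bar>Im w\<bar> * \<bar>Im z\<bar>)"
proof -
  have "nrm (Res w f - Res z f) = cmod (w - z) * nrm (Res w (Res z f))"
    using Res_identity[OF assms(2,1,3)] Res_in assms by (simp add: nrm_scale)
  also have "\<dots> \<le> cmod (w - z) * (nrm f / \<bar>Im z\<bar> / \<bar>Im w\<bar>)"
    using Res_bound[OF assms(2), of "Res z f"] Res_bound[OF assms(1,3)] Res_in assms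
    by (intro mult_left_mono) (meson divide_right_mono abs_ge_zero order_trans, simp)
  finally show ?thesis by (simp add: mult.commute)
qed

lemma holomorphic_ip_Res:
  assumes f: "f \<in> vecs X" "g \<in> vecs X"
  shows "(\<lambda>z. ip (Res z f) g) holomorphic_on {z. Im z > 0}"
proof (rule holomorphic_onI)
  fix z :: complex assume "z \<in> {z. Im z > 0}"
  then have z: "Im z > 0" "Im z \<noteq> 0" by auto
  \<comment> \<open>The derivative of \<open>Res z f\<close> in \<open>z\<close> is
    \<open>Res z (Res z f)\<close>, so the difference quotient is compared with
    \<open>ip (Res z h) g\<close>.\<close>
  define h where "h = Res z f"
  have h: "h \<in> vecs X" using Res_in f z by (simp add: h_def)
  have ev: "\<forall>\<^sub>F w in at z. Im w > Im z / 2"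
  proof -
    have "(Im \<longlongrightarrow> Im z) (at z)" by (intro tendsto_intros)
    then show ?thesis using z by (intro order_tendstoD(1)) auto
  qed
  have "((\<lambda>w. (ip (Res w f) g - ip (Res z f) g) / (w - z) - ip (Res z h) g) \<longlongrightarrow> 0) (at z)"
  proof (rule Lim_null_comparison)
    show "\<forall>\<^sub>F w in at z. norm ((ip (Res w f) g - ip (Res z f) g) / (w - z) - ip (Res z h) g)
        \<le> cmod (w - z) * (nrm h / (Im z / 2 * Im z) * nrm g)"
      using ev eventually_neq_at_within[of z z]
    proof eventually_elim
      case (elim w)
      have w: "Im w \<noteq> 0" using elim z by auto
      note in' = Res_in[OF w] Res_in[OF z(2)] f h
      have "ip (Res w f) g - ip (Res z f) g = (w - z) * ip (Res w h) g"
        using Res_identity[OF w z(2) f(1)] in' by (simp add: ip_diff_left[symmetric] ip_scale_left h_def)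
      then have "(ip (Res w f) g - ip (Res z f) g) / (w - z) - ip (Res z h) g = ip (Res w h - Res z h) g"
        using elim in' by (simp add: ip_simps)
      also have "cmod \<dots> \<le> nrm (Res w h - Res z h) * nrm g"
        using in' by (intro Cauchy_Schwarz) auto
      also have "\<dots> \<le> cmod (w - z) * nrm h / (\<bar>Im w\<bar> * \<bar>Im z\<bar>) * nrm g"
        using Res_difference_bound[OF z(2) w h] f by (intro mult_right_mono) auto
      also have "cmod (w - z) * nrm h / (\<bar>Im w\<bar> * \<bar>Im z\<bar>) \<le> cmod (w - z) * nrm h / (Im z / 2 * Im z)"
        using elim z h by (intro divide_left_mono mult_mono) auto
      finally show ?case using f by (simp add: mult_right_mono mult.assoc)
    qed
    have "((\<lambda>w. cmod (w - z) * (nrm h / (Im z / 2 * Im z) * nrm g)) \<longlongrightarrow> cmod (z - z) * (nrm h / (Im z / 2 * Im z) * nrm g)) (at z)"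
      by (intro tendsto_intros)
    then show "((\<lambda>w. cmod (w - z) * (nrm h / (Im z / 2 * Im z) * nrm g)) \<longlongrightarrow> 0) (at z)" by simp
  qed
  then have "((\<lambda>z. ip (Res z f) g) has_field_derivative ip (Res z h) g) (at z)"
    by (simp add: has_field_derivative_iff LIM_zero_iff)
  then show "(\<lambda>z. ip (Res z f) g) field_differentiable (at z within {z. Im z > 0})"
    using field_differentiable_at_within field_differentiable_def by blast
qed

text \<open>The squared norm of \<open>R(\<lambda> + i\<epsilon>) f\<close> is monotone in \<open>\<epsilon>\<close> and controls the mutual distances.\<close>

lemma Res_vertical_distance:
  fixes l :: real
  assumes f: "f \<in> vecs X" and e: "\<epsilon> > 0" "\<eta> > 0"
  defines "u \<equiv> \<lambda>t. Res (Complex l t) f"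
  shows "(nrm (u \<epsilon> - u \<eta>))\<^sup>2 * (\<epsilon> + \<eta>) = (\<eta> - \<epsilon>) * ((nrm (u \<epsilon>))\<^sup>2 - (nrm (u \<eta>))\<^sup>2)"
proof -
  have in': "u \<epsilon> \<in> vecs X" "u \<eta> \<in> vecs X" using Res_in f e by (auto simp: u_def)
  let ?z = "Complex l \<epsilon>" and ?w = "Complex l \<eta>"
  have "(?z - cnj ?w) * ip (u \<epsilon>) (u \<eta>) = ip (u \<epsilon>) f - cnj (ip (u \<eta>) f)"
    using ip_Res_Res[of ?z ?w f f] e f in' ip_cnj[of "u \<eta>" f] by (simp add: u_def)
  then have "Im ((?z - cnj ?w) * ip (u \<epsilon>) (u \<eta>)) = Im (ip (u \<epsilon>) f) + Im (ip (u \<eta>) f)"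
    by simp
  moreover have "Im (ip (u \<epsilon>) f) = \<epsilon> * (nrm (u \<epsilon>))\<^sup>2" "Im (ip (u \<eta>) f) = \<eta> * (nrm (u \<eta>))\<^sup>2"
    using Im_ip_Res[of ?z f] Im_ip_Res[of ?w f] e f by (simp_all add: u_def)
  ultimately have "(\<epsilon> + \<eta>) * Re (ip (u \<epsilon>) (u \<eta>)) = \<epsilon> * (nrm (u \<epsilon>))\<^sup>2 + \<eta> * (nrm (u \<eta>))\<^sup>2"
    by simp
  then show ?thesis using in' by (simp add: nrm_diff_sq algebra_simps)
qed

end

section \<open>Functions with nonnegative imaginary part on the half plane\<close>

text \<open>One Cauchy kernel decays only like \<open>1 / \<bar>t\<bar>\<close>. Its difference with
  the kernel at the mirror point decays like \<open>1 / t\<^sup>2\<close> and is the Poisson kernel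
  up to a factor.\<close>

lemma poisson_kernel_eq:
  assumes "y > 0"
  shows "1 / (of_real t - Complex x y) - 1 / (of_real t - Complex x (- y))
    = 2 * \<i> * of_real (y / ((t - x)\<^sup>2 + y\<^sup>2))"
proof -
  have p: "(of_real t - Complex x y) * (of_real t - Complex x (- y)) = of_real ((t - x)\<^sup>2 + y\<^sup>2)"
    by (simp add: complex_eq_iff power2_eq_square algebra_simps)
  have nz: "of_real t - Complex x y \<noteq> 0" "of_real t - Complex x (- y) \<noteq> 0"
    using assms by (auto simp: complex_eq_iff)
  have "1 / (of_real t - Complex x y) - 1 / (of_real t - Complex x (- y))
    = (2 * \<i> * of_real y) / ((of_real t - Complex x y) * (of_real t - Complex x (- y)))"
    using nz by (simp add: divide_simps) (simp add: complex_eq_iff)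
  then show ?thesis unfolding p by simp
qed

text \<open>Cauchy's formula on the rectangle with base \<open>[-L, L]\<close> and height \<open>L\<close>, with the pole at the
  reflected point subtracted, so that the three other sides contribute only \<open>O(1/L)\<close>.\<close>

lemma poisson_truncated:
  assumes hol: "F holomorphic_on {z. Im z > -e}" and e: "e > 0"
    and bnd: "\<And>z. Im z \<ge> 0 \<Longrightarrow> cmod (F z) \<le> K"
    and y: "y > 0" and L: "L \<ge> 2 * (\<bar>x\<bar> + y)"
  shows "(\<lambda>t. of_real (y / ((t - x)\<^sup>2 + y\<^sup>2)) * F (of_real t)) integrable_on {-L..L}"
    and "cmod (F (Complex x y) -
      of_real (1 / pi) * integral {-L..L} (\<lambda>t. of_real (y / ((t - x)\<^sup>2 + y\<^sup>2)) * F (of_real t)))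
      \<le> 20 * K * y / L"
proof -
  define z where "z = Complex x y"
  define w where "w = Complex x (- y)"
  define k where "k = (\<lambda>u. 1 / (u - z) - 1 / (u - w))"
  define G where "G = (\<lambda>u. F u * k u)"
  let ?S = "{z::complex. Im z > -e}"
  have L0: "L > 0" using y L by simp
  have K0: "K \<ge> 0" using order_trans[OF norm_ge_zero bnd[of 0]] by simp
  define a where "a = Complex (-L) 0"
  define b where "b = Complex L L"
  have zbox: "z \<in> box a b"
    using y L by (auto simp: z_def a_def b_def box_def Basis_complex_def inner_complex_def)
  have S: "convex ?S" "open ?S"
    using convex_halfspace_Im_gt[of "-e"] open_halfspace_Im_gt[of "-e"] by auto
  have img: "path_image (rectpath a b) \<subseteq> cbox a b - box a b"
    using path_image_rectpath_cbox_minus_box[of a b] L0 by (simp add: a_def b_def)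
  have cb: "cbox a b \<subseteq> ?S" 
    using e by (auto simp: a_def b_def cbox_def Basis_complex_def inner_complex_def)
  have wS: "Im w < 0" using y by (simp add: w_def)
  have cb0: "Im u \<ge> 0" if "u \<in> cbox a b" for u
    using that by (auto simp: a_def b_def cbox_def Basis_complex_def inner_complex_def)
  have 1: "((\<lambda>u. F u / (u - z)) has_contour_integral (2 * pi * \<i> * F z)) (rectpath a b)"
  proof -
    have "((\<lambda>u. F u / (u - z)) has_contour_integral (2 * pi * \<i> * winding_number (rectpath a b) z * F z)) (rectpath a b)"
    proof (rule Cauchy_integral_formula_convex_simple[OF S(1) hol])
      show "z \<in> interior ?S" using S(2) y e by (simp add: interior_open z_def)
      show "path_image (rectpath a b) \<subseteq> ?S - {z}" using img cb zbox by auto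
    qed auto
    then show ?thesis using winding_number_rectpath[OF zbox] by simp
  qed
  have 2: "((\<lambda>u. F u / (u - w)) has_contour_integral 0) (rectpath a b)"
  proof (rule Cauchy_theorem_convex_simple)
    \<comment> \<open>The threshold \<open>- min e y\<close> keeps the reflected point
      \<open>w\<close>, at height \<open>- y\<close>, outside the half plane.\<close>
    let ?S' = "{z::complex. Im z > - min e y}"
    show "convex ?S'" using convex_halfspace_Im_gt[of "-min e y"] by simp
    show "(\<lambda>u. F u / (u - w)) holomorphic_on ?S'"
      by (intro holomorphic_intros holomorphic_on_subset[OF hol]) (auto simp: w_def)
    have "cbox a b \<subseteq> ?S'" using cb0 y e by force
    then show "path_image (rectpath a b) \<subseteq> ?S'" using img by blast
  qed auto
  have G: "(G has_contour_integral (2 * pi * \<i> * F z)) (rectpath a b)"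
    using has_contour_integral_diff[OF 1 2] by (simp add: G_def k_def algebra_simps)
  define b1 where "b1 = Complex L 0"
  define b2 where "b2 = Complex (-L) L"
  have rp: "rectpath a b = linepath a b1 +++ linepath b1 b +++ linepath b b2 +++ linepath b2 a"
    by (simp add: rectpath_def Let_def a_def b_def b1_def b2_def)
  define I where "I = (\<lambda>p q. contour_integral (linepath p q) G)"
  have cont: "continuous_on (cbox a b - box a b) G"
    unfolding G_def k_def
  proof (intro continuous_intros)
    show "continuous_on (cbox a b - box a b) F"
      using holomorphic_on_imp_continuous_on[OF hol] cb continuous_on_subset by blast
  qed (use zbox wS cb0 in force)+
  have segs: "closed_segment a b1 \<subseteq> cbox a b - box a b" "closed_segment b1 b \<subseteq> cbox a b - box a b"
    "closed_segment b b2 \<subseteq> cbox a b - box a b" "closed_segment b2 a \<subseteq> cbox a b - box a b"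
    using img unfolding rp by (auto simp: path_image_join)
  have ci: "G contour_integrable_on linepath a b1" "G contour_integrable_on linepath b1 b"
    "G contour_integrable_on linepath b b2" "G contour_integrable_on linepath b2 a"
    using segs cont continuous_on_subset contour_integrable_continuous_linepath by blast+
  have tot: "I a b1 + (I b1 b + (I b b2 + I b2 a)) = 2 * pi * \<i> * F z"
    using contour_integral_unique[OF G] ci unfolding rp I_def
    by (simp add: contour_integrable_joinI)
  have kb: "cmod (G u) \<le> K * (2 * y / (L / 2)\<^sup>2)" if u: "Im u \<ge> 0" "cmod u \<ge> L" for u
  proof -
    \<comment> \<open>The lower bound on \<open>L\<close> puts both poles into the disc of radius
      \<open>L / 2\<close>, hence at distance at least \<open>L / 2\<close> from the three sides
      other than the base.\<close>
    have nz: "cmod z \<le> L / 2" "cmod w \<le> L / 2"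
      using cmod_le[of z] cmod_le[of w] y L by (auto simp: z_def w_def)
    have d: "cmod (u - z) \<ge> L / 2" "cmod (u - w) \<ge> L / 2"
      using norm_triangle_ineq2[of u z] norm_triangle_ineq2[of u w] nz u by linarith+
    then have ne: "u - z \<noteq> 0" "u - w \<noteq> 0" using L0 by auto
    have "k u = (z - w) / ((u - z) * (u - w))"
      unfolding k_def using ne by (simp add: divide_simps)
    also have "z - w = Complex 0 (2 * y)" by (simp add: z_def w_def complex_eq_iff)
    finally have "k u = Complex 0 (2 * y) / ((u - z) * (u - w))" .
    moreover have "cmod (Complex 0 (2 * y)) = 2 * y" using y by (simp add: cmod_def real_sqrt_mult)
    ultimately have "cmod (k u) = 2 * y / (cmod (u - z) * cmod (u - w))"
      by (simp add: norm_divide norm_mult)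
    also have "\<dots> \<le> 2 * y / (L / 2)\<^sup>2"
      unfolding power2_eq_square using d L0 y by (intro divide_left_mono mult_mono mult_pos_pos) auto
    finally show ?thesis unfolding G_def norm_mult
      using bnd[OF u(1)] K0 by (intro mult_mono) auto
  qed
  define M where "M = K * (2 * y / (L / 2)\<^sup>2) * (2 * L)"
  have side: "cmod (I p q) \<le> M"
    if "G contour_integrable_on linepath p q" "cmod (q - p) \<le> 2 * L"
      "\<And>u. u \<in> closed_segment p q \<Longrightarrow> Im u \<ge> 0 \<and> cmod u \<ge> L" for p q
  proof -
    have C0: "K * (2 * y / (L / 2)\<^sup>2) \<ge> 0" using K0 y L0 by simp
    have "cmod (I p q) \<le> K * (2 * y / (L / 2)\<^sup>2) * cmod (q - p)"
      unfolding I_def using that kb C0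
      by (intro has_contour_integral_bound_linepath[OF has_contour_integral_integral]) auto
    also have "\<dots> \<le> M" unfolding M_def using C0 that by (intro mult_left_mono) auto
    finally show ?thesis .
  qed
  have segRe: "Re u = c" if "u \<in> closed_segment p q" "Re p = c" "Re q = c" for u p q c
  proof -
    obtain s where u: "u = (1 - s) *\<^sub>R p + s *\<^sub>R q"
      using \<open>u \<in> closed_segment p q\<close> by (auto simp: in_segment)
    show ?thesis unfolding u using that(2,3) by (simp add: algebra_simps)
  qed
  have segIm: "Im u = c" if "u \<in> closed_segment p q" "Im p = c" "Im q = c" for u p q c
  proof -
    obtain s where u: "u = (1 - s) *\<^sub>R p + s *\<^sub>R q"
      using \<open>u \<in> closed_segment p q\<close> by (auto simp: in_segment)
    show ?thesis unfolding u using that(2,3) by (simp add: algebra_simps)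
  qed
  have s1: "cmod (I b1 b) \<le> M"
  proof (rule side[OF ci(2)])
    show "cmod (b - b1) \<le> 2 * L" using L0 by (simp add: b_def b1_def cmod_def)
    fix u assume u: "u \<in> closed_segment b1 b"
    have "Re u = L" using segRe[OF u] by (simp add: b_def b1_def)
    then show "Im u \<ge> 0 \<and> cmod u \<ge> L" using abs_Re_le_cmod[of u] L0 segs(2) u cb0 by auto
  qed
  have s2: "cmod (I b b2) \<le> M"
  proof (rule side[OF ci(3)])
    show "cmod (b2 - b) \<le> 2 * L" using L0 by (simp add: b_def b2_def cmod_def real_sqrt_mult)
    fix u assume u: "u \<in> closed_segment b b2"
    have "Im u = L" using segIm[OF u] by (simp add: b_def b2_def)
    then show "Im u \<ge> 0 \<and> cmod u \<ge> L" using abs_Im_le_cmod[of u] L0 by auto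
  qed
  have s3: "cmod (I b2 a) \<le> M"
  proof (rule side[OF ci(4)])
    show "cmod (a - b2) \<le> 2 * L" using L0 by (simp add: a_def b2_def cmod_def)
    fix u assume u: "u \<in> closed_segment b2 a"
    have "Re u = - L" using segRe[OF u] by (simp add: a_def b2_def)
    then show "Im u \<ge> 0 \<and> cmod u \<ge> L" using abs_Re_le_cmod[of u] L0 segs(4) u cb0 by auto
  qed
  let ?g = "\<lambda>t. of_real (y / ((t - x)\<^sup>2 + y\<^sup>2)) * F (of_real t)"
  have Gt: "G (of_real t) = 2 * \<i> * ?g t" for t
    unfolding G_def k_def z_def w_def poisson_kernel_eq[OF y] by simp
  have ab1: "a = of_real (-L)" "b1 = of_real L" by (simp_all add: a_def b1_def complex_eq_iff)
  have contR: "continuous_on {-L..L} ?g"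
  proof (intro continuous_intros)
    show "\<forall>t\<in>{- L..L}. (t - x)\<^sup>2 + y\<^sup>2 \<noteq> 0" using y by (simp add: sum_power2_eq_zero_iff)
    have "continuous_on (of_real ` {-L..L}) F"
      by (rule continuous_on_subset[OF holomorphic_on_imp_continuous_on[OF hol]]) (use e in auto)
    then show "continuous_on {- L..L} (\<lambda>t. F (complex_of_real t))"
      by (intro continuous_on_compose2[of _ F _ of_real]) (auto intro: continuous_intros)
  qed
  then show int: "?g integrable_on {-L..L}" by (rule integrable_continuous_interval)
  have Iab: "I a b1 = 2 * \<i> * integral {-L..L} ?g"
  proof -
    have "I a b1 = integral {-L..L} (\<lambda>t. G (of_real t))"
      unfolding I_def using L0 ab1 by (subst contour_integral_linepath_Reals_eq) auto
    then show ?thesis by (simp only: Gt integral_mult_right)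
  qed
  have "2 * pi * \<i> * (F z - of_real (1 / pi) * integral {-L..L} ?g) = I b1 b + (I b b2 + I b2 a)"
    using tot unfolding Iab by (simp add: algebra_simps)
  then have "cmod (2 * pi * \<i> * (F z - of_real (1 / pi) * integral {-L..L} ?g))
     \<le> 3 * M"
    using norm_triangle_ineq[of "I b1 b" "I b b2 + I b2 a"] norm_triangle_ineq[of "I b b2" "I b2 a"] s1 s2 s3
    by (simp only:)
  \<comment> \<open>Each of the three sides contributes at most \<open>16 * K * y / L\<close>.
    Division by \<open>2 * pi\<close>, which exceeds 6, leaves \<open>8 * K * y / L\<close>, below
    the claimed bound.\<close>
  also have "\<dots> = 48 * K * y / L" unfolding M_def using L0 by (simp add: power2_eq_square field_simps)
  finally have "2 * pi * cmod (F z - of_real (1 / pi) * integral {-L..L} ?g) \<le> 48 * K * y / L"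
    by (simp add: norm_mult)
  moreover have "2 * 3 * cmod (F z - of_real (1 / pi) * integral {-L..L} ?g)
      \<le> 2 * pi * cmod (F z - of_real (1 / pi) * integral {-L..L} ?g)"
    using pi_gt3 by (intro mult_right_mono) auto
  moreover have "K * y / L \<ge> 0" using K0 y L0 by simp
  ultimately show "cmod (F (Complex x y) - of_real (1 / pi) * integral {-L..L} ?g) \<le> 20 * K * y / L"
    by (simp add: z_def)
qed

text \<open>It is applied to \<open>F z = ip0 (A.Res z g) g\<close> with \<open>K\<close> the
  squared norm of \<open>g\<close>. Such an \<open>F\<close> is the Stieltjes transform of a finite
  measure; in place of the measure, the functions \<open>P t e\<close> at small height
  \<open>e\<close> carry the mass.\<close>

locale half_plane_positive =
  fixes F :: "complex \<Rightarrow> complex" and K :: real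
  assumes hol: "F holomorphic_on {z. Im z > 0}"
    and bnd: "\<And>z. Im z > 0 \<Longrightarrow> cmod (F z) \<le> K / Im z"
    and pos: "\<And>z. Im z > 0 \<Longrightarrow> Im (F z) \<ge> 0"
begin

definition P :: "real \<Rightarrow> real \<Rightarrow> real" where "P x y = Im (F (Complex x y))"

lemma P_nonneg: "y > 0 \<Longrightarrow> P x y \<ge> 0"
  by (simp add: P_def pos)

lemma K_nonneg: "K \<ge> 0"
  using order_trans[OF norm_ge_zero bnd[of \<i>]] by simp

lemma P_le: "y > 0 \<Longrightarrow> P x y \<le> K / y"
  using bnd[of "Complex x y"] abs_Im_le_cmod[of "F (Complex x y)"] by (simp add: P_def)

lemma isCont_F: "Im z > 0 \<Longrightarrow> isCont F z"
  using holomorphic_on_imp_continuous_on[OF hol] continuous_on_eq_continuous_at[OF open_halfspace_Im_gt[of 0], of F]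
  by simp

lemma continuous_on_P: "e > 0 \<Longrightarrow> continuous_on A (\<lambda>t. P t e)"
  unfolding P_def
proof (intro continuous_intros continuous_at_imp_continuous_on ballI)
  fix t assume e: "e > 0"
  have c: "isCont (\<lambda>t. Complex t e) t"
    unfolding Complex_eq by (intro continuous_intros)
  show "isCont (\<lambda>t. F (Complex t e)) t"
    by (rule isCont_o2[OF c isCont_F]) (use e in simp)
qed

lemma isCont_P: "y > 0 \<Longrightarrow> isCont (P x) y"
proof -
  assume y: "y > 0"
  have c: "isCont (\<lambda>t. Complex x t) y"
    unfolding Complex_eq by (intro continuous_intros)
  have "isCont (\<lambda>t. F (Complex x t)) y"
    by (rule isCont_o2[OF c isCont_F]) (use y in simp)
  then show ?thesis unfolding P_def[abs_def] isCont_def by (rule tendsto_Im)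
qed

abbreviation ker :: "real \<Rightarrow> real \<Rightarrow> real \<Rightarrow> real" where "ker x y t \<equiv> y / ((t - x)\<^sup>2 + y\<^sup>2)"

lemma ker_integrable: 
  assumes "y > 0" "e > 0"
  shows "(\<lambda>t. ker x y t * P t e) integrable_on {a..b}"
proof (intro integrable_continuous_interval continuous_intros continuous_on_P ballI)
  show "(t - x)\<^sup>2 + y\<^sup>2 \<noteq> 0" for t using assms by (simp add: sum_power2_eq_zero_iff)
qed (use assms in auto)

lemma poisson_P:
  assumes y: "y > 0" and e: "e > 0" and L: "L \<ge> 2 * (\<bar>x\<bar> + y)"
  shows "\<bar>P x (y + e) - (1 / pi) * integral {-L..L} (\<lambda>t. ker x y t * P t e)\<bar> \<le> 20 * (K / e) * y / L"
proof -
  \<comment> \<open>Raised by \<open>e\<close>, the function is holomorphic across the real line and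
    bounded by \<open>K / e\<close> on the closed upper half plane.\<close>
  define G where "G = (\<lambda>z. F (z + \<i> * of_real e))"
  have 1: "G holomorphic_on {z. Im z > - e}"
    unfolding G_def by (rule holomorphic_on_compose_gen[OF _ hol, unfolded o_def]) (auto intro: holomorphic_intros)
  have 2: "cmod (G z) \<le> K / e" if "Im z \<ge> 0" for z
  proof -
    have "cmod (G z) \<le> K / (Im z + e)" using bnd[of "z + \<i> * of_real e"] that e by (simp add: G_def)
    also have "\<dots> \<le> K / e" using that e K_nonneg by (intro divide_left_mono) auto
    finally show ?thesis .
  qed
  let ?g = "\<lambda>t. of_real (ker x y t) * G (of_real t)"
  note p = poisson_truncated[OF 1 e 2 y L]
  have g: "Im (?g t) = ker x y t * P t e" for t
  proof -
    have "of_real t + \<i> * of_real e = Complex t e" by (simp add: complex_eq_iff)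
    then have "Im (G (of_real t)) = P t e" by (simp add: G_def P_def)
    moreover have "Im (of_real c * w) = c * Im w" for c w by simp
    ultimately show ?thesis by metis
  qed
  have gI: "Im (integral {-L..L} ?g) = integral {-L..L} (\<lambda>t. ker x y t * P t e)"
  proof -
    have inner: "w \<bullet> \<i> = Im w" for w by (simp add: inner_complex_def)
    show ?thesis using integral_component_eq[OF p(1), of \<i>] unfolding inner g by simp
  qed
  have "Complex x y + \<i> * of_real e = Complex x (y + e)" by (simp add: complex_eq_iff)
  then have "Im (G (Complex x y)) = P x (y + e)" by (simp add: G_def P_def)
  then have "P x (y + e) - (1 / pi) * integral {-L..L} (\<lambda>t. ker x y t * P t e)
      = Im (G (Complex x y) - of_real (1 / pi) * integral {-L..L} ?g)"
    using gI by simp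
  then have "\<bar>P x (y + e) - (1 / pi) * integral {-L..L} (\<lambda>t. ker x y t * P t e)\<bar>
      \<le> cmod (G (Complex x y) - of_real (1 / pi) * integral {-L..L} ?g)"
    by (simp only: abs_Im_le_cmod)
  also have "\<dots> \<le> 20 * (K / e) * y / L" by (rule p(2))
  finally show ?thesis .
qed

text \<open>Positivity allows enlarging the interval to \<open>{-L..L}\<close>, and the error in
  \<open>poisson_P\<close> vanishes as \<open>L\<close> grows. Together with
  \<open>poisson_upper\<close> this stands in for the Poisson integral over the whole line.\<close>

lemma poisson_lower:
  assumes y: "y > 0" and e: "e > 0"
  shows "integral {a..b} (\<lambda>t. ker x y t * P t e) \<le> pi * P x (y + e)"
proof (rule field_le_epsilon)
  fix \<eta> :: real assume \<eta>: "\<eta> > 0"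
  define c where "c = 20 * (K / e) * y * pi"
  have c: "c / \<eta> \<ge> 0" using K_nonneg y e \<eta> by (simp add: c_def)
  define L where "L = 2 * (\<bar>x\<bar> + y) + \<bar>a\<bar> + \<bar>b\<bar> + c / \<eta>"
  have L: "L \<ge> 2 * (\<bar>x\<bar> + y)" "L \<ge> \<bar>a\<bar>" "L \<ge> \<bar>b\<bar>" "L \<ge> c / \<eta>"
    unfolding L_def using c y abs_ge_zero[of x] abs_ge_zero[of a] abs_ge_zero[of b] by simp_all
  have L0: "L > 0" using L(1) y by simp
  have "c / L \<le> \<eta>" using L(4) L0 \<eta> by (simp add: pos_divide_le_eq mult.commute)
  then have "20 * (K / e) * y / L * pi \<le> \<eta>" by (simp add: c_def mult.commute)
  moreover have "integral {a..b} (\<lambda>t. ker x y t * P t e) \<le> integral {-L..L} (\<lambda>t. ker x y t * P t e)"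
    using ker_integrable[OF y e] L y e P_nonneg by (intro integral_subset_le) auto
  moreover have "(1 / pi) * integral {-L..L} (\<lambda>t. ker x y t * P t e) \<le> P x (y + e) + 20 * (K / e) * y / L"
    using poisson_P[OF y e L(1)] by linarith
  then have "integral {-L..L} (\<lambda>t. ker x y t * P t e) \<le> pi * P x (y + e) + 20 * (K / e) * y / L * pi"
    by (simp add: field_simps)
  ultimately show "integral {a..b} (\<lambda>t. ker x y t * P t e) \<le> pi * P x (y + e) + \<eta>" by linarith
qed

lemma poisson_upper:
  assumes y: "y > 0" and e: "e > 0" and \<eta>: "\<eta> > 0"
  obtains L where "L \<ge> M" "pi * P x (y + e) \<le> integral {-L..L} (\<lambda>t. ker x y t * P t e) + \<eta>"
proof -
  define c where "c = 20 * (K / e) * y * pi"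
  have c: "c / \<eta> \<ge> 0" using K_nonneg y e \<eta> by (simp add: c_def)
  define L where "L = 2 * (\<bar>x\<bar> + y) + \<bar>M\<bar> + c / \<eta>"
  have L: "L \<ge> 2 * (\<bar>x\<bar> + y)" "L \<ge> M" "L \<ge> c / \<eta>"
    unfolding L_def using c y abs_ge_zero[of x] abs_ge_self[of M] by simp_all
  have L0: "L > 0" using L(1) y by simp
  have "c / L \<le> \<eta>" using L(3) L0 \<eta> by (simp add: pos_divide_le_eq mult.commute)
  then have "20 * (K / e) * y / L * pi \<le> \<eta>" by (simp add: c_def mult.commute)
  moreover have "P x (y + e) \<le> (1 / pi) * integral {-L..L} (\<lambda>t. ker x y t * P t e) + 20 * (K / e) * y / L"
    using poisson_P[OF y e L(1)] by linarith
  then have "pi * P x (y + e) \<le> integral {-L..L} (\<lambda>t. ker x y t * P t e) + 20 * (K / e) * y / L * pi"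
    by (simp add: field_simps)
  ultimately show thesis using that[OF L(2)] by linarith
qed

text \<open>The kernel at height \<open>v - u\<close> above a point of \<open>{u..v}\<close> is at
  least \<open>1 / (2 * (v - u))\<close> on that interval. So the mass of an interval is controlled
  by one value of \<open>P\<close>, at a height comparable with the length of the interval.\<close>

lemma interval_mass:
  assumes uv: "u < v" "u \<le> x" "x \<le> v" and e: "e > 0"
  shows "integral {u..v} (\<lambda>t. P t e) \<le> 2 * pi * (v - u) * P x (v - u + e)"
proof -
  let ?n = "v - u"
  have n: "?n > 0" using uv by simp
  have "integral {u..v} (\<lambda>t. 1 / (2 * ?n) * P t e) \<le> integral {u..v} (\<lambda>t. ker x ?n t * P t e)"
  proof (rule integral_le)
    show "(\<lambda>t. 1 / (2 * ?n) * P t e) integrable_on {u..v}"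
      by (intro integrable_continuous_interval continuous_intros continuous_on_P e)
    fix t assume t: "t \<in> {u..v}"
    have "(t - x)\<^sup>2 \<le> ?n\<^sup>2" using t uv by (intro abs_le_square_iff[THEN iffD1]) auto
    then have "?n / (?n\<^sup>2 + ?n\<^sup>2) \<le> ker x ?n t" using n
      by (intro divide_left_mono) (auto intro!: mult_pos_pos add_nonneg_pos)
    moreover have "?n / (?n\<^sup>2 + ?n\<^sup>2) = 1 / (2 * ?n)" using n by (simp add: power2_eq_square divide_simps)
    ultimately show "1 / (2 * ?n) * P t e \<le> ker x ?n t * P t e"
      using P_nonneg[OF e] by (intro mult_right_mono) auto
  qed (rule ker_integrable[OF n e])
  also have "\<dots> \<le> pi * P x (?n + e)" by (rule poisson_lower[OF n e])
  finally have "1 / (2 * ?n) * integral {u..v} (\<lambda>t. P t e) \<le> pi * P x (?n + e)"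
    by (simp only: integral_mult_right)
  then show ?thesis using n by (simp add: field_simps)
qed

text \<open>The limits \<open>h x\<close> are only assumed pointwise. Cousin's lemma replaces uniformity: on each
  interval of a fine tagged division the mass is controlled by the limit at the tag.\<close>

lemma near_mass:
  assumes lim: "\<And>x. x \<in> {l - r..l + r} \<Longrightarrow> (P x \<longlongrightarrow> h x) (at_right 0)"
    and h: "\<And>x. x \<in> {l - r..l + r} \<Longrightarrow> h x \<le> C * (x - l)\<^sup>2" and C: "C \<ge> 0" and r: "r > 0"
    and y: "0 < y"
  shows "\<exists>d>0. \<forall>e. 0 < e \<longrightarrow> e < d \<longrightarrow> integral {l - r..l + r} (\<lambda>t. ker l y t * P t e) \<le> 8 * pi * r * (C + 1) * y"
proof -
  \<comment> \<open>With this tolerance \<open>C * (x - l)\<^sup>2 + \<eta>\<close> is at most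
    \<open>C + 1\<close> times \<open>(x - l)\<^sup>2 + y\<^sup>2\<close>, and the latter cancels
    the denominator of \<open>ker l y x\<close>.\<close>
  define \<eta> where "\<eta> = y\<^sup>2"
  have \<eta>: "\<eta> > 0" using y by (simp add: \<eta>_def)
  have "\<exists>d>0. (\<forall>t. \<bar>t - x\<bar> < d \<longrightarrow> ker l y t \<le> 2 * ker l y x) \<and> (\<forall>e. 0 < e \<longrightarrow> e < d \<longrightarrow> P x e \<le> C * (x - l)\<^sup>2 + \<eta>)"
    if x: "x \<in> {l - r..l + r}" for x
  proof -
    have "(x - l)\<^sup>2 + y\<^sup>2 \<noteq> 0" using y by (simp add: sum_power2_eq_zero_iff)
    then have "isCont (ker l y) x" by (intro continuous_intros) auto
    have kx: "ker l y x > 0" using y by (intro divide_pos_pos add_nonneg_pos) auto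
    have "((\<lambda>t. ker l y t) \<longlongrightarrow> ker l y x) (nhds x)"
      using \<open>isCont (ker l y) x\<close> tendsto_at_iff_tendsto_nhds[of "\<lambda>t. ker l y t" x]
      by (simp only: isCont_def)
    moreover have "ker l y x < 2 * ker l y x" using kx by linarith
    ultimately have "\<forall>\<^sub>F t in nhds x. ker l y t < 2 * ker l y x"
      by (rule order_tendstoD(2))
    then obtain d1 where d1: "d1 > 0" "\<And>t. dist t x < d1 \<Longrightarrow> ker l y t < 2 * ker l y x"
      unfolding eventually_nhds_metric by blast
    have "h x < C * (x - l)\<^sup>2 + \<eta>" using h[OF x] \<eta> by simp
    then have "\<forall>\<^sub>F e in at_right 0. P x e < C * (x - l)\<^sup>2 + \<eta>"
      using lim[OF x] order_tendstoD(2) by blast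
    then obtain d2 where d2: "d2 > 0" "\<And>e. 0 < e \<Longrightarrow> e < d2 \<Longrightarrow> P x e < C * (x - l)\<^sup>2 + \<eta>"
      unfolding eventually_at_right_field by auto
    show ?thesis
      using d1 d2 by (intro exI[of _ "min d1 d2"]) (auto simp: dist_real_def intro: less_imp_le)
  qed
  then obtain d where d: "\<And>x. x \<in> {l - r..l + r} \<Longrightarrow> d x > 0"
    "\<And>x t. x \<in> {l - r..l + r} \<Longrightarrow> \<bar>t - x\<bar> < d x \<Longrightarrow> ker l y t \<le> 2 * ker l y x"
    "\<And>x e. x \<in> {l - r..l + r} \<Longrightarrow> 0 < e \<Longrightarrow> e < d x \<Longrightarrow> P x e \<le> C * (x - l)\<^sup>2 + \<eta>"
    by metis
  \<comment> \<open>With radius \<open>d x / 4\<close> an interval of the division has length below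
    \<open>d x / 2\<close>; adding \<open>e < d x / 4\<close> keeps the height that occurs in
    \<open>interval_mass\<close> below \<open>d x\<close>.\<close>
  define \<gamma> where "\<gamma> = (\<lambda>x. ball x (if x \<in> {l - r..l + r} then d x / 4 else 1))"
  have "gauge \<gamma>" unfolding \<gamma>_def gauge_def using d(1) by auto
  then obtain p where p: "p tagged_division_of {l - r..l + r}" "\<gamma> fine p"
    using fine_division_exists_real by blast
  have fin: "finite p" using p(1) by (rule tagged_division_ofD(1))
  \<comment> \<open>The division is finite, so its thresholds have a positive minimum; the 1 keeps
    the set nonempty.\<close>
  define e0 where "e0 = Min (insert 1 ((\<lambda>(x, J). d x / 4) ` p))"
  have tag: "x \<in> {l - r..l + r}" if "(x, J) \<in> p" for x J
    using p(1) that by (meson subsetD tagged_division_ofD(2,3))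
  have e0: "e0 > 0" unfolding e0_def using fin d(1) tag by (subst Min_gr_iff) auto
  have piece: "integral J (\<lambda>t. ker l y t * P t e) \<le> 4 * pi * (C + 1) * y * measure lborel J"
    if xJ: "(x, J) \<in> p" and e: "0 < e" "e < e0" for x J e
  proof -
    obtain u v where J: "J = {u..v}" using p(1) xJ tagged_division_ofD(4) by (metis interval_cbox)
    have xin: "x \<in> J" using p(1) xJ tagged_division_ofD(2) by blast
    have Jsub: "J \<subseteq> ball x (d x / 4)" using fineD[OF p(2) xJ] tag[OF xJ] by (simp add: \<gamma>_def)
    have uv: "u \<le> x" "x \<le> v" using xin J by auto
    have ed: "e < d x / 4"
    proof -
      have "e0 \<le> d x / 4" unfolding e0_def using fin xJ by (intro Min_le) force+
      then show ?thesis using e by simp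
    qed
    show ?thesis
    proof (cases "u = v")
      case True
      then show ?thesis using J by simp
    next
      case False
      then have uv': "u < v" using uv by simp
      have "u \<in> J" "v \<in> J" using J uv by auto
      then have "u \<in> ball x (d x / 4)" "v \<in> ball x (d x / 4)" using Jsub by blast+
      then have near: "\<bar>u - x\<bar> < d x / 4" "\<bar>v - x\<bar> < d x / 4"
        by (simp_all add: dist_real_def abs_minus_commute)
      define q where "q = C * (x - l)\<^sup>2 + \<eta>"
      have "integral J (\<lambda>t. ker l y t * P t e) \<le> integral J (\<lambda>t. 2 * ker l y x * P t e)"
        unfolding J
      proof (rule integral_le[OF ker_integrable[OF y e(1)]])
        show "(\<lambda>t. 2 * ker l y x * P t e) integrable_on {u..v}"
          by (rule integrable_continuous_interval, rule continuous_on_mult[OF continuous_on_const continuous_on_P[OF e(1)]])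
        fix t assume "t \<in> {u..v}"
        then have "\<bar>t - x\<bar> < d x" using near uv by auto
        then show "ker l y t * P t e \<le> 2 * ker l y x * P t e"
          using d(2)[OF tag[OF xJ]] P_nonneg[OF e(1)] by (intro mult_right_mono) auto
      qed
      also have "\<dots> = 2 * ker l y x * integral J (\<lambda>t. P t e)" by (simp only: integral_mult_right)
      also have "\<dots> \<le> 2 * ker l y x * (2 * pi * (v - u) * q)"
      proof (rule mult_left_mono)
        have "integral J (\<lambda>t. P t e) \<le> 2 * pi * (v - u) * P x (v - u + e)"
          unfolding J by (rule interval_mass[OF uv' uv e(1)])
        also have "\<dots> \<le> 2 * pi * (v - u) * q"
        proof (rule mult_left_mono)
          have "v - u + e < d x" using near ed by linarith
          then show "P x (v - u + e) \<le> q" unfolding q_def using d(3)[OF tag[OF xJ]] uv' e by simp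
        qed (use uv' in simp)
        finally show "integral J (\<lambda>t. P t e) \<le> 2 * pi * (v - u) * q" .
      qed (use y in simp)
      also have "\<dots> = 4 * pi * (v - u) * (ker l y x * q)" by simp
      also have "\<dots> \<le> 4 * pi * (v - u) * ((C + 1) * y)"
      proof (rule mult_left_mono)
        have n: "(x - l)\<^sup>2 + y\<^sup>2 > 0" using y by (intro add_nonneg_pos) auto
        have "q \<le> (C + 1) * ((x - l)\<^sup>2 + y\<^sup>2)" using C by (simp add: q_def \<eta>_def algebra_simps)
        then have "y * q \<le> y * ((C + 1) * ((x - l)\<^sup>2 + y\<^sup>2))" using y by (intro mult_left_mono) auto
        then show "ker l y x * q \<le> (C + 1) * y" using n by (simp add: divide_le_eq algebra_simps)
      qed (use uv' in simp)
      finally show ?thesis using J uv' by (simp add: algebra_simps)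
    qed
  qed
  have "integral {l - r..l + r} (\<lambda>t. ker l y t * P t e) \<le> 8 * pi * r * (C + 1) * y" if e: "0 < e" "e < e0" for e
  proof -
    have "integral {l - r..l + r} (\<lambda>t. ker l y t * P t e) = (\<Sum>(x, J)\<in>p. integral J (\<lambda>t. ker l y t * P t e))"
      using integral_combine_tagged_division_topdown[of "\<lambda>t. ker l y t * P t e" "l - r" "l + r" p]
        ker_integrable[OF y e(1)] p(1) by simp
    also have "\<dots> \<le> (\<Sum>(x, J)\<in>p. 4 * pi * (C + 1) * y * measure lborel J)"
      using piece e by (intro sum_mono) auto
    also have "\<dots> = 4 * pi * (C + 1) * y * (\<Sum>(x, J)\<in>p. measure lborel J)"
      by (simp add: sum_distrib_left case_prod_unfold)
    also have "(\<Sum>(x, J)\<in>p. measure lborel J) = 2 * r"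
      using additive_content_tagged_division[of p "l - r" "l + r"] p(1) r by simp
    finally show ?thesis by (simp add: algebra_simps)
  qed
  then show ?thesis using e0 by blast
qed

text \<open>At distance at least \<open>r\<close> from \<open>l\<close>, the kernel at height
  \<open>y\<close> is at most \<open>y * (1 + 1 / r\<^sup>2)\<close> times the kernel at height 1.
  The mass weighted with the latter is bounded by \<open>poisson_lower\<close> and
  \<open>P_le\<close>.\<close>

lemma far_mass:
  assumes y: "0 < y" and e: "0 < e" and r: "r > 0" and ab: "\<And>t. t \<in> {a..b} \<Longrightarrow> \<bar>t - l\<bar> \<ge> r"
  shows "integral {a..b} (\<lambda>t. ker l y t * P t e) \<le> y * (1 + 1 / r\<^sup>2) * (pi * K)"
proof -
  have "integral {a..b} (\<lambda>t. ker l y t * P t e) \<le> integral {a..b} (\<lambda>t. y * (1 + 1 / r\<^sup>2) * (ker l 1 t * P t e))"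
  proof (rule integral_le[OF ker_integrable[OF y e]])
    show "(\<lambda>t. y * (1 + 1 / r\<^sup>2) * (ker l 1 t * P t e)) integrable_on {a..b}"
      by (intro integrable_on_mult_right ker_integrable e) simp
    fix t assume "t \<in> {a..b}"
    then have "\<bar>r\<bar> \<le> \<bar>t - l\<bar>" using ab r by simp
    then have s: "r\<^sup>2 \<le> (t - l)\<^sup>2" by (simp add: abs_le_square_iff)
    define s where "s = (t - l)\<^sup>2"
    have s: "r\<^sup>2 \<le> s" "r\<^sup>2 > 0" "s > 0" using s r by (auto simp: s_def)
    have "y / (s + y\<^sup>2) \<le> y / s" using s y by (intro divide_left_mono mult_pos_pos add_pos_nonneg) auto
    also have "y / s = y * (1 / s)" by simp
    also have "y * (1 / s) \<le> y * ((1 + 1 / r\<^sup>2) * (1 / (s + 1)))"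
    proof (rule mult_left_mono)
      show "1 / s \<le> (1 + 1 / r\<^sup>2) * (1 / (s + 1))"
    proof -
      have "s + 1 \<le> (1 + 1 / r\<^sup>2) * s" using s by (simp add: field_simps)
      then show ?thesis using s by (simp add: divide_simps) (simp add: field_simps)
    qed
    qed (use y in simp)
    finally have "ker l y t \<le> y * (1 + 1 / r\<^sup>2) * ker l 1 t" by (simp add: s_def)
    then show "ker l y t * P t e \<le> y * (1 + 1 / r\<^sup>2) * (ker l 1 t * P t e)"
      using P_nonneg[OF e, of t] mult_right_mono by (fastforce simp: mult.assoc)
  qed
  also have "\<dots> = y * (1 + 1 / r\<^sup>2) * integral {a..b} (\<lambda>t. ker l 1 t * P t e)"
    by (simp only: integral_mult_right)
  also have "\<dots> \<le> y * (1 + 1 / r\<^sup>2) * (pi * K)"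
  proof (rule mult_left_mono)
    have "integral {a..b} (\<lambda>t. ker l 1 t * P t e) \<le> pi * P l (1 + e)" by (rule poisson_lower) (use e in auto)
    also have "P l (1 + e) \<le> K / (1 + e)" using e by (intro P_le) simp
    also have "K / (1 + e) \<le> K / 1" using e K_nonneg by (intro divide_left_mono) auto
    finally show "integral {a..b} (\<lambda>t. ker l 1 t * P t e) \<le> pi * K" by simp
  qed (use y in simp)
  finally show ?thesis .
qed

text \<open>The mass near \<open>l\<close> and the masses on both sides of it contribute
  \<open>O(y)\<close> each. For the resolvent, \<open>P l y\<close> is \<open>y\<close> times the
  squared norm of \<open>A.Res (Complex l y) g\<close>, so that after cancelling \<open>y\<close>
  the norm is bounded uniformly.\<close>

lemma vertical_bound:
  assumes lim: "\<And>x. x \<in> {l - r..l + r} \<Longrightarrow> (P x \<longlongrightarrow> h x) (at_right 0)"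
    and h: "\<And>x. x \<in> {l - r..l + r} \<Longrightarrow> h x \<le> C * (x - l)\<^sup>2" and C: "C \<ge> 0" and r: "r > 0"
    and y: "0 < y"
  shows "P l y \<le> (8 * r * (C + 1) + 2 * (1 + 1 / r\<^sup>2) * K) * y"
proof -
  obtain d where d: "d > 0"
    "\<And>e. 0 < e \<Longrightarrow> e < d \<Longrightarrow> integral {l - r..l + r} (\<lambda>t. ker l y t * P t e) \<le> 8 * pi * r * (C + 1) * y"
    using near_mass[OF lim h C r y] by blast
  let ?B = "(8 * r * (C + 1) + 2 * (1 + 1 / r\<^sup>2) * K) * y"
  have key: "P l (y + e) \<le> ?B" if e: "0 < e" "e < d" for e
  proof -
    have "pi * P l (y + e) \<le> pi * ?B"
    proof (rule field_le_epsilon)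
      fix \<eta> :: real assume \<eta>: "\<eta> > 0"
      let ?f = "\<lambda>t. ker l y t * P t e"
      obtain L where L: "L \<ge> \<bar>l\<bar> + r" "pi * P l (y + e) \<le> integral {-L..L} ?f + \<eta>"
        using poisson_upper[OF y e(1) \<eta>] by blast
      note int = ker_integrable[OF y e(1), of l]
      have "integral {-L..L} ?f = integral {-L..l - r} ?f + integral {l - r..L} ?f"
        by (rule Henstock_Kurzweil_Integration.integral_combine[symmetric]) (use L r int in auto)
      also have "integral {l - r..L} ?f = integral {l - r..l + r} ?f + integral {l + r..L} ?f"
        by (rule Henstock_Kurzweil_Integration.integral_combine[symmetric]) (use L r int in auto)
      finally have "integral {-L..L} ?f = integral {-L..l - r} ?f + (integral {l - r..l + r} ?f + integral {l + r..L} ?f)" .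
      moreover have "integral {-L..l - r} ?f \<le> y * (1 + 1 / r\<^sup>2) * (pi * K)"
        by (rule far_mass[OF y e(1) r]) auto
      moreover have "integral {l + r..L} ?f \<le> y * (1 + 1 / r\<^sup>2) * (pi * K)"
        by (rule far_mass[OF y e(1) r]) auto
      moreover have "pi * ?B = 8 * pi * r * (C + 1) * y + 2 * (y * (1 + 1 / r\<^sup>2) * (pi * K))"
        by (simp add: algebra_simps)
      ultimately show "pi * P l (y + e) \<le> pi * ?B + \<eta>" using L(2) d(2)[OF e] by linarith
    qed
    then show ?thesis by simp
  qed
  \<comment> \<open>The Poisson inequalities speak of height \<open>y + e\<close>; continuity inside
    the half plane removes \<open>e\<close>.\<close>
  have "((\<lambda>e. P l (y + e)) \<longlongrightarrow> P l (y + 0)) (at_right 0)"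
  proof (rule isCont_tendsto_compose[of "y + 0" "P l"])
    show "((\<lambda>e. y + e) \<longlongrightarrow> y + 0) (at_right 0)" by (intro tendsto_intros)
  qed (use isCont_P y in simp)
  moreover have "\<forall>\<^sub>F e in at_right 0. P l (y + e) \<le> ?B"
    unfolding eventually_at_right_field using d(1) key by auto
  ultimately show ?thesis using tendsto_upperbound[of "\<lambda>e. P l (y + e)"] by fastforce
qed

end

section \<open>Uniformly differentiable families of maps\<close>

text \<open>Normed spaces given by carrier, norm and real scaling. The main instances consist of
  operators between spaces of the scale, whose norm \<open>opnorm X Y\<close> depends on the values
  \<open>X\<close> and \<open>Y\<close> and so is not determined by a type.\<close>

locale nspace =
  fixes V :: "'b::ab_group_add set" and N :: "'b \<Rightarrow> real" and sc :: "real \<Rightarrow> 'b \<Rightarrow> 'b"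
  assumes zero_in [simp]: "0 \<in> V"
    and add_in [simp]: "a \<in> V \<Longrightarrow> b \<in> V \<Longrightarrow> a + b \<in> V"
    and diff_in [simp]: "a \<in> V \<Longrightarrow> b \<in> V \<Longrightarrow> a - b \<in> V"
    and sc_in [simp]: "a \<in> V \<Longrightarrow> sc r a \<in> V"
    and N_triangle: "a \<in> V \<Longrightarrow> b \<in> V \<Longrightarrow> N (a + b) \<le> N a + N b"
    and N_sc: "a \<in> V \<Longrightarrow> N (sc r a) = \<bar>r\<bar> * N a"
    and N_nonneg [simp]: "a \<in> V \<Longrightarrow> N a \<ge> 0"
    and N_zero [simp]: "N 0 = 0"
    and N_minus: "a \<in> V \<Longrightarrow> N (- a) = N a"
    and sc_add: "a \<in> V \<Longrightarrow> b \<in> V \<Longrightarrow> sc r (a + b) = sc r a + sc r b"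
begin

lemma minus_in [simp]: "a \<in> V \<Longrightarrow> - a \<in> V"
  using diff_in[OF zero_in] by simp

lemma N_diff: "a \<in> V \<Longrightarrow> b \<in> V \<Longrightarrow> N (a - b) \<le> N a + N b"
  using N_triangle[of a "- b"] N_minus[of b] by simp

lemma sc_zero [simp]: "sc r 0 = 0"
  using sc_add[of 0 0 r] by simp

lemma sc_minus: "a \<in> V \<Longrightarrow> sc r (- a) = - sc r a"
  using sc_add[of a "- a" r] by (simp add: minus_unique)

lemma sum_in: "(\<And>i. i \<in> I \<Longrightarrow> g i \<in> V) \<Longrightarrow> sum g I \<in> V"
  by (induction I rule: infinite_finite_induct) auto

end

text \<open>Unlike \<open>at x within U\<close>, this filter does not remove \<open>x\<close>, so an
  estimate that holds eventually also holds for \<open>y = x\<close>.\<close>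

abbreviation nw :: "'e::metric_space \<Rightarrow> 'e set \<Rightarrow> 'e filter" where
  "nw x U \<equiv> inf (nhds x) (principal U)"

lemma eventually_nw: "eventually P (nw x U) \<longleftrightarrow> (\<exists>d>0. \<forall>y\<in>U. dist y x < d \<longrightarrow> P y)"
  unfolding eventually_inf_principal eventually_nhds_metric by meson

lemma eventually_nw_in: "\<forall>\<^sub>F y in nw x U. y \<in> U"
  by (simp add: eventually_inf_principal)

lemma eventually_nw_mono: "U' \<subseteq> U \<Longrightarrow> eventually P (nw x U) \<Longrightarrow> eventually P (nw x U')"
  unfolding eventually_nw by blast

lemma eventually_nw_small: "e > 0 \<Longrightarrow> \<forall>\<^sub>F y in nw x U. norm (y - x) < e"
  unfolding eventually_nw by (auto simp: dist_norm)

definition equicont ::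
    "'b::ab_group_add set \<Rightarrow> ('b \<Rightarrow> real) \<Rightarrow> 'e::real_normed_vector set \<Rightarrow> 'i set \<Rightarrow> ('i \<Rightarrow> 'e \<Rightarrow> 'b) \<Rightarrow> bool"
  where "equicont V N U I h \<longleftrightarrow> (\<forall>i\<in>I. \<forall>x\<in>U. h i x \<in> V) \<and> (\<forall>x\<in>U. \<exists>K. \<forall>i\<in>I. N (h i x) \<le> K) \<and>
    (\<forall>x\<in>U. \<forall>e>0. \<forall>\<^sub>F y in nw x U. \<forall>i\<in>I. N (h i y - h i x) \<le> e)"

definition equidiff ::
    "'b::ab_group_add set \<Rightarrow> ('b \<Rightarrow> real) \<Rightarrow> (real \<Rightarrow> 'b \<Rightarrow> 'b) \<Rightarrow> 'e::real_normed_vector set \<Rightarrow> 'i set \<Rightarrow>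
     ('i \<Rightarrow> 'e \<Rightarrow> 'b) \<Rightarrow> ('i \<Rightarrow> 'e \<Rightarrow> 'e \<Rightarrow> 'b) \<Rightarrow> bool"
  where "equidiff V N sc U I h D \<longleftrightarrow>
    (\<forall>i\<in>I. \<forall>x\<in>U. (\<forall>v. D i x v \<in> V) \<and> (\<forall>u v. D i x (u + v) = D i x u + D i x v) \<and>
      (\<forall>r v. D i x (r *\<^sub>R v) = sc r (D i x v))) \<and>
    (\<forall>x\<in>U. \<forall>e>0. \<forall>\<^sub>F y in nw x U. \<forall>i\<in>I. N (h i y - h i x - D i x (y - x)) \<le> e * norm (y - x))"

text \<open>Directional derivatives along the unit ball: estimates uniform over this family are
  estimates of the derivative in operator norm.\<close>

definition dfam :: "'i set \<Rightarrow> ('i \<Rightarrow> 'e \<Rightarrow> 'e \<Rightarrow> 'b) \<Rightarrow> ('e::real_normed_vector \<Rightarrow> 'b) set" where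
  "dfam I D = {\<lambda>x. D i x v |i v. i \<in> I \<and> norm v \<le> 1}"

definition fam2 :: "('a \<Rightarrow> 'b \<Rightarrow> 'c) \<Rightarrow> ('e \<Rightarrow> 'a) set \<Rightarrow> ('e \<Rightarrow> 'b) set \<Rightarrow> ('e \<Rightarrow> 'c) set" where
  "fam2 b FF GG = {\<lambda>x. b (f x) (g x) |f g. f \<in> FF \<and> g \<in> GG}"

lemma dfamI: "i \<in> I \<Longrightarrow> norm v \<le> 1 \<Longrightarrow> (\<lambda>x. D i x v) \<in> dfam I D"
  by (auto simp: dfam_def)

lemma dfamE:
  assumes "f \<in> dfam I D" obtains i v where "i \<in> I" "norm v \<le> 1" "f = (\<lambda>x. D i x v)"
  using assms by (auto simp: dfam_def)

lemma fam2I: "f \<in> FF \<Longrightarrow> g \<in> GG \<Longrightarrow> (\<lambda>x. b (f x) (g x)) \<in> fam2 b FF GG"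
  by (auto simp: fam2_def)

lemma fam2_image: "fam2 b FF GG = (\<lambda>(f, g) x. b (f x) (g x)) ` (FF \<times> GG)"
  by (auto simp: fam2_def)

text \<open>A set of functions is uniformly \<open>C\<^sup>k\<close>. Quantifying over sets of functions lets the recursion on
  \<open>k\<close> stay within one type, although the derivative of a map into \<open>'b\<close> has its values in linear maps.\<close>

primrec UC ::
    "'b::ab_group_add set \<Rightarrow> ('b \<Rightarrow> real) \<Rightarrow> (real \<Rightarrow> 'b \<Rightarrow> 'b) \<Rightarrow> nat \<Rightarrow> 'e::real_normed_vector set \<Rightarrow>
     ('e \<Rightarrow> 'b) set \<Rightarrow> bool"
  where
    "UC V N sc 0 U FF \<longleftrightarrow> equicont V N U FF (\<lambda>f. f)"
  | "UC V N sc (Suc k) U FF \<longleftrightarrow> equicont V N U FF (\<lambda>f. f) \<and>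
      (\<exists>D. equidiff V N sc U FF (\<lambda>f. f) D \<and> UC V N sc k U (dfam FF D))"

lemma equicont_image: "equicont V N U (h ` I) (\<lambda>f. f) \<longleftrightarrow> equicont V N U I h"
  by (simp add: equicont_def)

lemma UC_equicont: "UC V N sc k U FF \<Longrightarrow> equicont V N U FF (\<lambda>f. f)"
  by (cases k) auto

lemma equicontD:
  assumes "equicont V N U I h"
  shows "i \<in> I \<Longrightarrow> x \<in> U \<Longrightarrow> h i x \<in> V"
    and "x \<in> U \<Longrightarrow> \<exists>K>0. \<forall>i\<in>I. N (h i x) \<le> K"
    and "x \<in> U \<Longrightarrow> e > 0 \<Longrightarrow> \<forall>\<^sub>F y in nw x U. \<forall>i\<in>I. N (h i y - h i x) \<le> e"
proof -
  show "\<exists>K>0. \<forall>i\<in>I. N (h i x) \<le> K" if x: "x \<in> U"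
  proof -
    obtain K where "\<forall>i\<in>I. N (h i x) \<le> K" using assms x by (auto simp: equicont_def)
    then have "\<forall>i\<in>I. N (h i x) \<le> max K 1" by auto
    then show ?thesis by (intro exI[of _ "max K 1"]) auto
  qed
qed (use assms in \<open>auto simp: equicont_def\<close>)

lemma equidiffD:
  assumes "equidiff V N sc U I h D"
  shows "i \<in> I \<Longrightarrow> x \<in> U \<Longrightarrow> D i x v \<in> V"
    and "i \<in> I \<Longrightarrow> x \<in> U \<Longrightarrow> D i x (u + v) = D i x u + D i x v"
    and "i \<in> I \<Longrightarrow> x \<in> U \<Longrightarrow> D i x (r *\<^sub>R v) = sc r (D i x v)"
    and "x \<in> U \<Longrightarrow> e > 0 \<Longrightarrow> \<forall>\<^sub>F y in nw x U. \<forall>i\<in>I. N (h i y - h i x - D i x (y - x)) \<le> e * norm (y - x)"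
  using assms by (auto simp: equidiff_def)

lemma equidiff_diff:
  assumes "equidiff V N sc U I h D" "i \<in> I" "x \<in> U"
  shows "D i x (u - v) = D i x u - D i x v"
  using equidiffD(2)[OF assms, of "u - v" v] by simp

lemma UC_SucE:
  assumes "UC V N sc (Suc k) U FF"
  obtains D where "equicont V N U FF (\<lambda>f. f)" "equidiff V N sc U FF (\<lambda>f. f) D"
    "UC V N sc k U (dfam FF D)"
  using assms by auto

text \<open>This passes from a family produced by the closure rules to the functions of interest,
  which agree with members of it only on \<open>U'\<close>. The derivative of a chosen member serves
  for the function.\<close>

lemma UC_refine:
  assumes "UC V N sc k U FF" "U' \<subseteq> U" "\<And>g. g \<in> GG \<Longrightarrow> \<exists>f\<in>FF. \<forall>x\<in>U'. g x = f x"
  shows "UC V N sc k U' GG"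
  using assms
proof (induction k arbitrary: FF GG)
  have base: "equicont V N U' GG (\<lambda>f. f)" if a: "equicont V N U FF (\<lambda>f. f)" "\<And>g. g \<in> GG \<Longrightarrow> \<exists>f\<in>FF. \<forall>x\<in>U'. g x = f x"
    for FF GG
  proof -
    obtain c where c: "\<And>g. g \<in> GG \<Longrightarrow> c g \<in> FF" "\<And>g x. g \<in> GG \<Longrightarrow> x \<in> U' \<Longrightarrow> g x = c g x"
      using a(2) by metis
    show ?thesis unfolding equicont_def
    proof (intro conjI ballI allI impI)
      fix f x assume "f \<in> GG" "x \<in> U'"
      then show "f x \<in> V" using c[of f] equicontD(1)[OF a(1), of "c f" x] assms(2) by auto
    next
      fix x assume x: "x \<in> U'"
      then obtain K where "\<forall>f\<in>FF. N (f x) \<le> K" using equicontD(2)[OF a(1), of x] assms(2) by blast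
      then have "N (f x) \<le> K" if "f \<in> GG" for f
        using c(1)[OF that] c(2)[OF that x] by simp
      then show "\<exists>K. \<forall>f\<in>GG. N (f x) \<le> K" by blast
    next
      fix x e assume x: "x \<in> U'" and e: "(e::real) > 0"
      have "\<forall>\<^sub>F y in nw x U'. \<forall>f\<in>FF. N (f y - f x) \<le> e"
        using equicontD(3)[OF a(1) _ e, of x] x assms(2) eventually_nw_mono by blast
      then show "\<forall>\<^sub>F y in nw x U'. \<forall>f\<in>GG. N (f y - f x) \<le> e"
        using eventually_nw_in
      proof eventually_elim
        case (elim y)
        show ?case
        proof
          fix f assume f: "f \<in> GG"
          show "N (f y - f x) \<le> e"
            using bspec[OF elim(1) c(1)[OF f]] c(2)[OF f x] c(2)[OF f elim(2)] by simp
        qed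
      qed
    qed
  qed
  {
    case 0
    then show ?case using base[of FF GG] by simp
  next
    case (Suc k)
    obtain D where D: "equicont V N U FF (\<lambda>f. f)" "equidiff V N sc U FF (\<lambda>f. f) D"
      "UC V N sc k U (dfam FF D)"
      using Suc.prems(1) by (rule UC_SucE)
    obtain c where c: "\<And>g. g \<in> GG \<Longrightarrow> c g \<in> FF" "\<And>g x. g \<in> GG \<Longrightarrow> x \<in> U' \<Longrightarrow> g x = c g x"
      using Suc.prems(3) by metis
    have "equidiff V N sc U' GG (\<lambda>f. f) (\<lambda>g. D (c g))"
      unfolding equidiff_def
    proof (intro conjI ballI allI impI)
      fix x e assume x: "x \<in> U'" and e: "(e::real) > 0"
      have "\<forall>\<^sub>F y in nw x U'. \<forall>f\<in>FF. N (f y - f x - D f x (y - x)) \<le> e * norm (y - x)"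
        using equidiffD(4)[OF D(2) _ e, of x] x assms(2) eventually_nw_mono by blast
      then show "\<forall>\<^sub>F y in nw x U'. \<forall>f\<in>GG. N (f y - f x - D (c f) x (y - x)) \<le> e * norm (y - x)"
        using eventually_nw_in
      proof eventually_elim
        case (elim y)
        show ?case
        proof
          fix f assume f: "f \<in> GG"
          show "N (f y - f x - D (c f) x (y - x)) \<le> e * norm (y - x)"
            using bspec[OF elim(1) c(1)[OF f]] c(2)[OF f x] c(2)[OF f elim(2)] by simp
        qed
      qed
    qed (use equidiffD[OF D(2)] c assms(2) in blast)+
    moreover have "UC V N sc k U' (dfam GG (\<lambda>g. D (c g)))"
      by (rule Suc.IH[OF D(3) assms(2)]) (auto elim!: dfamE intro!: bexI[OF _ dfamI] c(1))
    ultimately show ?case using base[OF D(1) Suc.prems(3)] by auto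
  }
qed

lemma UC_subset: "UC V N sc k U FF \<Longrightarrow> GG \<subseteq> FF \<Longrightarrow> UC V N sc k U GG"
  by (rule UC_refine) auto

lemma UC_Suc_le: "UC V N sc (Suc k) U FF \<Longrightarrow> UC V N sc k U FF"
proof (induction k arbitrary: FF)
  case (Suc k)
  obtain D where D: "equicont V N U FF (\<lambda>f. f)" "equidiff V N sc U FF (\<lambda>f. f) D"
    "UC V N sc (Suc k) U (dfam FF D)"
    using Suc.prems by (rule UC_SucE)
  then show ?case using Suc.IH by auto
qed simp

lemma UC_le: "UC V N sc k U FF \<Longrightarrow> j \<le> k \<Longrightarrow> UC V N sc j U FF"
proof (induction k)
  case (Suc k)
  then show ?case using UC_Suc_le[of V N sc k U FF] by (cases "j = Suc k") (simp_all del: UC.simps)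
qed simp

text \<open>Families are usually indexed, and different indices may give the same function;
  \<open>c\<close> selects one index for each function, whose derivative is then used.\<close>

lemma UC_SucI:
  assumes "equicont V N U I h" "equidiff V N sc U I h D"
    "UC V N sc k U (dfam I D)"
  shows "UC V N sc (Suc k) U (h ` I)"
proof -
  define c where "c = inv_into I h"
  have c: "c f \<in> I" "h (c f) = f" if "f \<in> h ` I" for f
    using that by (auto simp: c_def inv_into_into f_inv_into_f)
  have "equidiff V N sc U (h ` I) (\<lambda>f. f) (\<lambda>f. D (c f))"
    unfolding equidiff_def
  proof (intro conjI ballI allI impI)
    fix x e assume x: "x \<in> U" and e: "(e::real) > 0"
    have "\<forall>\<^sub>F y in nw x U. \<forall>i\<in>I. N (h i y - h i x - D i x (y - x)) \<le> e * norm (y - x)"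
      using equidiffD(4)[OF assms(2) x e] .
    then show "\<forall>\<^sub>F y in nw x U. \<forall>f\<in>h ` I. N (f y - f x - D (c f) x (y - x)) \<le> e * norm (y - x)"
      by eventually_elim (use c in metis)
  qed (use equidiffD[OF assms(2)] c in blast)+
  moreover have "UC V N sc k U (dfam (h ` I) (\<lambda>f. D (c f)))"
    by (rule UC_subset[OF assms(3)]) (use c in \<open>auto elim!: dfamE intro!: dfamI\<close>)
  ultimately show ?thesis using assms(1) equicont_image[of V N U h I] by auto
qed

context nspace
begin

text \<open>\<open>dfam\<close> controls only directions in the unit ball; homogeneity extends the
  bound to all \<open>v\<close> through \<open>sgn v\<close>.\<close>

lemma deriv_bound:
  assumes D: "equidiff V N sc U I h D"
    and "equicont V N U (dfam I D) (\<lambda>f. f)" "x \<in> U"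
  shows "\<exists>K>0. \<forall>i\<in>I. \<forall>v. N (D i x v) \<le> K * norm v"
proof -
  obtain K where K: "K > 0" "\<forall>f\<in>dfam I D. N (f x) \<le> K"
    using equicontD(2)[OF assms(2,3)] by blast
  have "N (D i x v) \<le> K * norm v" if i: "i \<in> I" for i v
  proof -
    have "v = norm v *\<^sub>R sgn v" by (cases "v = 0") (auto simp: sgn_div_norm)
    then have "D i x v = sc (norm v) (D i x (sgn v))"
      using equidiffD(3)[OF D i assms(3)] by metis
    then have "N (D i x v) = norm v * N (D i x (sgn v))"
      using N_sc equidiffD(1)[OF D i assms(3)] by simp
    also have "\<dots> \<le> norm v * K"
    proof (rule mult_left_mono)
      have "(\<lambda>x. D i x (sgn v)) \<in> dfam I D" using i by (intro dfamI) (auto simp: norm_sgn)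
      then show "N (D i x (sgn v)) \<le> K" using K(2) by fastforce
    qed simp
    finally show ?thesis by (simp add: mult.commute)
  qed
  then show ?thesis using K(1) by blast
qed

lemma lipschitz_at:
  assumes "equicont V N U I h" and D: "equidiff V N sc U I h D"
    and "equicont V N U (dfam I D) (\<lambda>f. f)" "x \<in> U"
  shows "\<exists>L>0. \<forall>\<^sub>F y in nw x U. \<forall>i\<in>I. N (h i y - h i x) \<le> L * norm (y - x)"
proof -
  obtain K where K: "K > 0" "\<forall>i\<in>I. \<forall>v. N (D i x v) \<le> K * norm v"
    using deriv_bound[OF D assms(3,4)] by blast
  have "\<forall>\<^sub>F y in nw x U. \<forall>i\<in>I. N (h i y - h i x) \<le> (1 + K) * norm (y - x)"
    using equidiffD(4)[OF D assms(4), of 1, simplified] eventually_nw_in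
  proof eventually_elim
    case (elim y)
    show ?case
    proof
      fix i assume i: "i \<in> I"
      have in': "h i y \<in> V" "h i x \<in> V" "D i x (y - x) \<in> V"
        using equicontD(1)[OF assms(1) i] equidiffD(1)[OF D i] elim assms(4) by auto
      then have "N (h i y - h i x) \<le> N (h i y - h i x - D i x (y - x)) + N (D i x (y - x))"
        using N_triangle[of "h i y - h i x - D i x (y - x)" "D i x (y - x)"] by simp
      also have "\<dots> \<le> norm (y - x) + K * norm (y - x)" using elim i K(2) by (intro add_mono) auto
      finally show "N (h i y - h i x) \<le> (1 + K) * norm (y - x)" by (simp add: algebra_simps)
    qed
  qed
  then show ?thesis using K(1) by (intro exI[of _ "1 + K"]) auto
qed

section \<open>Closure of uniform smoothness under the usual operations\<close>

lemma UC_const: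
  fixes U :: "'e::real_normed_vector set"
  assumes "A \<subseteq> V" "\<And>a. a \<in> A \<Longrightarrow> N a \<le> K"
  shows "UC V N sc k U ((\<lambda>a x. a) ` A)"
  using assms
proof (induction k arbitrary: A K)
  have base: "equicont V N U A (\<lambda>a x. a)" if "A \<subseteq> V" "\<And>a. a \<in> A \<Longrightarrow> N a \<le> K" for A K
    using that unfolding equicont_def by auto
  {
    case 0 then show ?case using base[of A K] by (simp add: equicont_image)
  next
    case (Suc k)
    show ?case
    proof (rule UC_SucI[where D = "\<lambda>a x v. 0"])
      show "equicont V N U A (\<lambda>a x. a)" using base[of A K] Suc.prems by blast
      show "equidiff V N sc U A (\<lambda>a x. a) (\<lambda>a x v. 0)" unfolding equidiff_def by auto
      have "UC V N sc k U ((\<lambda>a x. a) ` {0})" by (rule Suc.IH[of _ 0]) auto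
      then show "UC V N sc k U (dfam A (\<lambda>a x v. 0))"
        by (rule UC_subset) (auto simp: dfam_def)
    qed
  }
qed

lemma UC_linear_function:
  assumes "\<And>v. f v \<in> V" "\<And>u v. f (u + v) = f u + f v" "\<And>r v. f (r *\<^sub>R v) = sc r (f v)"
    and "\<And>v. N (f v) \<le> K * norm v"
  shows "UC V N sc k U {f}"
proof -
  have fd: "f u - f v = f (u - v)" for u v using assms(2)[of "u - v" v] by simp
  have base: "equicont V N U {()} (\<lambda>_. f)"
    unfolding equicont_def
  proof (intro conjI ballI allI impI)
    fix x e assume e: "(e::real) > 0"
    have "\<forall>\<^sub>F y in nw x U. norm (y - x) < e / (\<bar>K\<bar> + 1)" using e by (intro eventually_nw_small) auto
    then show "\<forall>\<^sub>F y in nw x U. \<forall>i\<in>{()}. N (f y - f x) \<le> e"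
    proof eventually_elim
      case (elim y)
      have "N (f y - f x) \<le> (\<bar>K\<bar> + 1) * norm (y - x)"
        unfolding fd using assms(4)[of "y - x"] by (rule order_trans) (intro mult_right_mono, auto)
      also have "\<dots> \<le> (\<bar>K\<bar> + 1) * (e / (\<bar>K\<bar> + 1))" using elim by (intro mult_left_mono) auto
      finally show ?case using e by simp
    qed
  qed (use assms in auto)
  show ?thesis
  proof (cases k)
    case 0 then show ?thesis using base equicont_image[of V N U "\<lambda>_. f" "{()}"] by simp
  next
    case (Suc j)
    have "UC V N sc (Suc j) U ((\<lambda>_. f) ` {()})"
    proof (rule UC_SucI[OF base, where D = "\<lambda>_ x v. f v"])
      show "equidiff V N sc U {()} (\<lambda>_. f) (\<lambda>_ x v. f v)"
        unfolding equidiff_def using assms by (auto simp: fd)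
      have "UC V N sc j U ((\<lambda>a x. a) ` (f ` {v. norm v \<le> 1}))"
      proof (rule UC_const[where K = "\<bar>K\<bar>"])
        fix a assume "a \<in> f ` {v. norm v \<le> 1}"
        then obtain v where v: "a = f v" "norm v \<le> 1" by auto
        have "K * norm v \<le> \<bar>K\<bar> * 1" using v(2) by (intro mult_mono) auto
        then show "N a \<le> \<bar>K\<bar>" using assms(4)[of v] v by simp
      qed (use assms in auto)
      then show "UC V N sc j U (dfam {()} (\<lambda>_ x v. f v))"
        by (rule UC_subset) (auto simp: dfam_def)
    qed
    then show ?thesis using Suc by simp
  qed
qed

lemma equicont_add:
  assumes h: "equicont V N U I h" and g: "equicont V N U J g"
  shows "equicont V N U (I \<times> J) (\<lambda>(i, j) x. h i x + g j x)"
  unfolding equicont_def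
proof (intro conjI ballI allI impI)
  fix p x assume "p \<in> I \<times> J" "x \<in> U"
  then show "(case p of (i, j) \<Rightarrow> \<lambda>x. h i x + g j x) x \<in> V"
    using equicontD(1)[OF h] equicontD(1)[OF g] by auto
next
  fix x assume x: "x \<in> U"
  obtain K L where KL: "\<forall>i\<in>I. N (h i x) \<le> K" "\<forall>i\<in>J. N (g i x) \<le> L"
    using equicontD(2)[OF h x] equicontD(2)[OF g x] by blast
  have "N (h i x + g j x) \<le> K + L" if "i \<in> I" "j \<in> J" for i j
    using N_triangle[of "h i x" "g j x"] equicontD(1)[OF h that(1) x] equicontD(1)[OF g that(2) x] KL that by fastforce
  then show "\<exists>K. \<forall>p\<in>I \<times> J. N ((case p of (i, j) \<Rightarrow> \<lambda>x. h i x + g j x) x) \<le> K" by (intro exI[of _ "K + L"]) auto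
next
  fix x e assume x: "x \<in> U" and e: "(e::real) > 0"
  show "\<forall>\<^sub>F y in nw x U. \<forall>p\<in>I \<times> J. N ((case p of (i, j) \<Rightarrow> \<lambda>x. h i x + g j x) y - (case p of (i, j) \<Rightarrow> \<lambda>x. h i x + g j x) x) \<le> e"
    using equicontD(3)[OF h x half_gt_zero[OF e]] equicontD(3)[OF g x half_gt_zero[OF e]] eventually_nw_in
  proof eventually_elim
    case (elim y)
    have "N (h i y + g j y - (h i x + g j x)) \<le> e" if ij: "i \<in> I" "j \<in> J" for i j
    proof -
      note in' = equicontD(1)[OF h ij(1)] equicontD(1)[OF g ij(2)] x elim
      have eq: "h i y + g j y - (h i x + g j x) = (h i y - h i x) + (g j y - g j x)" by simp
      have "N (h i y + g j y - (h i x + g j x)) \<le> N (h i y - h i x) + N (g j y - g j x)"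
        unfolding eq by (rule N_triangle) (use in' in auto)
      also have "\<dots> \<le> e / 2 + e / 2" using elim ij by (intro add_mono) auto
      finally show ?thesis by simp
    qed
    then show ?case by auto
  qed
qed

lemma UC_add:
  assumes "UC V N sc k U FF" "UC V N sc k U GG"
  shows "UC V N sc k U (fam2 (+) FF GG)"
  using assms
proof (induction k arbitrary: FF GG)
  {
    case 0
    then show ?case using equicont_add[of U FF "\<lambda>f. f" GG "\<lambda>f. f"] unfolding fam2_image by (simp add: equicont_image)
  next
    case (Suc k)
    obtain D where D: "equicont V N U FF (\<lambda>f. f)" "equidiff V N sc U FF (\<lambda>f. f) D"
      "UC V N sc k U (dfam FF D)"
      using Suc.prems(1) by (rule UC_SucE)
    obtain E where E: "equicont V N U GG (\<lambda>f. f)" "equidiff V N sc U GG (\<lambda>f. f) E"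
      "UC V N sc k U (dfam GG E)"
      using Suc.prems(2) by (rule UC_SucE)
    show ?case unfolding fam2_image
    proof (rule UC_SucI[OF equicont_add[OF D(1) E(1)], where D = "\<lambda>(f, g) x v. D f x v + E g x v"])
      show "equidiff V N sc U (FF \<times> GG) (\<lambda>(i, j) x. i x + j x) (\<lambda>(f, g) x v. D f x v + E g x v)"
        unfolding equidiff_def
      proof (intro conjI ballI allI impI)
        fix x e assume x: "x \<in> U" and e: "(e::real) > 0"
        show "\<forall>\<^sub>F y in nw x U. \<forall>i\<in>FF \<times> GG. N ((case i of (i, j) \<Rightarrow> \<lambda>x. i x + j x) y - (case i of (i, j) \<Rightarrow> \<lambda>x. i x + j x) x -
            (case i of (f, g) \<Rightarrow> \<lambda>x v. D f x v + E g x v) x (y - x)) \<le> e * norm (y - x)"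
          using equidiffD(4)[OF D(2) x half_gt_zero[OF e]] equidiffD(4)[OF E(2) x half_gt_zero[OF e]] eventually_nw_in
        proof eventually_elim
          case (elim y)
          have "N (f y + g y - (f x + g x) - (D f x (y - x) + E g x (y - x))) \<le> e * norm (y - x)"
            if fg: "f \<in> FF" "g \<in> GG" for f g
          proof -
            note in' = equicontD(1)[OF D(1) fg(1)] equicontD(1)[OF E(1) fg(2)] x elim
              equidiffD(1)[OF D(2) fg(1) x] equidiffD(1)[OF E(2) fg(2) x]
            have eq: "f y + g y - (f x + g x) - (D f x (y - x) + E g x (y - x)) =
              (f y - f x - D f x (y - x)) + (g y - g x - E g x (y - x))" by simp
            have "N (f y + g y - (f x + g x) - (D f x (y - x) + E g x (y - x))) \<le>
                N (f y - f x - D f x (y - x)) + N (g y - g x - E g x (y - x))"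
              unfolding eq by (rule N_triangle) (use in' in auto)
            also have "\<dots> \<le> e / 2 * norm (y - x) + e / 2 * norm (y - x)" using elim fg by (intro add_mono) auto
            finally show ?thesis by (simp add: algebra_simps)
          qed
          then show ?case by auto
        qed
      qed (use equidiffD(1-3)[OF D(2)] equidiffD(1-3)[OF E(2)] in \<open>auto simp: sc_add\<close>)
      show "UC V N sc k U (dfam (FF \<times> GG) (\<lambda>(f, g) x v. D f x v + E g x v))"
        by (rule UC_subset[OF Suc.IH[OF D(3) E(3)]]) (auto elim!: dfamE intro!: fam2I dfamI)
    qed
  }
qed

lemma UC_sum:
  assumes "finite I" "\<And>i. i \<in> I \<Longrightarrow> UC V N sc k U (FF i)"
  shows "UC V N sc k U {\<lambda>x. \<Sum>i\<in>I. g i x |g. \<forall>i\<in>I. g i \<in> FF i}"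
  using assms
proof (induction I rule: finite_induct)
  case empty
  have "UC V N sc k U ((\<lambda>a x. a) ` {0})" by (rule UC_const[of _ 0]) auto
  then show ?case by (rule UC_subset) auto
next
  case (insert i I)
  have "UC V N sc k U (fam2 (+) (FF i) {\<lambda>x. \<Sum>i\<in>I. g i x |g. \<forall>i\<in>I. g i \<in> FF i})"
    by (rule UC_add) (use insert in auto)
  then show ?case
  proof (rule UC_subset, safe)
    fix g assume g: "\<forall>j\<in>insert i I. g j \<in> FF j"
    have "(\<lambda>x. g i x + (\<Sum>i\<in>I. g i x)) \<in> fam2 (+) (FF i) {\<lambda>x. \<Sum>i\<in>I. g i x |g. \<forall>i\<in>I. g i \<in> FF i}"
      by (rule fam2I) (use g in auto)
    then show "(\<lambda>x. \<Sum>j\<in>insert i I. g j x) \<in> fam2 (+) (FF i) {\<lambda>x. \<Sum>i\<in>I. g i x |g. \<forall>i\<in>I. g i \<in> FF i}"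
      using insert.hyps by simp
  qed
qed

end

text \<open>The instances are multiplication of reals, scaling of vectors, composition of operators,
  and the matrix elements \<open>Re (pair (P (Q \<phi>)) \<psi>)\<close> as functions of the
  operators \<open>P\<close> and \<open>Q\<close>.\<close>

locale nbilinear =
  A: nspace V1 N1 sc1 + B: nspace V2 N2 sc2 + C: nspace V3 N3 sc3
  for V1 :: "'a::ab_group_add set" and N1 sc1 and V2 :: "'b::ab_group_add set" and N2 sc2
    and V3 :: "'c::ab_group_add set" and N3 sc3 +
  fixes b :: "'a \<Rightarrow> 'b \<Rightarrow> 'c" and M :: real
  assumes b_in [simp]: "x \<in> V1 \<Longrightarrow> y \<in> V2 \<Longrightarrow> b x y \<in> V3"
    and b_bound: "x \<in> V1 \<Longrightarrow> y \<in> V2 \<Longrightarrow> N3 (b x y) \<le> M * N1 x * N2 y"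
    and M_nonneg: "M \<ge> 0"
    and b_add_left: "x \<in> V1 \<Longrightarrow> x' \<in> V1 \<Longrightarrow> y \<in> V2 \<Longrightarrow> b (x + x') y = b x y + b x' y"
    and b_add_right: "x \<in> V1 \<Longrightarrow> y \<in> V2 \<Longrightarrow> y' \<in> V2 \<Longrightarrow> b x (y + y') = b x y + b x y'"
    and b_sc_left: "x \<in> V1 \<Longrightarrow> y \<in> V2 \<Longrightarrow> b (sc1 r x) y = sc3 r (b x y)"
    and b_sc_right: "x \<in> V1 \<Longrightarrow> y \<in> V2 \<Longrightarrow> b x (sc2 r y) = sc3 r (b x y)"
begin

lemma b_diff_left: "x \<in> V1 \<Longrightarrow> x' \<in> V1 \<Longrightarrow> y \<in> V2 \<Longrightarrow> b (x - x') y = b x y - b x' y"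
  using b_add_left[of "x - x'" x' y] by simp

lemma b_diff_right: "x \<in> V1 \<Longrightarrow> y \<in> V2 \<Longrightarrow> y' \<in> V2 \<Longrightarrow> b x (y - y') = b x y - b x y'"
  using b_add_right[of x "y - y'" y'] by simp

lemma b_le: "x \<in> V1 \<Longrightarrow> y \<in> V2 \<Longrightarrow> N1 x \<le> p \<Longrightarrow> N2 y \<le> q \<Longrightarrow> N3 (b x y) \<le> M * p * q"
  by (rule order_trans[OF b_bound])
    (auto intro!: mult_mono mult_nonneg_nonneg simp: M_nonneg order_trans[OF A.N_nonneg])

lemma equicont_b:
  assumes h: "equicont V1 N1 U I h" and g: "equicont V2 N2 U J g"
  shows "equicont V3 N3 U (I \<times> J) (\<lambda>(i, j) x. b (h i x) (g j x))"
  unfolding equicont_def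
proof (intro conjI ballI allI impI)
  fix p x assume "p \<in> I \<times> J" "x \<in> U"
  then show "(case p of (i, j) \<Rightarrow> \<lambda>x. b (h i x) (g j x)) x \<in> V3"
    using equicontD(1)[OF h] equicontD(1)[OF g] by auto
next
  fix x assume x: "x \<in> U"
  obtain K L where KL: "\<forall>i\<in>I. N1 (h i x) \<le> K" "\<forall>i\<in>J. N2 (g i x) \<le> L"
    using equicontD(2)[OF h x] equicontD(2)[OF g x] by blast
  have "N3 (b (h i x) (g j x)) \<le> M * K * L" if "i \<in> I" "j \<in> J" for i j
    using b_le equicontD(1)[OF h that(1) x] equicontD(1)[OF g that(2) x] KL that by blast
  then show "\<exists>K. \<forall>p\<in>I \<times> J. N3 ((case p of (i, j) \<Rightarrow> \<lambda>x. b (h i x) (g j x)) x) \<le> K" by (intro exI[of _ "M * K * L"]) auto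
next
  fix x e assume x: "x \<in> U" and e: "(e::real) > 0"
  obtain K L where KL: "K > 0" "\<forall>i\<in>I. N1 (h i x) \<le> K" "L > 0" "\<forall>i\<in>J. N2 (g i x) \<le> L"
    using equicontD(2)[OF h x] equicontD(2)[OF g x] by blast
  \<comment> \<open>The error below is at most \<open>M * (K + L + 1) * d\<close>. The factor
    \<open>M + 1\<close> keeps the denominator positive for \<open>M = 0\<close>, and
    \<open>d \<le> 1\<close> serves to bound \<open>N2 (g j y)\<close> by
    \<open>L + 1\<close>.\<close>
  define d where "d = min 1 (e / ((M + 1) * (K + L + 1)))"
  have pos: "(M + 1) * (K + L + 1) > 0" using M_nonneg KL by (intro mult_pos_pos) auto
  have d: "d > 0" "d \<le> 1" "(M + 1) * (K + L + 1) * d \<le> e"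
  proof -
    show "d > 0" "d \<le> 1" using e pos by (auto simp: d_def)
    have "d \<le> e / ((M + 1) * (K + L + 1))" by (simp add: d_def)
    then show "(M + 1) * (K + L + 1) * d \<le> e" using pos by (simp add: pos_le_divide_eq mult.commute)
  qed
  show "\<forall>\<^sub>F y in nw x U. \<forall>p\<in>I \<times> J. N3 ((case p of (i, j) \<Rightarrow> \<lambda>x. b (h i x) (g j x)) y - (case p of (i, j) \<Rightarrow> \<lambda>x. b (h i x) (g j x)) x) \<le> e"
    using equicontD(3)[OF h x d(1)] equicontD(3)[OF g x d(1)] eventually_nw_in
  proof eventually_elim
    case (elim y)
    have "N3 (b (h i y) (g j y) - b (h i x) (g j x)) \<le> e" if ij: "i \<in> I" "j \<in> J" for i j
    proof -
      have in': "h i y \<in> V1" "h i x \<in> V1" "g j y \<in> V2" "g j x \<in> V2"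
        using equicontD(1)[OF h ij(1)] equicontD(1)[OF g ij(2)] x elim by auto
      have gy: "N2 (g j y) \<le> L + 1"
      proof -
        have "N2 (g j y) \<le> N2 (g j y - g j x) + N2 (g j x)"
          using B.N_triangle[of "g j y - g j x" "g j x"] in' by simp
        then show ?thesis using elim ij KL(4) d(2) by fastforce
      qed
      have "b (h i y) (g j y) - b (h i x) (g j x) = b (h i y - h i x) (g j y) + b (h i x) (g j y - g j x)"
        using in' by (simp add: b_diff_left b_diff_right)
      then have "N3 (b (h i y) (g j y) - b (h i x) (g j x)) \<le> N3 (b (h i y - h i x) (g j y)) + N3 (b (h i x) (g j y - g j x))"
        using C.N_triangle in' by simp
      also have "\<dots> \<le> M * d * (L + 1) + M * K * d"
        using elim ij KL gy in' by (intro add_mono b_le) auto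
      also have "\<dots> = M * (K + L + 1) * d" by (simp add: algebra_simps)
      also have "\<dots> \<le> (M + 1) * (K + L + 1) * d" using d(1) KL by (intro mult_right_mono) auto
      also have "\<dots> \<le> e" by (rule d(3))
      finally show ?thesis .
    qed
    then show ?case by auto
  qed
qed

text \<open>By the Leibniz rule a derivative is a sum of two products of the same kind, each with
  one factor replaced by its derivative, and both are covered by the induction hypothesis for
  \<open>k\<close>.\<close>

lemma UC_b:
  assumes "UC V1 N1 sc1 k U FF" "UC V2 N2 sc2 k U GG"
  shows "UC V3 N3 sc3 k U (fam2 b FF GG)"
  using assms
proof (induction k arbitrary: FF GG)
  {
    case 0
    then show ?case using equicont_b[of U FF "\<lambda>f. f" GG "\<lambda>f. f"] unfolding fam2_image by (simp add: equicont_image)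
  next
    case (Suc k)
    obtain D where D: "equicont V1 N1 U FF (\<lambda>f. f)" "equidiff V1 N1 sc1 U FF (\<lambda>f. f) D"
      "UC V1 N1 sc1 k U (dfam FF D)"
      using Suc.prems(1) by (rule UC_SucE)
    obtain E where E: "equicont V2 N2 U GG (\<lambda>f. f)" "equidiff V2 N2 sc2 U GG (\<lambda>f. f) E"
      "UC V2 N2 sc2 k U (dfam GG E)"
      using Suc.prems(2) by (rule UC_SucE)
    show ?case unfolding fam2_image
    proof (rule UC_SucI[OF equicont_b[OF D(1) E(1)], where D = "\<lambda>(f, g) x v. b (D f x v) (g x) + b (f x) (E g x v)"])
      show "equidiff V3 N3 sc3 U (FF \<times> GG) (\<lambda>(i, j) x. b (i x) (j x)) (\<lambda>(f, g) x v. b (D f x v) (g x) + b (f x) (E g x v))"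
        unfolding equidiff_def
      proof (intro conjI ballI allI impI)
        fix x e assume x: "x \<in> U" and e: "(e::real) > 0"
        obtain K L where KL: "K > 0" "\<forall>i\<in>FF. N1 (i x) \<le> K" "L > 0" "\<forall>i\<in>GG. N2 (i x) \<le> L"
          using equicontD(2)[OF D(1) x] equicontD(2)[OF E(1) x] by blast
        obtain P where P: "P > 0" "\<forall>f\<in>FF. \<forall>v. N1 (D f x v) \<le> P * norm v"
          using A.deriv_bound[OF D(2) UC_equicont[OF D(3)] x] by blast
        define d where "d = min 1 (e / ((M + 1) * (K + L + P + 1)))"
        have pos: "(M + 1) * (K + L + P + 1) > 0" using M_nonneg KL P by (intro mult_pos_pos) auto
        have d: "d > 0" "d \<le> 1" "(M + 1) * (K + L + P + 1) * d \<le> e"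
        proof -
          show "d > 0" "d \<le> 1" using e pos by (auto simp: d_def)
          have "d \<le> e / ((M + 1) * (K + L + P + 1))" by (simp add: d_def)
          then show "(M + 1) * (K + L + P + 1) * d \<le> e" using pos by (simp add: pos_le_divide_eq mult.commute)
        qed
        show "\<forall>\<^sub>F y in nw x U. \<forall>i\<in>FF \<times> GG. N3 ((case i of (i, j) \<Rightarrow> \<lambda>x. b (i x) (j x)) y - (case i of (i, j) \<Rightarrow> \<lambda>x. b (i x) (j x)) x -
            (case i of (f, g) \<Rightarrow> \<lambda>x v. b (D f x v) (g x) + b (f x) (E g x v)) x (y - x)) \<le> e * norm (y - x)"
          using equidiffD(4)[OF D(2) x d(1)] equidiffD(4)[OF E(2) x d(1)] equicontD(3)[OF E(1) x d(1)] eventually_nw_in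
        proof eventually_elim
          case (elim y)
          let ?n = "norm (y - x)"
          have "N3 (b (f y) (g y) - b (f x) (g x) - (b (D f x (y - x)) (g x) + b (f x) (E g x (y - x)))) \<le> e * ?n"
            if fg: "f \<in> FF" "g \<in> GG" for f g
          proof -
            have in': "f y \<in> V1" "f x \<in> V1" "D f x (y - x) \<in> V1" "g y \<in> V2" "g x \<in> V2" "E g x (y - x) \<in> V2"
              using equicontD(1)[OF D(1) fg(1)] equicontD(1)[OF E(1) fg(2)] x elim
                equidiffD(1)[OF D(2) fg(1) x] equidiffD(1)[OF E(2) fg(2) x] by auto
            have gy: "N2 (g y) \<le> L + 1"
            proof -
              have "N2 (g y) \<le> N2 (g y - g x) + N2 (g x)"
                using B.N_triangle[of "g y - g x" "g x"] in' by simp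
              then show ?thesis using elim fg KL(4) d(2) by fastforce
            qed
            let ?t1 = "b (f y - f x - D f x (y - x)) (g y)" and ?t2 = "b (D f x (y - x)) (g y - g x)"
              and ?t3 = "b (f x) (g y - g x - E g x (y - x))"
            have "b (f y) (g y) - b (f x) (g x) - (b (D f x (y - x)) (g x) + b (f x) (E g x (y - x))) = ?t1 + (?t2 + ?t3)"
              using in' by (simp add: b_diff_left b_diff_right)
            then have "N3 (b (f y) (g y) - b (f x) (g x) - (b (D f x (y - x)) (g x) + b (f x) (E g x (y - x))))
               \<le> N3 ?t1 + (N3 ?t2 + N3 ?t3)"
              using C.N_triangle[of ?t1 "?t2 + ?t3"] C.N_triangle[of ?t2 ?t3] in' by simp
            also have "\<dots> \<le> M * (d * ?n) * (L + 1) + (M * (P * ?n) * d + M * K * (d * ?n))"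
              using elim fg KL gy in' P by (intro add_mono b_le) auto
            also have "\<dots> = M * (K + L + P + 1) * d * ?n" by (simp add: algebra_simps)
            also have "\<dots> \<le> (M + 1) * (K + L + P + 1) * d * ?n" using d(1) KL P by (intro mult_right_mono) auto
            also have "\<dots> \<le> e * ?n" using d(3) by (intro mult_right_mono) auto
            finally show ?thesis .
          qed
          then show ?case by auto
        qed
      next
        fix p x assume px: "p \<in> FF \<times> GG" "x \<in> U"
        obtain f g where p: "p = (f, g)" "f \<in> FF" "g \<in> GG" using px by auto
        note F = equidiffD(1-3)[OF D(2) p(2) px(2)] and G = equidiffD(1-3)[OF E(2) p(3) px(2)]
          and in' = equicontD(1)[OF D(1) p(2) px(2)] equicontD(1)[OF E(1) p(3) px(2)]
        show "(case p of (f, g) \<Rightarrow> \<lambda>x v. b (D f x v) (g x) + b (f x) (E g x v)) x v \<in> V3" for v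
          using p F G in' by auto
        show "(case p of (f, g) \<Rightarrow> \<lambda>x v. b (D f x v) (g x) + b (f x) (E g x v)) x (u + v) =
          (case p of (f, g) \<Rightarrow> \<lambda>x v. b (D f x v) (g x) + b (f x) (E g x v)) x u +
          (case p of (f, g) \<Rightarrow> \<lambda>x v. b (D f x v) (g x) + b (f x) (E g x v)) x v" for u v
          using p F G in' by (simp add: b_add_left b_add_right)
        show "(case p of (f, g) \<Rightarrow> \<lambda>x v. b (D f x v) (g x) + b (f x) (E g x v)) x (r *\<^sub>R v) =
          sc3 r ((case p of (f, g) \<Rightarrow> \<lambda>x v. b (D f x v) (g x) + b (f x) (E g x v)) x v)" for r v
          using p F G in' by (simp add: b_sc_left b_sc_right C.sc_add)
      qed
      have "UC V3 N3 sc3 k U (fam2 (+) (fam2 b (dfam FF D) GG) (fam2 b FF (dfam GG E)))"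
        by (intro C.UC_add Suc.IH D(3) E(3) UC_Suc_le[OF Suc.prems(1)] UC_Suc_le[OF Suc.prems(2)])
      then show "UC V3 N3 sc3 k U (dfam (FF \<times> GG) (\<lambda>(f, g) x v. b (D f x v) (g x) + b (f x) (E g x v)))"
        by (rule UC_subset) (auto elim!: dfamE intro!: fam2I dfamI)
    qed
  }
qed

end

lemma UC_linear:
  assumes A: "nspace V1 N1 sc1" and B: "nspace V2 N2 sc2"
    and T: "\<And>a. a \<in> V1 \<Longrightarrow> T a \<in> V2" "\<And>a b. a \<in> V1 \<Longrightarrow> b \<in> V1 \<Longrightarrow> T (a + b) = T a + T b"
      "\<And>r a. a \<in> V1 \<Longrightarrow> T (sc1 r a) = sc2 r (T a)"
    and bound: "\<And>a. a \<in> V1 \<Longrightarrow> N2 (T a) \<le> M * N1 a"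
    and "UC V1 N1 sc1 k U FF"
  shows "UC V2 N2 sc2 k U ((\<lambda>f x. T (f x)) ` FF)"
  using assms(7)
proof (induction k arbitrary: FF)
  interpret A: nspace V1 N1 sc1 by fact
  interpret B: nspace V2 N2 sc2 by fact
  have Td: "T (a - b) = T a - T b" if "a \<in> V1" "b \<in> V1" for a b
    using T(2)[of "a - b" b] that by simp
  define M' where "M' = \<bar>M\<bar> + 1"
  have M': "M' > 0" by (simp add: M'_def)
  have bound': "N2 (T a) \<le> M' * N1 a" if "a \<in> V1" for a
    using bound[OF that] by (rule order_trans) (use that in \<open>auto simp: M'_def intro!: mult_right_mono\<close>)
  have base: "equicont V2 N2 U FF (\<lambda>f x. T (f x))" if a: "equicont V1 N1 U FF (\<lambda>f. f)" for FF
    unfolding equicont_def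
  proof (intro conjI ballI allI impI)
    fix x assume x: "x \<in> U"
    obtain K where K: "\<forall>f\<in>FF. N1 (f x) \<le> K" using equicontD(2)[OF a x] by blast
    have "N2 (T (f x)) \<le> M' * K" if "f \<in> FF" for f
      using bound'[of "f x"] equicontD(1)[OF a that x] K that M' by (meson order_trans mult_left_mono less_imp_le)
    then show "\<exists>K. \<forall>f\<in>FF. N2 (T (f x)) \<le> K" by blast
  next
    fix x e assume x: "x \<in> U" and e: "(e::real) > 0"
    have "e / M' > 0" using e M' by simp
    from equicontD(3)[OF a x this] eventually_nw_in
    show "\<forall>\<^sub>F y in nw x U. \<forall>f\<in>FF. N2 (T (f y) - T (f x)) \<le> e"
    proof eventually_elim
      case (elim y)
      show ?case
      proof
        fix f assume f: "f \<in> FF"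
        have in': "f y \<in> V1" "f x \<in> V1" using equicontD(1)[OF a f] x elim by auto
        have "N2 (T (f y) - T (f x)) \<le> M' * N1 (f y - f x)"
          using bound'[of "f y - f x"] in' by (simp add: Td)
        also have "\<dots> \<le> M' * (e / M')" using elim f M' by (intro mult_left_mono) auto
        finally show "N2 (T (f y) - T (f x)) \<le> e" using M' by simp
      qed
    qed
  qed (use T equicontD(1)[OF a] in auto)
  {
    case 0
    then show ?case using base[of FF] by (simp add: equicont_image)
  next
    case (Suc k)
    obtain D where D: "equicont V1 N1 U FF (\<lambda>f. f)" "equidiff V1 N1 sc1 U FF (\<lambda>f. f) D"
      "UC V1 N1 sc1 k U (dfam FF D)"
      using Suc.prems by (rule UC_SucE)
    show ?case
    proof (rule UC_SucI[OF base[OF D(1)], where D = "\<lambda>f x v. T (D f x v)"])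
      show "equidiff V2 N2 sc2 U FF (\<lambda>f x. T (f x)) (\<lambda>f x v. T (D f x v))"
        unfolding equidiff_def
      proof (intro conjI ballI allI impI)
        fix x e assume x: "x \<in> U" and e: "(e::real) > 0"
        have "e / M' > 0" using e M' by simp
        from equidiffD(4)[OF D(2) x this] eventually_nw_in
        show "\<forall>\<^sub>F y in nw x U. \<forall>f\<in>FF. N2 (T (f y) - T (f x) - T (D f x (y - x))) \<le> e * norm (y - x)"
        proof eventually_elim
          case (elim y)
          show ?case
          proof
            fix f assume f: "f \<in> FF"
            have in': "f y \<in> V1" "f x \<in> V1" "D f x (y - x) \<in> V1"
              using equicontD(1)[OF D(1) f] equidiffD(1)[OF D(2) f x] x elim by auto
            have "N2 (T (f y) - T (f x) - T (D f x (y - x))) \<le> M' * N1 (f y - f x - D f x (y - x))"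
              using bound'[of "f y - f x - D f x (y - x)"] in' by (simp add: Td)
            also have "\<dots> \<le> M' * (e / M' * norm (y - x))" using elim f M' by (intro mult_left_mono) auto
            finally show "N2 (T (f y) - T (f x) - T (D f x (y - x))) \<le> e * norm (y - x)" using M' by simp
          qed
        qed
      qed (use equidiffD(1-3)[OF D(2)] T in simp_all)
      show "UC V2 N2 sc2 k U (dfam FF (\<lambda>f x v. T (D f x v)))"
        by (rule UC_subset[OF Suc.IH[OF D(3)]]) (auto elim!: dfamE intro!: image_eqI dfamI)
    qed
  }
qed

lemma filterlim_nw:
  assumes "continuous (at x within U) \<psi>" "x \<in> U" "\<psi> ` U \<subseteq> \<Omega>"
  shows "filterlim \<psi> (nw (\<psi> x) \<Omega>) (nw x U)"
  unfolding filterlim_iff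
proof (intro allI impI)
  fix P assume "eventually P (nw (\<psi> x) \<Omega>)"
  then obtain e where e: "e > 0" "\<And>y. y \<in> \<Omega> \<Longrightarrow> dist y (\<psi> x) < e \<Longrightarrow> P y" unfolding eventually_nw by blast
  obtain d where "d > 0" "\<And>y. y \<in> U \<Longrightarrow> dist y x < d \<Longrightarrow> dist (\<psi> y) (\<psi> x) < e"
    using assms(1) e(1) unfolding continuous_within_eps_delta by blast
  then show "\<forall>\<^sub>F y in nw x U. P (\<psi> y)" unfolding eventually_nw using e(2) assms(3) by blast
qed

lemma equicont_comp:
  assumes h: "equicont V N \<Omega> I h" and c: "continuous_on U \<psi>" and s: "\<psi> ` U \<subseteq> \<Omega>"
  shows "equicont V N U I (\<lambda>i x. h i (\<psi> x))"
  unfolding equicont_def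
proof (intro conjI ballI allI impI)
  fix x e assume x: "x \<in> U" and e: "(e::real) > 0"
  have "\<forall>\<^sub>F y in nw (\<psi> x) \<Omega>. \<forall>i\<in>I. N (h i y - h i (\<psi> x)) \<le> e"
    using equicontD(3)[OF h _ e, of "\<psi> x"] s x by blast
  then show "\<forall>\<^sub>F y in nw x U. \<forall>i\<in>I. N (h i (\<psi> y) - h i (\<psi> x)) \<le> e"
    using filterlim_nw[OF _ x s] c x by (auto simp: filterlim_iff continuous_on_eq_continuous_within)
next
  fix x assume "x \<in> U"
  then show "\<exists>K. \<forall>i\<in>I. N (h i (\<psi> x)) \<le> K" using equicontD(2)[OF h, of "\<psi> x"] s by blast
qed (use equicontD(1)[OF h] s in blast)

lemma (in nspace) equidiff_comp:
  assumes h: "equicont V N \<Omega> I h" and D: "equidiff V N sc \<Omega> I h D" and dD: "equicont V N \<Omega> (dfam I D) (\<lambda>f. f)"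
    and s: "\<psi> ` U \<subseteq> \<Omega>" and der: "\<And>x. x \<in> U \<Longrightarrow> (\<psi> has_derivative \<psi>' x) (at x within U)"
  shows "equidiff V N sc U I (\<lambda>i x. h i (\<psi> x)) (\<lambda>i x v. D i (\<psi> x) (\<psi>' x v))"
  unfolding equidiff_def
proof (intro conjI ballI allI impI)
  fix x e assume x: "x \<in> U" and e: "(e::real) > 0"
  have \<psi>x: "\<psi> x \<in> \<Omega>" using s x by blast
  obtain K where K: "K > 0" "\<forall>i\<in>I. \<forall>v. N (D i (\<psi> x) v) \<le> K * norm v"
    using deriv_bound[OF D dD \<psi>x] by blast
  have bl: "bounded_linear (\<psi>' x)" using der[OF x] has_derivative_bounded_linear by blast
  obtain B where B: "B > 0" "\<And>v. norm (\<psi>' x v) \<le> norm v * B"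
    using bounded_linear.pos_bounded[OF bl] by blast
  \<comment> \<open>\<open>e1\<close> absorbs the growth factor \<open>B + 1\<close> of \<psi>, and
    \<open>e2\<close> the bound \<open>K\<close> of the outer derivative; the condition
    \<open>e2 \<le> 1\<close> is what yields the growth factor \<open>B + 1\<close>.\<close>
  define e1 where "e1 = e / (2 * (B + 1))"
  define e2 where "e2 = min 1 (e / (2 * K))"
  have e1: "e1 > 0" "e1 * (B + 1) = e / 2" using e B by (auto simp: e1_def divide_simps)
  have e2: "e2 > 0" "e2 \<le> 1" using e K by (auto simp: e2_def)
  have "e2 \<le> e / (2 * K)" by (simp add: e2_def)
  then have e2': "K * e2 \<le> e / 2" using K by (simp add: divide_simps mult.commute mult.left_commute)
  have 1: "\<forall>\<^sub>F y in nw x U. norm (\<psi> y - \<psi> x - \<psi>' x (y - x)) \<le> e2 * norm (y - x)"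
    using der[OF x] e2(1) unfolding has_derivative_within_alt eventually_nw dist_norm by blast
  have cont: "continuous (at x within U) \<psi>" using der[OF x] has_derivative_continuous by blast
  have "\<forall>\<^sub>F y in nw (\<psi> x) \<Omega>. \<forall>i\<in>I. N (h i y - h i (\<psi> x) - D i (\<psi> x) (y - \<psi> x)) \<le> e1 * norm (y - \<psi> x)"
    using equidiffD(4)[OF D \<psi>x e1(1)] .
  then have 2: "\<forall>\<^sub>F y in nw x U. \<forall>i\<in>I. N (h i (\<psi> y) - h i (\<psi> x) - D i (\<psi> x) (\<psi> y - \<psi> x)) \<le> e1 * norm (\<psi> y - \<psi> x)"
    using filterlim_nw[OF cont x s] by (auto simp: filterlim_iff)
  show "\<forall>\<^sub>F y in nw x U. \<forall>i\<in>I. N (h i (\<psi> y) - h i (\<psi> x) - D i (\<psi> x) (\<psi>' x (y - x))) \<le> e * norm (y - x)"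
    using 1 2 eventually_nw_in
  proof eventually_elim
    case (elim y)
    let ?r = "\<psi> y - \<psi> x - \<psi>' x (y - x)"
    have \<psi>y: "\<psi> y \<in> \<Omega>" using s elim by blast
    have nn: "norm (\<psi> y - \<psi> x) \<le> (B + 1) * norm (y - x)"
    proof -
      have "norm (\<psi> y - \<psi> x) \<le> norm ?r + norm (\<psi>' x (y - x))"
        using norm_triangle_ineq[of ?r "\<psi>' x (y - x)"] by simp
      also have "\<dots> \<le> 1 * norm (y - x) + norm (y - x) * B"
        using elim(1) B(2)[of "y - x"] e2(2) by (intro add_mono) (meson order_trans mult_right_mono norm_ge_zero)+
      finally show ?thesis by (simp add: algebra_simps)
    qed
    show ?case
    proof
      fix i assume i: "i \<in> I"
      have in': "h i (\<psi> y) \<in> V" "h i (\<psi> x) \<in> V" "\<And>v. D i (\<psi> x) v \<in> V"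
        using equicontD(1)[OF h i] \<psi>x \<psi>y equidiffD(1)[OF D i \<psi>x] by auto
      have split: "h i (\<psi> y) - h i (\<psi> x) - D i (\<psi> x) (\<psi>' x (y - x)) =
        (h i (\<psi> y) - h i (\<psi> x) - D i (\<psi> x) (\<psi> y - \<psi> x)) + D i (\<psi> x) ?r"
        using equidiff_diff[OF D i \<psi>x, of "\<psi> y - \<psi> x" "\<psi>' x (y - x)"] by simp
      have "N (h i (\<psi> y) - h i (\<psi> x) - D i (\<psi> x) (\<psi>' x (y - x))) \<le>
        N (h i (\<psi> y) - h i (\<psi> x) - D i (\<psi> x) (\<psi> y - \<psi> x)) + N (D i (\<psi> x) ?r)"
        unfolding split by (rule N_triangle) (use in' in auto)
      also have "\<dots> \<le> e1 * ((B + 1) * norm (y - x)) + K * (e2 * norm (y - x))"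
      proof (rule add_mono)
        have "N (h i (\<psi> y) - h i (\<psi> x) - D i (\<psi> x) (\<psi> y - \<psi> x)) \<le> e1 * norm (\<psi> y - \<psi> x)"
          using elim i by blast
        also have "\<dots> \<le> e1 * ((B + 1) * norm (y - x))" using nn e1 by (intro mult_left_mono) auto
        finally show "N (h i (\<psi> y) - h i (\<psi> x) - D i (\<psi> x) (\<psi> y - \<psi> x)) \<le> e1 * ((B + 1) * norm (y - x))" .
        have "N (D i (\<psi> x) ?r) \<le> K * norm ?r" using K i by blast
        also have "\<dots> \<le> K * (e2 * norm (y - x))" using elim(1) K by (intro mult_left_mono) auto
        finally show "N (D i (\<psi> x) ?r) \<le> K * (e2 * norm (y - x))" .
      qed
      also have "\<dots> = (e1 * (B + 1) + K * e2) * norm (y - x)" by (simp add: algebra_simps)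
      also have "\<dots> \<le> e * norm (y - x)" using e1 e2' by (intro mult_right_mono) auto
      finally show "N (h i (\<psi> y) - h i (\<psi> x) - D i (\<psi> x) (\<psi>' x (y - x))) \<le> e * norm (y - x)" .
    qed
  qed
next
  fix i x u v assume a: "i \<in> I" "x \<in> U"
  have bl: "bounded_linear (\<psi>' x)" using der[OF a(2)] has_derivative_bounded_linear by blast
  have \<psi>x: "\<psi> x \<in> \<Omega>" using s a by blast
  show "D i (\<psi> x) (\<psi>' x (u + v)) = D i (\<psi> x) (\<psi>' x u) + D i (\<psi> x) (\<psi>' x v)"
    using equidiffD(2)[OF D a(1) \<psi>x] by (simp add: linear_simps(1)[OF bl])
  fix r show "D i (\<psi> x) (\<psi>' x (r *\<^sub>R v)) = sc r (D i (\<psi> x) (\<psi>' x v))"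
    using equidiffD(3)[OF D a(1) \<psi>x] by (simp add: linear_simps(5)[OF bl])
  show "D i (\<psi> x) (\<psi>' x v) \<in> V" using equidiffD(1)[OF D a(1) \<psi>x] .
qed

text \<open>Since \<open>l\<close> does not increase norms, it maps the unit ball into itself, so
  the derivatives of the compositions are compositions of members of \<open>dfam FF D\<close> with
  the same affine map.\<close>

lemma (in nspace) UC_affine:
  assumes l: "bounded_linear l" "\<And>v. norm (l v) \<le> norm v" and s: "(\<lambda>x. a + l x) ` U \<subseteq> \<Omega>"
    and "UC V N sc k \<Omega> FF"
  shows "UC V N sc k U ((\<lambda>f x. f (a + l x)) ` FF)"
  using assms(4)
proof (induction k arbitrary: FF)
  let ?\<psi> = "\<lambda>x. a + l x"
  have der: "(?\<psi> has_derivative l) (at x within U)" for x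
    using has_derivative_add[OF has_derivative_const bounded_linear_imp_has_derivative[OF l(1)]] by simp
  have cont: "continuous_on U ?\<psi>"
    by (intro continuous_intros bounded_linear.continuous_on[OF l(1)])
  note base = equicont_comp[OF _ cont s]
  {
    case 0
    then show ?case using base[of V N FF "\<lambda>f. f"] by (simp add: equicont_image)
  next
    case (Suc k)
    obtain D where D: "equicont V N \<Omega> FF (\<lambda>f. f)" "equidiff V N sc \<Omega> FF (\<lambda>f. f) D"
      "UC V N sc k \<Omega> (dfam FF D)"
      using Suc.prems by (rule UC_SucE)
    show ?case
    proof (rule UC_SucI[OF base[OF D(1)] equidiff_comp[OF D(1,2) UC_equicont[OF D(3)] s der]])
      show "UC V N sc k U (dfam FF (\<lambda>f x v. D f (a + l x) (l v)))"
        by (rule UC_subset[OF Suc.IH[OF D(3)]])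
          (auto elim!: dfamE intro!: image_eqI dfamI intro: order_trans[OF l(2)])
    qed
  }
qed

lemma nspace_norm: "nspace UNIV (norm :: 'b::real_normed_vector \<Rightarrow> real) (*\<^sub>R)"
  by unfold_locales (auto simp: norm_triangle_ineq scaleR_add_right)

interpretation NV: nspace UNIV "norm :: 'b::real_normed_vector \<Rightarrow> real" "(*\<^sub>R)"
  by (rule nspace_norm)

abbreviation NC :: "nat \<Rightarrow> 'e::real_normed_vector set \<Rightarrow> ('e \<Rightarrow> 'b::real_normed_vector) set \<Rightarrow> bool" where
  "NC \<equiv> UC UNIV norm (*\<^sub>R)"

lemma nbilinear_mult: "nbilinear UNIV norm (*\<^sub>R) UNIV norm (*\<^sub>R) UNIV norm (*\<^sub>R) ((*) :: real \<Rightarrow> real \<Rightarrow> real) 1"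
  by (intro nbilinear.intro nbilinear_axioms.intro nspace_norm) (auto simp: abs_mult algebra_simps)

lemma nbilinear_scaleR: "nbilinear UNIV norm (*\<^sub>R) UNIV norm (*\<^sub>R) UNIV norm (*\<^sub>R)
    ((*\<^sub>R) :: real \<Rightarrow> 'b::real_normed_vector \<Rightarrow> 'b) 1"
  by (intro nbilinear.intro nbilinear_axioms.intro nspace_norm) (auto simp: algebra_simps)

lemma equidiff_has_derivative:
  assumes D: "equidiff UNIV norm (*\<^sub>R) U I h D" and d: "equicont UNIV norm U (dfam I D) (\<lambda>f. f)"
    and i: "i \<in> I" and x: "x \<in> U"
  shows "(h i has_derivative D i x) (at x within U)"
proof -
  obtain K where K: "\<forall>i\<in>I. \<forall>v. norm (D i x v) \<le> K * norm v" using NV.deriv_bound[OF D d x] by blast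
  have "bounded_linear (D i x)"
    using equidiffD(2,3)[OF D i x] K i by (intro bounded_linear_intro[of _ K]) (auto simp: mult.commute)
  moreover have "\<exists>d>0. \<forall>y\<in>U. norm (y - x) < d \<longrightarrow> norm (h i y - h i x - D i x (y - x)) \<le> e * norm (y - x)" if "e > 0" for e
    using equidiffD(4)[OF D x that] i unfolding eventually_nw dist_norm by blast
  ultimately show ?thesis unfolding has_derivative_within_alt by blast
qed

lemma UC_continuous_on:
  assumes "NC k U FF" "f \<in> FF" shows "continuous_on U f"
  unfolding continuous_on_iff
proof (intro ballI allI impI)
  fix x e assume x: "x \<in> U" and e: "(e::real) > 0"
  obtain d where "d > 0" "\<forall>y\<in>U. dist y x < d \<longrightarrow> (\<forall>f\<in>FF. norm (f y - f x) \<le> e / 2)"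
    using equicontD(3)[OF UC_equicont[OF assms(1)] x half_gt_zero[OF e]] unfolding eventually_nw by blast
  then have "dist (f y) (f x) < e" if "y \<in> U" "dist y x < d" for y
    using that assms(2) e by (force simp: dist_norm)
  then show "\<exists>d>0. \<forall>x'\<in>U. dist x' x < d \<longrightarrow> dist (f x') (f x) < e" using \<open>d > 0\<close> by blast
qed

text \<open>This is the composition that occurs when unknowns are eliminated. The inner derivative
  is \<open>v\<close> plus real multiples of the fixed vectors \<open>w i\<close>, so the chain rule
  gives a finite sum of products of real functions, to which the rules for sums and products
  apply.\<close>

lemma UC_shift:
  fixes FF :: "('e::real_normed_vector \<Rightarrow> real) set" and \<tau> :: "'i \<Rightarrow> 'e \<Rightarrow> real"
  assumes fin: "finite I" and \<tau>: "\<And>i. i \<in> I \<Longrightarrow> NC k U {\<tau> i}"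
    and s: "(\<lambda>x. x + (\<Sum>i\<in>I. \<tau> i x *\<^sub>R w i)) ` U \<subseteq> \<Omega>" and "NC k \<Omega> FF"
  shows "NC k U ((\<lambda>f x. f (x + (\<Sum>i\<in>I. \<tau> i x *\<^sub>R w i))) ` FF)"
  using assms(4) \<tau>
proof (induction k arbitrary: FF)
  let ?\<psi> = "\<lambda>x. x + (\<Sum>i\<in>I. \<tau> i x *\<^sub>R w i)"
  have cont: "continuous_on U ?\<psi>" if "\<And>i. i \<in> I \<Longrightarrow> NC k U {\<tau> i}" for k
    by (intro continuous_intros UC_continuous_on[OF that]) auto
  note base = equicont_comp[OF _ cont s]
  {
    case 0
    have "equicont UNIV norm U FF (\<lambda>f x. f (?\<psi> x))"
      by (rule base[OF UC_equicont[OF 0(1)] 0(2)])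
    then show ?case unfolding UC.simps equicont_image .
  next
    case (Suc k)
    interpret M: nbilinear UNIV norm "(*\<^sub>R)" UNIV norm "(*\<^sub>R)" UNIV norm "(*\<^sub>R)" "(*) :: real \<Rightarrow> real \<Rightarrow> real" 1
      by (rule nbilinear_mult)
    obtain D where D: "equicont UNIV norm \<Omega> FF (\<lambda>f. f)" "equidiff UNIV norm (*\<^sub>R) \<Omega> FF (\<lambda>f. f) D"
      "NC k \<Omega> (dfam FF D)"
      using Suc.prems(1) by (rule UC_SucE)
    have "\<exists>E. equidiff UNIV norm (*\<^sub>R) U {\<tau> i} (\<lambda>f. f) E \<and> NC k U (dfam {\<tau> i} E)" if "i \<in> I" for i
      using Suc.prems(2)[OF that] by (rule UC_SucE) blast
    then obtain E where E: "\<And>i. i \<in> I \<Longrightarrow> equidiff UNIV norm (*\<^sub>R) U {\<tau> i} (\<lambda>f. f) (E i)"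
      "\<And>i. i \<in> I \<Longrightarrow> NC k U (dfam {\<tau> i} (E i))" by metis
    have \<tau>k: "NC k U {\<tau> i}" if "i \<in> I" for i by (rule UC_Suc_le[OF Suc.prems(2)[OF that]])
    define T where "T = (\<lambda>i. E i (\<tau> i))"
    have d\<tau>: "(\<tau> i has_derivative T i x) (at x within U)" if "i \<in> I" "x \<in> U" for i x
      using equidiff_has_derivative[OF E(1)[OF that(1)] UC_equicont[OF E(2)[OF that(1)]] _ that(2), of "\<tau> i"]
      by (simp add: T_def)
    have der: "(?\<psi> has_derivative (\<lambda>v. v + (\<Sum>i\<in>I. T i x v *\<^sub>R w i))) (at x within U)" if "x \<in> U" for x
      by (intro derivative_intros d\<tau> that)
    let ?D = "\<lambda>f x v. D f (?\<psi> x) (v + (\<Sum>i\<in>I. T i x v *\<^sub>R w i))"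
    let ?A = "(\<lambda>f x. f (?\<psi> x)) ` dfam FF D"
    have A: "NC k U ?A" by (rule Suc.IH[OF D(3) \<tau>k])
    have B: "NC k U (fam2 (*) (dfam {\<tau> i} (E i)) (fam2 (*) {\<lambda>_. norm (w i)} ?A))" if i: "i \<in> I" for i
    proof (intro M.UC_b E(2)[OF i] A)
      have "NC k U ((\<lambda>a x. a) ` {norm (w i)})" by (rule NV.UC_const[of _ "norm (w i)"]) auto
      then show "NC k U {\<lambda>_. norm (w i)}" by simp
    qed
    show ?case
    proof (rule UC_SucI[OF base[OF D(1) Suc.prems(2)] NV.equidiff_comp[OF D(1,2) UC_equicont[OF D(3)] s der]])
      show "NC k U (dfam FF ?D)"
      proof (rule UC_refine[OF NV.UC_add[OF A NV.UC_sum[OF fin B]] subset_refl])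
        let ?S = "{\<lambda>x. \<Sum>i\<in>I. g i x |g. \<forall>i\<in>I. g i \<in> fam2 (*) (dfam {\<tau> i} (E i)) (fam2 (*) {\<lambda>_. norm (w i)} ?A)}"
        fix q assume "q \<in> dfam FF ?D"
        then obtain f v where f: "f \<in> FF" and v: "norm v \<le> 1" and q: "q = (\<lambda>x. ?D f x v)" by (rule dfamE)
        \<comment> \<open>The vectors \<open>w i\<close> need not lie in the unit ball; splitting
          off \<open>norm (w i)\<close> leaves the direction \<open>sgn (w i)\<close>, which
          \<open>dfam\<close> admits.\<close>
        let ?g = "\<lambda>i x. T i x v * (norm (w i) * D f (?\<psi> x) (sgn (w i)))"
        have eq: "?D f x v = D f (?\<psi> x) v + (\<Sum>i\<in>I. ?g i x)" if x: "x \<in> U" for x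
        proof -
          have \<psi>x: "?\<psi> x \<in> \<Omega>" using s x by blast
          have lin: "linear (D f (?\<psi> x))"
            using equidiffD(2,3)[OF D(2) f \<psi>x] by (intro linearI) auto
          have "D f (?\<psi> x) (w i) = norm (w i) * D f (?\<psi> x) (sgn (w i))" for i
          proof -
            have "w i = norm (w i) *\<^sub>R sgn (w i)" by (cases "w i = 0") (auto simp: sgn_div_norm)
            then show ?thesis using linear_cmul[OF lin, of "norm (w i)" "sgn (w i)"] by simp
          qed
          then show ?thesis by (simp add: linear_add[OF lin] linear_sum[OF lin] linear_cmul[OF lin])
        qed
        have A_in: "(\<lambda>x. D f (?\<psi> x) u) \<in> ?A" if "norm u \<le> 1" for u
          using dfamI[of f FF u D] f that by (auto intro: image_eqI)
        have gi: "?g i \<in> fam2 (*) (dfam {\<tau> i} (E i)) (fam2 (*) {\<lambda>_. norm (w i)} ?A)" for i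
          unfolding T_def
          by (intro fam2I[where f = "\<lambda>x. E i (\<tau> i) x v"] fam2I[where f = "\<lambda>_. norm (w i)"] dfamI A_in v)
            (auto simp: norm_sgn)
        have "(\<lambda>x. \<Sum>i\<in>I. ?g i x) \<in> ?S"
          using gi by (intro CollectI exI[where x = ?g]) blast
        then have "(\<lambda>x. D f (?\<psi> x) v + (\<Sum>i\<in>I. ?g i x)) \<in> fam2 (+) ?A ?S"
          by (intro fam2I A_in v)
        then show "\<exists>f\<in>fam2 (+) ?A ?S. \<forall>x\<in>U. q x = f x"
          using eq unfolding q by (intro bexI[where x = "\<lambda>x. D f (?\<psi> x) v + (\<Sum>i\<in>I. ?g i x)"]) auto
      qed
    qed
  }
qed

text \<open>The derivative of \<open>T = (1 + K)\<^sup>-\<^sup>1\<close> is \<open>- T K' T\<close>.\<close>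

lemma UC_inverse:
  assumes mul: "nbilinear V N sc V N sc V N sc mul M"
    and T: "\<And>x. x \<in> U \<Longrightarrow> T x \<in> V" "\<And>x. x \<in> U \<Longrightarrow> N (T x) \<le> B"
    and eq: "\<And>x y. x \<in> U \<Longrightarrow> y \<in> U \<Longrightarrow> T y - T x = - mul (mul (T y) (K y - K x)) (T x)"
    and "UC V N sc k U {K}"
  shows "UC V N sc k U {T}"
  using assms(5)
proof (induction k)
  interpret nbilinear V N sc V N sc V N sc mul M by fact
  define B' where "B' = \<bar>B\<bar> + 1"
  \<comment> \<open>A Lipschitz constant of \<open>T\<close> with respect to \<open>K\<close>: in
    \<open>eq\<close> both outer factors are bounded by \<open>B'\<close>. Adding 1 makes it
    positive.\<close>
  define L where "L = M * (M * B') * B' + 1"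
  have B': "B' > 0" "\<And>x. x \<in> U \<Longrightarrow> N (T x) \<le> B'" using T(2) by (force simp: B'_def)+
  have L: "L > 0" unfolding L_def using B' M_nonneg by (intro add_nonneg_pos mult_nonneg_nonneg) auto
  have KV: "K x \<in> V" if "equicont V N U {K} (\<lambda>f. f)" "x \<in> U" for x using equicontD(1)[OF that(1), of K] that(2) by simp
  have tri: "N (mul (mul a b) c) \<le> M * (M * p * q) * r"
    if "a \<in> V" "b \<in> V" "c \<in> V" "N a \<le> p" "N b \<le> q" "N c \<le> r" for a b c p q r
    using that by (intro b_le) auto
  have lip: "N (T y - T x) \<le> L * N (K y - K x)" if a: "equicont V N U {K} (\<lambda>f. f)" "x \<in> U" "y \<in> U" for x y
  proof -
    have "N (T y - T x) = N (mul (mul (T y) (K y - K x)) (T x))"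
      unfolding eq[OF a(2,3)] using a T(1) KV by (intro A.N_minus) auto
    also have "\<dots> \<le> M * (M * B' * N (K y - K x)) * B'"
      using a T(1) KV B' by (intro tri) auto
    also have "\<dots> \<le> L * N (K y - K x)" using KV a by (simp add: L_def algebra_simps)
    finally show ?thesis .
  qed
  have base: "equicont V N U {T} (\<lambda>f. f)" if a: "equicont V N U {K} (\<lambda>f. f)"
    unfolding equicont_def
  proof (intro conjI ballI allI impI)
    fix x e assume x: "x \<in> U" and e: "(e::real) > 0"
    have "e / L > 0" using e L by simp
    from equicontD(3)[OF a x this] eventually_nw_in
    show "\<forall>\<^sub>F y in nw x U. \<forall>f\<in>{T}. N (f y - f x) \<le> e"
    proof eventually_elim
      case (elim y)
      have "N (T y - T x) \<le> L * N (K y - K x)" using lip[OF a x] elim by simp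
      also have "\<dots> \<le> L * (e / L)" using elim L by (intro mult_left_mono) auto
      finally show ?case using L by simp
    qed
  qed (use T in auto)
  {
    case 0
    then show ?case using base by simp
  next
    case (Suc k)
    obtain D where D: "equicont V N U {K} (\<lambda>f. f)" "equidiff V N sc U {K} (\<lambda>f. f) D" "UC V N sc k U (dfam {K} D)"
      using Suc.prems by (rule UC_SucE)
    have UT: "UC V N sc k U {T}" using Suc.IH[OF UC_Suc_le[OF Suc.prems]] .
    let ?D = "\<lambda>f x v. - mul (mul (T x) (D K x v)) (T x)"
    have "UC V N sc (Suc k) U ((\<lambda>f. f) ` {T})"
    proof (rule UC_SucI[OF base[OF D(1)], where D = ?D])
      have "UC V N sc k U (fam2 mul (fam2 mul {T} (dfam {K} D)) {T})"
        by (intro UC_b UT D(3))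
      then have "UC V N sc k U ((\<lambda>f x. - f x) ` fam2 mul (fam2 mul {T} (dfam {K} D)) {T})"
        by (intro UC_linear[where M = 1, OF A.nspace_axioms A.nspace_axioms]) (auto simp: A.N_minus A.sc_minus)
      then show "UC V N sc k U (dfam {T} ?D)"
        by (rule UC_subset) (auto elim!: dfamE intro!: fam2I dfamI image_eqI[OF refl])
      show "equidiff V N sc U {T} (\<lambda>f. f) ?D"
        unfolding equidiff_def
      proof (intro conjI ballI allI impI)
        fix x e assume x: "x \<in> U" and e: "(e::real) > 0"
        obtain P where P: "P > 0" "\<forall>\<^sub>F y in nw x U. \<forall>f\<in>{K}. N (f y - f x) \<le> P * norm (y - x)"
          using A.lipschitz_at[OF D(1,2) UC_equicont[OF D(3)] x] by blast
        define c1 where "c1 = M * (M * L * P * P) * B'"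
        define c2 where "c2 = M * (M * B' * 1) * B'"
        define c where "c = c1 + c2 + 1"
        have c1: "c1 \<ge> 0" unfolding c1_def using B' M_nonneg L P by (intro mult_nonneg_nonneg) auto
        have c: "c > 0" unfolding c_def c1_def c2_def using B' M_nonneg L P by (intro add_nonneg_pos add_nonneg_nonneg mult_nonneg_nonneg) auto
        have ec: "e / c > 0" using e c by simp
        show "\<forall>\<^sub>F y in nw x U. \<forall>f\<in>{T}. N (f y - f x - ?D f x (y - x)) \<le> e * norm (y - x)"
          using P(2) equidiffD(4)[OF D(2) x ec] eventually_nw_small[OF ec, of x U] eventually_nw_in
        proof eventually_elim
          case (elim y)
          let ?n = "norm (y - x)"
          have in': "T y \<in> V" "T x \<in> V" "K y \<in> V" "K x \<in> V" "D K x (y - x) \<in> V"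
            using T(1) KV[OF D(1)] elim x equidiffD(1)[OF D(2)] by auto
          \<comment> \<open>\<open>t1\<close> has two small factors and is quadratic in
            \<open>y - x\<close> by the Lipschitz bounds; \<open>t2\<close> contains the remainder
            of the first-order expansion of \<open>K\<close>.\<close>
          define t1 where "t1 = mul (mul (T y - T x) (K y - K x)) (T x)"
          define t2 where "t2 = mul (mul (T x) (K y - K x - D K x (y - x))) (T x)"
          have "mul (mul (T y) (K y - K x)) (T x) = t1 + mul (mul (T x) (K y - K x)) (T x)"
            unfolding t1_def using in' by (simp add: b_diff_left)
          moreover have "mul (mul (T x) (K y - K x)) (T x) = t2 + mul (mul (T x) (D K x (y - x))) (T x)"
            unfolding t2_def using in' by (simp add: b_diff_left b_diff_right)
          ultimately have split: "T y - T x - - mul (mul (T x) (D K x (y - x))) (T x) = - t1 + - t2"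
            using eq[OF x elim(4)] by (simp add: algebra_simps)
          have t_in: "t1 \<in> V" "t2 \<in> V" using in' by (auto simp: t1_def t2_def)
          have "N (T y - T x - - mul (mul (T x) (D K x (y - x))) (T x)) \<le> N t1 + N t2"
            unfolding split using A.N_triangle[of "- t1" "- t2"] t_in by (simp add: A.N_minus)
          also have "\<dots> \<le> M * (M * (L * (P * ?n)) * (P * ?n)) * B' + M * (M * B' * (e / c * ?n)) * B'"
            unfolding t1_def t2_def
          proof (intro add_mono tri)
            have "N (T y - T x) \<le> L * N (K y - K x)" using lip[OF D(1) x] elim by simp
            also have "\<dots> \<le> L * (P * ?n)" using elim L by (intro mult_left_mono) auto
            finally show "N (T y - T x) \<le> L * (P * ?n)" .
          qed (use elim in' B' x in auto)
          also have "\<dots> = (c1 * ?n + c2 * (e / c)) * ?n"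
            by (simp add: c1_def c2_def algebra_simps)
          also have "\<dots> \<le> e * ?n"
          proof (rule mult_right_mono)
            have "c1 * ?n \<le> c1 * (e / c)" using elim(3) c1 by (intro mult_left_mono) auto
            then have "c1 * ?n + c2 * (e / c) \<le> (c1 + c2 + 1) * (e / c)"
              using ec by (simp only: distrib_right mult_1_left)
            then show "c1 * ?n + c2 * (e / c) \<le> e" using c by (simp add: c_def)
          qed simp
          finally show ?case by simp
        qed
      next
        fix f x u v assume x: "x \<in> U"
        have in': "T x \<in> V" "\<And>v. D K x v \<in> V"
          using T(1) x equidiffD(1)[OF D(2)] by auto
        show "?D f x v \<in> V" using in' by simp
        show "?D f x (u + v) = ?D f x u + ?D f x v"
          using in' equidiffD(2)[OF D(2) _ x] by (simp add: b_add_left b_add_right)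
        fix r show "?D f x (r *\<^sub>R v) = sc r (?D f x v)"
          using in' equidiffD(3)[OF D(2) _ x] by (simp add: b_sc_left b_sc_right A.sc_minus)
      qed
    qed
    then show ?case by simp
  }
qed

section \<open>Implicit functions\<close>

text \<open>Differentiation with the directions fixed, so that derivatives of all orders have one
  type. The head of the list is the direction of the last differentiation, as in
  \<open>Ck_on\<close>.\<close>

primrec iter_deriv :: "('e::real_normed_vector \<Rightarrow> 'b::real_normed_vector) \<Rightarrow> 'e list \<Rightarrow> 'e \<Rightarrow> 'b" where
  "iter_deriv f [] = f"
| "iter_deriv f (v # vs) = (\<lambda>x. frechet_derivative (iter_deriv f vs) (at x) v)"

text \<open>The recursion of \<open>UC\<close> unrolled: \<open>GG j\<close> collects the
  derivatives of order \<open>j\<close> along directions in the unit ball.\<close>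

lemma UC_chain:
  assumes "UC V N sc k U FF"
  shows "\<exists>GG D. GG 0 = FF \<and> (\<forall>j\<le>k. equicont V N U (GG j) (\<lambda>f. f)) \<and>
    (\<forall>j<k. equidiff V N sc U (GG j) (\<lambda>f. f) (D j) \<and> GG (Suc j) = dfam (GG j) (D j))"
  using assms
proof (induction k arbitrary: FF)
  case 0
  then show ?case by (intro exI[of _ "\<lambda>_. FF"]) auto
next
  case (Suc k)
  obtain D0 where D: "equicont V N U FF (\<lambda>f. f)" "equidiff V N sc U FF (\<lambda>f. f) D0" "UC V N sc k U (dfam FF D0)"
    using Suc.prems by (rule UC_SucE)
  obtain GG D where G: "GG 0 = dfam FF D0" "\<forall>j\<le>k. equicont V N U (GG j) (\<lambda>f. f)"
    "\<forall>j<k. equidiff V N sc U (GG j) (\<lambda>f. f) (D j) \<and> GG (Suc j) = dfam (GG j) (D j)"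
    using Suc.IH[OF D(3)] by metis
  show ?case
  proof (intro exI conjI allI impI)
    show "case_nat FF GG 0 = FF" by simp
    show "equicont V N U (case_nat FF GG j) (\<lambda>f. f)" if "j \<le> Suc k" for j
      using that D(1) G(2) by (cases j) auto
    show "equidiff V N sc U (case_nat FF GG j) (\<lambda>f. f) (case_nat D0 D j)" if "j < Suc k" for j
      using that D(2) G(3) by (cases j) auto
    show "case_nat FF GG (Suc j) = dfam (case_nat FF GG j) (case_nat D0 D j)" if "j < Suc k" for j
      using that G(1,3) by (cases j) auto
  qed
qed

text \<open>An iterated derivative of order \<open>j\<close> is the product of the norms of its
  directions times a member of \<open>GG j\<close>, so uniform estimates on \<open>GG j\<close>
  become estimates of multilinear maps. Smoothness on an open set of the whole space then restricts
  to any subset \<open>W\<close> and any set \<open>Y\<close> of directions.\<close>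

lemma Ck_on_if_UC:
  fixes f :: "'e::real_normed_vector \<Rightarrow> 'b::real_normed_vector"
  assumes "NC k U {f}" and U: "open U" and W: "W \<subseteq> U"
  shows "Ck_on k Y W f"
proof -
  obtain GG D where G0: "GG 0 = {f}" and Gc: "\<And>j. j \<le> k \<Longrightarrow> equicont UNIV norm U (GG j) (\<lambda>f. f)"
    and Gd: "\<And>j. j < k \<Longrightarrow> equidiff UNIV norm (*\<^sub>R) U (GG j) (\<lambda>f. f) (D j)"
    and GS: "\<And>j. j < k \<Longrightarrow> GG (Suc j) = dfam (GG j) (D j)"
    using UC_chain[OF assms(1)] by metis
  have Dder: "(q has_derivative D j q x) (at x)" if "j < k" "q \<in> GG j" "x \<in> U" for j q x
  proof -
    have "equicont UNIV norm U (dfam (GG j) (D j)) (\<lambda>f. f)"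
      unfolding GS[OF that(1), symmetric] by (rule Gc) (use that(1) in simp)
    from equidiff_has_derivative[OF Gd[OF that(1)] this that(2,3)]
    show ?thesis unfolding at_within_open[OF that(3) U] .
  qed
  let ?P = "\<lambda>vs. prod_list (map norm vs)"
  have lift: "(iter_deriv f vs has_derivative (\<lambda>w. ?P vs *\<^sub>R D j q x w)) (at x)"
    if "j < k" "q \<in> GG j" "x \<in> U" "\<forall>x\<in>U. iter_deriv f vs x = ?P vs *\<^sub>R q x" for j q vs x
  proof (rule has_derivative_transform_within_open[OF _ U that(3)])
    show "((\<lambda>x. ?P vs *\<^sub>R q x) has_derivative (\<lambda>w. ?P vs *\<^sub>R D j q x w)) (at x)"
      by (intro has_derivative_scaleR_right Dder that)
  qed (use that(4) in simp)
  have rep: "\<exists>q\<in>GG (length vs). \<forall>x\<in>U. iter_deriv f vs x = ?P vs *\<^sub>R q x" if "length vs \<le> k" for vs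
    using that
  proof (induction vs)
    case Nil
    then show ?case using G0 by simp
  next
    case (Cons v vs)
    then obtain q where q: "q \<in> GG (length vs)" "\<forall>x\<in>U. iter_deriv f vs x = ?P vs *\<^sub>R q x" by auto
    have l: "length vs < k" using Cons by simp
    have "iter_deriv f (v # vs) x = ?P (v # vs) *\<^sub>R D (length vs) q x (sgn v)" if x: "x \<in> U" for x
    proof -
      have "iter_deriv f (v # vs) x = ?P vs *\<^sub>R D (length vs) q x v"
        using frechet_derivative_at[OF lift[OF l q(1) x q(2)]] by (simp add: fun_eq_iff)
      also have "D (length vs) q x v = norm v *\<^sub>R D (length vs) q x (sgn v)"
      proof -
        have "v = norm v *\<^sub>R sgn v" by (cases "v = 0") (auto simp: sgn_div_norm)
        then show ?thesis using equidiffD(3)[OF Gd[OF l] q(1) x, of "norm v" "sgn v"] by simp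
      qed
      finally show ?thesis by (simp add: mult.commute)
    qed
    moreover have "(\<lambda>x. D (length vs) q x (sgn v)) \<in> GG (length (v # vs))"
      using GS[OF l] by (simp, intro dfamI q) (auto simp: norm_sgn)
    ultimately show ?case by (intro bexI[where x = "\<lambda>x. D (length vs) q x (sgn v)"] ballI)
  qed
  have hd: "(iter_deriv f vs has_derivative (\<lambda>w. iter_deriv f (w # vs) x)) (at x)"
    if "length vs < k" "x \<in> U" for vs x
  proof -
    have l: "length vs \<le> k" using that by simp
    obtain q where q: "q \<in> GG (length vs)" "\<forall>x\<in>U. iter_deriv f vs x = ?P vs *\<^sub>R q x"
      using rep[OF l] by blast
    show ?thesis
      using lift[OF that(1) q(1) that(2) q(2)] frechet_derivative_at[OF lift[OF that(1) q(1) that(2) q(2)]] by simp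
  qed
  \<comment> \<open>In the head position additivity is linearity of a derivative. In an inner
    position both sides are derivatives of functions that agree on \<open>U\<close> by
    induction.\<close>
  have add: "iter_deriv f (vs[i := u + v]) x = iter_deriv f (vs[i := u]) x + iter_deriv f (vs[i := v]) x"
    if "length vs \<le> k" "i < length vs" "x \<in> U" for vs i u v x
    using that
  proof (induction vs arbitrary: i x)
    case (Cons w vs)
    have l: "length vs < k" using Cons.prems by simp
    show ?case
    proof (cases i)
      case 0
      have "linear (\<lambda>w. iter_deriv f (w # vs) x)"
        using hd[OF l Cons.prems(3)] has_derivative_linear by blast
      then show ?thesis using 0 linear_add[of "\<lambda>w. iter_deriv f (w # vs) x" u v] by simp
    next
      case (Suc i')
      have i': "i' < length vs" using Suc Cons.prems by simp
      have "(iter_deriv f (vs[i' := u + v]) has_derivative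
          (\<lambda>w. iter_deriv f (w # vs[i' := u]) x + iter_deriv f (w # vs[i' := v]) x)) (at x)"
      proof (rule has_derivative_transform_within_open[OF _ U Cons.prems(3)])
        show "((\<lambda>x. iter_deriv f (vs[i' := u]) x + iter_deriv f (vs[i' := v]) x) has_derivative
          (\<lambda>w. iter_deriv f (w # vs[i' := u]) x + iter_deriv f (w # vs[i' := v]) x)) (at x)"
          by (intro has_derivative_add hd) (use l Cons.prems in auto)
      qed (use Cons.IH[OF _ i'] l in auto)
      from has_derivative_unique[OF this hd] l Cons.prems(3)
      have "(\<lambda>w. iter_deriv f (w # vs[i' := u]) x + iter_deriv f (w # vs[i' := v]) x)
          = (\<lambda>w. iter_deriv f (w # vs[i' := u + v]) x)" by simp
      from fun_cong[OF this, of w] show ?thesis using Suc by (simp del: iter_deriv.simps)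
    qed
  qed simp
  have scl: "iter_deriv f (vs[i := a *\<^sub>R u]) x = a *\<^sub>R iter_deriv f (vs[i := u]) x"
    if "length vs \<le> k" "i < length vs" "x \<in> U" for vs i u a x
    using that
  proof (induction vs arbitrary: i x)
    case (Cons w vs)
    have l: "length vs < k" using Cons.prems by simp
    show ?case
    proof (cases i)
      case 0
      have "linear (\<lambda>w. iter_deriv f (w # vs) x)"
        using hd[OF l Cons.prems(3)] has_derivative_linear by blast
      then show ?thesis using 0 linear_cmul[of "\<lambda>w. iter_deriv f (w # vs) x" a u] by simp
    next
      case (Suc i')
      have i': "i' < length vs" using Suc Cons.prems by simp
      have "(iter_deriv f (vs[i' := a *\<^sub>R u]) has_derivative
          (\<lambda>w. a *\<^sub>R iter_deriv f (w # vs[i' := u]) x)) (at x)"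
      proof (rule has_derivative_transform_within_open[OF _ U Cons.prems(3)])
        show "((\<lambda>x. a *\<^sub>R iter_deriv f (vs[i' := u]) x) has_derivative
          (\<lambda>w. a *\<^sub>R iter_deriv f (w # vs[i' := u]) x)) (at x)"
          by (intro has_derivative_scaleR_right hd) (use l Cons.prems in auto)
      qed (use Cons.IH[OF _ i'] l in auto)
      from has_derivative_unique[OF this hd] l Cons.prems(3)
      have "(\<lambda>w. a *\<^sub>R iter_deriv f (w # vs[i' := u]) x)
          = (\<lambda>w. iter_deriv f (w # vs[i' := a *\<^sub>R u]) x)" by simp
      from fun_cong[OF this, of w] show ?thesis using Suc by (simp del: iter_deriv.simps)
    qed
  qed simp
  have P0: "?P vs \<ge> 0" for vs :: "'e list" by (induction vs) auto
  show ?thesis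
    unfolding Ck_on_def
  proof (intro exI[of _ "\<lambda>j x vs. iter_deriv f vs x"] conjI ballI allI impI)
    show "iter_deriv f [] x = f x" for x by simp
  next
    fix j x assume j: "j \<le> k" and "x \<in> W"
    then have x: "x \<in> U" using W by blast
    obtain K where K: "\<forall>q\<in>GG j. norm (q x) \<le> K" using equicontD(2)[OF Gc[OF j] x] by blast
    have "norm (iter_deriv f vs x) \<le> K * ?P vs" if "length vs = j" for vs
    proof -
      have l: "length vs \<le> k" using that j by simp
      obtain q where q: "q \<in> GG (length vs)" "\<forall>x\<in>U. iter_deriv f vs x = ?P vs *\<^sub>R q x"
        using rep[OF l] by blast
      then have "q \<in> GG j" "iter_deriv f vs x = ?P vs *\<^sub>R q x" using that x by auto
      then show ?thesis using mult_left_mono[of "norm (q x)" K, OF _ P0[of vs]] K P0[of vs]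
        by (simp add: mult.commute)
    qed
    then show "bounded_multilinear_on Y j (\<lambda>vs. iter_deriv f vs x)"
      unfolding bounded_multilinear_on_def using add scl j x by auto
  next
    fix j x e assume j: "j \<le> k" and "x \<in> W" and e: "(e::real) > 0"
    then have x: "x \<in> U" using W by blast
    obtain d where d: "d > 0" "\<forall>y\<in>U. dist y x < d \<longrightarrow> (\<forall>q\<in>GG j. norm (q y - q x) \<le> e)"
      using equicontD(3)[OF Gc[OF j] x e] unfolding eventually_nw by blast
    have "norm (iter_deriv f vs y - iter_deriv f vs x) \<le> e * ?P vs"
      if y: "y \<in> W" "norm (y - x) < d" and l: "length vs = j" for y vs
    proof -
      have yU: "y \<in> U" using y W by blast
      obtain q where q: "q \<in> GG j" "\<forall>x\<in>U. iter_deriv f vs x = ?P vs *\<^sub>R q x"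
        using rep[of vs] l j by auto
      have "norm (q y - q x) \<le> e" using d(2) y yU q(1) by (simp add: dist_norm)
      moreover have "iter_deriv f vs y - iter_deriv f vs x = ?P vs *\<^sub>R (q y - q x)"
        using q(2) x yU by (simp add: scaleR_diff_right)
      ultimately show ?thesis using mult_left_mono[of "norm (q y - q x)" e, OF _ P0[of vs]] P0[of vs]
        by (simp add: mult.commute)
    qed
    then show "\<exists>d>0. \<forall>y\<in>W. norm (y - x) < d \<longrightarrow> (\<forall>vs\<in>lists Y. length vs = j \<longrightarrow>
        norm (iter_deriv f vs y - iter_deriv f vs x) \<le> e * ?P vs)"
      using d(1) by blast
  next
    fix j x e assume j: "j < k" and "x \<in> W" and e: "(e::real) > 0"
    then have x: "x \<in> U" using W by blast
    obtain d where d: "d > 0" "\<forall>y\<in>U. dist y x < d \<longrightarrow> (\<forall>q\<in>GG j. norm (q y - q x - D j q x (y - x)) \<le> e * norm (y - x))"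
      using equidiffD(4)[OF Gd[OF j] x e] unfolding eventually_nw by blast
    have "norm (iter_deriv f vs y - iter_deriv f vs x - iter_deriv f ((y - x) # vs) x) \<le> e * norm (y - x) * ?P vs"
      if y: "y \<in> W" "norm (y - x) < d" and l: "length vs = j" for y vs
    proof -
      have yU: "y \<in> U" using y W by blast
      obtain q where q: "q \<in> GG j" "\<forall>x\<in>U. iter_deriv f vs x = ?P vs *\<^sub>R q x"
        using rep[of vs] l j by auto
      have "norm (q y - q x - D j q x (y - x)) \<le> e * norm (y - x)" using d(2) y yU q(1) by (simp add: dist_norm)
      moreover have "iter_deriv f ((y - x) # vs) x = ?P vs *\<^sub>R D j q x (y - x)"
        using frechet_derivative_at[OF lift[OF j q(1) x q(2)]] by (simp add: fun_eq_iff)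
      then have "iter_deriv f vs y - iter_deriv f vs x - iter_deriv f ((y - x) # vs) x = ?P vs *\<^sub>R (q y - q x - D j q x (y - x))"
        using q(2) x yU by (simp add: scaleR_diff_right)
      ultimately show ?thesis
        using mult_left_mono[of "norm (q y - q x - D j q x (y - x))" "e * norm (y - x)", OF _ P0[of vs]] P0[of vs]
        by (simp add: mult.commute mult.left_commute del: iter_deriv.simps)
    qed
    then show "\<exists>d>0. \<forall>y\<in>W. norm (y - x) < d \<longrightarrow> (\<forall>vs\<in>lists Y. length vs = j \<longrightarrow>
        norm (iter_deriv f vs y - iter_deriv f vs x - iter_deriv f ((y - x) # vs) x) \<le> e * norm (y - x) * ?P vs)"
      using d(1) by blast
  qed
qed

lemma equidiff_has_derivative_open:
  assumes "NC k U (dfam {f} D)" "equidiff UNIV norm (*\<^sub>R) U {f} (\<lambda>f. f) D" "open U" "x \<in> U"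
  shows "(f has_derivative D f x) (at x)"
  using equidiff_has_derivative[OF assms(2) UC_equicont[OF assms(1)] _ assms(4), of f]
  unfolding at_within_open[OF assms(4,3)] by blast

text \<open>Along \<open>e\<close> the function is strictly increasing near \<open>p0\<close>, so
  the intermediate value theorem gives the zero and monotonicity its uniqueness. Implicit
  differentiation expresses the derivative of \<sigma> by \<sigma> and the derivative of
  \<open>f\<close>, which raises the smoothness of \<sigma> one order at a time.\<close>

lemma implicit_scalar_pos:
  fixes f :: "'e::real_normed_vector \<Rightarrow> real"
  assumes f: "NC k U {f}" and k: "k \<ge> 1" and U: "open U" and p0: "p0 \<in> U" and f0: "f p0 = 0"
    and der0: "(f has_derivative f0') (at p0)" and pos: "f0' e > 0"
  shows "\<exists>W \<epsilon> \<sigma>. open W \<and> p0 \<in> W \<and> \<epsilon> > 0 \<and> NC k W {\<sigma>} \<and>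
    (\<forall>p\<in>W. \<bar>\<sigma> p\<bar> < \<epsilon> \<and> (\<forall>t. \<bar>t\<bar> < \<epsilon> \<longrightarrow> p + t *\<^sub>R e \<in> U \<and> (f (p + t *\<^sub>R e) = 0 \<longleftrightarrow> t = \<sigma> p)))"
proof -
  obtain k' where k': "k = Suc k'" using k by (cases k) auto
  obtain D where D: "equicont UNIV norm U {f} (\<lambda>f. f)" "equidiff UNIV norm (*\<^sub>R) U {f} (\<lambda>f. f) D"
    "NC k' U (dfam {f} D)"
    using f unfolding k' by (rule UC_SucE)
  define f' where "f' = D f"
  have der: "(f has_derivative f' x) (at x)" if "x \<in> U" for x
    using equidiff_has_derivative_open[OF D(3,2) U that] by (simp add: f'_def)
  have f'p0: "f' p0 = f0'" using der[OF p0] der0 has_derivative_unique by blast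
  have lin: "linear (f' x)" if "x \<in> U" for x using der[OF that] has_derivative_linear by blast
  have e_sgn: "f' x e = norm e * f' x (sgn e)" if "x \<in> U" for x
  proof -
    have "e = norm e *\<^sub>R sgn e" by (cases "e = 0") (auto simp: sgn_div_norm)
    then show ?thesis using linear_cmul[OF lin[OF that], of "norm e" "sgn e"] by simp
  qed
  have sgn_in: "(\<lambda>x. f' x (sgn e)) \<in> dfam {f} D"
    unfolding f'_def by (intro dfamI) (auto simp: norm_sgn)
  \<comment> \<open>Half of the derivative at \<open>p0\<close>; by continuity the derivative along
    \<open>e\<close> stays above it near \<open>p0\<close>.\<close>
  define c where "c = f0' e / 2"
  have c: "c > 0" using pos by (simp add: c_def)
  have "continuous_on U (\<lambda>x. norm e * f' x (sgn e))"
    by (intro continuous_intros UC_continuous_on[OF D(3) sgn_in])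
  then have "isCont (\<lambda>x. norm e * f' x (sgn e)) p0" using U p0 by (simp add: continuous_on_eq_continuous_at)
  then have "((\<lambda>x. norm e * f' x (sgn e)) \<longlongrightarrow> f0' e) (at p0)"
    using e_sgn[OF p0] f'p0 by (simp add: isCont_def)
  then have "\<forall>\<^sub>F x in at p0. norm e * f' x (sgn e) > c" using pos by (intro order_tendstoD(1)) (auto simp: c_def)
  then have "\<forall>\<^sub>F x in nhds p0. norm e * f' x (sgn e) > c"
    using e_sgn[OF p0] f'p0 pos by (simp add: eventually_nhds_conv_at c_def)
  then have "\<forall>\<^sub>F x in nhds p0. norm e * f' x (sgn e) > c \<and> x \<in> U"
    using eventually_nhds_in_open[OF U p0] by (rule eventually_conj)
  then obtain R where R: "R > 0" "\<And>x. dist x p0 < R \<Longrightarrow> norm e * f' x (sgn e) > c \<and> x \<in> U"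
    unfolding eventually_nhds_metric by blast
  have RU: "x \<in> U" and Rc: "f' x e > c" if "dist x p0 < R" for x
    using R(2)[OF that] e_sgn by auto
  \<comment> \<open>For \<open>\<bar>t\<bar> \<le> \<eta>\<close> the shift
    \<open>t *\<^sub>R e\<close> has norm at most \<open>R / 2\<close>, so a point within
    \<open>R / 2\<close> of \<open>p0\<close> stays in the ball where the derivative along
    \<open>e\<close> exceeds \<open>c\<close>.\<close>
  define \<eta> where "\<eta> = R / (2 * (norm e + 1))"
  have \<eta>: "\<eta> > 0" using R(1) by (auto simp: \<eta>_def intro!: divide_pos_pos add_nonneg_pos)
  have \<eta>e: "norm (t *\<^sub>R e) \<le> R / 2" if "\<bar>t\<bar> \<le> \<eta>" for t
  proof -
    have "norm (t *\<^sub>R e) \<le> \<eta> * (norm e + 1)" using that by (auto intro!: mult_mono)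
    also have "\<dots> = R / 2"
    proof -
      have "a \<noteq> 0 \<Longrightarrow> R / (2 * a) * a = R / 2" for a by simp
      moreover have "norm e + 1 \<noteq> 0" using norm_ge_zero[of e] by linarith
      ultimately show ?thesis unfolding \<eta>_def by blast
    qed
    finally show ?thesis .
  qed
  have near: "dist (p + t *\<^sub>R e) p0 < R" if "dist p p0 < R / 2" "\<bar>t\<bar> \<le> \<eta>" for p t
  proof -
    have "dist (p + t *\<^sub>R e) p0 \<le> norm (p - p0) + norm (t *\<^sub>R e)"
      unfolding dist_norm using norm_triangle_ineq[of "p - p0" "t *\<^sub>R e"] by (simp add: algebra_simps)
    then show ?thesis using that \<eta>e[OF that(2)] by (simp add: dist_norm)
  qed
  have line: "((\<lambda>t. f (p + t *\<^sub>R e)) has_field_derivative f' (p + t *\<^sub>R e) e) (at t)"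
    if "dist p p0 < R / 2" "\<bar>t\<bar> \<le> \<eta>" for p t
  proof -
    have 1: "((\<lambda>t. p + t *\<^sub>R e) has_derivative (\<lambda>h. h *\<^sub>R e)) (at t)"
      by (auto intro!: derivative_eq_intros)
    have U': "p + t *\<^sub>R e \<in> U" using RU near that by blast
    have "((\<lambda>t. f (p + t *\<^sub>R e)) has_derivative (\<lambda>h. f' (p + t *\<^sub>R e) (h *\<^sub>R e))) (at t)"
      using has_derivative_compose[OF 1 der[OF U']] .
    then show ?thesis
      using linear_cmul[OF lin[OF U']] by (simp add: has_field_derivative_def mult_commute_abs)
  qed
  have mono: "f (p + t *\<^sub>R e) - f (p + s *\<^sub>R e) \<ge> c * (t - s)"
    if p: "dist p p0 < R / 2" and st: "-\<eta> \<le> s" "s \<le> t" "t \<le> \<eta>" for p s t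
  proof (cases "s = t")
    case False
    then have "s < t" using st by simp
    then obtain z where z: "s < z" "z < t" "f (p + t *\<^sub>R e) - f (p + s *\<^sub>R e) = (t - s) * f' (p + z *\<^sub>R e) e"
      using MVT2[of s t "\<lambda>t. f (p + t *\<^sub>R e)" "\<lambda>t. f' (p + t *\<^sub>R e) e"] line[OF p] st by (smt (verit) abs_le_iff)
    have "f' (p + z *\<^sub>R e) e > c" using Rc near p z st by (smt (verit) abs_le_iff)
    then show ?thesis using z(3) \<open>s < t\<close> by (simp add: mult.commute)
  qed simp
  have abs_mono: "c * \<bar>t - s\<bar> \<le> \<bar>f (p + t *\<^sub>R e) - f (p + s *\<^sub>R e)\<bar>"
    if p: "dist p p0 < R / 2" and st: "\<bar>s\<bar> \<le> \<eta>" "\<bar>t\<bar> \<le> \<eta>" for p s t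
  proof (cases "s \<le> t")
    case True
    then show ?thesis using mono[OF p, of s t] st by (simp add: abs_le_iff)
  next
    case False
    then show ?thesis using mono[OF p, of t s] st by (simp add: abs_le_iff abs_minus_commute)
  qed
  have isCont_f: "isCont f x" if "x \<in> U" for x using der[OF that] has_derivative_continuous by blast
  have ends: "\<forall>\<^sub>F p in nhds p0. f (p + \<eta> *\<^sub>R e) > 0 \<and> f (p + (-\<eta>) *\<^sub>R e) < 0"
  proof (rule eventually_conj)
    have d0: "dist p0 p0 < R / 2" using R(1) by simp
    have tend: "((\<lambda>p. f (p + t *\<^sub>R e)) \<longlongrightarrow> f (p0 + t *\<^sub>R e)) (nhds p0)" if "\<bar>t\<bar> \<le> \<eta>" for t
    proof -
      have "isCont (\<lambda>p. f (p + t *\<^sub>R e)) p0"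
        by (rule isCont_o2[of _ _ f]) (auto intro!: continuous_intros isCont_f RU near[OF d0 that])
      then show ?thesis using tendsto_at_iff_tendsto_nhds[of "\<lambda>p. f (p + t *\<^sub>R e)" p0] by (simp add: isCont_def)
    qed
    have "f (p0 + \<eta> *\<^sub>R e) \<ge> c * \<eta>" using mono[OF d0, of 0 \<eta>] \<eta> f0 by simp
    then show "\<forall>\<^sub>F p in nhds p0. f (p + \<eta> *\<^sub>R e) > 0"
      using c \<eta> by (intro order_tendstoD(1)[OF tend]) (auto intro: less_le_trans[OF mult_pos_pos])
    have "- f (p0 + (-\<eta>) *\<^sub>R e) \<ge> c * \<eta>" using mono[OF d0, of "-\<eta>" 0] \<eta> f0 by simp
    then have "f (p0 + (-\<eta>) *\<^sub>R e) < 0" using mult_pos_pos[OF c \<eta>] by linarith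
    then show "\<forall>\<^sub>F p in nhds p0. f (p + (-\<eta>) *\<^sub>R e) < 0"
      using \<eta> by (intro order_tendstoD(2)[OF tend]) auto
  qed
  then obtain r0 where r0: "r0 > 0" "\<And>p. dist p p0 < r0 \<Longrightarrow> f (p + \<eta> *\<^sub>R e) > 0 \<and> f (p + (-\<eta>) *\<^sub>R e) < 0"
    unfolding eventually_nhds_metric by blast
  define W where "W = ball p0 (min r0 (R / 2))"
  have Wd: "dist p p0 < R / 2" "f (p + \<eta> *\<^sub>R e) > 0" "f (p + (-\<eta>) *\<^sub>R e) < 0" if "p \<in> W" for p
    using that r0(2)[of p] by (auto simp: W_def dist_commute)
  have "\<exists>t. \<bar>t\<bar> < \<eta> \<and> f (p + t *\<^sub>R e) = 0" if p: "p \<in> W" for p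
  proof -
    have "\<exists>t\<ge>-\<eta>. t \<le> \<eta> \<and> f (p + t *\<^sub>R e) = 0"
    proof (rule IVT)
      show "\<forall>t. - \<eta> \<le> t \<and> t \<le> \<eta> \<longrightarrow> isCont (\<lambda>t. f (p + t *\<^sub>R e)) t"
        by (intro allI impI DERIV_isCont[OF line[OF Wd(1)[OF p]]]) (auto intro!: abs_leI)
    qed (use Wd[OF p] \<eta> in auto)
    then obtain t where t: "-\<eta> \<le> t" "t \<le> \<eta>" "f (p + t *\<^sub>R e) = 0" by blast
    moreover have "t \<noteq> \<eta>" "t \<noteq> -\<eta>" using Wd[OF p] t(3) by auto
    ultimately show ?thesis by (intro exI[of _ t]) auto
  qed
  then obtain \<sigma> where \<sigma>: "\<And>p. p \<in> W \<Longrightarrow> \<bar>\<sigma> p\<bar> < \<eta>" "\<And>p. p \<in> W \<Longrightarrow> f (p + \<sigma> p *\<^sub>R e) = 0" by metis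
  have uniq: "t = \<sigma> p" if "p \<in> W" "\<bar>t\<bar> < \<eta>" "f (p + t *\<^sub>R e) = 0" for p t
    using abs_mono[OF Wd(1)[OF that(1)], of "\<sigma> p" t] \<sigma>[OF that(1)] that c by (simp add: mult_le_0_iff)
  \<comment> \<open>The sum over the one-element set \<open>{()}\<close> gives the map the shape
    that \<open>UC_shift\<close> expects.\<close>
  let ?\<psi> = "\<lambda>p. p + (\<Sum>i\<in>{()}. \<sigma> p *\<^sub>R e)"
  have \<psi>R: "dist (p + \<sigma> p *\<^sub>R e) p0 < R" if "p \<in> W" for p
    using near[OF Wd(1)[OF that]] \<sigma>(1)[OF that] by simp
  have \<psi>U: "p + \<sigma> p *\<^sub>R e \<in> U" if "p \<in> W" for p using RU \<psi>R that by blast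
  \<comment> \<open>The solution of the differentiated equation. The minus sign sits on the argument
    \<open>v\<close>, so that the first factor is again a derivative of \<open>f\<close> along a
    direction in the unit ball.\<close>
  define \<sigma>' where "\<sigma>' = (\<lambda>p v. f' (p + \<sigma> p *\<^sub>R e) (- v) * (1 / f' (p + \<sigma> p *\<^sub>R e) e))"
  have lipf: "\<exists>L>0. \<forall>\<^sub>F q in nw p W. \<bar>\<sigma> q - \<sigma> p\<bar> \<le> L * norm (q - p)" if p: "p \<in> W" for p
  proof -
    let ?x = "p + \<sigma> p *\<^sub>R e"
    obtain L where L: "L > 0" "\<forall>\<^sub>F y in nw ?x U. \<forall>i\<in>{f}. norm (i y - i ?x) \<le> L * norm (y - ?x)"
      using NV.lipschitz_at[OF D(1,2) UC_equicont[OF D(3)] \<psi>U[OF p]] by blast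
    then obtain d where d: "d > 0" "\<And>y. y \<in> U \<Longrightarrow> dist y ?x < d \<Longrightarrow> norm (f y - f ?x) \<le> L * norm (y - ?x)"
      unfolding eventually_nw by auto
    have "\<forall>\<^sub>F q in nw p W. \<bar>\<sigma> q - \<sigma> p\<bar> \<le> L / c * norm (q - p)"
      using eventually_nw_small[OF d(1), of p W] eventually_nw_in
    proof eventually_elim
      case (elim q)
      have "q + \<sigma> p *\<^sub>R e \<in> U" using near[OF Wd(1)[OF elim(2)]] \<sigma>(1)[OF p] RU by simp
      then have "norm (f (q + \<sigma> p *\<^sub>R e) - f ?x) \<le> L * norm (q + \<sigma> p *\<^sub>R e - ?x)"
        using elim by (intro d(2)) (auto simp: dist_norm)
      then have 1: "\<bar>f (q + \<sigma> p *\<^sub>R e)\<bar> \<le> L * norm (q - p)" using \<sigma>(2)[OF p] by simp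
      have "c * \<bar>\<sigma> q - \<sigma> p\<bar> \<le> \<bar>f (q + \<sigma> q *\<^sub>R e) - f (q + \<sigma> p *\<^sub>R e)\<bar>"
        using abs_mono[OF Wd(1)[OF elim(2)], of "\<sigma> p" "\<sigma> q"] \<sigma>(1)[OF p] \<sigma>(1)[OF elim(2)] by simp
      then have "c * \<bar>\<sigma> q - \<sigma> p\<bar> \<le> L * norm (q - p)" using 1 \<sigma>(2)[OF elim(2)] by simp
      then show ?case using c by (simp add: field_simps)
    qed
    then show ?thesis using L(1) c by (intro exI[of _ "L / c"]) auto
  qed
  have eqd: "equidiff UNIV norm (*\<^sub>R) W {\<sigma>} (\<lambda>f. f) (\<lambda>_. \<sigma>')"
    unfolding equidiff_def
  proof (intro conjI ballI allI impI)
    fix p \<epsilon> assume p: "p \<in> W" and \<epsilon>: "(\<epsilon>::real) > 0"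
    let ?x = "p + \<sigma> p *\<^sub>R e"
    have xU: "?x \<in> U" by (rule \<psi>U[OF p])
    obtain L where L: "L > 0" "\<forall>\<^sub>F q in nw p W. \<bar>\<sigma> q - \<sigma> p\<bar> \<le> L * norm (q - p)" using lipf[OF p] by blast
    define e1 where "e1 = \<epsilon> * c / (1 + L * norm e)"
    have Le: "1 + L * norm e > 0" using L(1) by (intro add_pos_nonneg) auto
    have e1: "e1 > 0" "e1 * (1 + L * norm e) = \<epsilon> * c" using \<epsilon> c Le by (auto simp: e1_def)
    obtain d where d: "d > 0" "\<And>y. y \<in> U \<Longrightarrow> dist y ?x < d \<Longrightarrow> norm (f y - f ?x - f' ?x (y - ?x)) \<le> e1 * norm (y - ?x)"
      using equidiffD(4)[OF D(2) xU e1(1)] unfolding eventually_nw f'_def by auto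
    have "d / (1 + L * norm e) > 0" using d(1) Le by simp
    from L(2) eventually_nw_small[OF this, of p W] eventually_nw_in
    have "\<forall>\<^sub>F q in nw p W. norm (\<sigma> q - \<sigma> p - \<sigma>' p (q - p)) \<le> \<epsilon> * norm (q - p)"
    proof eventually_elim
      case (elim q)
      let ?y = "q + \<sigma> q *\<^sub>R e"
      have yx: "?y - ?x = (q - p) + (\<sigma> q - \<sigma> p) *\<^sub>R e" by (simp add: algebra_simps)
      have "norm (?y - ?x) \<le> norm (q - p) + \<bar>\<sigma> q - \<sigma> p\<bar> * norm e"
        unfolding yx using norm_triangle_ineq[of "q - p" "(\<sigma> q - \<sigma> p) *\<^sub>R e"] by simp
      also have "\<dots> \<le> norm (q - p) + L * norm (q - p) * norm e" using elim(1) by (intro add_left_mono mult_right_mono) auto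
      finally have n: "norm (?y - ?x) \<le> (1 + L * norm e) * norm (q - p)" by (simp add: algebra_simps)
      also have "\<dots> < (1 + L * norm e) * (d / (1 + L * norm e))" using elim(2) Le by (intro mult_strict_left_mono) auto
      finally have "dist ?y ?x < d" using Le by (simp add: dist_norm)
      then have "norm (f ?y - f ?x - f' ?x (?y - ?x)) \<le> e1 * norm (?y - ?x)" using d(2) \<psi>U[OF elim(3)] by blast
      then have "\<bar>f' ?x (?y - ?x)\<bar> \<le> e1 * norm (?y - ?x)" using \<sigma>(2)[OF p] \<sigma>(2)[OF elim(3)] by simp
      also have "\<dots> \<le> e1 * ((1 + L * norm e) * norm (q - p))" using n e1 by (intro mult_left_mono) auto
      also have "\<dots> = \<epsilon> * c * norm (q - p)" using e1(2) by (simp add: mult.assoc[symmetric])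
      also have "f' ?x (?y - ?x) = f' ?x (q - p) + (\<sigma> q - \<sigma> p) * f' ?x e"
        unfolding yx using linear_add[OF lin[OF xU]] linear_cmul[OF lin[OF xU]] by simp
      finally have 1: "\<bar>f' ?x (q - p) + (\<sigma> q - \<sigma> p) * f' ?x e\<bar> \<le> \<epsilon> * c * norm (q - p)" .
      have b: "f' ?x e > c" using Rc \<psi>R[OF p] by blast
      have "\<sigma> q - \<sigma> p - \<sigma>' p (q - p) = (f' ?x (q - p) + (\<sigma> q - \<sigma> p) * f' ?x e) / f' ?x e"
        unfolding \<sigma>'_def linear_neg[OF lin[OF xU]] using b c by (simp add: field_simps)
      then have "norm (\<sigma> q - \<sigma> p - \<sigma>' p (q - p)) = \<bar>f' ?x (q - p) + (\<sigma> q - \<sigma> p) * f' ?x e\<bar> / f' ?x e"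
        using b c by (simp add: abs_divide)
      also have "\<dots> \<le> (\<epsilon> * c * norm (q - p)) / c" using 1 b c \<epsilon> by (intro frac_le) auto
      finally show ?case using c by simp
    qed
    then show "\<forall>\<^sub>F y in nw p W. \<forall>i\<in>{\<sigma>}. norm (i y - i p - \<sigma>' p (y - p)) \<le> \<epsilon> * norm (y - p)" by simp
  next
    fix p u v assume "p \<in> W"
    then have l: "linear (f' (p + \<sigma> p *\<^sub>R e))" using lin \<psi>U by blast
    show "\<sigma>' p (u + v) = \<sigma>' p u + \<sigma>' p v"
      unfolding \<sigma>'_def by (simp add: linear_neg[OF l] linear_diff[OF l] linear_add[OF l] add_divide_distrib diff_divide_distrib)
    show "\<sigma>' p (r *\<^sub>R v) = r *\<^sub>R \<sigma>' p v" for r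
      unfolding \<sigma>'_def by (simp add: linear_neg[OF l] linear_cmul[OF l])
  qed simp
  have base: "equicont UNIV norm W {\<sigma>} (\<lambda>f. f)"
    unfolding equicont_def
  proof (intro conjI ballI allI impI)
    fix p \<epsilon> assume p: "p \<in> W" and \<epsilon>: "(\<epsilon>::real) > 0"
    obtain L where L: "L > 0" "\<forall>\<^sub>F q in nw p W. \<bar>\<sigma> q - \<sigma> p\<bar> \<le> L * norm (q - p)" using lipf[OF p] by blast
    have "\<epsilon> / L > 0" using \<epsilon> L by simp
    from L(2) eventually_nw_small[OF this, of p W]
    show "\<forall>\<^sub>F y in nw p W. \<forall>i\<in>{\<sigma>}. norm (i y - i p) \<le> \<epsilon>"
    proof eventually_elim
      case (elim q)
      have "\<bar>\<sigma> q - \<sigma> p\<bar> \<le> L * norm (q - p)" by (rule elim)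
      also have "\<dots> \<le> L * (\<epsilon> / L)" using elim L by (intro mult_left_mono) auto
      finally show ?case using L by simp
    qed
  qed auto
  have "NC j W {\<sigma>}" if "j \<le> k" for j
    using that
  proof (induction j)
    case 0
    then show ?case unfolding UC.simps using base by blast
  next
    case (Suc j)
    have IH: "NC j W {\<sigma>}" by (rule Suc.IH) (use Suc.prems in simp)
    have Dj: "NC j U (dfam {f} D)" using UC_le[OF D(3)] Suc.prems k' by simp
    interpret M: nbilinear UNIV norm "(*\<^sub>R)" UNIV norm "(*\<^sub>R)" UNIV norm "(*\<^sub>R)" "(*) :: real \<Rightarrow> real \<Rightarrow> real" 1
      by (rule nbilinear_mult)
    let ?A = "(\<lambda>q x. q (?\<psi> x)) ` dfam {f} D"
    have A: "NC j W ?A"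
      by (rule UC_shift[OF _ _ _ Dj]) (use IH \<psi>U in auto)
    have A_in: "(\<lambda>x. f' (?\<psi> x) u) \<in> ?A" if "norm u \<le> 1" for u
      unfolding f'_def using dfamI[of f "{f}" u D] that by (auto intro: image_eqI)
    define T where "T = (\<lambda>p. 1 / f' (p + \<sigma> p *\<^sub>R e) e)"
    have "NC j W (fam2 (*) {\<lambda>_. norm e} ?A)"
    proof (intro M.UC_b A)
      have "NC j W ((\<lambda>a x. a) ` {norm e})" by (rule NV.UC_const[of _ "norm e"]) auto
      then show "NC j W {\<lambda>_. norm e}" by simp
    qed
    then have h: "NC j W {\<lambda>p. f' (p + \<sigma> p *\<^sub>R e) e}"
    proof (rule UC_refine[OF _ subset_refl])
      fix g assume "g \<in> {\<lambda>p. f' (p + \<sigma> p *\<^sub>R e) e}"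
      moreover have "(\<lambda>x. norm e * f' (?\<psi> x) (sgn e)) \<in> fam2 (*) {\<lambda>_. norm e} ?A"
        by (intro fam2I[where f = "\<lambda>_. norm e"] A_in) (auto simp: norm_sgn)
      ultimately show "\<exists>f\<in>fam2 (*) {\<lambda>_. norm e} ?A. \<forall>x\<in>W. g x = f x"
        using e_sgn \<psi>U by (intro bexI[where x = "\<lambda>x. norm e * f' (?\<psi> x) (sgn e)"]) auto
    qed
    \<comment> \<open>The reciprocal is treated as an inverse in the sense of
      \<open>UC_inverse\<close>, through the identity
      \<open>1/b - 1/a = - (1/b) * (b - a) * (1/a)\<close>.\<close>
    have T: "NC j W {T}"
    proof (rule UC_inverse[OF nbilinear_mult _ _ _ h, where B = "1 / c"])
      fix x y assume xy: "x \<in> W" "y \<in> W"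
      have b: "f' (x + \<sigma> x *\<^sub>R e) e > c" "f' (y + \<sigma> y *\<^sub>R e) e > c" using Rc \<psi>R xy by blast+
      show "norm (T x) \<le> 1 / c" using b c by (simp add: T_def field_simps)
      show "T y - T x = - (T y * (f' (y + \<sigma> y *\<^sub>R e) e - f' (x + \<sigma> x *\<^sub>R e) e) * T x)"
        using b c by (simp add: T_def field_simps)
    qed simp_all
    have "NC (Suc j) W ((\<lambda>f. f) ` {\<sigma>})"
    proof (rule UC_SucI[OF base eqd])
      show "NC j W (dfam {\<sigma>} (\<lambda>_. \<sigma>'))"
      proof (rule UC_refine[OF M.UC_b[OF A T] subset_refl])
        fix g assume "g \<in> dfam {\<sigma>} (\<lambda>_. \<sigma>')"
        then obtain v where v: "norm v \<le> 1" "g = (\<lambda>x. \<sigma>' x v)" by (auto elim: dfamE)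
        have "(\<lambda>x. f' (?\<psi> x) (- v) * T x) \<in> fam2 (*) ?A {T}"
          using v(1) by (intro fam2I A_in) auto
        then show "\<exists>f\<in>fam2 (*) ?A {T}. \<forall>x\<in>W. g x = f x"
          unfolding v(2) \<sigma>'_def T_def by (intro bexI[rotated]) auto
      qed
    qed
    then show ?case unfolding image_ident .
  qed
  then have NCk: "NC k W {\<sigma>}" by blast
  have W: "open W" "p0 \<in> W" using r0(1) R(1) by (auto simp: W_def)
  have in_U: "p + t *\<^sub>R e \<in> U" if "p \<in> W" "\<bar>t\<bar> < \<eta>" for p t
    using RU near[OF Wd(1)[OF that(1)]] that(2) by simp
  have "f (p + t *\<^sub>R e) = 0 \<longleftrightarrow> t = \<sigma> p" if "p \<in> W" "\<bar>t\<bar> < \<eta>" for p t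
    using uniq[OF that] \<sigma>(2)[OF that(1)] by blast
  then show ?thesis
    using W \<eta> NCk in_U \<sigma>(1) by (intro exI[of _ W] exI[of _ \<eta>] exI[of _ \<sigma>]) simp
qed

lemma implicit_scalar:
  fixes f :: "'e::real_normed_vector \<Rightarrow> real"
  assumes f: "NC k U {f}" and "k \<ge> 1" "open U" "p0 \<in> U" "f p0 = 0"
    and der0: "(f has_derivative f0') (at p0)" and nz: "f0' e \<noteq> 0"
  shows "\<exists>W \<epsilon> \<sigma>. open W \<and> p0 \<in> W \<and> \<epsilon> > 0 \<and> NC k W {\<sigma>} \<and>
    (\<forall>p\<in>W. \<bar>\<sigma> p\<bar> < \<epsilon> \<and> (\<forall>t. \<bar>t\<bar> < \<epsilon> \<longrightarrow> p + t *\<^sub>R e \<in> U \<and> (f (p + t *\<^sub>R e) = 0 \<longleftrightarrow> t = \<sigma> p)))"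
proof (cases "f0' e > 0")
  case True
  then show ?thesis using implicit_scalar_pos[OF assms(1-6)] by blast
next
  case False
  have "NC k U ((\<lambda>f x. - f x) ` {f})"
    by (rule UC_linear[OF nspace_norm nspace_norm _ _ _ _ f, where M = 1]) auto
  then have 1: "NC k U {\<lambda>x. - f x}" by simp
  have "- f p0 = 0" "- f0' e > 0" using assms(5) nz False by auto
  from implicit_scalar_pos[OF 1 assms(2-4) this(1) has_derivative_minus[OF der0] this(2)]
  show ?thesis by (simp only: neg_equal_0_iff_equal)
qed

text \<open>The unknowns are eliminated one after the other; the derivative at \<open>p0\<close> is triangular.\<close>

lemma implicit_system:
  fixes F :: "nat \<Rightarrow> 'e::real_normed_vector \<Rightarrow> real"
  assumes k: "k \<ge> 1" and \<Omega>: "open \<Omega>" "p0 \<in> \<Omega>"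
    and F: "\<And>i. i < n \<Longrightarrow> NC k \<Omega> {F i}" "\<And>i. i < n \<Longrightarrow> F i p0 = 0"
    and F': "\<And>i. i < n \<Longrightarrow> (F i has_derivative F' i) (at p0)"
    and diag: "\<And>i. i < n \<Longrightarrow> F' i (e i) \<noteq> 0" and tri: "\<And>i j. i < n \<Longrightarrow> j < i \<Longrightarrow> F' i (e j) = 0"
  shows "\<exists>U \<epsilon> \<tau>. open U \<and> p0 \<in> U \<and> \<epsilon> > 0 \<and> (\<forall>i<n. NC k U {\<tau> i}) \<and> (\<forall>p\<in>U. \<forall>i<n. \<bar>\<tau> i p\<bar> < \<epsilon>) \<and>
    (\<forall>p\<in>U. \<forall>t. (\<forall>i<n. \<bar>t i\<bar> < \<epsilon>) \<longrightarrow> p + (\<Sum>i<n. t i *\<^sub>R e i) \<in> \<Omega> \<and>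
      ((\<forall>i<n. F i (p + (\<Sum>i<n. t i *\<^sub>R e i)) = 0) \<longleftrightarrow> (\<forall>i<n. t i = \<tau> i p)))"
  using F F' diag tri
proof (induction n)
  case 0
  show ?case by (rule exI[of _ \<Omega>], rule exI[of _ 1]) (use \<Omega> in auto)
next
  case (Suc n)
  have "\<exists>U \<epsilon> \<tau>. open U \<and> p0 \<in> U \<and> \<epsilon> > 0 \<and> (\<forall>i<n. NC k U {\<tau> i}) \<and> (\<forall>p\<in>U. \<forall>i<n. \<bar>\<tau> i p\<bar> < \<epsilon>) \<and>
    (\<forall>p\<in>U. \<forall>t. (\<forall>i<n. \<bar>t i\<bar> < \<epsilon>) \<longrightarrow> p + (\<Sum>i<n. t i *\<^sub>R e i) \<in> \<Omega> \<and>
      ((\<forall>i<n. F i (p + (\<Sum>i<n. t i *\<^sub>R e i)) = 0) \<longleftrightarrow> (\<forall>i<n. t i = \<tau> i p)))"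
    by (rule Suc.IH) (use Suc.prems in simp_all)
  then obtain U \<epsilon> \<tau> where U: "open U" "p0 \<in> U" "\<epsilon> > 0" and \<tau>_all: "\<forall>i<n. NC k U {\<tau> i}"
    and \<tau>e_all: "\<forall>p\<in>U. \<forall>i<n. \<bar>\<tau> i p\<bar> < \<epsilon>"
    and both_all: "\<forall>p\<in>U. \<forall>t. (\<forall>i<n. \<bar>t i\<bar> < \<epsilon>) \<longrightarrow> p + (\<Sum>i<n. t i *\<^sub>R e i) \<in> \<Omega> \<and>
      ((\<forall>i<n. F i (p + (\<Sum>i<n. t i *\<^sub>R e i)) = 0) \<longleftrightarrow> (\<forall>i<n. t i = \<tau> i p))"
    by (elim exE conjE) (rule that)
  note \<tau> = \<tau>_all[rule_format] and \<tau>e = \<tau>e_all[rule_format]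
  have both: "p + (\<Sum>i<n. t i *\<^sub>R e i) \<in> \<Omega> \<and>
      ((\<forall>i<n. F i (p + (\<Sum>i<n. t i *\<^sub>R e i)) = 0) \<longleftrightarrow> (\<forall>i<n. t i = \<tau> i p))"
    if "p \<in> U" "\<forall>i<n. \<bar>t i\<bar> < \<epsilon>" for p t
    using both_all that by blast
  note in\<Omega> = both[THEN conjunct1] and sol = both[THEN conjunct2]
  have \<tau>0: "\<tau> i p0 = 0" if "i < n" for i
    using sol[OF U(2), of "\<lambda>_. 0"] U(3) Suc.prems(2) that by simp
  let ?\<psi> = "\<lambda>p. p + (\<Sum>i\<in>{..<n}. \<tau> i p *\<^sub>R e i)"
  have \<psi>\<Omega>: "?\<psi> p \<in> \<Omega>" if "p \<in> U" for p
    using in\<Omega>[OF that, of "\<lambda>i. \<tau> i p"] \<tau>e[OF that] by simp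
  have \<psi>0: "?\<psi> p0 = p0" using \<tau>0 by simp
  \<comment> \<open>The last equation, restricted to the solution set of the first \<open>n\<close>
    equations.\<close>
  define g where "g = (\<lambda>p. F n (?\<psi> p))"
  have "NC k U ((\<lambda>f x. f (?\<psi> x)) ` {F n})"
    by (rule UC_shift[OF _ \<tau> _ Suc.prems(1)]) (use \<psi>\<Omega> in auto)
  then have g: "NC k U {g}" by (simp add: g_def)
  obtain k' where k': "k = Suc k'" using k by (cases k) auto
  have "\<exists>T. (\<tau> i has_derivative T) (at p0)" if "i < n" for i
  proof -
    have \<tau>i: "NC (Suc k') U {\<tau> i}" using \<tau>[OF that] unfolding k' .
    obtain D where "equidiff UNIV norm (*\<^sub>R) U {\<tau> i} (\<lambda>f. f) D" "NC k' U (dfam {\<tau> i} D)"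
      using \<tau>i by (rule UC_SucE)
    then show ?thesis using equidiff_has_derivative_open[OF _ _ U(1,2)] by blast
  qed
  then obtain T where T: "\<And>i. i < n \<Longrightarrow> (\<tau> i has_derivative T i) (at p0)" by metis
  have d\<psi>: "(?\<psi> has_derivative (\<lambda>v. v + (\<Sum>i\<in>{..<n}. T i v *\<^sub>R e i))) (at p0)"
    by (intro derivative_intros T) auto
  have dFn: "(F n has_derivative F' n) (at (?\<psi> p0))" unfolding \<psi>0 using Suc.prems(3) by simp
  have lin: "linear (F' n)" using has_derivative_linear[OF dFn] .
  have dg: "(g has_derivative (\<lambda>v. F' n (v + (\<Sum>i\<in>{..<n}. T i v *\<^sub>R e i)))) (at p0)"
    unfolding g_def by (rule has_derivative_compose[OF d\<psi> dFn])
  \<comment> \<open>The corrections \<open>T i (e n)\<close> multiply \<open>F' n (e i)\<close> with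
    \<open>i < n\<close>, which vanish by triangularity; only the diagonal entry is left.\<close>
  have nz: "F' n (e n + (\<Sum>i\<in>{..<n}. T i (e n) *\<^sub>R e i)) \<noteq> 0"
    using Suc.prems(4)[of n] Suc.prems(5)[of n] by (simp add: linear_add[OF lin] linear_sum[OF lin] linear_cmul[OF lin])
  have g0: "g p0 = 0" unfolding g_def \<psi>0 using Suc.prems(2) by simp
  obtain W \<epsilon>' \<sigma> where W: "open W" "p0 \<in> W" "\<epsilon>' > 0" and \<sigma>: "NC k W {\<sigma>}"
    and \<sigma>e: "\<And>p. p \<in> W \<Longrightarrow> \<bar>\<sigma> p\<bar> < \<epsilon>'"
    and inU: "\<And>p t. p \<in> W \<Longrightarrow> \<bar>t\<bar> < \<epsilon>' \<Longrightarrow> p + t *\<^sub>R e n \<in> U"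
    and gsol: "\<And>p t. p \<in> W \<Longrightarrow> \<bar>t\<bar> < \<epsilon>' \<Longrightarrow> g (p + t *\<^sub>R e n) = 0 \<longleftrightarrow> t = \<sigma> p"
    using implicit_scalar[OF g k U(1,2) g0 dg nz] by metis
  have \<sigma>0: "\<sigma> p0 = 0" using gsol[OF W(2), of 0] W(3) g0 by simp
  let ?\<rho> = "\<lambda>p. p + (\<Sum>i\<in>{()}. \<sigma> p *\<^sub>R e n)"
  define \<tau>' where "\<tau>' = (\<lambda>i p. if i < n then \<tau> i (?\<rho> p) else \<sigma> p)"
  have \<tau>': "NC k W {\<tau>' i}" if "i < Suc n" for i
  proof (cases "i < n")
    case True
    have "NC k W ((\<lambda>f x. f (?\<rho> x)) ` {\<tau> i})"
      by (rule UC_shift[OF _ _ _ \<tau>[OF True]]) (use \<sigma> inU \<sigma>e in auto)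
    moreover have "\<tau>' i = (\<lambda>x. \<tau> i (?\<rho> x))" using True by (simp add: \<tau>'_def)
    ultimately show ?thesis by simp
  next
    case False
    then show ?thesis using \<sigma> by (simp add: \<tau>'_def)
  qed
  \<comment> \<open>One bound has to serve for all unknowns. Since all \<open>\<tau>' i\<close>
    vanish at \<open>p0\<close>, they stay below \<delta> on the smaller neighbourhood
    \<open>S\<close> found next.\<close>
  define \<delta> where "\<delta> = min \<epsilon> \<epsilon>'"
  have \<delta>: "\<delta> > 0" "\<delta> \<le> \<epsilon>" "\<delta> \<le> \<epsilon>'" using U(3) W(3) by (auto simp: \<delta>_def)
  have "\<forall>\<^sub>F p in nhds p0. \<forall>i\<in>{..<Suc n}. \<bar>\<tau>' i p\<bar> < \<delta>"
  proof (rule eventually_ball_finite)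
    show "\<forall>i\<in>{..<Suc n}. \<forall>\<^sub>F p in nhds p0. \<bar>\<tau>' i p\<bar> < \<delta>"
    proof
      fix i assume i: "i \<in> {..<Suc n}"
      have "isCont (\<tau>' i) p0" using UC_continuous_on[OF \<tau>'] i W(1,2) by (simp add: continuous_on_eq_continuous_at)
      moreover have "\<tau>' i p0 = 0" using \<tau>0 \<sigma>0 by (simp add: \<tau>'_def)
      ultimately have "(\<tau>' i \<longlongrightarrow> 0) (nhds p0)"
        using tendsto_at_iff_tendsto_nhds[of "\<tau>' i" p0] by (simp add: isCont_def)
      then have "\<forall>\<^sub>F p in nhds p0. dist (\<tau>' i p) 0 < \<delta>" using \<delta>(1) by (rule tendstoD)
      then show "\<forall>\<^sub>F p in nhds p0. \<bar>\<tau>' i p\<bar> < \<delta>" by simp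
    qed
  qed simp
  then obtain S where S: "open S" "p0 \<in> S" "\<And>p i. p \<in> S \<Longrightarrow> i < Suc n \<Longrightarrow> \<bar>\<tau>' i p\<bar> < \<delta>"
    unfolding eventually_nhds by auto
  have key: "p + (\<Sum>i<Suc n. t i *\<^sub>R e i) \<in> \<Omega> \<and>
      ((\<forall>i<Suc n. F i (p + (\<Sum>i<Suc n. t i *\<^sub>R e i)) = 0) \<longleftrightarrow> (\<forall>i<Suc n. t i = \<tau>' i p))"
    if p: "p \<in> W \<inter> S" and t: "\<forall>i<Suc n. \<bar>t i\<bar> < \<delta>" for p t
  proof -
    let ?p = "p + t n *\<^sub>R e n"
    have tn: "\<bar>t n\<bar> < \<epsilon>'" and ti: "\<forall>i<n. \<bar>t i\<bar> < \<epsilon>" using t \<delta>(2,3) by (meson lessI less_SucI order_less_le_trans)+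
    have pU: "?p \<in> U" using inU p tn by blast
    have split: "p + (\<Sum>i<Suc n. t i *\<^sub>R e i) = ?p + (\<Sum>i<n. t i *\<^sub>R e i)" by simp
    have "(\<forall>i<Suc n. F i (p + (\<Sum>i<Suc n. t i *\<^sub>R e i)) = 0) \<longleftrightarrow>
        (\<forall>i<n. t i = \<tau> i ?p) \<and> F n (?p + (\<Sum>i<n. t i *\<^sub>R e i)) = 0"
      unfolding split using sol[OF pU ti] by (auto simp: less_Suc_eq)
    also have "\<dots> \<longleftrightarrow> (\<forall>i<n. t i = \<tau> i ?p) \<and> g ?p = 0"
    proof -
      have "(\<Sum>i<n. t i *\<^sub>R e i) = (\<Sum>i<n. \<tau> i ?p *\<^sub>R e i)" if "\<forall>i<n. t i = \<tau> i ?p"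
        using that by (intro sum.cong) auto
      then show ?thesis unfolding g_def by auto
    qed
    also have "\<dots> \<longleftrightarrow> (\<forall>i<n. t i = \<tau> i ?p) \<and> t n = \<sigma> p" using gsol p tn by auto
    also have "\<dots> \<longleftrightarrow> (\<forall>i<Suc n. t i = \<tau>' i p)" by (auto simp: \<tau>'_def less_Suc_eq)
    moreover have "p + (\<Sum>i<Suc n. t i *\<^sub>R e i) \<in> \<Omega>" unfolding split by (rule in\<Omega>[OF pU ti])
    ultimately show ?thesis by blast
  qed
  show ?case
  proof (intro exI conjI)
    show "open (W \<inter> S)" "p0 \<in> W \<inter> S" "\<delta> > 0" using W S \<delta> by auto
    show "\<forall>i<Suc n. NC k (W \<inter> S) {\<tau>' i}"
      using UC_refine[OF \<tau>', of _ "W \<inter> S"] by blast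
    show "\<forall>p\<in>W \<inter> S. \<forall>i<Suc n. \<bar>\<tau>' i p\<bar> < \<delta>" using S(3) by blast
  qed (use key in blast)
qed

section \<open>Boundary values of the resolvent\<close>

locale gelfand = hilbert_scale S pair C
  for S :: "real \<Rightarrow> 'a::complex_vector hspace" and pair C +
  fixes s :: real
  assumes s_pos: "s > 0"
begin

sublocale H0: hilb "S 0" by unfold_locales (rule hilbert)
sublocale Hp: hilb "S s" by unfold_locales (rule hilbert)
sublocale Hm: hilb "S (- s)" by unfold_locales (rule hilbert)

abbreviation "V0 \<equiv> vecs (S 0)"
abbreviation "Vp \<equiv> vecs (S s)"
abbreviation "Vm \<equiv> vecs (S (- s))"
abbreviation "n0 \<equiv> hnorm (S 0)"
abbreviation "np \<equiv> hnorm (S s)"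
abbreviation "nm \<equiv> hnorm (S (- s))"
abbreviation "ip0 \<equiv> hip (S 0)"

lemma Vp_0 [intro, simp]: "f \<in> Vp \<Longrightarrow> f \<in> V0"
  and V0_m [intro, simp]: "f \<in> V0 \<Longrightarrow> f \<in> Vm"
  using embedded[of 0 s] embedded[of "- s" 0] s_pos by auto

lemma n0_le_np: "f \<in> Vp \<Longrightarrow> n0 f \<le> np f"
  using hnorm_0_le s_pos by blast

lemma nm_le_n0: "\<exists>K>0. \<forall>f\<in>V0. nm f \<le> K * n0 f"
proof -
  obtain K where "\<forall>f\<in>V0. nm f \<le> K * n0 f" using embedding_bounded[of "- s" 0] s_pos by auto
  then have "\<forall>f\<in>V0. nm f \<le> max K 1 * n0 f"
    using H0.nrm_nonneg by (meson max.cobounded1 mult_right_mono order_trans)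
  then show ?thesis by (intro exI[of _ "max K 1"]) auto
qed

lemma pair_bound: "\<exists>K>0. (\<forall>f\<in>Vp. \<forall>g\<in>Vm. cmod (pair f g) \<le> K * np f * nm g) \<and>
    (\<forall>f\<in>Vm. \<forall>g\<in>Vp. cmod (pair f g) \<le> K * nm f * np g)"
proof -
  obtain K1 where K1: "\<forall>f\<in>Vp. \<forall>g\<in>Vm. cmod (pair f g) \<le> K1 * np f * nm g"
    using pair_bounded[of s] by blast
  obtain K2 where K2: "\<forall>f\<in>Vm. \<forall>g\<in>Vp. cmod (pair f g) \<le> K2 * nm f * np g"
    using pair_bounded[of "- s"] by auto
  define K where "K = max 1 (max K1 K2)"
  have "cmod (pair f g) \<le> K * np f * nm g" if "f \<in> Vp" "g \<in> Vm" for f g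
  proof -
    have "cmod (pair f g) \<le> K1 * (np f * nm g)" using K1 that by (simp add: mult.assoc)
    also have "\<dots> \<le> K * (np f * nm g)" using that by (intro mult_right_mono) (auto simp: K_def)
    finally show ?thesis by (simp add: mult.assoc)
  qed
  moreover have "cmod (pair f g) \<le> K * nm f * np g" if "f \<in> Vm" "g \<in> Vp" for f g
  proof -
    have "cmod (pair f g) \<le> K2 * (nm f * np g)" using K2 that by (simp add: mult.assoc)
    also have "\<dots> \<le> K * (nm f * np g)" using that by (intro mult_right_mono) (auto simp: K_def)
    finally show ?thesis by (simp add: mult.assoc)
  qed
  moreover have "K > 0" by (simp add: K_def)
  ultimately show ?thesis by blast
qed

lemma pair_m_add_left: "f \<in> Vm \<Longrightarrow> f' \<in> Vm \<Longrightarrow> g \<in> Vp \<Longrightarrow> pair (f + f') g = pair f g + pair f' g"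
  and pair_m_scale_left: "f \<in> Vm \<Longrightarrow> g \<in> Vp \<Longrightarrow> pair (c *\<^sub>C f) g = c * pair f g"
  and pair_m_add_right: "f \<in> Vm \<Longrightarrow> g \<in> Vp \<Longrightarrow> g' \<in> Vp \<Longrightarrow> pair f (g + g') = pair f g + pair f g'"
  and pair_m_scale_right: "f \<in> Vm \<Longrightarrow> g \<in> Vp \<Longrightarrow> pair f (c *\<^sub>C g) = cnj c * pair f g"
  using pair_add_left[of f "- s" f' g] pair_scale_left[of f "- s" g c] pair_add_right[of f "- s" g g']
    pair_scale_right[of f "- s" g c] by simp_all

lemma pair_m_minus_left: "f \<in> Vm \<Longrightarrow> g \<in> Vp \<Longrightarrow> pair (- f) g = - pair f g"
  using pair_m_scale_left[of f g "-1"] by simp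

lemma pair_m_diff_left: "f \<in> Vm \<Longrightarrow> f' \<in> Vm \<Longrightarrow> g \<in> Vp \<Longrightarrow> pair (f - f') g = pair f g - pair f' g"
  using pair_m_add_left[of f "- f'" g] by (simp add: pair_m_minus_left)

lemma pair_m_0_left: "g \<in> Vp \<Longrightarrow> pair 0 g = 0"
  using pair_m_scale_left[of 0 g 0] by simp

lemma pair_p_diff_right: "g \<in> Vp \<Longrightarrow> f \<in> Vm \<Longrightarrow> f' \<in> Vm \<Longrightarrow> pair g (f - f') = pair g f - pair g f'"
  using pair_add_right[of g s "f - f'" f'] by simp

lemma pair_m_tendsto:
  assumes "\<And>i. \<sigma> i \<in> Vm" "f \<in> Vm" "g \<in> Vp" "((\<lambda>i. nm (\<sigma> i - f)) \<longlongrightarrow> 0) F"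
  shows "((\<lambda>i. pair (\<sigma> i) g) \<longlongrightarrow> pair f g) F" "((\<lambda>i. pair g (\<sigma> i)) \<longlongrightarrow> pair g f) F"
proof -
  obtain K where K: "K > 0" "\<forall>f\<in>Vp. \<forall>g\<in>Vm. cmod (pair f g) \<le> K * np f * nm g"
    "\<forall>f\<in>Vm. \<forall>g\<in>Vp. cmod (pair f g) \<le> K * nm f * np g" using pair_bound by blast
  have lim: "((\<lambda>i. K * np g * nm (\<sigma> i - f)) \<longlongrightarrow> 0) F" using tendsto_mult_left[OF assms(4), of "K * np g"] by simp
  have "((\<lambda>i. pair (\<sigma> i) g - pair f g) \<longlongrightarrow> 0) F"
  proof (rule Lim_null_comparison[OF always_eventually lim], rule allI)
    fix i
    have "cmod (pair (\<sigma> i - f) g) \<le> K * nm (\<sigma> i - f) * np g" using K(3) assms(1-3) by blast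
    then show "norm (pair (\<sigma> i) g - pair f g) \<le> K * np g * nm (\<sigma> i - f)"
      using assms(1-3) by (simp add: pair_m_diff_left[symmetric] mult.assoc mult.commute[of "nm _"])
  qed
  then show "((\<lambda>i. pair (\<sigma> i) g) \<longlongrightarrow> pair f g) F" by (simp add: LIM_zero_iff)
  have "((\<lambda>i. pair g (\<sigma> i) - pair g f) \<longlongrightarrow> 0) F"
  proof (rule Lim_null_comparison[OF always_eventually lim], rule allI)
    fix i show "norm (pair g (\<sigma> i) - pair g f) \<le> K * np g * nm (\<sigma> i - f)"
      using K(2) assms(1-3) by (simp add: pair_p_diff_right[symmetric])
  qed
  then show "((\<lambda>i. pair g (\<sigma> i)) \<longlongrightarrow> pair g f) F" by (simp add: LIM_zero_iff)
qed

lemma dense_sequence: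
  assumes "dense_in X A" "f \<in> vecs X" "hilb X"
  obtains \<sigma> :: "nat \<Rightarrow> 'a" where "\<And>i. \<sigma> i \<in> A" "(\<lambda>i. hnorm X (\<sigma> i - f)) \<longlonglongrightarrow> 0"
proof -
  interpret X: hilb X by fact
  have AX: "A \<subseteq> vecs X" using assms(1) by (simp add: dense_in_def)
  have "f \<in> hclosure X A" using assms(1,2) by (simp add: dense_in_def)
  then have "\<forall>e>0. \<exists>g\<in>A. hnorm X (f - g) < e" unfolding hclosure_def by blast
  then have "\<exists>g\<in>A. hnorm X (f - g) < 1 / real (Suc n)" for n by simp
  then obtain \<sigma> where \<sigma>: "\<And>n. \<sigma> n \<in> A" "\<And>n. hnorm X (f - \<sigma> n) < 1 / real (Suc n)" by metis
  have \<sigma>X: "\<sigma> n \<in> vecs X" for n using \<sigma>(1) AX by blast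
  have "(\<lambda>i. hnorm X (\<sigma> i - f)) \<longlonglongrightarrow> 0"
  proof (rule tendsto_sandwich[OF _ _ tendsto_const LIMSEQ_Suc[OF lim_1_over_n]])
    show "\<forall>\<^sub>F n in sequentially. 0 \<le> hnorm X (\<sigma> n - f)" using \<sigma>X assms(2) by (intro always_eventually allI X.nrm_nonneg X.vecs_diff)
    show "\<forall>\<^sub>F n in sequentially. hnorm X (\<sigma> n - f) \<le> 1 / real (Suc n)"
      unfolding X.nrm_minus_commute[OF \<sigma>X assms(2)] using \<sigma>(2) by (intro always_eventually allI less_imp_le)
  qed
  then show thesis using that \<sigma>(1) by blast
qed

text \<open>Hermitian symmetry of the extended pairing follows from that of the inner product by
  density of \<open>V0\<close> in \<open>Vm\<close>.\<close>

lemma pair_cnj: "f \<in> Vm \<Longrightarrow> g \<in> Vp \<Longrightarrow> pair g f = cnj (pair f g)"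
proof -
  assume f: "f \<in> Vm" and g: "g \<in> Vp"
  have "dense_in (S (- s)) V0" using embedding_dense[of "- s" 0] s_pos by simp
  then obtain \<sigma> where \<sigma>: "\<And>i. \<sigma> i \<in> V0" "(\<lambda>i. nm (\<sigma> i - f)) \<longlonglongrightarrow> 0"
    using dense_sequence f Hm.hilb_axioms by blast
  have "(\<lambda>i. pair g (\<sigma> i)) \<longlonglongrightarrow> pair g f" "(\<lambda>i. pair (\<sigma> i) g) \<longlonglongrightarrow> pair f g"
    using pair_m_tendsto[OF _ f g \<sigma>(2)] \<sigma>(1) by auto
  moreover have "pair g (\<sigma> i) = cnj (pair (\<sigma> i) g)" for i
    using pair_eq_hip[of g "\<sigma> i"] pair_eq_hip[of "\<sigma> i" g] H0.ip_cnj[of "\<sigma> i" g] \<sigma>(1) g by simp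
  ultimately have "(\<lambda>i. cnj (pair (\<sigma> i) g)) \<longlonglongrightarrow> pair g f" "(\<lambda>i. cnj (pair (\<sigma> i) g)) \<longlonglongrightarrow> cnj (pair f g)"
    by (simp_all add: tendsto_cnj)
  then show ?thesis using LIMSEQ_unique by blast
qed

text \<open>By \<open>dual\<close> the zero functional on \<open>Vp\<close> has only one
  representative in \<open>Vm\<close>, and both \<open>f\<close> and 0 represent it.\<close>

lemma nondegenerate:
  assumes f: "f \<in> Vm" and z: "\<And>g. g \<in> Vp \<Longrightarrow> pair f g = 0"
  shows "f = 0"
proof -
  have "\<exists>!g. g \<in> Vm \<and> (\<forall>h\<in>Vp. 0 = pair h g)"
    by (rule dual[of s "\<lambda>_. 0" 0]) auto
  moreover have "\<forall>h\<in>Vp. 0 = pair h f" using z f pair_cnj by simp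
  moreover have "\<forall>h\<in>Vp. 0 = pair h 0" using pair_cnj[of 0] pair_m_0_left by simp
  ultimately show ?thesis using f by (metis Hm.vecs_0)
qed

lemma conj_diff: "f \<in> vecs (S t) \<Longrightarrow> g \<in> vecs (S t) \<Longrightarrow> C (f - g) = C f - C g"
proof -
  assume fg: "f \<in> vecs (S t)" "g \<in> vecs (S t)"
  interpret hilb "S t" by unfold_locales (rule hilbert)
  have "C (f - g) + C g = C (f - g + g)" using fg by (intro conj_add[symmetric]) auto
  then show ?thesis by (simp add: algebra_simps)
qed

end

section \<open>Operator norms\<close>

lemma opnorm_le:
  assumes "hilb X" "\<And>f. f \<in> vecs X \<Longrightarrow> hnorm Y (T f) \<le> K * hnorm X f" "K \<ge> 0"
  shows "opnorm X Y T \<le> K"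
  unfolding opnorm_def
proof (rule cSUP_least)
  interpret hilb X by fact
  show "{f \<in> vecs X. hnorm X f \<le> 1} \<noteq> {}" by (intro ex_in_conv[THEN iffD1] exI[of _ 0]) simp
  fix f assume "f \<in> {f \<in> vecs X. hnorm X f \<le> 1}"
  then show "hnorm Y (T f) \<le> K" using assms(2)[of f] assms(3) mult_left_mono[of "hnorm X f" 1 K] by auto
qed

lemma bounded_opsD:
  assumes "T \<in> bounded_ops X Y" and X: "hilb X"
  shows "f \<in> vecs X \<Longrightarrow> T f \<in> vecs Y" "f \<in> vecs X \<Longrightarrow> g \<in> vecs X \<Longrightarrow> T (f + g) = T f + T g"
    "f \<in> vecs X \<Longrightarrow> T (c *\<^sub>C f) = c *\<^sub>C T f" "\<exists>K\<ge>0. \<forall>f\<in>vecs X. hnorm Y (T f) \<le> K * hnorm X f"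
proof -
  interpret hilb X by fact
  obtain K where "\<forall>f\<in>vecs X. hnorm Y (T f) \<le> K * hnorm X f" using assms by (auto simp: bounded_ops_def)
  then have "\<forall>f\<in>vecs X. hnorm Y (T f) \<le> max K 0 * hnorm X f"
    by (meson max.cobounded1 mult_right_mono nrm_nonneg order_trans)
  then show "\<exists>K\<ge>0. \<forall>f\<in>vecs X. hnorm Y (T f) \<le> K * hnorm X f" by (intro exI[of _ "max K 0"]) auto
qed (use assms in \<open>auto simp: bounded_ops_def clinear_on_def\<close>)

text \<open>\<open>opnorm\<close> is a supremum of reals, which dominates the values only if they
  are bounded above; membership in \<open>bounded_ops\<close> provides this.\<close>

lemma opnorm_bound:
  assumes X: "hilb X" and Y: "hilb Y" and T: "T \<in> bounded_ops X Y" and f: "f \<in> vecs X"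
  shows "hnorm Y (T f) \<le> opnorm X Y T * hnorm X f"
proof -
  interpret X: hilb X by fact
  interpret Y: hilb Y by fact
  obtain K where K: "K \<ge> 0" "\<forall>f\<in>vecs X. hnorm Y (T f) \<le> K * hnorm X f" using bounded_opsD(4)[OF T X] by blast
  have bdd: "bdd_above ((\<lambda>f. hnorm Y (T f)) ` {f \<in> vecs X. hnorm X f \<le> 1})"
  proof (rule bdd_aboveI2[of _ _ K])
    fix f assume "f \<in> {f \<in> vecs X. hnorm X f \<le> 1}"
    then show "hnorm Y (T f) \<le> K" using K mult_left_mono[of "hnorm X f" 1 K] by force
  qed
  show ?thesis
  proof (cases "f = 0")
    case True
    then show ?thesis using bounded_opsD(3)[OF T X X.vecs_0, of 0] by simp
  next
    case False
    then have n: "hnorm X f > 0" using X.nrm_eq_0[OF f] X.nrm_nonneg[OF f] by linarith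
    let ?c = "complex_of_real (1 / hnorm X f)"
    have c: "cmod ?c = 1 / hnorm X f" using n by (simp add: norm_divide)
    have "hnorm X (?c *\<^sub>C f) = 1" using X.nrm_scale[OF f, of ?c] n c by simp
    then have mem: "?c *\<^sub>C f \<in> {f \<in> vecs X. hnorm X f \<le> 1}" using f by simp
    have "hnorm Y (T (?c *\<^sub>C f)) \<le> opnorm X Y T"
      unfolding opnorm_def by (rule cSUP_upper[OF mem bdd])
    also have "T (?c *\<^sub>C f) = ?c *\<^sub>C T f" using bounded_opsD(3)[OF T X f] .
    finally have "hnorm Y (T f) / hnorm X f \<le> opnorm X Y T"
      using Y.nrm_scale[OF bounded_opsD(1)[OF T X f], of ?c] c by simp
    then show ?thesis using n by (simp add: divide_le_eq)
  qed
qed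

lemma opnorm_nonneg:
  assumes "hilb X" "hilb Y" "T \<in> bounded_ops X Y" shows "opnorm X Y T \<ge> 0"
proof -
  interpret X: hilb X by fact
  interpret Y: hilb Y by fact
  obtain K where K: "K \<ge> 0" "\<forall>f\<in>vecs X. hnorm Y (T f) \<le> K * hnorm X f" using bounded_opsD(4)[OF assms(3,1)] by blast
  have bdd: "bdd_above ((\<lambda>f. hnorm Y (T f)) ` {f \<in> vecs X. hnorm X f \<le> 1})"
  proof (rule bdd_aboveI2[of _ _ K])
    fix f assume "f \<in> {f \<in> vecs X. hnorm X f \<le> 1}"
    then show "hnorm Y (T f) \<le> K" using K mult_left_mono[of "hnorm X f" 1 K] by force
  qed
  have "hnorm Y (T 0) \<le> opnorm X Y T" unfolding opnorm_def by (intro cSUP_upper[OF _ bdd]) simp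
  moreover have "hnorm Y (T 0) \<ge> 0" using bounded_opsD(1)[OF assms(3,1)] by simp
  ultimately show ?thesis by linarith
qed

lemma bounded_ops_diff:
  assumes X: "hilb X" and Y: "hilb Y" and T: "T \<in> bounded_ops X Y" "T' \<in> bounded_ops X Y"
  shows "(\<lambda>f. T f - T' f) \<in> bounded_ops X Y"
proof -
  interpret X: hilb X by fact
  interpret Y: hilb Y by fact
  note a = bounded_opsD[OF T(1) X] and b = bounded_opsD[OF T(2) X]
  obtain K K' where K: "\<forall>f\<in>vecs X. hnorm Y (T f) \<le> K * hnorm X f" "\<forall>f\<in>vecs X. hnorm Y (T' f) \<le> K' * hnorm X f"
    using a(4) b(4) by blast
  have "hnorm Y (T f - T' f) \<le> (K + K') * hnorm X f" if "f \<in> vecs X" for f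
  proof -
    have "hnorm Y (T f - T' f) \<le> hnorm Y (T f) + hnorm Y (T' f)" using a(1) b(1) that by (intro Y.nrm_triangle_diff) auto
    also have "\<dots> \<le> K * hnorm X f + K' * hnorm X f" using K that by (intro add_mono) auto
    finally show ?thesis by (simp add: algebra_simps)
  qed
  then show ?thesis unfolding bounded_ops_def clinear_on_def
    using a(1-3) b(1-3) by (auto simp: complex_vector.scale_right_diff_distrib)
qed

section \<open>Consequences of the limiting absorption hypothesis\<close>

locale lap = gelfand S pair C s + A: sa_op "S 0" D T
  for S :: "real \<Rightarrow> 'a::complex_vector hspace" and pair C s D T +
  fixes l0 \<delta>\<^sub>1 :: real and k :: nat
  assumes lap: "limiting_absorption k S D T l0 s \<delta>\<^sub>1" and \<delta>\<^sub>1: "\<delta>\<^sub>1 > 0"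
begin

abbreviation "I \<equiv> {l0 - \<delta>\<^sub>1<..<l0 + \<delta>\<^sub>1}"
text \<open>With \<open>sg = -1\<close> the boundary value is taken from the upper half plane, with
  \<open>sg = 1\<close> from the lower one.\<close>

abbreviation "R \<equiv> boundary_resolvent (S s) (S (- s)) D T"
abbreviation "\<Delta> \<equiv> spectral_delta S D T s"

lemma boundary_limit_R: "sg \<in> {1, -1} \<Longrightarrow> l \<in> I \<Longrightarrow> boundary_limit (S s) (S (- s)) D T sg l (R sg l)"
proof -
  assume sg: "sg \<in> {1, -1}" and l: "l \<in> I"
  have ex: "\<exists>R. boundary_limit (S s) (S (- s)) D T sg l R"
    using bspec[OF lap[unfolded limiting_absorption_def] sg, THEN conjunct1] l by (rule bspec)
  show ?thesis unfolding boundary_resolvent_def by (rule someI_ex[OF ex])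
qed

lemma R_bounded: "sg \<in> {1, -1} \<Longrightarrow> l \<in> I \<Longrightarrow> R sg l \<in> bounded_ops (S s) (S (- s))"
  using boundary_limit_R unfolding boundary_limit_def by blast

lemma R_in: "sg \<in> {1, -1} \<Longrightarrow> l \<in> I \<Longrightarrow> f \<in> Vp \<Longrightarrow> R sg l f \<in> Vm"
  using R_bounded bounded_opsD(1) Hp.hilb_axioms by blast

lemma Res_bounded: "Im z \<noteq> 0 \<Longrightarrow> A.Res z \<in> bounded_ops (S s) (S (- s))"
proof -
  assume z: "Im z \<noteq> 0"
  obtain K where K: "K > 0" "\<forall>f\<in>V0. nm f \<le> K * n0 f" using nm_le_n0 by blast
  have "nm (A.Res z f) \<le> K / \<bar>Im z\<bar> * np f" if f: "f \<in> Vp" for f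
  proof -
    have "nm (A.Res z f) \<le> K * n0 (A.Res z f)" using K A.Res_in[OF z] f by simp
    also have "\<dots> \<le> K * (n0 f / \<bar>Im z\<bar>)" using A.Res_bound[OF z, of f] f K by (intro mult_left_mono) auto
    also have "\<dots> \<le> K * (np f / \<bar>Im z\<bar>)" using n0_le_np[OF f] K by (intro mult_left_mono divide_right_mono) auto
    finally show ?thesis by simp
  qed
  then have "\<exists>K. \<forall>f\<in>Vp. nm (A.Res z f) \<le> K * np f" by blast
  then show ?thesis unfolding bounded_ops_def clinear_on_def
    using A.Res_add[OF z] A.Res_scale[OF z] A.Res_in[OF z] by auto
qed

lemma R_limit:
  assumes sg: "sg \<in> {1, -1}" and l: "l \<in> I" and f: "f \<in> Vp"
  shows "((\<lambda>\<epsilon>. nm (A.Res (Complex l (- sg * \<epsilon>)) f - R sg l f)) \<longlongrightarrow> 0) (at_right 0)"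
proof -
  have z: "of_real l - of_real (sg * \<epsilon>) * \<i> = Complex l (- sg * \<epsilon>)" for \<epsilon>
    by (simp add: complex_eq_iff)
  have lim: "((\<lambda>\<epsilon>. opnorm (S s) (S (- s)) (\<lambda>f. A.Res (Complex l (- sg * \<epsilon>)) f - R sg l f) * np f) \<longlongrightarrow> 0) (at_right 0)"
    using boundary_limit_R[OF sg l] tendsto_mult_right[of _ 0 "at_right 0" "np f"]
    unfolding boundary_limit_def z by fastforce
  have ev: "\<forall>\<^sub>F \<epsilon> in at_right (0::real). \<epsilon> > 0" by (simp add: eventually_at_right_less)
  show ?thesis
  proof (rule tendsto_sandwich[OF _ _ tendsto_const lim])
    show "\<forall>\<^sub>F \<epsilon> in at_right 0. 0 \<le> nm (A.Res (Complex l (- sg * \<epsilon>)) f - R sg l f)"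
      using ev
    proof eventually_elim
      case (elim \<epsilon>)
      have "Im (Complex l (- sg * \<epsilon>)) \<noteq> 0" using sg elim by auto
      then show ?case using A.Res_in f R_in[OF sg l f] by (intro Hm.nrm_nonneg Hm.vecs_diff) auto
    qed
    show "\<forall>\<^sub>F \<epsilon> in at_right 0. nm (A.Res (Complex l (- sg * \<epsilon>)) f - R sg l f) \<le>
        opnorm (S s) (S (- s)) (\<lambda>f. A.Res (Complex l (- sg * \<epsilon>)) f - R sg l f) * np f"
      using ev
    proof eventually_elim
      case (elim \<epsilon>)
      have "Im (Complex l (- sg * \<epsilon>)) \<noteq> 0" using sg elim by auto
      then have "(\<lambda>f. A.Res (Complex l (- sg * \<epsilon>)) f - R sg l f) \<in> bounded_ops (S s) (S (- s))"
        using Res_bounded R_bounded[OF sg l] by (intro bounded_ops_diff Hp.hilb_axioms Hm.hilb_axioms) auto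
      from opnorm_bound[OF Hp.hilb_axioms Hm.hilb_axioms this f] show ?case .
    qed
  qed
qed

lemma ev_pos: "\<forall>\<^sub>F \<epsilon> in at_right (0::real). \<epsilon> > 0"
  by (simp add: eventually_at_right_less)

text \<open>In the following limits the resolvents are redefined to be \<open>0\<close> for \<open>\<epsilon> \<le> 0\<close>, which puts their
  values into \<open>Vm\<close> for all \<open>\<epsilon>\<close>.\<close>

lemma pair_R_limit:
  assumes sg: "sg \<in> {1, -1}" and l: "l \<in> I" and f: "f \<in> Vp" and g: "g \<in> Vp"
  shows "((\<lambda>\<epsilon>. ip0 (A.Res (Complex l (- sg * \<epsilon>)) f) g) \<longlongrightarrow> pair (R sg l f) g) (at_right 0)"
proof -
  define u where "u = (\<lambda>\<epsilon>. if \<epsilon> > 0 then A.Res (Complex l (- sg * \<epsilon>)) f else 0)"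
  have u0: "u \<epsilon> \<in> V0" for \<epsilon> using A.Res_in f sg by (auto simp: u_def)
  have "((\<lambda>\<epsilon>. nm (u \<epsilon> - R sg l f)) \<longlongrightarrow> 0) (at_right 0)"
    using R_limit[OF sg l f]
    by (rule Lim_transform_eventually) (use ev_pos in \<open>eventually_elim, simp add: u_def\<close>)
  then have "((\<lambda>\<epsilon>. pair (u \<epsilon>) g) \<longlongrightarrow> pair (R sg l f) g) (at_right 0)"
    using u0 R_in[OF sg l f] g by (intro pair_m_tendsto) auto
  then show ?thesis
  proof (rule Lim_transform_eventually)
    show "\<forall>\<^sub>F \<epsilon> in at_right 0. pair (u \<epsilon>) g = ip0 (A.Res (Complex l (- sg * \<epsilon>)) f) g"
      using ev_pos
    proof eventually_elim
      case (elim \<epsilon>)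
      then show ?case using pair_eq_hip[OF u0[of \<epsilon>], of g] g by (simp add: u_def)
    qed
  qed
qed

lemma \<Delta>_in: "l \<in> I \<Longrightarrow> f \<in> Vp \<Longrightarrow> \<Delta> l f \<in> Vm"
  unfolding spectral_delta_def using R_in by auto

lemma \<Delta>_add: "l \<in> I \<Longrightarrow> f \<in> Vp \<Longrightarrow> g \<in> Vp \<Longrightarrow> \<Delta> l (f + g) = \<Delta> l f + \<Delta> l g"
  and \<Delta>_scale: "l \<in> I \<Longrightarrow> f \<in> Vp \<Longrightarrow> \<Delta> l (c *\<^sub>C f) = c *\<^sub>C \<Delta> l f"
  unfolding spectral_delta_def
  using bounded_opsD(2,3)[OF R_bounded Hp.hilb_axioms]
  by (simp_all add: complex_vector.scale_right_diff_distrib complex_vector.scale_right_distrib mult.commute)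

definition B :: "real \<Rightarrow> 'a \<Rightarrow> 'a \<Rightarrow> complex" where "B l f g = pair (\<Delta> l f) g"

text \<open>By \<open>ip_Res_Res\<close> the jump of the resolvent between
  \<open>Complex l \<epsilon>\<close> and its conjugate is \<open>2 * \<i> * \<epsilon>\<close>
  times an inner product of resolvent vectors. In this form \<open>B\<close> inherits positivity,
  symmetry and the Cauchy-Schwarz inequality from the Hilbert space.\<close>

lemma B_limit:
  assumes l: "l \<in> I" and f: "f \<in> Vp" and g: "g \<in> Vp"
  shows "((\<lambda>\<epsilon>. of_real (\<epsilon> / pi) * ip0 (A.Res (Complex l \<epsilon>) f) (A.Res (Complex l \<epsilon>) g)) \<longlongrightarrow> B l f g) (at_right 0)"
proof -
  have "((\<lambda>\<epsilon>. 1 / (2 * of_real pi * \<i>) * (ip0 (A.Res (Complex l (- (-1) * \<epsilon>)) f) g - ip0 (A.Res (Complex l (- 1 * \<epsilon>)) f) g))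
      \<longlongrightarrow> 1 / (2 * of_real pi * \<i>) * (pair (R (-1) l f) g - pair (R 1 l f) g)) (at_right 0)"
    by (intro tendsto_intros pair_R_limit l f g) auto
  also have "1 / (2 * of_real pi * \<i>) * (pair (R (-1) l f) g - pair (R 1 l f) g) = B l f g"
    unfolding B_def spectral_delta_def using R_in[of _ l f] l f g
    by (simp add: pair_m_scale_left pair_m_diff_left)
  finally show ?thesis
  proof (rule Lim_transform_eventually)
    show "\<forall>\<^sub>F \<epsilon> in at_right 0. 1 / (2 * of_real pi * \<i>) * (ip0 (A.Res (Complex l (- (-1) * \<epsilon>)) f) g - ip0 (A.Res (Complex l (- 1 * \<epsilon>)) f) g)
        = of_real (\<epsilon> / pi) * ip0 (A.Res (Complex l \<epsilon>) f) (A.Res (Complex l \<epsilon>) g)"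
      using ev_pos
    proof eventually_elim
      case (elim \<epsilon>)
      let ?z = "Complex l \<epsilon>"
      have z: "Im ?z \<noteq> 0" "Im (cnj ?z) \<noteq> 0" using elim by auto
      have cz: "Complex l (- \<epsilon>) = cnj ?z" by (simp add: complex_eq_iff)
      have "?z - cnj ?z = 2 * \<i> * of_real \<epsilon>" by (simp add: complex_eq_iff)
      then have eq: "2 * \<i> * of_real \<epsilon> * ip0 (A.Res ?z f) (A.Res ?z g) = ip0 (A.Res ?z f) g - ip0 (A.Res (cnj ?z) f) g"
        using A.ip_Res_Res[OF z(1) z(1), of f g] A.Res_adjoint[OF z(2), of f g] f g by simp
      have m: "- (-1) * \<epsilon> = \<epsilon>" "- 1 * \<epsilon> = - \<epsilon>" by simp_all
      show ?case unfolding m cz eq[symmetric] by simp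
    qed
  qed
qed

lemma B_nonneg: assumes "l \<in> I" "f \<in> Vp" shows "Re (B l f f) \<ge> 0" "Im (B l f f) = 0"
proof -
  note lim = B_limit[OF assms assms(2)]
  have ev: "\<forall>\<^sub>F \<epsilon> in at_right 0. of_real (\<epsilon> / pi) * ip0 (A.Res (Complex l \<epsilon>) f) (A.Res (Complex l \<epsilon>) f)
      = complex_of_real (\<epsilon> / pi * (n0 (A.Res (Complex l \<epsilon>) f))\<^sup>2)"
    using ev_pos
  proof eventually_elim
    case (elim \<epsilon>)
    then have "A.Res (Complex l \<epsilon>) f \<in> V0" using assms by (intro A.Res_in) auto
    then show ?case using H0.ip_self by simp
  qed
  have lim': "((\<lambda>\<epsilon>. complex_of_real (\<epsilon> / pi * (n0 (A.Res (Complex l \<epsilon>) f))\<^sup>2)) \<longlongrightarrow> B l f f) (at_right 0)"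
    using Lim_transform_eventually[OF lim ev] .
  have "((\<lambda>\<epsilon>. \<epsilon> / pi * (n0 (A.Res (Complex l \<epsilon>) f))\<^sup>2) \<longlongrightarrow> Re (B l f f)) (at_right 0)"
    using tendsto_Re[OF lim'] by simp
  then show "Re (B l f f) \<ge> 0"
  proof (rule tendsto_lowerbound)
    show "\<forall>\<^sub>F \<epsilon> in at_right 0. 0 \<le> \<epsilon> / pi * (n0 (A.Res (Complex l \<epsilon>) f))\<^sup>2"
      using ev_pos by eventually_elim simp
  qed simp
  have "((\<lambda>\<epsilon>. 0) \<longlongrightarrow> Im (B l f f)) (at_right (0::real))" using tendsto_Im[OF lim'] by simp
  from tendsto_unique[OF _ this tendsto_const] show "Im (B l f f) = 0" by simp
qed

lemma B_cnj: assumes "l \<in> I" "f \<in> Vp" "g \<in> Vp" shows "B l g f = cnj (B l f g)"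
proof (rule tendsto_unique[OF _ B_limit[OF assms(1,3,2)]])
  have "((\<lambda>\<epsilon>. cnj (of_real (\<epsilon> / pi) * ip0 (A.Res (Complex l \<epsilon>) f) (A.Res (Complex l \<epsilon>) g))) \<longlongrightarrow> cnj (B l f g)) (at_right 0)"
    by (intro tendsto_cnj B_limit assms)
  then show "((\<lambda>\<epsilon>. of_real (\<epsilon> / pi) * ip0 (A.Res (Complex l \<epsilon>) g) (A.Res (Complex l \<epsilon>) f)) \<longlongrightarrow> cnj (B l f g)) (at_right 0)"
  proof (rule Lim_transform_eventually)
    show "\<forall>\<^sub>F \<epsilon> in at_right 0. cnj (of_real (\<epsilon> / pi) * ip0 (A.Res (Complex l \<epsilon>) f) (A.Res (Complex l \<epsilon>) g))
       = of_real (\<epsilon> / pi) * ip0 (A.Res (Complex l \<epsilon>) g) (A.Res (Complex l \<epsilon>) f)"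
      using ev_pos
    proof eventually_elim
      case (elim \<epsilon>)
      then have "A.Res (Complex l \<epsilon>) f \<in> V0" "A.Res (Complex l \<epsilon>) g \<in> V0" using assms by (auto intro!: A.Res_in)
      from H0.ip_cnj[OF this] show ?case by simp
    qed
  qed
qed simp

lemma B_Cauchy_Schwarz:
  assumes "l \<in> I" "f \<in> Vp" "g \<in> Vp"
  shows "(cmod (B l f g))\<^sup>2 \<le> Re (B l f f) * Re (B l g g)"
proof (rule tendsto_le[of "at_right (0::real)"])
  let ?b = "\<lambda>f g \<epsilon>. of_real (\<epsilon> / pi) * ip0 (A.Res (Complex l \<epsilon>) f) (A.Res (Complex l \<epsilon>) g)"
  show "((\<lambda>\<epsilon>. (cmod (?b f g \<epsilon>))\<^sup>2) \<longlongrightarrow> (cmod (B l f g))\<^sup>2) (at_right 0)"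
    by (intro tendsto_intros B_limit assms)
  show "((\<lambda>\<epsilon>. Re (?b f f \<epsilon>) * Re (?b g g \<epsilon>)) \<longlongrightarrow> Re (B l f f) * Re (B l g g)) (at_right 0)"
    by (intro tendsto_intros B_limit assms)
  show "\<forall>\<^sub>F \<epsilon> in at_right 0. (cmod (?b f g \<epsilon>))\<^sup>2 \<le> Re (?b f f \<epsilon>) * Re (?b g g \<epsilon>)"
    using ev_pos
  proof eventually_elim
    case (elim \<epsilon>)
    let ?u = "A.Res (Complex l \<epsilon>) f" and ?v = "A.Res (Complex l \<epsilon>) g"
    have uv: "?u \<in> V0" "?v \<in> V0" using assms elim by (auto intro!: A.Res_in)
    have "cmod (?b f g \<epsilon>) = \<epsilon> / pi * cmod (ip0 ?u ?v)"
      unfolding norm_mult using elim by (simp add: norm_divide)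
    also have "\<dots> \<le> \<epsilon> / pi * (n0 ?u * n0 ?v)"
      using elim H0.Cauchy_Schwarz[OF uv] by (intro mult_left_mono) auto
    finally have "cmod (?b f g \<epsilon>) \<le> \<epsilon> / pi * (n0 ?u * n0 ?v)" .
    then have "(cmod (?b f g \<epsilon>))\<^sup>2 \<le> (\<epsilon> / pi * (n0 ?u * n0 ?v))\<^sup>2" by (intro power_mono) auto
    also have "\<dots> = Re (?b f f \<epsilon>) * Re (?b g g \<epsilon>)"
      using H0.ip_self[OF uv(1)] H0.ip_self[OF uv(2)] by (simp add: power2_eq_square)
    finally show ?case .
  qed
qed simp

lemma \<Delta>_eq_0:
  assumes "l \<in> I" "f \<in> Vp" "Re (B l f f) = 0" shows "\<Delta> l f = 0"
proof (rule nondegenerate[OF \<Delta>_in[OF assms(1,2)]])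
  fix g assume "g \<in> Vp"
  then show "pair (\<Delta> l f) g = 0" using B_Cauchy_Schwarz[OF assms(1,2), of g] assms(3) by (simp add: B_def)
qed

text \<open>For \<open>g\<close> in \<open>Vp\<close>, the square of \<epsilon> times the norm of
  the resolvent vector is \<epsilon> times the modulus of the imaginary part of
  \<open>ip0 (A.Res z g) g\<close>, and the inner product converges. Density of \<open>Vp\<close>
  and the bound \<open>1 / \<epsilon>\<close> of the resolvent give the rest.\<close>

lemma \<epsilon>_Res_tendsto_0:
  assumes l: "l \<in> I" and u: "u \<in> V0" and \<sigma>: "\<sigma> \<in> {1, -1}"
  shows "((\<lambda>\<epsilon>. \<epsilon> * n0 (A.Res (Complex l (\<sigma> * \<epsilon>)) u)) \<longlongrightarrow> 0) (at_right 0)"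
proof (rule tendstoI)
  fix e :: real assume e: "e > 0"
  have "dense_in (S 0) Vp" using embedding_dense[of 0 s] s_pos by simp
  obtain g where g: "g \<in> Vp" "n0 (u - g) < e / 2"
  proof -
    have "u \<in> hclosure (S 0) Vp" using u \<open>dense_in (S 0) Vp\<close> by (simp add: dense_in_def)
    then have "\<forall>e>0. \<exists>g\<in>Vp. n0 (u - g) < e" unfolding hclosure_def by blast
    then show ?thesis using that half_gt_zero[OF e] by blast
  qed
  have sg: "- \<sigma> \<in> {1, -1}" using \<sigma> by auto
  have lim: "((\<lambda>\<epsilon>. \<epsilon> * cmod (ip0 (A.Res (Complex l (\<sigma> * \<epsilon>)) g) g)) \<longlongrightarrow> 0 * cmod (pair (R (- \<sigma>) l g) g)) (at_right 0)"
    using pair_R_limit[OF sg l g(1) g(1)] by (intro tendsto_intros) auto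
  have "(e / 2)\<^sup>2 > 0" using e by simp
  then have "\<forall>\<^sub>F \<epsilon> in at_right 0. \<epsilon> * cmod (ip0 (A.Res (Complex l (\<sigma> * \<epsilon>)) g) g) < (e / 2)\<^sup>2"
    using lim by (intro order_tendstoD(2)) auto
  then show "\<forall>\<^sub>F \<epsilon> in at_right 0. dist (\<epsilon> * n0 (A.Res (Complex l (\<sigma> * \<epsilon>)) u)) 0 < e"
    using ev_pos
  proof eventually_elim
    case (elim \<epsilon>)
    let ?z = "Complex l (\<sigma> * \<epsilon>)"
    have z: "Im ?z \<noteq> 0" "\<bar>Im ?z\<bar> = \<epsilon>" using \<sigma> elim by auto
    have in': "A.Res ?z g \<in> V0" "A.Res ?z u \<in> V0" "A.Res ?z (u - g) \<in> V0" using A.Res_in[OF z(1)] g u by auto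
    have "\<epsilon> * (n0 (A.Res ?z g))\<^sup>2 = \<bar>Im (ip0 (A.Res ?z g) g)\<bar>"
      using A.Im_ip_Res[OF z(1), of g] g z by (simp add: abs_mult)
    also have "\<dots> \<le> cmod (ip0 (A.Res ?z g) g)" by (rule abs_Im_le_cmod)
    finally have "\<epsilon> * (\<epsilon> * (n0 (A.Res ?z g))\<^sup>2) \<le> \<epsilon> * cmod (ip0 (A.Res ?z g) g)"
      using elim by (intro mult_left_mono) auto
    moreover have "\<epsilon> * (\<epsilon> * (n0 (A.Res ?z g))\<^sup>2) = (\<epsilon> * n0 (A.Res ?z g))\<^sup>2"
      by (simp add: power2_eq_square)
    ultimately have "(\<epsilon> * n0 (A.Res ?z g))\<^sup>2 < (e / 2)\<^sup>2" using elim(1) by linarith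
    then have 1: "\<epsilon> * n0 (A.Res ?z g) < e / 2" using e by (intro power2_less_imp_less[of _ "e / 2"]) auto
    have 2: "\<epsilon> * n0 (A.Res ?z (u - g)) < e / 2"
      using A.Res_bound[OF z(1), of "u - g"] u g z elim(2) by (simp add: field_simps)
    have "A.Res ?z u = A.Res ?z (u - g) + A.Res ?z g" using A.Res_diff[OF z(1), of u g] u g by simp
    then have "n0 (A.Res ?z u) \<le> n0 (A.Res ?z (u - g)) + n0 (A.Res ?z g)" using H0.nrm_triangle[OF in'(3,1)] by simp
    then have "\<epsilon> * n0 (A.Res ?z u) \<le> \<epsilon> * n0 (A.Res ?z (u - g)) + \<epsilon> * n0 (A.Res ?z g)"
      using elim(2) by (simp add: distrib_left[symmetric])
    then show ?case using 1 2 in' elim(2) by simp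
  qed
qed

text \<open>The resolvent at \<open>z\<close> maps \<open>f\<close> to
  \<open>u + (z - l) * A.Res z u\<close>, and the last term tends to 0 by
  \<open>\<epsilon>_Res_tendsto_0\<close>. So both boundary values recover \<open>u\<close>.\<close>

lemma R_shift:
  assumes sg: "sg \<in> {1, -1}" and l: "l \<in> I" and u: "u \<in> D" and f: "T u - of_real l *\<^sub>C u = f" "f \<in> Vp"
  shows "R sg l f = u"
proof -
  have sg': "- sg \<in> {1, -1}" using sg by auto
  define v where "v = (\<lambda>\<epsilon>. if \<epsilon> > 0 then A.Res (Complex l (- sg * \<epsilon>)) f else 0)"
  have v: "v \<epsilon> \<in> Vm" for \<epsilon> using A.Res_in f sg by (auto simp: v_def)
  obtain K where K: "K > 0" "\<forall>f\<in>V0. nm f \<le> K * n0 f" using nm_le_n0 by blast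
  have u0: "u \<in> V0" using u by simp
  have 1: "((\<lambda>\<epsilon>. nm (v \<epsilon> - R sg l f)) \<longlongrightarrow> 0) (at_right 0)"
    using R_limit[OF sg l f(2)]
    by (rule Lim_transform_eventually) (use ev_pos in \<open>eventually_elim, simp add: v_def\<close>)
  have lim: "((\<lambda>\<epsilon>. K * (\<epsilon> * n0 (A.Res (Complex l (- sg * \<epsilon>)) u))) \<longlongrightarrow> 0) (at_right 0)"
    using tendsto_mult_left[OF \<epsilon>_Res_tendsto_0[OF l u0 sg'], of K] by simp
  have 2: "((\<lambda>\<epsilon>. nm (v \<epsilon> - u)) \<longlongrightarrow> 0) (at_right 0)"
  proof (rule tendsto_sandwich[OF _ _ tendsto_const lim])
    show "\<forall>\<^sub>F \<epsilon> in at_right 0. 0 \<le> nm (v \<epsilon> - u)" using v u0 by (intro always_eventually allI Hm.nrm_nonneg) auto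
    show "\<forall>\<^sub>F \<epsilon> in at_right 0. nm (v \<epsilon> - u) \<le> K * (\<epsilon> * n0 (A.Res (Complex l (- sg * \<epsilon>)) u))"
      using ev_pos
    proof eventually_elim
      case (elim \<epsilon>)
      let ?z = "Complex l (- sg * \<epsilon>)"
      have z: "Im ?z \<noteq> 0" using sg elim by auto
      have zl: "?z - of_real l = of_real (- sg * \<epsilon>) * \<i>" by (simp add: complex_eq_iff)
      have "f = (T u - ?z *\<^sub>C u) + (?z - of_real l) *\<^sub>C u"
        using f(1) by (simp add: complex_vector.scale_left_diff_distrib)
      then have "A.Res ?z f = u + (?z - of_real l) *\<^sub>C A.Res ?z u"
        using A.Res_add[OF z, of "T u - ?z *\<^sub>C u" "(?z - of_real l) *\<^sub>C u"] A.Res_shift[OF z u]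
          A.Res_scale[OF z u0] A.T_in[OF u] u0 by simp
      then have "v \<epsilon> - u = (?z - of_real l) *\<^sub>C A.Res ?z u" using elim by (simp add: v_def)
      then have "nm (v \<epsilon> - u) = \<epsilon> * nm (A.Res ?z u)"
        unfolding zl using Hm.nrm_scale[of "A.Res ?z u"] A.Res_in[OF z u0] sg elim by (auto simp: norm_mult)
      also have "\<dots> \<le> \<epsilon> * (K * n0 (A.Res ?z u))" using K A.Res_in[OF z u0] elim by (intro mult_left_mono) auto
      finally show ?case by (simp add: mult.left_commute)
    qed
  qed
  show ?thesis using Hm.limit_unique[OF v _ _ _ 1 2] R_in[OF sg l f(2)] u0 by simp
qed

text \<open>Under the quadratic bound the resolvent vectors stay bounded along the vertical line.
  Their squared norms are monotone, hence convergent, and this makes the vectors a Cauchy sequence.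
  The closed graph puts the limit into \<open>D\<close>, and \<open>R_shift\<close> identifies it
  with the boundary value.\<close>

lemma R_in_domain:
  assumes l: "l \<in> I" and g: "g \<in> Vp" and r: "r > 0" "{l - r..l + r} \<subseteq> I"
    and quad: "\<And>x. x \<in> {l - r..l + r} \<Longrightarrow> Re (B x g g) \<le> c * (x - l)\<^sup>2" and c: "c \<ge> 0"
  shows "R (-1) l g \<in> D" "T (R (-1) l g) - of_real l *\<^sub>C R (-1) l g = g"
proof -
  define F where "F = (\<lambda>z. ip0 (A.Res z g) g)"
  have g0: "g \<in> V0" using g by simp
  interpret P: half_plane_positive F "(n0 g)\<^sup>2"
  proof
    show "F holomorphic_on {z. Im z > 0}" unfolding F_def by (rule A.holomorphic_ip_Res[OF g0 g0])
  next
    fix z :: complex assume z: "Im z > 0"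
    then have z': "Im z \<noteq> 0" by simp
    have "cmod (F z) \<le> n0 (A.Res z g) * n0 g" unfolding F_def using A.Res_in[OF z' g0] g0 by (rule H0.Cauchy_Schwarz)
    also have "\<dots> \<le> n0 g / \<bar>Im z\<bar> * n0 g" using A.Res_bound[OF z' g0] g0 by (intro mult_right_mono) auto
    finally show "cmod (F z) \<le> (n0 g)\<^sup>2 / Im z" using z by (simp add: power2_eq_square)
    show "Im (F z) \<ge> 0" unfolding F_def A.Im_ip_Res[OF z' g0] using z by simp
  qed
  define u where "u = (\<lambda>\<epsilon>. A.Res (Complex l \<epsilon>) g)"
  have P: "P.P x \<epsilon> = \<epsilon> * (n0 (A.Res (Complex x \<epsilon>) g))\<^sup>2" if "\<epsilon> > 0" for x \<epsilon>
  proof -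
    have "Im (F (Complex x \<epsilon>)) = \<epsilon> * (n0 (A.Res (Complex x \<epsilon>) g))\<^sup>2"
      unfolding F_def using A.Im_ip_Res[of "Complex x \<epsilon>" g] that g0 by simp
    then show ?thesis unfolding P.P_def .
  qed
  have lim: "(P.P x \<longlongrightarrow> pi * Re (B x g g)) (at_right 0)" if x: "x \<in> {l - r..l + r}" for x
  proof -
    have "x \<in> I" using x r by blast
    then have "((\<lambda>\<epsilon>. pi * Re (of_real (\<epsilon> / pi) * ip0 (A.Res (Complex x \<epsilon>) g) (A.Res (Complex x \<epsilon>) g))) \<longlongrightarrow> pi * Re (B x g g)) (at_right 0)"
      by (intro tendsto_intros B_limit g)
    then show ?thesis
    proof (rule Lim_transform_eventually)
      show "\<forall>\<^sub>F \<epsilon> in at_right 0. pi * Re (of_real (\<epsilon> / pi) * ip0 (A.Res (Complex x \<epsilon>) g) (A.Res (Complex x \<epsilon>) g)) = P.P x \<epsilon>"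
        using ev_pos
      proof eventually_elim
        case (elim \<epsilon>)
        have "A.Res (Complex x \<epsilon>) g \<in> V0" using elim g0 by (intro A.Res_in) auto
        then show ?case using H0.ip_self P[OF elim] by simp
      qed
    qed
  qed
  \<comment> \<open>The spectral density contains the factor \<open>1 / pi\<close>, so the boundary
    values of \<open>P\<close> are \<open>pi\<close> times those of \<open>B\<close>.\<close>
  have hq: "pi * Re (B x g g) \<le> (pi * c) * (x - l)\<^sup>2" if "x \<in> {l - r..l + r}" for x
    using quad[OF that] by (simp add: mult.assoc)
  define M where "M = 8 * r * (pi * c + 1) + 2 * (1 + 1 / r\<^sup>2) * (n0 g)\<^sup>2"
  have M: "P.P l \<epsilon> \<le> M * \<epsilon>" if "\<epsilon> > 0" for \<epsilon>
    unfolding M_def by (rule P.vertical_bound[OF lim hq _ r(1) that]) (use c in simp_all)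
  have u0: "u \<epsilon> \<in> V0" "u \<epsilon> \<in> D" if "\<epsilon> > 0" for \<epsilon>
    using A.Res_in_D[of "Complex l \<epsilon>" g] that g0 by (auto simp: u_def)
  define a where "a = (\<lambda>\<epsilon>. (n0 (u \<epsilon>))\<^sup>2)"
  have a_le: "a \<epsilon> \<le> M" if "\<epsilon> > 0" for \<epsilon>
    using M[OF that] P[OF that, of l] that by (simp add: a_def u_def mult.commute)
  have dist: "(n0 (u \<epsilon> - u \<eta>))\<^sup>2 * (\<epsilon> + \<eta>) = (\<eta> - \<epsilon>) * (a \<epsilon> - a \<eta>)" if "\<epsilon> > 0" "\<eta> > 0" for \<epsilon> \<eta>
    using A.Res_vertical_distance[OF g0 that, of l] by (simp add: u_def a_def)
  have mono: "a \<eta> \<le> a \<epsilon>" if "0 < \<epsilon>" "\<epsilon> < \<eta>" for \<epsilon> \<eta>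
  proof -
    have "0 \<le> (\<eta> - \<epsilon>) * (a \<epsilon> - a \<eta>)"
      using that by (simp add: dist[symmetric])
    then show ?thesis using that by (simp add: zero_le_mult_iff)
  qed
  have close: "(n0 (u \<epsilon> - u \<eta>))\<^sup>2 \<le> \<bar>a \<epsilon> - a \<eta>\<bar>" if "\<epsilon> > 0" "\<eta> > 0" for \<epsilon> \<eta>
  proof -
    have "(n0 (u \<epsilon> - u \<eta>))\<^sup>2 * (\<epsilon> + \<eta>) \<le> \<bar>\<eta> - \<epsilon>\<bar> * \<bar>a \<epsilon> - a \<eta>\<bar>"
      unfolding dist[OF that] by (simp add: abs_mult[symmetric])
    also have "\<dots> \<le> (\<epsilon> + \<eta>) * \<bar>a \<epsilon> - a \<eta>\<bar>" using that by (intro mult_right_mono) auto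
    finally show ?thesis using that by (simp add: mult.commute)
  qed
  define x where "x = (\<lambda>n. u (1 / real (Suc n)))"
  have "incseq (\<lambda>n. a (1 / real (Suc n)))"
  proof (rule incseq_SucI)
    fix n show "a (1 / real (Suc n)) \<le> a (1 / real (Suc (Suc n)))" by (rule mono) (auto intro!: divide_strict_left_mono)
  qed
  then have "convergent (\<lambda>n. a (1 / real (Suc n)))"
    using a_le by (intro Bseq_mono_convergent[OF BseqI'[of _ M]]) (auto simp: a_def incseq_def)
  then have cau: "Cauchy (\<lambda>n. a (1 / real (Suc n)))" by (rule convergent_Cauchy)
  have x0: "x n \<in> V0" "x n \<in> D" for n using u0 by (auto simp: x_def)
  have cauchy: "\<exists>N. \<forall>i\<ge>N. \<forall>j\<ge>N. n0 (x i - x j) < e" if e: "e > 0" for e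
  proof -
    have "e\<^sup>2 > 0" using e by simp
    then obtain N where N: "\<And>i j. i \<ge> N \<Longrightarrow> j \<ge> N \<Longrightarrow> \<bar>a (1 / real (Suc i)) - a (1 / real (Suc j))\<bar> < e\<^sup>2"
      using metric_CauchyD[OF cau] unfolding dist_real_def by blast
    have "n0 (x i - x j) < e" if "i \<ge> N" "j \<ge> N" for i j
    proof -
      have "(n0 (x i - x j))\<^sup>2 < e\<^sup>2" using close[of "1 / real (Suc i)" "1 / real (Suc j)"] N[OF that] by (simp add: x_def)
      then show ?thesis using e by (intro power2_less_imp_less[of _ e]) auto
    qed
    then show ?thesis by blast
  qed
  have rng: "range x \<subseteq> V0" using x0 by blast
  obtain y where y: "y \<in> V0" "(\<lambda>n. n0 (x n - y)) \<longlonglongrightarrow> 0"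
    by (rule H0.complete[OF rng cauchy])
  let ?w = "\<lambda>n. Complex l (1 / real (Suc n))"
  have Tx: "T (x n) = g + ?w n *\<^sub>C x n" for n
    using A.T_Res[of "?w n" g] g0 by (simp add: x_def u_def)
  have "(\<lambda>n. n0 (T (x n) - (g + of_real l *\<^sub>C y))) \<longlonglongrightarrow> 0"
  proof (rule tendsto_sandwich[OF _ _ tendsto_const])
    show "\<forall>\<^sub>F n in sequentially. 0 \<le> n0 (T (x n) - (g + of_real l *\<^sub>C y))"
      using x0 y g0 by (intro always_eventually allI H0.nrm_nonneg) auto
    have "(\<lambda>n. \<bar>l\<bar> * n0 (x n - y) + 1 / real (Suc n) * (n0 (x n - y) + n0 y)) \<longlonglongrightarrow> \<bar>l\<bar> * 0 + 0 * (0 + n0 y)"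
      by (intro tendsto_intros y LIMSEQ_Suc[OF lim_1_over_n])
    then show "(\<lambda>n. \<bar>l\<bar> * n0 (x n - y) + 1 / real (Suc n) * (n0 (x n - y) + n0 y)) \<longlonglongrightarrow> 0" by simp
    have "n0 (T (x n) - (g + of_real l *\<^sub>C y)) \<le> \<bar>l\<bar> * n0 (x n - y) + 1 / real (Suc n) * (n0 (x n - y) + n0 y)" for n
    proof -
      let ?t = "complex_of_real (1 / real (Suc n)) * \<i>"
      have w: "?w n = of_real l + ?t" by (simp add: complex_eq_iff)
      have eq: "T (x n) - (g + of_real l *\<^sub>C y) = of_real l *\<^sub>C (x n - y) + ?t *\<^sub>C x n"
        unfolding Tx w by (simp add: complex_vector.scale_right_diff_distrib complex_vector.scale_left_distrib)
      have "n0 (of_real l *\<^sub>C (x n - y) + ?t *\<^sub>C x n) \<le> n0 (of_real l *\<^sub>C (x n - y)) + n0 (?t *\<^sub>C x n)"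
        using x0 y by (intro H0.nrm_triangle) auto
      also have "\<dots> = \<bar>l\<bar> * n0 (x n - y) + 1 / real (Suc n) * n0 (x n)"
        using x0 y H0.nrm_scale[of "x n - y" "of_real l"] H0.nrm_scale[of "x n" ?t] by (simp add: norm_mult norm_divide del: of_nat_Suc)
      also have "\<dots> \<le> \<bar>l\<bar> * n0 (x n - y) + 1 / real (Suc n) * (n0 (x n - y) + n0 y)"
        using H0.nrm_triangle[of "x n - y" y] x0 y by (intro add_left_mono mult_left_mono) auto
      finally show ?thesis unfolding eq .
    qed
    then show "\<forall>\<^sub>F n in sequentially. n0 (T (x n) - (g + of_real l *\<^sub>C y)) \<le> \<bar>l\<bar> * n0 (x n - y) + 1 / real (Suc n) * (n0 (x n - y) + n0 y)"
      by simp
  qed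
  then have yD: "y \<in> D" "T y = g + of_real l *\<^sub>C y"
    using A.closed_graph[of sequentially x y "g + of_real l *\<^sub>C y"] x0 y g0 by auto
  then have "R (-1) l g = y" using R_shift[of "-1" l y g] l g by simp
  then show "R (-1) l g \<in> D" "T (R (-1) l g) - of_real l *\<^sub>C R (-1) l g = g" using yD by auto
qed

end

section \<open>Constant rank of the spectral density\<close>

text \<open>Operators are functions on the whole ambient type. The value 0 outside
  \<open>vecs X\<close> makes an operator determined by its restriction, so that pointwise addition
  and equality of functions can be used.\<close>

definition ops :: "('a::complex_vector) hspace \<Rightarrow> 'a hspace \<Rightarrow> ('a \<Rightarrow> 'a) set" where
  "ops X Y = {T \<in> bounded_ops X Y. \<forall>f. f \<notin> vecs X \<longrightarrow> T f = 0}"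

definition rst :: "('a::complex_vector) hspace \<Rightarrow> ('a \<Rightarrow> 'a) \<Rightarrow> 'a \<Rightarrow> 'a" where
  "rst X T = (\<lambda>f. if f \<in> vecs X then T f else 0)"

definition csc :: "complex \<Rightarrow> ('a::complex_vector \<Rightarrow> 'a) \<Rightarrow> 'a \<Rightarrow> 'a" where
  "csc c T = (\<lambda>f. c *\<^sub>C T f)"

definition rsc :: "real \<Rightarrow> ('a::complex_vector \<Rightarrow> 'a) \<Rightarrow> 'a \<Rightarrow> 'a" where
  "rsc r T = csc (of_real r) T"

lemma rsc_mult: "rsc (a * b) T = rsc a (rsc b T)"
  and rsc_plus: "rsc (a + b) T = rsc a T + rsc b T"
  and rsc_diff: "rsc a (T - T') = rsc a T - rsc a T'"
  and rsc_one: "rsc 1 T = T"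
  and rsc_zero: "rsc 0 T = 0"
  by (simp_all add: rsc_def csc_def fun_eq_iff complex_vector.scale_left_distrib
      complex_vector.scale_right_diff_distrib)

lemma opsD:
  assumes "T \<in> ops X Y"
  shows "T \<in> bounded_ops X Y" "f \<notin> vecs X \<Longrightarrow> T f = 0"
  using assms by (auto simp: ops_def)

lemma opnorm_cong: "(\<And>f. f \<in> vecs X \<Longrightarrow> T f = T' f) \<Longrightarrow> opnorm X Y T = opnorm X Y T'"
  unfolding opnorm_def by (intro SUP_cong) auto

lemma bounded_opsI:
  assumes "\<And>f. f \<in> vecs X \<Longrightarrow> T f \<in> vecs Y" "\<And>f g. f \<in> vecs X \<Longrightarrow> g \<in> vecs X \<Longrightarrow> T (f + g) = T f + T g"
    "\<And>c f. f \<in> vecs X \<Longrightarrow> T (c *\<^sub>C f) = c *\<^sub>C T f" "\<And>f. f \<in> vecs X \<Longrightarrow> hnorm Y (T f) \<le> K * hnorm X f"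
  shows "T \<in> bounded_ops X Y"
  using assms unfolding bounded_ops_def clinear_on_def by blast

lemma rst_ops: "hilb X \<Longrightarrow> T \<in> bounded_ops X Y \<Longrightarrow> rst X T \<in> ops X Y"
proof -
  assume X: "hilb X" and T: "T \<in> bounded_ops X Y"
  interpret hilb X by fact
  show ?thesis using T unfolding ops_def bounded_ops_def clinear_on_def rst_def by auto
qed

locale hilb2 = X: hilb X + Y: hilb Y for X Y :: "'a::complex_vector hspace"
begin

abbreviation "N \<equiv> opnorm X Y"

lemma ops_in: "T \<in> ops X Y \<Longrightarrow> f \<in> vecs X \<Longrightarrow> T f \<in> vecs Y"
  using opsD(1) bounded_opsD(1)[OF _ X.hilb_axioms] by blast

lemma ops_add: "T \<in> ops X Y \<Longrightarrow> f \<in> vecs X \<Longrightarrow> g \<in> vecs X \<Longrightarrow> T (f + g) = T f + T g"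
  and ops_scale: "T \<in> ops X Y \<Longrightarrow> f \<in> vecs X \<Longrightarrow> T (c *\<^sub>C f) = c *\<^sub>C T f"
  using opsD(1) bounded_opsD(2,3)[OF _ X.hilb_axioms] by blast+

lemma ops_bound: "T \<in> ops X Y \<Longrightarrow> f \<in> vecs X \<Longrightarrow> hnorm Y (T f) \<le> N T * hnorm X f"
  using opnorm_bound[OF X.hilb_axioms Y.hilb_axioms opsD(1)] by blast

lemma N_nonneg: "T \<in> ops X Y \<Longrightarrow> N T \<ge> 0"
  using opnorm_nonneg[OF X.hilb_axioms Y.hilb_axioms opsD(1)] by blast

lemma opsI:
  assumes "\<And>f. f \<in> vecs X \<Longrightarrow> T f \<in> vecs Y" "\<And>f g. f \<in> vecs X \<Longrightarrow> g \<in> vecs X \<Longrightarrow> T (f + g) = T f + T g"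
    "\<And>c f. f \<in> vecs X \<Longrightarrow> T (c *\<^sub>C f) = c *\<^sub>C T f" "\<And>f. f \<in> vecs X \<Longrightarrow> hnorm Y (T f) \<le> K * hnorm X f"
    "\<And>f. f \<notin> vecs X \<Longrightarrow> T f = 0" "K \<ge> 0"
  shows "T \<in> ops X Y" "N T \<le> K"
  using bounded_opsI[OF assms(1-4)] assms(5) opnorm_le[OF X.hilb_axioms assms(4,6)] by (auto simp: ops_def)

lemma csc_ops: "T \<in> ops X Y \<Longrightarrow> csc c T \<in> ops X Y" "T \<in> ops X Y \<Longrightarrow> N (csc c T) \<le> cmod c * N T"
proof -
  assume T: "T \<in> ops X Y"
  have b: "hnorm Y (csc c T f) \<le> (cmod c * N T) * hnorm X f" if "f \<in> vecs X" for f
    using Y.nrm_scale[OF ops_in[OF T that], of c] ops_bound[OF T that] mult_left_mono[of _ _ "cmod c"]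
    by (fastforce simp: csc_def mult.assoc)
  have "cmod c * N T \<ge> 0" using N_nonneg[OF T] by simp
  with b show "csc c T \<in> ops X Y" "N (csc c T) \<le> cmod c * N T"
    using ops_in[OF T] ops_add[OF T] ops_scale[OF T] opsD(2)[OF T]
    by (intro opsI[where K = "cmod c * N T"]; simp add: csc_def complex_vector.scale_right_distrib mult.commute)+
qed

lemma N_csc: "T \<in> ops X Y \<Longrightarrow> N (csc c T) = cmod c * N T"
proof (cases "c = 0")
  case True
  assume T: "T \<in> ops X Y"
  then show ?thesis using True csc_ops[OF T, of c] N_nonneg[of "csc c T"] by simp
next
  case False
  assume T: "T \<in> ops X Y"
  have "csc (1 / c) (csc c T) = T" using False by (simp add: csc_def)
  then have "N T \<le> cmod (1 / c) * N (csc c T)" using csc_ops(2)[OF csc_ops(1)[OF T, of c], of "1 / c"] by simp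
  then have "cmod c * N T \<le> N (csc c T)" using False by (simp add: norm_divide field_simps)
  then show ?thesis using csc_ops(2)[OF T, of c] by simp
qed

sublocale nspace "ops X Y" "opnorm X Y" rsc
proof
  have z: "(0::'a \<Rightarrow> 'a) \<in> ops X Y \<and> N 0 \<le> 0"
    using opsI[of "0::'a \<Rightarrow> 'a" 0] by simp
  then show "0 \<in> ops X Y" by blast
  then show "N 0 = 0" using z N_nonneg[of 0] by simp
next
  fix a b assume a: "a \<in> ops X Y" and b: "b \<in> ops X Y"
  have bound: "hnorm Y (a f + b f) \<le> (N a + N b) * hnorm X f" if "f \<in> vecs X" for f
    using Y.nrm_triangle[OF ops_in[OF a that] ops_in[OF b that]] ops_bound[OF a that] ops_bound[OF b that]
    by (simp add: algebra_simps)
  have nn: "N a + N b \<ge> 0" using N_nonneg[OF a] N_nonneg[OF b] by simp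
  show "a + b \<in> ops X Y" "N (a + b) \<le> N a + N b"
    using bound nn ops_in[OF a] ops_add[OF a] ops_scale[OF a] opsD(2)[OF a] ops_in[OF b] ops_add[OF b] ops_scale[OF b] opsD(2)[OF b]
    by (intro opsI[where K = "N a + N b"]; simp add: complex_vector.scale_right_distrib algebra_simps)+
next
  fix a b assume a: "a \<in> ops X Y" and b: "b \<in> ops X Y"
  have bound: "hnorm Y (a f - b f) \<le> (N a + N b) * hnorm X f" if "f \<in> vecs X" for f
    using Y.nrm_triangle_diff[OF ops_in[OF a that] ops_in[OF b that]] ops_bound[OF a that] ops_bound[OF b that]
    by (simp add: algebra_simps)
  have nn: "N a + N b \<ge> 0" using N_nonneg[OF a] N_nonneg[OF b] by simp
  show "a - b \<in> ops X Y"
    using bound nn ops_in[OF a] ops_add[OF a] ops_scale[OF a] opsD(2)[OF a] ops_in[OF b] ops_add[OF b] ops_scale[OF b] opsD(2)[OF b]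
    by (intro opsI[where K = "N a + N b"]; simp add: complex_vector.scale_right_diff_distrib algebra_simps)
next
  fix a b assume a: "a \<in> ops X Y" and b: "b \<in> ops X Y"
  fix r show "rsc r a \<in> ops X Y" unfolding rsc_def using csc_ops(1)[OF a] .
  show "N (rsc r a) = \<bar>r\<bar> * N a" unfolding rsc_def using N_csc[OF a] by simp
  show "rsc r (a + b) = rsc r a + rsc r b" by (simp add: rsc_def csc_def fun_eq_iff complex_vector.scale_right_distrib)
  show "N a \<ge> 0" using N_nonneg[OF a] .
  have "- a = csc (- 1) a" by (simp add: csc_def fun_eq_iff)
  then show "N (- a) = N a" using N_csc[OF a, of "-1"] by simp
qed

end

lemma nbilinear_compose:
  assumes "hilb X" "hilb Y" "hilb Z"
  shows "nbilinear (ops Y Z) (opnorm Y Z) rsc (ops X Y) (opnorm X Y) rsc (ops X Z) (opnorm X Z) rsc (\<lambda>S T. rst X (\<lambda>f. S (T f))) 1"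
proof -
  interpret X: hilb X by fact
  interpret Y: hilb Y by fact
  interpret Z: hilb Z by fact
  interpret XY: hilb2 X Y by unfold_locales
  interpret YZ: hilb2 Y Z by unfold_locales
  interpret XZ: hilb2 X Z by unfold_locales
  show ?thesis
  proof (intro nbilinear.intro nbilinear_axioms.intro YZ.nspace_axioms XY.nspace_axioms XZ.nspace_axioms)
    fix S T assume S: "S \<in> ops Y Z" and T: "T \<in> ops X Y"
    have b: "hnorm Z (S (T f)) \<le> (opnorm Y Z S * opnorm X Y T) * hnorm X f" if "f \<in> vecs X" for f
      using YZ.ops_bound[OF S XY.ops_in[OF T that]] XY.ops_bound[OF T that] mult_left_mono[OF _ YZ.N_nonneg[OF S]]
      by (fastforce simp: mult.assoc)
    have nn: "opnorm Y Z S * opnorm X Y T \<ge> 0" using YZ.N_nonneg[OF S] XY.N_nonneg[OF T] by simp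
    note f = XY.ops_in[OF T] XY.ops_add[OF T] XY.ops_scale[OF T] YZ.ops_in[OF S] YZ.ops_add[OF S] YZ.ops_scale[OF S]
    have "rst X (\<lambda>f. S (T f)) \<in> ops X Z" "opnorm X Z (rst X (\<lambda>f. S (T f))) \<le> opnorm Y Z S * opnorm X Y T"
      using b nn f by (intro XZ.opsI[where K = "opnorm Y Z S * opnorm X Y T"]; simp add: rst_def)+
    then show "rst X (\<lambda>f. S (T f)) \<in> ops X Z" "opnorm X Z (rst X (\<lambda>f. S (T f))) \<le> 1 * opnorm Y Z S * opnorm X Y T"
      by simp_all
  next
    fix S T r assume S: "S \<in> ops Y Z" and T: "T \<in> ops X Y"
    show "rst X (\<lambda>f. rsc r S (T f)) = rsc r (rst X (\<lambda>f. S (T f)))" by (auto simp: rst_def rsc_def csc_def)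
    show "rst X (\<lambda>f. S (rsc r T f)) = rsc r (rst X (\<lambda>f. S (T f)))"
      using XY.ops_in[OF T] YZ.ops_scale[OF S] by (auto simp: rst_def rsc_def csc_def)
  next
    fix S T T' assume S: "S \<in> ops Y Z" and T: "T \<in> ops X Y" "T' \<in> ops X Y"
    show "rst X (\<lambda>f. S ((T + T') f)) = rst X (\<lambda>f. S (T f)) + rst X (\<lambda>f. S (T' f))"
      using XY.ops_in[OF T(1)] XY.ops_in[OF T(2)] YZ.ops_add[OF S] by (auto simp: rst_def fun_eq_iff)
  qed (auto simp: rst_def fun_eq_iff)
qed

text \<open>The families \<open>rsc a (g j l)\<close> with \<open>\<bar>a\<bar> \<le> 1\<close> are
  closed under differentiation: the direction \<open>v\<close> turns \<open>a\<close> into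
  \<open>v * a\<close> and \<open>j\<close> into \<open>Suc j\<close>.\<close>

lemma Ck_op_UC:
  fixes F :: "real \<Rightarrow> 'a::complex_vector \<Rightarrow> 'a"
  assumes X: "hilb X" and Y: "hilb Y" and F: "Ck_op X Y k J F"
  shows "UC (ops X Y) (opnorm X Y) rsc k J {\<lambda>l. rst X (F l)}"
proof -
  interpret hilb2 X Y by (intro hilb2.intro X Y)
  obtain G where G0: "\<forall>lam\<in>J. \<forall>f\<in>vecs X. G 0 lam f = F lam f"
    and G1: "\<forall>j\<le>k. \<forall>lam\<in>J. G j lam \<in> bounded_ops X Y \<and>
          ((\<lambda>\<mu>. opnorm X Y (\<lambda>f. G j \<mu> f - G j lam f)) \<longlongrightarrow> 0) (at lam within J)"
    and G2: "\<forall>j<k. \<forall>lam\<in>J.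
          ((\<lambda>\<mu>. opnorm X Y (\<lambda>f. of_real (1 / (\<mu> - lam)) *\<^sub>C (G j \<mu> f - G j lam f) - G (Suc j) lam f))
             \<longlongrightarrow> 0) (at lam within J)"
    using F unfolding Ck_op_def by (elim exE conjE) (rule that)
  define g where "g = (\<lambda>j l. rst X (G j l))"
  have g_in: "g j l \<in> ops X Y" if "j \<le> k" "l \<in> J" for j l
    using G1 that rst_ops[OF X] by (simp add: g_def)
  have cont: "\<forall>\<^sub>F y in nw x J. N (g j y - g j x) \<le> e" if j: "j \<le> k" and x: "x \<in> J" and e: "e > 0" for j x e
  proof -
    have "\<forall>\<^sub>F \<mu> in at x within J. opnorm X Y (\<lambda>f. G j \<mu> f - G j x f) < e"
      using G1 j x e by (intro order_tendstoD(2)) auto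
    then obtain d where d: "d > 0" "\<forall>y\<in>J. y \<noteq> x \<and> dist y x < d \<longrightarrow> opnorm X Y (\<lambda>f. G j y f - G j x f) < e"
      unfolding eventually_at by blast
    have "N (g j y - g j x) \<le> e" if y: "y \<in> J" "dist y x < d" for y
    proof (cases "y = x")
      case False
      have "N (g j y - g j x) = opnorm X Y (\<lambda>f. G j y f - G j x f)"
        by (rule opnorm_cong) (simp add: g_def rst_def)
      then show ?thesis using d(2) y False by (simp add: less_imp_le)
    qed (use e in simp)
    then show ?thesis unfolding eventually_nw using d(1) by blast
  qed
  have diff: "\<forall>\<^sub>F y in nw x J. N (g j y - g j x - rsc (y - x) (g (Suc j) x)) \<le> e * \<bar>y - x\<bar>"
    if j: "j < k" and x: "x \<in> J" and e: "e > 0" for j x e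
  proof -
    let ?Q = "\<lambda>y f. of_real (1 / (y - x)) *\<^sub>C (G j y f - G j x f) - G (Suc j) x f"
    have "\<forall>\<^sub>F \<mu> in at x within J. opnorm X Y (?Q \<mu>) < e"
      using G2 j x e by (intro order_tendstoD(2)) auto
    then obtain d where d: "d > 0" "\<forall>y\<in>J. y \<noteq> x \<and> dist y x < d \<longrightarrow> opnorm X Y (?Q y) < e"
      unfolding eventually_at by blast
    have "N (g j y - g j x - rsc (y - x) (g (Suc j) x)) \<le> e * \<bar>y - x\<bar>" if y: "y \<in> J" "dist y x < d" for y
    proof (cases "y = x")
      case True
      then show ?thesis using e by (simp add: rsc_zero)
    next
      case False
      let ?q = "rsc (1 / (y - x)) (g j y - g j x) - g (Suc j) x"
      have in': "?q \<in> ops X Y" using g_in j x y by (intro diff_in sc_in) auto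
      have "g j y - g j x - rsc (y - x) (g (Suc j) x) = rsc (y - x) ?q"
        using False by (simp add: rsc_diff rsc_mult[symmetric] rsc_one)
      then have "N (g j y - g j x - rsc (y - x) (g (Suc j) x)) = \<bar>y - x\<bar> * N ?q"
        using N_sc[OF in'] by simp
      moreover have "N ?q = opnorm X Y (?Q y)" by (rule opnorm_cong) (simp add: g_def rst_def rsc_def csc_def)
      then have "N ?q \<le> e" using d(2) y False by (simp add: less_imp_le)
      then have "\<bar>y - x\<bar> * N ?q \<le> \<bar>y - x\<bar> * e" by (rule mult_left_mono) simp
      ultimately show ?thesis by (metis mult.commute)
    qed
    then show ?thesis unfolding eventually_nw using d(1) by blast
  qed
  let ?I = "{a::real. \<bar>a\<bar> \<le> 1}"
  have base: "equicont (ops X Y) N J ?I (\<lambda>a l. rsc a (g j l))" if j: "j \<le> k" for j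
    unfolding equicont_def
  proof (intro conjI ballI allI impI)
    fix a x assume "a \<in> ?I" "x \<in> J"
    then show "rsc a (g j x) \<in> ops X Y" using g_in[OF j] sc_in by blast
  next
    fix x assume x: "x \<in> J"
    have "N (rsc a (g j x)) \<le> N (g j x)" if "a \<in> ?I" for a
      using N_sc[OF g_in[OF j x], of a] N_nonneg[OF g_in[OF j x]] that mult_right_mono[of "\<bar>a\<bar>" 1 "N (g j x)"] by simp
    then show "\<exists>K. \<forall>a\<in>?I. N (rsc a (g j x)) \<le> K" by blast
  next
    fix x e assume x: "x \<in> J" and e: "(e::real) > 0"
    show "\<forall>\<^sub>F y in nw x J. \<forall>a\<in>?I. N (rsc a (g j y) - rsc a (g j x)) \<le> e"
      using cont[OF j x e] eventually_nw_in
    proof eventually_elim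
      case (elim y)
      show ?case
      proof
        fix a assume a: "a \<in> ?I"
        have in': "g j y - g j x \<in> ops X Y" using g_in[OF j] x elim by auto
        have "N (rsc a (g j y) - rsc a (g j x)) = \<bar>a\<bar> * N (g j y - g j x)"
          unfolding rsc_diff[symmetric] by (rule N_sc[OF in'])
        also have "\<dots> \<le> 1 * e" using a elim N_nonneg[OF in'] by (intro mult_mono) auto
        finally show "N (rsc a (g j y) - rsc a (g j x)) \<le> e" by simp
      qed
    qed
  qed
  have "UC (ops X Y) N rsc n J ((\<lambda>a l. rsc a (g j l)) ` ?I)" if "j + n \<le> k" for j n
    using that
  proof (induction n arbitrary: j)
    case 0
    then show ?case using base[of j] by (simp add: equicont_image)
  next
    case (Suc n)
    have j: "j < k" "j \<le> k" using Suc.prems by auto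
    show ?case
    proof (rule UC_SucI[OF base[OF j(2)], where D = "\<lambda>a x v. rsc (v * a) (g (Suc j) x)"])
      show "equidiff (ops X Y) N rsc J ?I (\<lambda>a l. rsc a (g j l)) (\<lambda>a x v. rsc (v * a) (g (Suc j) x))"
        unfolding equidiff_def
      proof (intro conjI ballI allI impI)
        fix x e assume x: "x \<in> J" and e: "(e::real) > 0"
        show "\<forall>\<^sub>F y in nw x J. \<forall>a\<in>?I. N (rsc a (g j y) - rsc a (g j x) - rsc ((y - x) * a) (g (Suc j) x)) \<le> e * norm (y - x)"
          using diff[OF j(1) x e] eventually_nw_in
        proof eventually_elim
          case (elim y)
          show ?case
          proof
            fix a assume a: "a \<in> ?I"
            let ?q = "g j y - g j x - rsc (y - x) (g (Suc j) x)"
            have in': "?q \<in> ops X Y" using g_in j x elim by (intro diff_in sc_in) auto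
            have "rsc a (g j y) - rsc a (g j x) - rsc ((y - x) * a) (g (Suc j) x) = rsc a ?q"
              by (simp add: rsc_diff rsc_mult[symmetric] mult.commute)
            then have "N (rsc a (g j y) - rsc a (g j x) - rsc ((y - x) * a) (g (Suc j) x)) = \<bar>a\<bar> * N ?q"
              using N_sc[OF in'] by simp
            also have "\<dots> \<le> 1 * (e * \<bar>y - x\<bar>)" using a elim N_nonneg[OF in'] by (intro mult_mono) auto
            finally show "N (rsc a (g j y) - rsc a (g j x) - rsc ((y - x) * a) (g (Suc j) x)) \<le> e * norm (y - x)" by simp
          qed
        qed
      next
        fix a x v assume "a \<in> ?I" "x \<in> J"
        then show "rsc (v * a) (g (Suc j) x) \<in> ops X Y" using g_in[of "Suc j" x] j sc_in by simp
      next
        fix a x u v show "rsc ((u + v) * a) (g (Suc j) x) = rsc (u * a) (g (Suc j) x) + rsc (v * a) (g (Suc j) x)"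
          by (simp only: distrib_right rsc_plus)
      next
        fix a x r v show "rsc ((r *\<^sub>R v) * a) (g (Suc j) x) = rsc r (rsc (v * a) (g (Suc j) x))"
          unfolding rsc_mult[symmetric] by (simp add: mult.assoc)
      qed
      show "UC (ops X Y) N rsc n J (dfam ?I (\<lambda>a x v. rsc (v * a) (g (Suc j) x)))"
      proof (rule UC_subset[OF Suc.IH[of "Suc j"]])
        show "dfam ?I (\<lambda>a x v. rsc (v * a) (g (Suc j) x)) \<subseteq> (\<lambda>a l. rsc a (g (Suc j) l)) ` ?I"
        proof
          fix f assume "f \<in> dfam ?I (\<lambda>a x v. rsc (v * a) (g (Suc j) x))"
          then obtain a v where "a \<in> ?I" "norm (v::real) \<le> 1" "f = (\<lambda>x. rsc (v * a) (g (Suc j) x))" by (rule dfamE)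
          moreover from this have "\<bar>v * a\<bar> \<le> 1" by (auto simp: abs_mult intro: mult_le_one)
          ultimately show "f \<in> (\<lambda>a l. rsc a (g (Suc j) l)) ` ?I" by (intro image_eqI[of _ _ "v * a"]) auto
        qed
      qed (use Suc.prems in simp)
    qed
  qed
  from this[of 0 k] show ?thesis
  proof (rule UC_refine[OF _ subset_refl])
    fix q assume "q \<in> {\<lambda>l. rst X (F l)}"
    then show "\<exists>f\<in>(\<lambda>a l. rsc a (g 0 l)) ` ?I. \<forall>x\<in>J. q x = f x"
      using G0 by (intro bexI[of _ "\<lambda>l. rsc 1 (g 0 l)"]) (auto simp: g_def rst_def rsc_one fun_eq_iff intro!: image_eqI[of _ _ 1])
  qed simp
qed

lemma has_cdim_family_spans:
  fixes w :: "nat \<Rightarrow> 'a::complex_vector"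
  assumes V: "has_cdim V m" and w: "\<And>i. i < m \<Longrightarrow> w i \<in> V"
    and ind: "\<And>c. (\<Sum>i<m. c i *\<^sub>C w i) = 0 \<Longrightarrow> \<forall>i<m. c i = 0" and v: "v \<in> V"
  shows "\<exists>c. v = (\<Sum>i<m. c i *\<^sub>C w i)"
proof -
  obtain E where E: "finite E" "card E = m" "\<not> complex_vector.dependent E" "cspan E = V"
    using V unfolding has_cdim_def by blast
  have inj: "inj_on w {..<m}"
  proof (rule inj_onI)
    fix i j assume ij: "i \<in> {..<m}" "j \<in> {..<m}" "w i = w j"
    show "i = j"
    proof (rule ccontr)
      assume ne: "i \<noteq> j"
      \<comment> \<open>If two members with different indices coincided, the coefficients 1 and -1
        would give a nontrivial relation.\<close>
      have "(\<Sum>k<m. (if k = i then 1 else if k = j then -1 else 0) *\<^sub>C w k)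
         = (\<Sum>k<m. (if k = i then w i else 0) + (if k = j then - w j else 0))"
        using ne by (intro sum.cong) auto
      also have "\<dots> = w i - w j" using ij by (simp add: sum.distrib)
      finally have z: "(\<Sum>k<m. (if k = i then 1 else if k = j then -1 else 0) *\<^sub>C w k) = 0" using ij(3) by simp
      from ind[OF z, rule_format, of i] ij show False by simp
    qed
  qed
  let ?W = "w ` {..<m}"
  have indW: "\<not> complex_vector.dependent ?W"
  proof -
    have "\<forall>x\<in>?W. u x = 0" if "(\<Sum>x\<in>?W. u x *\<^sub>C x) = 0" for u
    proof -
      have "(\<Sum>i<m. u (w i) *\<^sub>C w i) = 0" using that by (simp add: sum.reindex[OF inj])
      from ind[OF this] show ?thesis by auto
    qed
    then show ?thesis using complex_vector.dependent_finite[of ?W] by auto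
  qed
  have "v \<in> cspan ?W"
  proof (rule ccontr)
    assume nv: "v \<notin> cspan ?W"
    then have "\<not> complex_vector.dependent (insert v ?W)" using indW by (intro complex_vector.independent_insertI)
    moreover have "insert v ?W \<subseteq> cspan E" using v w E by auto
    ultimately have "card (insert v ?W) \<le> card E" using complex_vector.independent_span_bound[OF E(1)] by blast
    moreover have "v \<notin> ?W" using nv complex_vector.span_base[of v ?W] by blast
    then have "card (insert v ?W) = Suc m" using card_image[OF inj] by simp
    ultimately show False using E by simp
  qed
  then obtain u where "v = (\<Sum>x\<in>?W. u x *\<^sub>C x)" using complex_vector.span_finite[of ?W] by auto
  then show ?thesis by (intro exI[of _ "\<lambda>i. u (w i)"]) (simp add: sum.reindex[OF inj])
qed

section \<open>Smoothness of the boundary values in operator norm\<close>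

context gelfand
begin

sublocale PM: hilb2 "S s" "S (- s)" by unfold_locales
sublocale MP: hilb2 "S (- s)" "S s" by unfold_locales
sublocale PP: hilb2 "S s" "S s" by unfold_locales

abbreviation "Npm \<equiv> opnorm (S s) (S (- s))"
abbreviation "Nmp \<equiv> opnorm (S (- s)) (S s)"
abbreviation "Npp \<equiv> opnorm (S s) (S s)"
abbreviation "opm \<equiv> ops (S s) (S (- s))"
abbreviation "omp \<equiv> ops (S (- s)) (S s)"
abbreviation "opp \<equiv> ops (S s) (S s)"

lemma Vp_sum: "(\<And>i. i \<in> J \<Longrightarrow> f i \<in> Vp) \<Longrightarrow> sum f J \<in> Vp"
  by (rule complex_vector.subspace_sum[OF Hp.csubspace_vecs])

lemma np_sum: "(\<And>i. i \<in> J \<Longrightarrow> f i \<in> Vp) \<Longrightarrow> np (sum f J) \<le> (\<Sum>i\<in>J. np (f i))"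
proof (induction J rule: infinite_finite_induct)
  case (insert i J)
  then have "np (f i + sum f J) \<le> np (f i) + np (sum f J)" by (intro Hp.nrm_triangle Vp_sum) auto
  then show ?case using insert by simp
qed auto

end

context lap
begin

lemma UC_R: "sg \<in> {1, -1} \<Longrightarrow> UC opm Npm rsc k I {\<lambda>l. rst (S s) (R sg l)}"
  using lap unfolding limiting_absorption_def by (intro Ck_op_UC Hp.hilb_axioms Hm.hilb_axioms) blast

lemma UC_R_combination:
  "UC opm Npm rsc k I {\<lambda>l. rst (S s) (\<lambda>f. a *\<^sub>C R (-1) l f + b *\<^sub>C R 1 l f)}"
proof -
  have 1: "UC opm Npm rsc k I ((\<lambda>f l. csc c (f l)) ` {\<lambda>l. rst (S s) (R sg l)})" if "sg \<in> {1, -1}" for c sg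
  proof (rule UC_linear[OF PM.nspace_axioms PM.nspace_axioms _ _ _ _ UC_R[OF that]])
    show "csc c (T + T') = csc c T + csc c T'" for T T' :: "'a \<Rightarrow> 'a"
      by (simp add: csc_def fun_eq_iff complex_vector.scale_right_distrib)
    show "csc c (rsc r T) = rsc r (csc c T)" for r and T :: "'a \<Rightarrow> 'a"
      by (simp add: csc_def rsc_def fun_eq_iff mult.commute)
    show "Npm (csc c T) \<le> cmod c * Npm T" if "T \<in> opm" for T using PM.csc_ops(2)[OF that] .
  qed (rule PM.csc_ops(1))
  have "UC opm Npm rsc k I (fam2 (+) ((\<lambda>f l. csc a (f l)) ` {\<lambda>l. rst (S s) (R (-1) l)}) ((\<lambda>f l. csc b (f l)) ` {\<lambda>l. rst (S s) (R 1 l)}))"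
    by (intro PM.UC_add 1) auto
  then show ?thesis
  proof (rule UC_subset)
    have "(\<lambda>l. csc a (rst (S s) (R (-1) l)) + csc b (rst (S s) (R 1 l))) \<in>
      fam2 (+) ((\<lambda>f l. csc a (f l)) ` {\<lambda>l. rst (S s) (R (-1) l)}) ((\<lambda>f l. csc b (f l)) ` {\<lambda>l. rst (S s) (R 1 l)})"
      by (rule fam2I) auto
    moreover have "(\<lambda>l. csc a (rst (S s) (R (-1) l)) + csc b (rst (S s) (R 1 l))) =
        (\<lambda>l. rst (S s) (\<lambda>f. a *\<^sub>C R (-1) l f + b *\<^sub>C R 1 l f))"
      by (auto simp: csc_def rst_def fun_eq_iff)
    ultimately show "{\<lambda>l. rst (S s) (\<lambda>f. a *\<^sub>C R (-1) l f + b *\<^sub>C R 1 l f)} \<subseteq>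
      fam2 (+) ((\<lambda>f l. csc a (f l)) ` {\<lambda>l. rst (S s) (R (-1) l)}) ((\<lambda>f l. csc b (f l)) ` {\<lambda>l. rst (S s) (R 1 l)})" by simp
  qed
qed

text \<open>The mean is taken because \<open>C\<close> exchanges the two boundary values, so that
  the mean is a real operator.\<close>

definition R0 :: "real \<Rightarrow> 'a \<Rightarrow> 'a" where
  "R0 l = rst (S s) (\<lambda>f. (1/2) *\<^sub>C R (-1) l f + (1/2) *\<^sub>C R 1 l f)"

definition \<Delta>0 :: "real \<Rightarrow> 'a \<Rightarrow> 'a" where "\<Delta>0 l = rst (S s) (\<Delta> l)"

lemma UC_R0: "UC opm Npm rsc k I {R0}"
  using UC_R_combination unfolding R0_def[abs_def] .

lemma UC_\<Delta>0: "UC opm Npm rsc k I {\<Delta>0}"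
proof -
  let ?c = "1 / (2 * of_real pi * \<i>)"
  have "\<Delta>0 = (\<lambda>l. rst (S s) (\<lambda>f. ?c *\<^sub>C R (-1) l f + (- ?c) *\<^sub>C R 1 l f))"
    unfolding \<Delta>0_def spectral_delta_def[abs_def] by (simp add: complex_vector.scale_right_diff_distrib)
  then show ?thesis using UC_R_combination[of ?c "- ?c"] by simp
qed

lemma \<Delta>0_ops: "l \<in> I \<Longrightarrow> \<Delta>0 l \<in> opm"
  using equicontD(1)[OF UC_equicont[OF UC_\<Delta>0], of \<Delta>0 l] by simp

lemma R0_ops: "l \<in> I \<Longrightarrow> R0 l \<in> opm"
  using equicontD(1)[OF UC_equicont[OF UC_R0], of R0 l] by simp

lemma B_add_left: "l \<in> I \<Longrightarrow> f \<in> Vp \<Longrightarrow> f' \<in> Vp \<Longrightarrow> g \<in> Vp \<Longrightarrow> B l (f + f') g = B l f g + B l f' g"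
  and B_scale_left: "l \<in> I \<Longrightarrow> f \<in> Vp \<Longrightarrow> g \<in> Vp \<Longrightarrow> B l (c *\<^sub>C f) g = c * B l f g"
  and B_add_right: "l \<in> I \<Longrightarrow> f \<in> Vp \<Longrightarrow> g \<in> Vp \<Longrightarrow> g' \<in> Vp \<Longrightarrow> B l f (g + g') = B l f g + B l f g'"
  and B_scale_right: "l \<in> I \<Longrightarrow> f \<in> Vp \<Longrightarrow> g \<in> Vp \<Longrightarrow> B l f (c *\<^sub>C g) = cnj c * B l f g"
  unfolding B_def
  by (simp_all add: \<Delta>_add \<Delta>_scale \<Delta>_in pair_m_add_left pair_m_scale_left pair_m_add_right pair_m_scale_right)

lemma B_zero: "l \<in> I \<Longrightarrow> f \<in> Vp \<Longrightarrow> B l 0 f = 0" "l \<in> I \<Longrightarrow> f \<in> Vp \<Longrightarrow> B l f 0 = 0"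
  using B_scale_left[of l 0 f 0] B_scale_right[of l f 0 0] by simp_all

lemma B_sum_left: "l \<in> I \<Longrightarrow> (\<And>i. i \<in> J \<Longrightarrow> f i \<in> Vp) \<Longrightarrow> g \<in> Vp \<Longrightarrow> B l (sum f J) g = (\<Sum>i\<in>J. B l (f i) g)"
proof (induction J rule: infinite_finite_induct)
  case (insert i J)
  then have "B l (f i + sum f J) g = B l (f i) g + B l (sum f J) g" by (intro B_add_left Vp_sum) auto
  then show ?case using insert by simp
qed (auto simp: B_zero)

lemma B_sum_right: "l \<in> I \<Longrightarrow> (\<And>i. i \<in> J \<Longrightarrow> f i \<in> Vp) \<Longrightarrow> g \<in> Vp \<Longrightarrow> B l g (sum f J) = (\<Sum>i\<in>J. B l g (f i))"
proof (induction J rule: infinite_finite_induct)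
  case (insert i J)
  then have "B l g (f i + sum f J) = B l g (f i) + B l g (sum f J)" by (intro B_add_right Vp_sum) auto
  then show ?case using insert by simp
qed (auto simp: B_zero)

lemma \<Delta>_zero: "l \<in> I \<Longrightarrow> \<Delta> l 0 = 0"
  using \<Delta>_scale[of l 0 0] by simp

lemma \<Delta>_sum: "l \<in> I \<Longrightarrow> (\<And>i. i \<in> J \<Longrightarrow> f i \<in> Vp) \<Longrightarrow> \<Delta> l (sum f J) = (\<Sum>i\<in>J. \<Delta> l (f i))"
proof (induction J rule: infinite_finite_induct)
  case (insert i J)
  then have "\<Delta> l (f i + sum f J) = \<Delta> l (f i) + \<Delta> l (sum f J)" by (intro \<Delta>_add Vp_sum) auto
  then show ?case using insert by simp
qed (auto simp: \<Delta>_zero)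

text \<open>The bound is uniform in \<open>f\<close> and \<open>g\<close>, so continuity and
  Lipschitz estimates of the density in operator norm carry over to the forms
  \<open>B\<close>.\<close>

lemma B_diff_bound:
  "\<exists>K>0. \<forall>x\<in>I. \<forall>y\<in>I. \<forall>f\<in>Vp. \<forall>g\<in>Vp. cmod (B x f g - B y f g) \<le> K * Npm (\<Delta>0 x - \<Delta>0 y) * np f * np g"
proof -
  obtain K where K: "K > 0" "\<forall>f\<in>Vm. \<forall>g\<in>Vp. cmod (pair f g) \<le> K * nm f * np g" using pair_bound by blast
  have "cmod (B x f g - B y f g) \<le> K * Npm (\<Delta>0 x - \<Delta>0 y) * np f * np g"
    if xy: "x \<in> I" "y \<in> I" and fg: "f \<in> Vp" "g \<in> Vp" for x y f g
  proof -
    have D: "\<Delta>0 x - \<Delta>0 y \<in> opm" using \<Delta>0_ops xy by simp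
    have "B x f g - B y f g = pair ((\<Delta>0 x - \<Delta>0 y) f) g"
      unfolding B_def using fg xy \<Delta>_in by (simp add: \<Delta>0_def rst_def pair_m_diff_left)
    also have "cmod \<dots> \<le> K * nm ((\<Delta>0 x - \<Delta>0 y) f) * np g" using K PM.ops_in[OF D fg(1)] fg by blast
    also have "\<dots> \<le> K * (Npm (\<Delta>0 x - \<Delta>0 y) * np f) * np g"
      using PM.ops_bound[OF D fg(1)] K fg by (intro mult_right_mono mult_left_mono) auto
    finally show ?thesis by (simp add: mult.assoc)
  qed
  then show ?thesis using K(1) by blast
qed

end

text \<open>The \<open>e i\<close> span a complement of the kernel of \<open>\<Delta> l0\<close> in
  \<open>Vp\<close>. By continuity and constant rank the same complement serves for
  \<open>\<Delta> x\<close> with \<open>x\<close> near \<open>l0\<close>.\<close>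

locale lap_rank = lap S pair C s D T l0 \<delta>\<^sub>1 k
  for S :: "real \<Rightarrow> 'a::complex_vector hspace" and pair C s D T l0 \<delta>\<^sub>1 k +
  fixes m :: nat and e :: "nat \<Rightarrow> 'a"
  assumes k: "k \<ge> 1" and rank: "\<And>l. l \<in> I \<Longrightarrow> has_cdim (\<Delta> l ` Vp) m"
    and e_in: "\<And>i. i < m \<Longrightarrow> e i \<in> Vp"
    and e_orth: "\<And>i j. i < m \<Longrightarrow> j < m \<Longrightarrow> B l0 (e i) (e j) = (if i = j then 1 else 0)"
begin

definition E :: "(nat \<Rightarrow> complex) \<Rightarrow> 'a" where "E c = (\<Sum>i<m. c i *\<^sub>C e i)"

abbreviation L2 :: "(nat \<Rightarrow> complex) \<Rightarrow> real" where "L2 c \<equiv> L2_set (\<lambda>i. cmod (c i)) {..<m}"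

lemma E_in: "E c \<in> Vp" unfolding E_def using e_in by (intro Vp_sum) auto

lemma np_E: "np (E c) \<le> L2_set (\<lambda>i. np (e i)) {..<m} * L2 c"
proof -
  have "np (E c) \<le> (\<Sum>i<m. np (c i *\<^sub>C e i))" unfolding E_def using e_in by (intro np_sum) auto
  also have "\<dots> = (\<Sum>i<m. \<bar>np (e i)\<bar> * \<bar>cmod (c i)\<bar>)" using e_in by (intro sum.cong) (auto simp: Hp.nrm_scale)
  also have "\<dots> \<le> L2_set (\<lambda>i. np (e i)) {..<m} * L2 c" by (rule L2_set_mult_ineq)
  finally show ?thesis .
qed

lemma E_terms: "i \<in> {..<m} \<Longrightarrow> c i *\<^sub>C e i \<in> Vp" using e_in by auto

lemma l0_in: "l0 \<in> I" using \<delta>\<^sub>1 by simp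

lemma B_E: "Re (B l0 (E c) (E c)) = (L2 c)\<^sup>2"
proof -
  have "B l0 (E c) (E c) = (\<Sum>i<m. \<Sum>j<m. c i * (cnj (c j) * B l0 (e i) (e j)))"
  proof -
    have "B l0 (E c) (E c) = (\<Sum>i<m. B l0 (c i *\<^sub>C e i) (E c))"
      using B_sum_left[OF l0_in E_terms E_in] unfolding E_def .
    also have "\<dots> = (\<Sum>i<m. \<Sum>j<m. B l0 (c i *\<^sub>C e i) (c j *\<^sub>C e j))"
    proof (rule sum.cong[OF refl])
      fix i assume "i \<in> {..<m}"
      from B_sum_right[OF l0_in E_terms E_terms[OF this]]
      show "B l0 (c i *\<^sub>C e i) (E c) = (\<Sum>j<m. B l0 (c i *\<^sub>C e i) (c j *\<^sub>C e j))" unfolding E_def .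
    qed
    also have "\<dots> = (\<Sum>i<m. \<Sum>j<m. c i * (cnj (c j) * B l0 (e i) (e j)))"
    proof (intro sum.cong refl)
      fix i j assume "i \<in> {..<m}" "j \<in> {..<m}"
      then have "e i \<in> Vp" "e j \<in> Vp" using e_in by auto
      then show "B l0 (c i *\<^sub>C e i) (c j *\<^sub>C e j) = c i * (cnj (c j) * B l0 (e i) (e j))"
        using B_scale_left[OF l0_in, of "e i" "c j *\<^sub>C e j" "c i"] B_scale_right[OF l0_in, of "e i" "e j" "c j"] by simp
    qed
    finally show ?thesis .
  qed
  also have "\<dots> = (\<Sum>i<m. \<Sum>j<m. if i = j then c i * cnj (c i) else 0)"
    by (intro sum.cong refl) (auto simp: e_orth)
  also have "\<dots> = (\<Sum>i<m. of_real ((cmod (c i))\<^sup>2))" by (simp add: complex_norm_square del: of_real_power)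
  finally show ?thesis by (simp add: L2_set_def sum_nonneg del: of_real_power)
qed

lemma B_E_lower: "\<exists>d>0. \<forall>x. \<bar>x - l0\<bar> < d \<longrightarrow> x \<in> I \<and> (\<forall>c. Re (B x (E c) (E c)) \<ge> (L2 c)\<^sup>2 / 2)"
proof -
  obtain K where K: "K > 0" "\<forall>x\<in>I. \<forall>y\<in>I. \<forall>f\<in>Vp. \<forall>g\<in>Vp. cmod (B x f g - B y f g) \<le> K * Npm (\<Delta>0 x - \<Delta>0 y) * np f * np g"
    using B_diff_bound by blast
  define M where "M = L2_set (\<lambda>i. np (e i)) {..<m}"
  have M0: "M \<ge> 0" by (simp add: M_def)
  \<comment> \<open>Chosen so that on the vectors \<open>E c\<close> the form changes by at most
    half of its value at \<open>l0\<close>; \<open>M\<^sup>2 + 1\<close> avoids a division by 0 when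
    \<open>M = 0\<close>.\<close>
  define \<eta> where "\<eta> = 1 / (2 * K * (M\<^sup>2 + 1))"
  have den: "2 * K * (M\<^sup>2 + 1) > 0" using K(1) by (intro mult_pos_pos add_nonneg_pos) auto
  have "K * (1 / (2 * K * a)) * a = 1 / 2" if "a \<noteq> 0" for a using K(1) that by simp
  moreover have "M\<^sup>2 + 1 \<noteq> 0" using zero_le_power2[of M] by linarith
  ultimately have \<eta>: "\<eta> > 0" "K * \<eta> * (M\<^sup>2 + 1) = 1 / 2" using den unfolding \<eta>_def by auto
  obtain d where d: "d > 0" "\<forall>y\<in>I. dist y l0 < d \<longrightarrow> (\<forall>f\<in>{\<Delta>0}. Npm (f y - f l0) \<le> \<eta>)"
    using equicontD(3)[OF UC_equicont[OF UC_\<Delta>0] l0_in \<eta>(1)] unfolding eventually_nw by blast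
  have "x \<in> I \<and> (\<forall>c. Re (B x (E c) (E c)) \<ge> (L2 c)\<^sup>2 / 2)" if x: "\<bar>x - l0\<bar> < min d \<delta>\<^sub>1" for x
  proof (intro conjI allI)
    show xI: "x \<in> I" using x by auto
    fix c
    have n: "np (E c) \<le> M * L2 c" using np_E unfolding M_def .
    have N: "Npm (\<Delta>0 x - \<Delta>0 l0) \<le> \<eta>" using d(2) xI x by (simp add: dist_real_def)
    have N0: "Npm (\<Delta>0 x - \<Delta>0 l0) \<ge> 0" using \<Delta>0_ops xI l0_in by (intro PM.N_nonneg) auto
    have "cmod (B x (E c) (E c) - B l0 (E c) (E c)) \<le> K * Npm (\<Delta>0 x - \<Delta>0 l0) * np (E c) * np (E c)"
      using K(2) xI l0_in E_in by blast
    also have "\<dots> \<le> K * \<eta> * (M * L2 c) * (M * L2 c)"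
      using N N0 n K(1) E_in M0 by (intro mult_mono mult_nonneg_nonneg) auto
    also have "\<dots> = K * \<eta> * M\<^sup>2 * (L2 c)\<^sup>2" by (simp add: power2_eq_square)
    also have "\<dots> \<le> K * \<eta> * (M\<^sup>2 + 1) * (L2 c)\<^sup>2" using K(1) \<eta>(1) by (intro mult_right_mono mult_left_mono) auto
    also have "\<dots> = (L2 c)\<^sup>2 / 2" unfolding \<eta>(2) by simp
    finally have "\<bar>Re (B x (E c) (E c)) - Re (B l0 (E c) (E c))\<bar> \<le> (L2 c)\<^sup>2 / 2"
      using abs_Re_le_cmod[of "B x (E c) (E c) - B l0 (E c) (E c)"] by simp
    then show "Re (B x (E c) (E c)) \<ge> (L2 c)\<^sup>2 / 2" unfolding B_E by linarith
  qed
  then show ?thesis using d(1) \<delta>\<^sub>1 by (intro exI[of _ "min d \<delta>\<^sub>1"]) auto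
qed

lemma L2_0: "L2 c = 0 \<Longrightarrow> i < m \<Longrightarrow> c i = 0"
  by (simp add: L2_set_eq_0_iff)

context
  fixes x
  assumes x: "x \<in> I" and low: "\<And>c. Re (B x (E c) (E c)) \<ge> (L2 c)\<^sup>2 / 2"
begin

lemma L2_le_0: "Re (B x (E c) (E c)) = 0 \<Longrightarrow> i < m \<Longrightarrow> c i = 0"
proof -
  assume "Re (B x (E c) (E c)) = 0" "i < m"
  then have "(L2 c)\<^sup>2 \<le> 0" using low[of c] by simp
  then show ?thesis using L2_0 \<open>i < m\<close> by simp
qed

text \<open>The lower bound makes the \<open>m\<close> vectors \<open>\<Delta> x (e i)\<close>
  independent. As the range of \<open>\<Delta> x\<close> again has dimension \<open>m\<close>, they
  span it.\<close>

lemma range_E: assumes g: "g \<in> Vp" shows "\<exists>c. \<Delta> x g = \<Delta> x (E c)"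
proof -
  have E: "\<Delta> x (E c) = (\<Sum>i<m. c i *\<^sub>C \<Delta> x (e i))" for c
  proof -
    have "\<Delta> x (E c) = (\<Sum>i<m. \<Delta> x (c i *\<^sub>C e i))" unfolding E_def by (rule \<Delta>_sum[OF x E_terms])
    also have "\<dots> = (\<Sum>i<m. c i *\<^sub>C \<Delta> x (e i))" by (intro sum.cong refl) (use e_in \<Delta>_scale[OF x] in auto)
    finally show ?thesis .
  qed
  have "\<exists>c. \<Delta> x g = (\<Sum>i<m. c i *\<^sub>C \<Delta> x (e i))"
  proof (rule has_cdim_family_spans[OF rank[OF x]])
    fix c assume "(\<Sum>i<m. c i *\<^sub>C \<Delta> x (e i)) = 0"
    then have "\<Delta> x (E c) = 0" by (simp add: E)
    then have "Re (B x (E c) (E c)) = 0" unfolding B_def using pair_m_0_left E_in by simp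
    then show "\<forall>i<m. c i = 0" using L2_le_0 by blast
  qed (use e_in g in auto)
  then show ?thesis unfolding E .
qed

text \<open>Modulo the kernel \<open>g\<close> is some \<open>E c\<close>; orthogonality to the
  \<open>e j\<close> then says \<open>B x (E c) (E c) = 0\<close>, and the lower bound forces
  \<open>c = 0\<close>.\<close>

lemma \<Delta>_eq_0_if_orthogonal:
  assumes g: "g \<in> Vp" and orth: "\<And>j. j < m \<Longrightarrow> B x g (e j) = 0"
  shows "\<Delta> x g = 0"
proof -
  obtain c where c: "\<Delta> x g = \<Delta> x (E c)" using range_E[OF g] by blast
  have "B x (E c) (E c) = B x g (E c)" unfolding B_def c ..
  also have "\<dots> = (\<Sum>j<m. cnj (c j) * B x g (e j))"
  proof -
    have "B x g (E c) = (\<Sum>j<m. B x g (c j *\<^sub>C e j))" unfolding E_def by (rule B_sum_right[OF x E_terms g])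
    also have "\<dots> = (\<Sum>j<m. cnj (c j) * B x g (e j))" by (intro sum.cong refl) (use e_in B_scale_right[OF x g] in auto)
    finally show ?thesis .
  qed
  also have "\<dots> = 0" using orth by simp
  finally have "\<And>i. i < m \<Longrightarrow> c i = 0" using L2_le_0[of c] by simp
  then have "E c = 0" by (simp add: E_def)
  then show ?thesis using c \<Delta>_zero[OF x] by simp
qed

end

text \<open>Since \<open>\<Delta> x g = \<Delta> x (E c)\<close>, the numbers
  \<open>B x g g\<close>, \<open>B x g (E c)\<close> and \<open>B x (E c) (E c)\<close> coincide.
  The second is \<open>O(\<bar>x - l\<bar>)\<close> times the length of \<open>c\<close> because
  \<open>\<Delta> l g = 0\<close>; the lower bound for the third then makes \<open>c\<close> itself
  \<open>O(\<bar>x - l\<bar>)\<close>. The two factors together give the square.\<close>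

lemma B_quadratic:
  assumes l: "l \<in> I" and g: "g \<in> Vp" and 0: "\<Delta> l g = 0" and d: "d > 0"
    and low: "\<And>x c. \<bar>x - l\<bar> < d \<Longrightarrow> x \<in> I \<and> Re (B x (E c) (E c)) \<ge> (L2 c)\<^sup>2 / 2"
  shows "\<exists>r>0. \<exists>c\<ge>0. {l - r..l + r} \<subseteq> I \<and> (\<forall>x\<in>{l - r..l + r}. Re (B x g g) \<le> c * (x - l)\<^sup>2)"
proof -
  obtain K where K: "K > 0" "\<forall>x\<in>I. \<forall>y\<in>I. \<forall>f\<in>Vp. \<forall>g\<in>Vp. cmod (B x f g - B y f g) \<le> K * Npm (\<Delta>0 x - \<Delta>0 y) * np f * np g"
    using B_diff_bound by blast
  define M where "M = L2_set (\<lambda>i. np (e i)) {..<m}"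
  have M0: "M \<ge> 0" by (simp add: M_def)
  obtain k' where k': "k = Suc k'" using k by (cases k) auto
  obtain D' where D': "equicont opm Npm I {\<Delta>0} (\<lambda>f. f)" "equidiff opm Npm rsc I {\<Delta>0} (\<lambda>f. f) D'"
    "UC opm Npm rsc k' I (dfam {\<Delta>0} D')"
    using UC_\<Delta>0 unfolding k' by (rule UC_SucE)
  obtain L where L: "L > 0" "\<forall>\<^sub>F y in nw l I. \<forall>f\<in>{\<Delta>0}. Npm (f y - f l) \<le> L * norm (y - l)"
    using PM.lipschitz_at[OF D'(1,2) UC_equicont[OF D'(3)] l] by blast
  then obtain d' where d': "d' > 0" "\<And>y. y \<in> I \<Longrightarrow> dist y l < d' \<Longrightarrow> Npm (\<Delta>0 y - \<Delta>0 l) \<le> L * \<bar>y - l\<bar>"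
    unfolding eventually_nw by auto
  define r where "r = min d d' / 2"
  have r: "r > 0" "r < d" "r < d'" using d d' by (auto simp: r_def min_def)
  define q where "q = K * L * np g * M"
  have q0: "q \<ge> 0" using K L M0 g by (simp add: q_def)
  have "Re (B x g g) \<le> 2 * q\<^sup>2 * (x - l)\<^sup>2" if x: "x \<in> {l - r..l + r}" for x
  proof -
    have xl: "\<bar>x - l\<bar> < d" "\<bar>x - l\<bar> < d'" using x r by auto
    have xI: "x \<in> I" and lo: "\<And>c. Re (B x (E c) (E c)) \<ge> (L2 c)\<^sup>2 / 2" using low xl by auto
    obtain c where c: "\<Delta> x g = \<Delta> x (E c)" using range_E[OF xI lo g] by blast
    have EE: "B x (E c) (E c) = B x g (E c)" unfolding B_def c ..
    have gE: "B x g (E c) = cnj (B x g g)"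
      using B_cnj[OF xI g E_in, of c] B_cnj[OF xI g g] c by (simp add: B_def)
    have "B l g (E c) = 0" unfolding B_def 0 using pair_m_0_left E_in by simp
    then have "cmod (B x g (E c)) \<le> K * Npm (\<Delta>0 x - \<Delta>0 l) * np g * np (E c)"
      using K(2)[rule_format, OF xI l g E_in[of c]] by simp
    also have "\<dots> \<le> K * (L * \<bar>x - l\<bar>) * np g * (M * L2 c)"
      using d'(2)[OF xI] xl(2) np_E[of c] K(1) E_in g L PM.N_nonneg[of "\<Delta>0 x - \<Delta>0 l"] \<Delta>0_ops[OF xI] \<Delta>0_ops[OF l]
      by (intro mult_mono mult_nonneg_nonneg) (auto simp: M_def dist_real_def)
    also have "\<dots> = q * \<bar>x - l\<bar> * L2 c" by (simp add: q_def)
    finally have b: "cmod (B x g (E c)) \<le> q * \<bar>x - l\<bar> * L2 c" .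
    have "(L2 c)\<^sup>2 / 2 \<le> cmod (B x g (E c))" using lo[of c] EE complex_Re_le_cmod[of "B x g (E c)"] by simp
    then have "(L2 c)\<^sup>2 \<le> 2 * (q * \<bar>x - l\<bar> * L2 c)" using b by linarith
    then have "L2 c * L2 c \<le> (2 * q * \<bar>x - l\<bar>) * L2 c" by (simp add: power2_eq_square mult.assoc)
    then have L2: "L2 c \<le> 2 * q * \<bar>x - l\<bar>"
    proof (cases "L2 c = 0")
      case False
      then have "L2 c > 0" using L2_set_nonneg[of "\<lambda>i. cmod (c i)" "{..<m}"] by linarith
      then show ?thesis using \<open>L2 c * L2 c \<le> _\<close> by (simp only: mult_le_cancel_right_pos)
    qed (use q0 in simp)
    have "Re (B x g g) = Re (B x g (E c))" unfolding gE by simp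
    also have "\<dots> \<le> cmod (B x g (E c))" by (rule complex_Re_le_cmod)
    also have "\<dots> \<le> q * \<bar>x - l\<bar> * (2 * q * \<bar>x - l\<bar>)"
      by (rule order_trans[OF b mult_left_mono[OF L2]]) (use q0 in simp)
    also have "\<dots> = 2 * q\<^sup>2 * (x - l)\<^sup>2" by (simp add: power2_eq_square)
    finally show ?thesis .
  qed
  moreover have "{l - r..l + r} \<subseteq> I"
  proof
    fix x assume "x \<in> {l - r..l + r}"
    then have "\<bar>x - l\<bar> < d" using r by auto
    then show "x \<in> I" using low by blast
  qed
  ultimately show ?thesis using r(1) by (intro exI[of _ r] exI[of _ "2 * q\<^sup>2"] conjI) auto
qed

end

section \<open>The simple embedded eigenvalue\<close>

text \<open>The map \<open>g \<mapsto> f - K g\<close> contracts distances by the factor 1/2, and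
  its iterates converge because \<open>vecs X\<close> is complete for its own norm.\<close>

lemma neumann_inverse:
  assumes X: "hilb X" and K: "K \<in> ops X X" "opnorm X X K \<le> 1/2" and f: "f \<in> vecs X"
  shows "\<exists>g\<in>vecs X. g + K g = f"
proof -
  interpret hilb2 X X by (intro hilb2.intro X)
  define \<sigma> where "\<sigma> = rec_nat 0 (\<lambda>_ g. f - K g)"
  have \<sigma>0: "\<sigma> 0 = 0" and \<sigma>S: "\<sigma> (Suc n) = f - K (\<sigma> n)" for n by (simp_all add: \<sigma>_def)
  have \<sigma>: "\<sigma> n \<in> vecs X" for n
    by (induction n) (auto simp: \<sigma>0 \<sigma>S f ops_in[OF K(1)])
  have Kd: "K (a - b) = K a - K b" if "a \<in> vecs X" "b \<in> vecs X" for a b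
    using ops_add[OF K(1), of "a - b" b] that by (simp add: algebra_simps)
  have half: "hnorm X (K a) \<le> 1/2 * hnorm X a" if "a \<in> vecs X" for a
    using ops_bound[OF K(1) that] K(2) X.nrm_nonneg[OF that] by (meson mult_right_mono order_trans)
  have step: "hnorm X (\<sigma> (Suc n) - \<sigma> n) \<le> (1/2)^n * hnorm X f" for n
  proof (induction n)
    case 0
    have "K 0 = 0" using ops_scale[OF K(1), of 0 0] by simp
    then show ?case by (simp add: \<sigma>0 \<sigma>S)
  next
    case (Suc n)
    have "\<sigma> (Suc (Suc n)) - \<sigma> (Suc n) = - K (\<sigma> (Suc n) - \<sigma> n)"
      unfolding Kd[OF \<sigma> \<sigma>] by (subst (1 2) \<sigma>S) simp
    then have "hnorm X (\<sigma> (Suc (Suc n)) - \<sigma> (Suc n)) \<le> 1/2 * hnorm X (\<sigma> (Suc n) - \<sigma> n)"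
      using half[of "\<sigma> (Suc n) - \<sigma> n"] \<sigma> X.nrm_minus[OF ops_in[OF K(1), of "\<sigma> (Suc n) - \<sigma> n"]] by simp
    also have "\<dots> \<le> 1/2 * ((1/2)^n * hnorm X f)" using Suc by simp
    finally show ?case by simp
  qed
  \<comment> \<open>The right side is the exact partial sum of the geometric series; the subtracted
    term is what makes the induction on \<open>p\<close> close.\<close>
  have far: "hnorm X (\<sigma> (n + p) - \<sigma> n) \<le> 2 * (1/2)^n * hnorm X f - 2 * (1/2)^(n+p) * hnorm X f" for n p
  proof (induction p)
    case (Suc p)
    have "hnorm X (\<sigma> (n + Suc p) - \<sigma> n) \<le> hnorm X (\<sigma> (Suc (n + p)) - \<sigma> (n + p)) + hnorm X (\<sigma> (n + p) - \<sigma> n)"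
      using X.nrm_triangle_sub[of "\<sigma> (Suc (n + p))" "\<sigma> (n + p)" "\<sigma> n"] \<sigma> by simp
    also have "\<dots> \<le> (1/2)^(n+p) * hnorm X f + (2 * (1/2)^n * hnorm X f - 2 * (1/2)^(n+p) * hnorm X f)"
      by (intro add_mono step Suc)
    finally show ?case by (simp add: field_simps)
  qed simp
  have far': "hnorm X (\<sigma> i - \<sigma> n) \<le> 2 * (1/2)^n * hnorm X f" if "i \<ge> n" for i n
  proof -
    have "2 * (1/2)^i * hnorm X f \<ge> 0" using f by simp
    moreover have "hnorm X (\<sigma> i - \<sigma> n) \<le> 2 * (1/2)^n * hnorm X f - 2 * (1/2)^i * hnorm X f"
      using far[of n "i - n"] that by simp
    ultimately show ?thesis by linarith
  qed
  have lim0: "(\<lambda>n. 2 * (1/2::real)^n * hnorm X f) \<longlonglongrightarrow> 2 * 0 * hnorm X f"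
    by (intro tendsto_intros LIMSEQ_power_zero) simp
  have cauchy: "\<exists>N. \<forall>i\<ge>N. \<forall>j\<ge>N. hnorm X (\<sigma> i - \<sigma> j) < e" if e: "e > 0" for e
  proof -
    have "\<forall>\<^sub>F n in sequentially. 2 * (1/2::real)^n * hnorm X f < e / 2"
      using lim0 e by (intro order_tendstoD(2)) auto
    then obtain N where N: "2 * (1/2::real)^N * hnorm X f < e / 2" using eventually_sequentially by auto
    have "hnorm X (\<sigma> i - \<sigma> j) < e" if "i \<ge> N" "j \<ge> N" for i j
      using X.nrm_triangle_sub[of "\<sigma> i" "\<sigma> N" "\<sigma> j", OF \<sigma> \<sigma> \<sigma>] X.nrm_minus_commute[of "\<sigma> N" "\<sigma> j", OF \<sigma> \<sigma>]
        far'[OF that(1)] far'[OF that(2)] N by linarith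
    then show ?thesis by blast
  qed
  have rng: "range \<sigma> \<subseteq> vecs X" using \<sigma> by blast
  obtain g where g: "g \<in> vecs X" "(\<lambda>i. hnorm X (\<sigma> i - g)) \<longlonglongrightarrow> 0"
    by (rule X.complete[OF rng cauchy])
  have 1: "(\<lambda>i. hnorm X (\<sigma> (Suc i) - g)) \<longlonglongrightarrow> 0" using LIMSEQ_Suc[OF g(2)] .
  have 2: "(\<lambda>i. hnorm X (\<sigma> (Suc i) - (f - K g))) \<longlonglongrightarrow> 0"
  proof (rule tendsto_sandwich[OF _ _ tendsto_const])
    show "(\<lambda>i. 1/2 * hnorm X (\<sigma> i - g)) \<longlonglongrightarrow> 0" using tendsto_mult_left[OF g(2), of "1/2"] by simp
    show "\<forall>\<^sub>F i in sequentially. 0 \<le> hnorm X (\<sigma> (Suc i) - (f - K g))"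
      using \<sigma> f g ops_in[OF K(1)] by (intro always_eventually allI X.nrm_nonneg) auto
    have "hnorm X (\<sigma> (Suc i) - (f - K g)) \<le> 1/2 * hnorm X (\<sigma> i - g)" for i
    proof -
      have "\<sigma> (Suc i) - (f - K g) = - K (\<sigma> i - g)" unfolding \<sigma>S Kd[OF \<sigma> g(1)] by simp
      then show ?thesis using half[of "\<sigma> i - g"] \<sigma> g X.nrm_minus[OF ops_in[OF K(1), of "\<sigma> i - g"]] by simp
    qed
    then show "\<forall>\<^sub>F i in sequentially. hnorm X (\<sigma> (Suc i) - (f - K g)) \<le> 1/2 * hnorm X (\<sigma> i - g)" by simp
  qed
  have "g = f - K g"
    using X.limit_unique[OF _ _ _ _ 1 2] \<sigma> g(1) f ops_in[OF K(1) g(1)] by simp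
  then have "g + K g = f" by (metis diff_add_cancel)
  then show ?thesis using g(1) by blast
qed

lemma neumann_bound:
  assumes X: "hilb X" and K: "K \<in> ops X X" "opnorm X X K \<le> 1/2" and g: "g \<in> vecs X"
  shows "hnorm X g \<le> 2 * hnorm X (g + K g)"
proof -
  interpret hilb2 X X by (intro hilb2.intro X)
  have Kg: "K g \<in> vecs X" using ops_in[OF K(1) g] .
  have "hnorm X (K g) \<le> 1/2 * hnorm X g"
    using ops_bound[OF K(1) g] K(2) X.nrm_nonneg[OF g] by (meson mult_right_mono order_trans)
  moreover have "hnorm X g \<le> hnorm X (g + K g) + hnorm X (K g)"
    using X.nrm_triangle_diff[of "g + K g" "K g"] g Kg by simp
  ultimately show ?thesis by linarith
qed

text \<open>That the derivative exists is known from the smoothness calculus; an expansion along the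
  ray \<open>t > 0\<close> with a quadratic error is enough to identify its value at
  \<open>v\<close>.\<close>

lemma has_derivative_direction:
  fixes f :: "'e::real_normed_vector \<Rightarrow> real"
  assumes der: "(f has_derivative f') (at x)" and r: "r > 0"
    and q: "\<And>t. 0 < t \<Longrightarrow> t < r \<Longrightarrow> \<bar>f (x + t *\<^sub>R v) - f x - t * a\<bar> \<le> c * t\<^sup>2"
  shows "f' v = a"
proof -
  have 1: "((\<lambda>t::real. x + t *\<^sub>R v) has_derivative (\<lambda>t. t *\<^sub>R v)) (at 0)" by (auto intro!: derivative_eq_intros)
  have der': "(f has_derivative f') (at (x + 0 *\<^sub>R v))" using der by simp
  have lin: "linear f'" using has_derivative_linear[OF der] .
  have "((\<lambda>t::real. f (x + t *\<^sub>R v)) has_derivative (\<lambda>t. f' (t *\<^sub>R v))) (at 0)"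
    using has_derivative_compose[OF 1 der'] .
  then have "((\<lambda>t::real. f (x + t *\<^sub>R v)) has_field_derivative f' v) (at 0)"
    using linear_cmul[OF lin] by (simp add: has_field_derivative_def mult_commute_abs)
  then have "((\<lambda>t. (f (x + t *\<^sub>R v) - f x) / t) \<longlongrightarrow> f' v) (at 0)"
    by (simp add: has_field_derivative_iff)
  then have A: "((\<lambda>t. (f (x + t *\<^sub>R v) - f x) / t) \<longlongrightarrow> f' v) (at_right 0)"
    by (rule filterlim_mono[OF _ order_refl]) (simp add: at_le)
  have "((\<lambda>t. (f (x + t *\<^sub>R v) - f x) / t - a) \<longlongrightarrow> 0) (at_right 0)"
  proof (rule Lim_null_comparison)
    show "\<forall>\<^sub>F t in at_right 0. norm ((f (x + t *\<^sub>R v) - f x) / t - a) \<le> c * t"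
      unfolding eventually_at_right_field
    proof (intro exI[of _ r] conjI r allI impI)
      fix t :: real assume t: "0 < t" "t < r"
      have "(f (x + t *\<^sub>R v) - f x) / t - a = (f (x + t *\<^sub>R v) - f x - t * a) / t" using t by (simp add: field_simps)
      then have "norm ((f (x + t *\<^sub>R v) - f x) / t - a) = \<bar>f (x + t *\<^sub>R v) - f x - t * a\<bar> / t" using t by simp
      also have "\<dots> \<le> c * t\<^sup>2 / t" using q[OF t] t by (intro divide_right_mono) auto
      finally show "norm ((f (x + t *\<^sub>R v) - f x) / t - a) \<le> c * t" using t by (simp add: power2_eq_square)
    qed
    have "((\<lambda>t. c * t) \<longlongrightarrow> c * 0) (at_right (0::real))" by (intro tendsto_intros)
    then show "((\<lambda>t. c * t) \<longlongrightarrow> 0) (at_right (0::real))" by simp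
  qed
  then have "((\<lambda>t. (f (x + t *\<^sub>R v) - f x) / t) \<longlongrightarrow> a) (at_right 0)" by (simp add: LIM_zero_iff)
  then show ?thesis using tendsto_unique[OF _ A] by simp
qed

text \<open>\<open>T\<close> stands for \<open>H + P\<close> with \<open>P\<close> the projection
  onto the eigenspace, which moves the eigenvalue of \<phi> from \<open>l0\<close> to
  \<open>l0 + 1\<close>.\<close>

locale embedded = lap S pair C s D T l0 \<delta>\<^sub>1 k
  for S :: "real \<Rightarrow> 'a::complex_vector hspace" and pair C s D T l0 \<delta>\<^sub>1 k +
  fixes \<phi> :: 'a and \<iota> :: "'x::banach \<Rightarrow> 'a \<Rightarrow> 'a" and m :: nat
  assumes k: "k \<ge> 1" and T_real: "real_op (S 0) C D T"
    and \<phi>_D: "\<phi> \<in> D" and \<phi>_Vp: "\<phi> \<in> Vp" and T\<phi>: "T \<phi> = of_real (l0 + 1) *\<^sub>C \<phi>"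
    and C\<phi>: "C \<phi> = \<phi>" and \<phi>_norm: "n0 \<phi> = 1"
    and pert: "perturbation_space S C s \<iota>"
    and rank: "\<And>l. l \<in> I \<Longrightarrow> has_cdim (\<Delta> l ` Vp) m"
    and spanning: "cspan (range (\<lambda>W. \<Delta> l0 (\<iota> W \<phi>))) = \<Delta> l0 ` Vp"
begin

lemma l0_in_I: "l0 \<in> I" using \<delta>\<^sub>1 by simp

subsection \<open>Reality\<close>

lemma C_D: "f \<in> D \<Longrightarrow> C f \<in> D" and T_C: "f \<in> D \<Longrightarrow> T (C f) = C (T f)"
  using T_real A.D_in unfolding real_op_def by blast+

lemma Res_C:
  assumes z: "Im z \<noteq> 0" and f: "f \<in> V0"
  shows "C (A.Res z f) = A.Res (cnj z) (C f)"
proof -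
  have z': "Im (cnj z) \<noteq> 0" using z by simp
  have RD: "A.Res z f \<in> D" "A.Res z f \<in> V0" using A.Res_in_D[OF z f] A.Res_in[OF z f] by auto
  have "T (C (A.Res z f)) = C f + cnj z *\<^sub>C C (A.Res z f)"
    unfolding T_C[OF RD(1)] A.T_Res[OF z f] using conj_add[of f 0 "z *\<^sub>C A.Res z f"] conj_scale[OF RD(2), of z] f RD by simp
  then have "T (C (A.Res z f)) - cnj z *\<^sub>C C (A.Res z f) = C f" by simp
  then show ?thesis using A.Res_eqI[OF z' C_D[OF RD(1)]] by simp
qed

text \<open>\<open>C\<close> conjugates the spectral parameter by \<open>Res_C\<close> and is
  bounded on \<open>Vm\<close>, so it exchanges the limits from above and from below.\<close>

lemma R_C:
  assumes sg: "sg \<in> {1, -1}" and l: "l \<in> I" and f: "f \<in> Vp"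
  shows "C (R sg l f) = R (- sg) l (C f)"
proof -
  have sg': "- sg \<in> {1, -1}" using sg by auto
  have Cf: "C f \<in> Vp" using conj_closed[OF f] .
  define u where "u = (\<lambda>\<epsilon>. if \<epsilon> > 0 then A.Res (Complex l (- sg * \<epsilon>)) f else 0)"
  have u0: "u \<epsilon> \<in> V0" for \<epsilon> using A.Res_in f sg by (auto simp: u_def)
  have Cu: "C (u \<epsilon>) \<in> Vm" for \<epsilon> using conj_closed[OF V0_m[OF u0]] .
  have Rf: "R sg l f \<in> Vm" using R_in[OF sg l f] .
  obtain K where K: "\<forall>f\<in>Vm. nm (C f) \<le> K * nm f" using conj_bounded[of "- s"] by blast
  have lim: "((\<lambda>\<epsilon>. nm (u \<epsilon> - R sg l f)) \<longlongrightarrow> 0) (at_right 0)"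
    using R_limit[OF sg l f]
    by (rule Lim_transform_eventually) (use ev_pos in \<open>eventually_elim, simp add: u_def\<close>)
  have 1: "((\<lambda>\<epsilon>. nm (C (u \<epsilon>) - C (R sg l f))) \<longlongrightarrow> 0) (at_right 0)"
  proof (rule tendsto_sandwich[OF _ _ tendsto_const])
    show "((\<lambda>\<epsilon>. K * nm (u \<epsilon> - R sg l f)) \<longlongrightarrow> 0) (at_right 0)" using tendsto_mult_left[OF lim, of K] by simp
    show "\<forall>\<^sub>F \<epsilon> in at_right 0. 0 \<le> nm (C (u \<epsilon>) - C (R sg l f))"
      using Cu conj_closed[OF Rf] by (intro always_eventually allI Hm.nrm_nonneg Hm.vecs_diff)
    have "nm (C (u \<epsilon>) - C (R sg l f)) \<le> K * nm (u \<epsilon> - R sg l f)" for \<epsilon>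
      unfolding conj_diff[OF V0_m[OF u0] Rf, symmetric] using K Hm.vecs_diff[OF V0_m[OF u0] Rf] by blast
    then show "\<forall>\<^sub>F \<epsilon> in at_right 0. nm (C (u \<epsilon>) - C (R sg l f)) \<le> K * nm (u \<epsilon> - R sg l f)" by simp
  qed
  have 2: "((\<lambda>\<epsilon>. nm (C (u \<epsilon>) - R (- sg) l (C f))) \<longlongrightarrow> 0) (at_right 0)"
    using R_limit[OF sg' l Cf]
  proof (rule Lim_transform_eventually)
    show "\<forall>\<^sub>F \<epsilon> in at_right 0. nm (A.Res (Complex l (- (- sg) * \<epsilon>)) (C f) - R (- sg) l (C f)) = nm (C (u \<epsilon>) - R (- sg) l (C f))"
      using ev_pos
    proof eventually_elim
      case (elim \<epsilon>)
      have z: "Im (Complex l (- sg * \<epsilon>)) \<noteq> 0" using sg elim by auto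
      have "cnj (Complex l (- sg * \<epsilon>)) = Complex l (- (- sg) * \<epsilon>)" by (simp add: complex_eq_iff)
      then have "C (u \<epsilon>) = A.Res (Complex l (- (- sg) * \<epsilon>)) (C f)"
        using Res_C[OF z, of f] f elim by (simp add: u_def)
      then show ?case by simp
    qed
  qed
  show ?thesis using Hm.limit_unique[OF Cu _ _ _ 1 2] conj_closed[OF Rf] R_in[OF sg' l Cf] by simp
qed

lemma conj_Vm_add: "f \<in> Vm \<Longrightarrow> g \<in> Vm \<Longrightarrow> C (f + g) = C f + C g" by (rule conj_add)

lemma C_R0: "l \<in> I \<Longrightarrow> f \<in> Vp \<Longrightarrow> C (R0 l f) = R0 l (C f)"
proof -
  assume l: "l \<in> I" and f: "f \<in> Vp"
  have in': "R (-1) l f \<in> Vm" "R 1 l f \<in> Vm" using R_in l f by auto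
  show ?thesis unfolding R0_def rst_def
    using f conj_closed[OF f] in' R_C[of 1 l f] R_C[of "-1" l f] l
    by (simp add: conj_Vm_add conj_scale[of _ "- s"] add.commute)
qed

lemma C_\<Delta>: "l \<in> I \<Longrightarrow> f \<in> Vp \<Longrightarrow> C (\<Delta> l f) = \<Delta> l (C f)"
proof -
  assume l: "l \<in> I" and f: "f \<in> Vp"
  have in': "R (-1) l f \<in> Vm" "R 1 l f \<in> Vm" using R_in l f by auto
  let ?c = "1 / (2 * of_real pi * \<i>)"
  have "C (\<Delta> l f) = cnj ?c *\<^sub>C (R 1 l (C f) - R (-1) l (C f))"
    unfolding spectral_delta_def using in' R_C[of 1 l f] R_C[of "-1" l f] l f
    by (subst conj_scale[of _ "- s"]) (auto simp: conj_diff[of _ "- s"])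
  \<comment> \<open>Under conjugation both the prefactor and the difference of the boundary values
    change sign.\<close>
  also have "\<dots> = ?c *\<^sub>C (R (-1) l (C f) - R 1 l (C f))"
    by (simp add: complex_vector.scale_right_diff_distrib)
  finally show ?thesis unfolding spectral_delta_def .
qed

lemma pair_C: assumes f: "f \<in> Vm" and g: "g \<in> Vp" shows "pair (C f) (C g) = cnj (pair f g)"
proof -
  have "dense_in (S (- s)) V0" using embedding_dense[of "- s" 0] s_pos by simp
  then obtain \<sigma> where \<sigma>: "\<And>i. \<sigma> i \<in> V0" "(\<lambda>i. nm (\<sigma> i - f)) \<longlonglongrightarrow> 0"
    using dense_sequence f Hm.hilb_axioms by blast
  obtain K where K: "\<forall>f\<in>Vm. nm (C f) \<le> K * nm f" using conj_bounded[of "- s"] by blast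
  have C\<sigma>: "C (\<sigma> i) \<in> Vm" for i using conj_closed[OF V0_m[OF \<sigma>(1)]] .
  have "(\<lambda>i. nm (C (\<sigma> i) - C f)) \<longlonglongrightarrow> 0"
  proof (rule tendsto_sandwich[OF _ _ tendsto_const])
    show "(\<lambda>i. K * nm (\<sigma> i - f)) \<longlonglongrightarrow> 0" using tendsto_mult_left[OF \<sigma>(2), of K] by simp
    show "\<forall>\<^sub>F i in sequentially. 0 \<le> nm (C (\<sigma> i) - C f)"
      using C\<sigma> conj_closed[OF f] by (intro always_eventually allI Hm.nrm_nonneg Hm.vecs_diff)
    have "nm (C (\<sigma> i) - C f) \<le> K * nm (\<sigma> i - f)" for i
      unfolding conj_diff[OF V0_m[OF \<sigma>(1)] f, symmetric] using K Hm.vecs_diff[OF V0_m[OF \<sigma>(1)] f] by blast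
    then show "\<forall>\<^sub>F i in sequentially. nm (C (\<sigma> i) - C f) \<le> K * nm (\<sigma> i - f)" by simp
  qed
  then have "(\<lambda>i. pair (C (\<sigma> i)) (C g)) \<longlonglongrightarrow> pair (C f) (C g)"
    using C\<sigma> conj_closed f g by (intro pair_m_tendsto) auto
  moreover have "pair (C (\<sigma> i)) (C g) = cnj (pair (\<sigma> i) g)" for i
    using pair_eq_hip[of "C (\<sigma> i)" "C g"] pair_eq_hip[of "\<sigma> i" g] conj_antiunitary[of "\<sigma> i" g]
      conj_closed[OF \<sigma>(1)] conj_closed[of g 0] \<sigma>(1) g by simp
  moreover have "(\<lambda>i. cnj (pair (\<sigma> i) g)) \<longlonglongrightarrow> cnj (pair f g)"
    using pair_m_tendsto(1)[OF _ f g \<sigma>(2)] \<sigma>(1) by (intro tendsto_cnj) auto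
  ultimately show ?thesis using LIMSEQ_unique by simp
qed

lemma pair_real: "f \<in> Vm \<Longrightarrow> g \<in> Vp \<Longrightarrow> C f = f \<Longrightarrow> C g = g \<Longrightarrow> Im (pair f g) = 0"
  using pair_C[of f g] by (simp add: complex_eq_iff)

lemma B_real: "l \<in> I \<Longrightarrow> f \<in> Vp \<Longrightarrow> g \<in> Vp \<Longrightarrow> C f = f \<Longrightarrow> C g = g \<Longrightarrow> Im (B l f g) = 0"
  unfolding B_def using pair_real[of "\<Delta> l f" g] C_\<Delta>[of l f] \<Delta>_in by simp

subsection \<open>Perturbations\<close>

lemma \<iota>_bounded: "\<iota> W \<in> bounded_ops (S (- s)) (S s)"
  and \<iota>_real: "real_op (S 0) C V0 (\<iota> W)"
  and \<iota>_add: "f \<in> Vm \<Longrightarrow> \<iota> (V + W) f = \<iota> V f + \<iota> W f"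
  and \<iota>_scale: "f \<in> Vm \<Longrightarrow> \<iota> (a *\<^sub>R W) f = of_real a *\<^sub>C \<iota> W f"
  and \<iota>_norm: "\<exists>K. \<forall>W. Nmp (\<iota> W) \<le> K * norm W"
  using pert unfolding perturbation_space_def by blast+

definition wop :: "'x \<Rightarrow> 'a \<Rightarrow> 'a" where "wop W = rst (S (- s)) (\<iota> W)"

lemma wop_ops: "wop W \<in> omp"
  unfolding wop_def by (rule rst_ops[OF Hm.hilb_axioms \<iota>_bounded])

lemma wop_eq: "f \<in> Vm \<Longrightarrow> wop W f = \<iota> W f" by (simp add: wop_def rst_def)

lemma \<iota>_in: "f \<in> Vm \<Longrightarrow> \<iota> W f \<in> Vp"
  using MP.ops_in[OF wop_ops] wop_eq by metis

lemma wop_add: "wop (V + W) = wop V + wop W"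
  by (auto simp: wop_def rst_def fun_eq_iff \<iota>_add)

lemma wop_scale: "wop (a *\<^sub>R W) = rsc a (wop W)"
  by (auto simp: wop_def rst_def fun_eq_iff \<iota>_scale rsc_def csc_def)

lemma wop_norm: "\<exists>K>0. \<forall>W. Nmp (wop W) \<le> K * norm W"
proof -
  obtain K where "\<forall>W. Nmp (\<iota> W) \<le> K * norm W" using \<iota>_norm by blast
  moreover have "Nmp (wop W) = Nmp (\<iota> W)" for W by (rule opnorm_cong) (simp add: wop_eq)
  ultimately have "\<forall>W. Nmp (wop W) \<le> max K 1 * norm W"
    by (metis max.cobounded1 mult_right_mono norm_ge_zero order_trans)
  then show ?thesis by (intro exI[of _ "max K 1"]) auto
qed

text \<open>A perturbation is assumed to be real on \<open>V0\<close>. Density of \<open>V0\<close>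
  and boundedness from \<open>Vm\<close> to \<open>Vp\<close> extend this to \<open>Vm\<close>,
  where \<open>R0\<close> takes its values.\<close>

lemma C_\<iota>: assumes f: "f \<in> Vm" shows "C (\<iota> W f) = \<iota> W (C f)"
proof -
  have "dense_in (S (- s)) V0" using embedding_dense[of "- s" 0] s_pos by simp
  then obtain \<sigma> where \<sigma>: "\<And>i. \<sigma> i \<in> V0" "(\<lambda>i. nm (\<sigma> i - f)) \<longlonglongrightarrow> 0"
    using dense_sequence f Hm.hilb_axioms by blast
  obtain K where K: "\<forall>f\<in>Vm. nm (C f) \<le> K * nm f" using conj_bounded[of "- s"] by blast
  obtain L where L: "\<forall>f\<in>Vp. np (C f) \<le> L * np f" using conj_bounded[of s] by blast
  obtain M where M: "M \<ge> 0" "\<forall>f\<in>Vm. np (\<iota> W f) \<le> M * nm f"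
    using bounded_opsD(4)[OF \<iota>_bounded Hm.hilb_axioms] by blast
  have L': "\<forall>f\<in>Vp. np (C f) \<le> \<bar>L\<bar> * np f"
    using L Hp.nrm_nonneg by (meson abs_ge_self mult_right_mono order_trans)
  have \<iota>d: "\<iota> W (a - b) = \<iota> W a - \<iota> W b" if "a \<in> Vm" "b \<in> Vm" for a b
    using bounded_opsD(2)[OF \<iota>_bounded Hm.hilb_axioms, of "a - b" b] that by (simp add: algebra_simps)
  have \<sigma>m: "\<sigma> i \<in> Vm" for i using \<sigma>(1) by blast
  note Cf = conj_closed[OF f] and C\<sigma> = conj_closed[OF \<sigma>m]
  have eq: "C (\<iota> W (\<sigma> i)) = \<iota> W (C (\<sigma> i))" for i
    using \<iota>_real \<sigma>(1) unfolding real_op_def by simp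
  have in': "C (\<iota> W (\<sigma> i)) \<in> Vp" for i using conj_closed \<iota>_in \<sigma>m by blast
  have 1: "(\<lambda>i. np (C (\<iota> W (\<sigma> i)) - C (\<iota> W f))) \<longlonglongrightarrow> 0"
  proof (rule tendsto_sandwich[OF _ _ tendsto_const])
    show "(\<lambda>i. \<bar>L\<bar> * M * nm (\<sigma> i - f)) \<longlonglongrightarrow> 0" using tendsto_mult_left[OF \<sigma>(2), of "\<bar>L\<bar> * M"] by simp
    show "\<forall>\<^sub>F i in sequentially. 0 \<le> np (C (\<iota> W (\<sigma> i)) - C (\<iota> W f))"
      using in' conj_closed[OF \<iota>_in[OF f]] by (intro always_eventually allI Hp.nrm_nonneg Hp.vecs_diff)
    have "np (C (\<iota> W (\<sigma> i)) - C (\<iota> W f)) \<le> \<bar>L\<bar> * M * nm (\<sigma> i - f)" for i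
    proof -
      have "C (\<iota> W (\<sigma> i)) - C (\<iota> W f) = C (\<iota> W (\<sigma> i - f))"
        unfolding \<iota>d[OF \<sigma>m f] by (rule conj_diff[symmetric, OF \<iota>_in[OF \<sigma>m] \<iota>_in[OF f]])
      also have "np \<dots> \<le> \<bar>L\<bar> * np (\<iota> W (\<sigma> i - f))" using L' \<iota>_in[OF Hm.vecs_diff[OF \<sigma>m f]] by blast
      also have "\<dots> \<le> \<bar>L\<bar> * (M * nm (\<sigma> i - f))" using M Hm.vecs_diff[OF \<sigma>m f] by (intro mult_left_mono) auto
      finally show ?thesis by (simp add: mult.assoc)
    qed
    then show "\<forall>\<^sub>F i in sequentially. np (C (\<iota> W (\<sigma> i)) - C (\<iota> W f)) \<le> \<bar>L\<bar> * M * nm (\<sigma> i - f)" by simp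
  qed
  have 2: "(\<lambda>i. np (C (\<iota> W (\<sigma> i)) - \<iota> W (C f))) \<longlonglongrightarrow> 0"
  proof (rule tendsto_sandwich[OF _ _ tendsto_const])
    show "(\<lambda>i. M * K * nm (\<sigma> i - f)) \<longlonglongrightarrow> 0" using tendsto_mult_left[OF \<sigma>(2), of "M * K"] by simp
    show "\<forall>\<^sub>F i in sequentially. 0 \<le> np (C (\<iota> W (\<sigma> i)) - \<iota> W (C f))"
      using in' \<iota>_in[OF Cf] by (intro always_eventually allI Hp.nrm_nonneg Hp.vecs_diff)
    have "np (C (\<iota> W (\<sigma> i)) - \<iota> W (C f)) \<le> M * K * nm (\<sigma> i - f)" for i
    proof -
      have "C (\<iota> W (\<sigma> i)) - \<iota> W (C f) = \<iota> W (C (\<sigma> i - f))"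
        unfolding eq conj_diff[OF \<sigma>m f] \<iota>d[OF C\<sigma> Cf] ..
      also have "np \<dots> \<le> M * nm (C (\<sigma> i - f))" using M conj_closed[OF Hm.vecs_diff[OF \<sigma>m f]] by blast
      also have "\<dots> \<le> M * (K * nm (\<sigma> i - f))" using K M Hm.vecs_diff[OF \<sigma>m f] by (intro mult_left_mono) auto
      finally show ?thesis by (simp add: mult.assoc)
    qed
    then show "\<forall>\<^sub>F i in sequentially. np (C (\<iota> W (\<sigma> i)) - \<iota> W (C f)) \<le> M * K * nm (\<sigma> i - f)" by simp
  qed
  show ?thesis using Hp.limit_unique[OF in' _ _ _ 1 2] conj_closed[OF \<iota>_in[OF f]] \<iota>_in[OF Cf] by simp
qed

lemma \<phi>_in [simp]: "\<phi> \<in> V0" "\<phi> \<in> Vm" using \<phi>_Vp by auto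

text \<open>A multiple of the eigenvector \<phi> solves the equation in \<open>D\<close>, so
  \<open>R_shift\<close> gives the boundary value.\<close>

lemma R_\<phi>:
  assumes sg: "sg \<in> {1, -1}" and l: "l \<in> I" and ne: "l \<noteq> l0 + 1"
  shows "R sg l \<phi> = of_real (1 / (l0 + 1 - l)) *\<^sub>C \<phi>"
proof (rule R_shift[OF sg l])
  let ?c = "complex_of_real (1 / (l0 + 1 - l))"
  show "?c *\<^sub>C \<phi> \<in> D" using \<phi>_D by simp
  have "T (?c *\<^sub>C \<phi>) - of_real l *\<^sub>C ?c *\<^sub>C \<phi> = (?c * of_real (l0 + 1) - of_real l * ?c) *\<^sub>C \<phi>"
    using A.T_scale[OF \<phi>_D, of ?c] T\<phi> by (simp only: complex_vector.scale_left_diff_distrib complex_vector.scale_scale)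
  also have "?c * of_real (l0 + 1) - of_real l * ?c = of_real ((1 / (l0 + 1 - l)) * (l0 + 1) - l * (1 / (l0 + 1 - l)))"
    by (simp only: of_real_mult of_real_diff)
  also have "(1 / (l0 + 1 - l)) * (l0 + 1) - l * (1 / (l0 + 1 - l)) = 1"
    using ne by (simp add: diff_divide_distrib[symmetric])
  finally show "T (?c *\<^sub>C \<phi>) - of_real l *\<^sub>C ?c *\<^sub>C \<phi> = \<phi>" by simp
qed (rule \<phi>_Vp)

lemma R0_\<phi>: "l \<in> I \<Longrightarrow> l \<noteq> l0 + 1 \<Longrightarrow> R0 l \<phi> = of_real (1 / (l0 + 1 - l)) *\<^sub>C \<phi>"
proof -
  assume a: "l \<in> I" "l \<noteq> l0 + 1"
  define c where "c = complex_of_real (1 / (l0 + 1 - l))"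
  have "R 1 l \<phi> = c *\<^sub>C \<phi>" "R (-1) l \<phi> = c *\<^sub>C \<phi>" unfolding c_def using R_\<phi> a by blast+
  then have "R0 l \<phi> = (1/2 * c + 1/2 * c) *\<^sub>C \<phi>"
    unfolding R0_def rst_def using \<phi>_Vp by (simp add: complex_vector.scale_left_distrib[symmetric])
  then have "R0 l \<phi> = c *\<^sub>C \<phi>" by simp
  then show ?thesis unfolding c_def .
qed

lemma \<Delta>_\<phi>: "l \<in> I \<Longrightarrow> l \<noteq> l0 + 1 \<Longrightarrow> \<Delta> l \<phi> = 0"
  unfolding spectral_delta_def using R_\<phi>[of 1 l] R_\<phi>[of "-1" l] by simp

text \<open>Taking the real part loses nothing: the value of \<open>B\<close> is real by
  \<open>B_\<beta>\<close>.\<close>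

definition \<beta> :: "'x \<Rightarrow> 'x \<Rightarrow> real" where "\<beta> V W = Re (B l0 (\<iota> V \<phi>) (\<iota> W \<phi>))"

lemma \<iota>\<phi>_in: "\<iota> W \<phi> \<in> Vp" using \<iota>_in by simp

lemma \<iota>\<phi>_real: "C (\<iota> W \<phi>) = \<iota> W \<phi>" using C_\<iota>[of \<phi> W] C\<phi> by simp

lemma B_\<beta>: "B l0 (\<iota> V \<phi>) (\<iota> W \<phi>) = of_real (\<beta> V W)"
  unfolding \<beta>_def using B_real[OF l0_in_I \<iota>\<phi>_in \<iota>\<phi>_in \<iota>\<phi>_real \<iota>\<phi>_real] by (simp add: complex_eq_iff)

lemma \<beta>_add_left: "\<beta> (V + V') W = \<beta> V W + \<beta> V' W"
  unfolding \<beta>_def using \<iota>_add[of \<phi>] B_add_left[OF l0_in_I \<iota>\<phi>_in \<iota>\<phi>_in \<iota>\<phi>_in] by simp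

lemma \<beta>_scale_left: "\<beta> (a *\<^sub>R V) W = a * \<beta> V W"
  unfolding \<beta>_def using \<iota>_scale[of \<phi>] B_scale_left[OF l0_in_I \<iota>\<phi>_in \<iota>\<phi>_in] by simp

lemma \<beta>_sym: "\<beta> V W = \<beta> W V"
  unfolding \<beta>_def using B_cnj[OF l0_in_I \<iota>\<phi>_in \<iota>\<phi>_in, of V W] by simp

lemma \<beta>_nonneg: "\<beta> V V \<ge> 0"
  unfolding \<beta>_def using B_nonneg[OF l0_in_I \<iota>\<phi>_in] by simp

lemma \<beta>_linear: "linear (\<lambda>V. \<beta> V W)"
  by (rule linearI) (simp_all add: \<beta>_add_left \<beta>_scale_left)

lemma \<beta>_bounded: "\<exists>K. \<forall>V. \<bar>\<beta> V W\<bar> \<le> K * norm V"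
proof -
  obtain K where K: "K > 0" "\<forall>f\<in>Vm. \<forall>g\<in>Vp. cmod (pair f g) \<le> K * nm f * np g" using pair_bound by blast
  obtain L where L: "L > 0" "\<forall>W. Nmp (wop W) \<le> L * norm W" using wop_norm by blast
  let ?N = "Npm (\<Delta>0 l0)"
  have N0: "?N \<ge> 0" using PM.N_nonneg[OF \<Delta>0_ops[OF l0_in_I]] .
  have "\<bar>\<beta> V W\<bar> \<le> (K * (?N * (L * nm \<phi>)) * np (\<iota> W \<phi>)) * norm V" for V
  proof -
    have np: "np (\<iota> V \<phi>) \<le> L * norm V * nm \<phi>"
    proof -
      have "np (wop V \<phi>) \<le> Nmp (wop V) * nm \<phi>" by (rule MP.ops_bound[OF wop_ops]) simp
      also have "\<dots> \<le> L * norm V * nm \<phi>" using L by (intro mult_right_mono) auto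
      finally show ?thesis by (simp add: wop_eq)
    qed
    have D: "\<Delta>0 l0 (\<iota> V \<phi>) = \<Delta> l0 (\<iota> V \<phi>)" by (simp add: \<Delta>0_def rst_def \<iota>\<phi>_in)
    have "\<bar>\<beta> V W\<bar> \<le> cmod (pair (\<Delta> l0 (\<iota> V \<phi>)) (\<iota> W \<phi>))"
      unfolding \<beta>_def B_def by (rule abs_Re_le_cmod)
    also have "\<dots> \<le> K * nm (\<Delta> l0 (\<iota> V \<phi>)) * np (\<iota> W \<phi>)" using K \<Delta>_in[OF l0_in_I \<iota>\<phi>_in] \<iota>\<phi>_in by blast
    also have "\<dots> \<le> K * (?N * np (\<iota> V \<phi>)) * np (\<iota> W \<phi>)"
      using PM.ops_bound[OF \<Delta>0_ops[OF l0_in_I] \<iota>\<phi>_in, of V] K \<iota>\<phi>_in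
      unfolding D by (intro mult_right_mono mult_left_mono) auto
    also have "\<dots> \<le> K * (?N * (L * norm V * nm \<phi>)) * np (\<iota> W \<phi>)"
      using np K N0 \<iota>\<phi>_in by (intro mult_right_mono mult_left_mono) auto
    finally show ?thesis by (simp add: algebra_simps)
  qed
  then show ?thesis by blast
qed

lemma \<Delta>_\<iota>_zero_if: "\<beta> V V = 0 \<Longrightarrow> \<Delta> l0 (\<iota> V \<phi>) = 0"
  unfolding \<beta>_def by (rule \<Delta>_eq_0[OF l0_in_I \<iota>\<phi>_in])

text \<open>Gram-Schmidt for a form that is only semidefinite. It cannot stop at
  \<open>n < m\<close> vectors: if every remainder were a null vector, the \<open>n\<close> vectors
  \<open>\<Delta> l0 (\<iota> (z i) \<phi>)\<close> would span the range of
  \<open>\<Delta> l0\<close> over the complex numbers, and this range has dimension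
  \<open>m\<close>.\<close>

lemma orthonormal_family: "n \<le> m \<Longrightarrow> \<exists>z. \<forall>i<n. \<forall>j<n. \<beta> (z i) (z j) = (if i = j then 1 else 0)"
proof (induction n)
  case (Suc n)
  then obtain z where z: "\<And>i j. i < n \<Longrightarrow> j < n \<Longrightarrow> \<beta> (z i) (z j) = (if i = j then 1 else 0)"
    by (metis Suc_leD)
  let ?p = "\<lambda>W. W - (\<Sum>i<n. \<beta> W (z i) *\<^sub>R z i)"
  have orth: "\<beta> (?p W) (z j) = 0" if j: "j < n" for W j
  proof -
    have "\<beta> (?p W) (z j) = \<beta> W (z j) - (\<Sum>i<n. \<beta> W (z i) * \<beta> (z i) (z j))"
      by (simp add: linear_diff[OF \<beta>_linear] linear_sum[OF \<beta>_linear] \<beta>_scale_left)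
    also have "(\<Sum>i<n. \<beta> W (z i) * \<beta> (z i) (z j)) = (\<Sum>i<n. if i = j then \<beta> W (z i) else 0)"
      using j by (intro sum.cong) (auto simp: z)
    finally show ?thesis using j by simp
  qed
  have "\<exists>W. \<beta> (?p W) (?p W) \<noteq> 0"
  proof (rule ccontr)
    assume "\<not> ?thesis"
    then have z0: "\<Delta> l0 (\<iota> (?p W) \<phi>) = 0" for W using \<Delta>_\<iota>_zero_if by blast
    let ?d = "\<lambda>W. \<Delta> l0 (\<iota> W \<phi>)"
    have dadd: "?d (V + W) = ?d V + ?d W" for V W
      using \<iota>_add[of \<phi>] \<Delta>_add[OF l0_in_I \<iota>\<phi>_in \<iota>\<phi>_in] by simp
    have dsc: "?d (a *\<^sub>R V) = of_real a *\<^sub>C ?d V" for V a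
      using \<iota>_scale[of \<phi>] \<Delta>_scale[OF l0_in_I \<iota>\<phi>_in] by simp
    have d0: "?d 0 = 0" using dsc[of 0 0] by simp
    have dsum: "?d (\<Sum>i<p. a i *\<^sub>R z i) = (\<Sum>i<p. of_real (a i) *\<^sub>C ?d (z i))" for a and p :: nat
      by (induction p) (simp_all add: d0 dadd dsc)
    have "?d W \<in> cspan (?d ` (z ` {..<n}))" for W
    proof -
      have "?d W = ?d (?p W + (\<Sum>i<n. \<beta> W (z i) *\<^sub>R z i))" by simp
      also have "\<dots> = (\<Sum>i<n. of_real (\<beta> W (z i)) *\<^sub>C ?d (z i))" unfolding dadd dsum z0 by simp
      also have "\<dots> \<in> cspan (?d ` (z ` {..<n}))"
        by (intro complex_vector.span_sum complex_vector.span_scale complex_vector.span_base) auto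
      finally show ?thesis .
    qed
    then have sub: "\<Delta> l0 ` Vp \<subseteq> cspan (?d ` (z ` {..<n}))"
      unfolding spanning[symmetric] by (intro complex_vector.span_minimal complex_vector.subspace_span) auto
    obtain E where E: "finite E" "card E = m" "\<not> complex_vector.dependent E" "cspan E = \<Delta> l0 ` Vp"
      using rank[OF l0_in_I] unfolding has_cdim_def by blast
    have "E \<subseteq> cspan (?d ` (z ` {..<n}))" using sub E(4) complex_vector.span_superset[of E] by auto
    from complex_vector.independent_span_bound[OF _ E(3) this]
    have "card E \<le> card (?d ` (z ` {..<n}))" by simp
    also have "\<dots> \<le> card {..<n}" using card_image_le[of "{..<n}" "\<lambda>i. ?d (z i)"] by (simp add: image_image)
    finally show False using E(2) Suc.prems by simp
  qed
  then obtain W where "\<beta> (?p W) (?p W) \<noteq> 0" by blast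
  then have W: "\<beta> (?p W) (?p W) > 0" using \<beta>_nonneg[of "?p W"] by linarith
  define y where "y = (1 / sqrt (\<beta> (?p W) (?p W))) *\<^sub>R ?p W"
  have yy: "\<beta> y y = 1"
    using W unfolding y_def \<beta>_scale_left \<beta>_sym[of "?p W" "_ *\<^sub>R ?p W"] by (simp add: real_sqrt_mult_self)
  have yz: "\<beta> y (z j) = 0" "\<beta> (z j) y = 0" if "j < n" for j
    using orth[OF that] \<beta>_sym[of "z j" y] unfolding y_def by (simp_all add: \<beta>_scale_left)
  show ?case
  proof (intro exI[of _ "z(n := y)"] allI impI)
    fix i j assume "i < Suc n" "j < Suc n"
    then show "\<beta> ((z(n := y)) i) ((z(n := y)) j) = (if i = j then 1 else 0)"
      using z yy yz by (auto simp: less_Suc_eq)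
  qed
qed simp

end

section \<open>Reduction to finitely many equations\<close>

text \<open>The directions \<open>z j\<close> span the complement of the tangent space of the manifold at \<open>0\<close>.\<close>

locale persistence = embedded S pair C s D T l0 \<delta>\<^sub>1 k \<phi> \<iota> m
  for S :: "real \<Rightarrow> 'a::complex_vector hspace" and pair C s D T l0 \<delta>\<^sub>1 k \<phi>
    and \<iota> :: "'x::banach \<Rightarrow> 'a \<Rightarrow> 'a" and m +
  fixes z :: "nat \<Rightarrow> 'x"
  assumes z: "\<And>i j. i < m \<Longrightarrow> j < m \<Longrightarrow> \<beta> (z i) (z j) = (if i = j then 1 else 0)"
begin

text \<open>The sign compensates the one in the expansion \<open>\<phi> - t * W \<phi>\<close> of
  \<open>g\<close>, so that the derivative in \<open>F'_W\<close> is \<beta> without a sign.\<close>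

definition e :: "nat \<Rightarrow> 'a" where "e j = - \<iota> (z j) \<phi>"

lemma ez_in: "e j \<in> Vp" unfolding e_def using \<iota>\<phi>_in by simp

lemma e_real: "C (e j) = e j"
proof -
  have "C (- 1 *\<^sub>C \<iota> (z j) \<phi>) = cnj (- 1) *\<^sub>C C (\<iota> (z j) \<phi>)" by (rule conj_scale[OF \<iota>\<phi>_in])
  then show ?thesis unfolding e_def by (simp add: \<iota>\<phi>_real)
qed

lemma B_e: "f \<in> Vp \<Longrightarrow> B l0 f (e j) = - B l0 f (\<iota> (z j) \<phi>)"
  unfolding e_def using B_scale_right[OF l0_in_I _ \<iota>\<phi>_in[of "z j"], of f "-1"] by simp

sublocale lap_rank S pair C s D T l0 \<delta>\<^sub>1 k m e
proof
  fix i j assume ij: "i < m" "j < m"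
  have "B l0 (e i) (e j) = cnj (- B l0 (\<iota> (z j) \<phi>) (e i))"
    using B_e[OF ez_in, of i j] B_cnj[OF l0_in_I \<iota>\<phi>_in ez_in, of i "z j"] by simp
  also have "\<dots> = cnj (B l0 (\<iota> (z j) \<phi>) (\<iota> (z i) \<phi>))" using B_e[OF \<iota>\<phi>_in] by simp
  also have "\<dots> = (if i = j then 1 else 0)" unfolding B_\<beta> using z[OF ij(2,1)] by auto
  finally show "B l0 (e i) (e j) = (if i = j then 1 else 0)" .
qed (use k rank ez_in in auto)

definition Kop :: "real \<times> 'x \<Rightarrow> 'a \<Rightarrow> 'a" where "Kop p = rst (S s) (\<lambda>f. wop (snd p) (R0 (fst p) f))"

text \<open>The bound on \<open>fst p - l0\<close> keeps \<open>fst p\<close> away from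
  \<open>l0 + 1\<close>, where the formula \<open>R0_\<phi>\<close> has its pole; the bound on
  \<open>Kop p\<close> makes \<open>1 + Kop p\<close> invertible by a Neumann series.\<close>

definition dom :: "(real \<times> 'x) set" where "dom = {p \<in> I \<times> UNIV. \<bar>fst p - l0\<bar> < 1 \<and> Npp (Kop p) < 1/2}"

text \<open>The inverse of \<open>1 + Kop p\<close>, extended by 0 so as to lie in
  \<open>opp\<close>.\<close>

definition Top :: "real \<times> 'x \<Rightarrow> 'a \<Rightarrow> 'a" where
  "Top p = (\<lambda>f. if f \<in> Vp then THE g. g \<in> Vp \<and> g + Kop p g = f else 0)"

lemma norm_fst_le': "norm (fst v) \<le> norm v"
  using norm_fst_le[of "fst v" "snd v"] by simp

lemma UC_Kop: "UC opp Npp rsc k (I \<times> UNIV) {Kop}"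
proof -
  interpret M: nbilinear omp Nmp rsc opm Npm rsc opp Npp rsc "\<lambda>P Q. rst (S s) (\<lambda>f. P (Q f))" 1
    by (rule nbilinear_compose[OF Hp.hilb_axioms Hm.hilb_axioms Hp.hilb_axioms])
  obtain L where L: "L > 0" "\<forall>W. Nmp (wop W) \<le> L * norm W" using wop_norm by blast
  have W: "UC omp Nmp rsc k (I \<times> UNIV) {\<lambda>p. wop (snd p)}"
  proof (rule MP.UC_linear_function[where K = L])
    show "Nmp (wop (snd v)) \<le> L * norm v" for v :: "real \<times> 'x"
    proof -
      have "norm (snd v) \<le> norm v" using norm_snd_le[of "snd v" "fst v"] by simp
      then have "L * norm (snd v) \<le> L * norm v" using L(1) by (intro mult_left_mono) auto
      then show ?thesis using L(2) order_trans by blast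
    qed
  qed (auto simp: wop_ops wop_add wop_scale)
  have "UC opm Npm rsc k (I \<times> (UNIV :: 'x set)) ((\<lambda>f p. f (0 + fst p)) ` {R0})"
    by (rule PM.UC_affine[OF bounded_linear_fst norm_fst_le' _ UC_R0]) (simp add: image_subset_iff)
  then have R: "UC opm Npm rsc k (I \<times> (UNIV :: 'x set)) {\<lambda>p. R0 (fst p)}" by simp
  have "UC opp Npp rsc k (I \<times> UNIV) (fam2 (\<lambda>P Q. rst (S s) (\<lambda>f. P (Q f))) {\<lambda>p. wop (snd p)} {\<lambda>p. R0 (fst p)})"
    by (rule M.UC_b[OF W R])
  then show ?thesis
    by (rule UC_subset) (auto simp: fam2_def Kop_def[abs_def])
qed

lemma Kop_ops: "p \<in> I \<times> UNIV \<Longrightarrow> Kop p \<in> opp"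
  using equicontD(1)[OF UC_equicont[OF UC_Kop], of Kop p] by simp

lemma Kop_eq: "f \<in> Vp \<Longrightarrow> fst p \<in> I \<Longrightarrow> Kop p f = \<iota> (snd p) (R0 (fst p) f)"
  using wop_eq[of "R0 (fst p) f" "snd p"] PM.ops_in[OF R0_ops] by (simp add: Kop_def rst_def)

lemma domD: "p \<in> dom \<Longrightarrow> fst p \<in> I" "p \<in> dom \<Longrightarrow> fst p \<noteq> l0 + 1" "p \<in> dom \<Longrightarrow> Kop p \<in> opp" "p \<in> dom \<Longrightarrow> Npp (Kop p) \<le> 1/2"
  using Kop_ops[of p] by (auto simp: dom_def mem_Times_iff)

lemma open_dom: "open dom"
proof -
  have "open (I \<times> (UNIV :: 'x set))" by (intro open_Times) auto
  have "\<exists>d>0. \<forall>q. dist q p < d \<longrightarrow> q \<in> dom" if p: "p \<in> dom" for p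
  proof -
    have pI: "p \<in> I \<times> UNIV" "\<bar>fst p - l0\<bar> < 1" "Npp (Kop p) < 1/2" using p by (auto simp: dom_def)
    define \<eta> where "\<eta> = (1/2 - Npp (Kop p)) / 2"
    have \<eta>: "\<eta> > 0" using pI by (simp add: \<eta>_def)
    obtain d1 where d1: "d1 > 0" "\<forall>q\<in>I \<times> UNIV. dist q p < d1 \<longrightarrow> (\<forall>f\<in>{Kop}. Npp (f q - f p) \<le> \<eta>)"
      using equicontD(3)[OF UC_equicont[OF UC_Kop] pI(1) \<eta>] unfolding eventually_nw by blast
    obtain d2 where d2: "d2 > 0" "\<forall>q. dist q p < d2 \<longrightarrow> q \<in> I \<times> UNIV"
      using \<open>open (I \<times> UNIV)\<close> pI(1) unfolding open_dist by blast
    define d where "d = min (min d1 d2) (1 - \<bar>fst p - l0\<bar>)"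
    have "q \<in> dom" if q: "dist q p < d" for q
    proof -
      have qd: "dist q p < d1" "dist q p < d2" "dist q p < 1 - \<bar>fst p - l0\<bar>" using q by (simp_all add: d_def)
      have qI: "q \<in> I \<times> UNIV" using d2(2) qd(2) by blast
      have "\<bar>fst q - fst p\<bar> \<le> dist q p" using dist_fst_le[of q p] by (simp add: dist_real_def)
      then have 1: "\<bar>fst q - l0\<bar> < 1" using qd(3) by linarith
      have "Npp (Kop q) \<le> Npp (Kop q - Kop p) + Npp (Kop p)"
        using PP.N_triangle[of "Kop q - Kop p" "Kop p"] Kop_ops[OF qI] Kop_ops[OF pI(1)] by simp
      also have "\<dots> \<le> \<eta> + Npp (Kop p)" using d1(2)[rule_format, OF qI qd(1), of Kop] by simp
      also have "\<dots> < 1/2" using pI(3) by (simp add: \<eta>_def field_simps)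
      finally show ?thesis using qI 1 by (simp add: dom_def)
    qed
    moreover have "d > 0" using d1 d2 pI(2) by (simp add: d_def)
    ultimately show ?thesis by blast
  qed
  then show ?thesis unfolding open_dist by blast
qed

lemma Kop_0: "l \<in> I \<Longrightarrow> Kop (l, 0) = 0"
proof -
  assume l: "l \<in> I"
  have "\<iota> 0 f = 0" if "f \<in> Vm" for f using \<iota>_scale[OF that, of 0 0] by simp
  then show ?thesis using wop_eq[of _ 0] PM.ops_in[OF R0_ops[OF l]] by (auto simp: Kop_def rst_def fun_eq_iff)
qed

lemma dom_0: "l \<in> I \<Longrightarrow> \<bar>l - l0\<bar> < 1 \<Longrightarrow> (l, 0) \<in> dom"
  by (simp add: dom_def Kop_0)

lemma Top_spec:
  assumes p: "p \<in> dom" and f: "f \<in> Vp"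
  shows "Top p f \<in> Vp" "Top p f + Kop p (Top p f) = f" "\<And>g. g \<in> Vp \<Longrightarrow> g + Kop p g = f \<Longrightarrow> Top p f = g"
proof -
  note K = domD(3,4)[OF p]
  have uniq: "g = h" if gh: "g \<in> Vp" "g + Kop p g = f" "h \<in> Vp" "h + Kop p h = f" for g h
  proof -
    have "Kop p (g - h) = Kop p g - Kop p h"
      using PP.ops_add[OF K(1), of "g - h" h] gh by (simp add: algebra_simps)
    then have "(g - h) + Kop p (g - h) = (g + Kop p g) - (h + Kop p h)" by simp
    then have "np (g - h) \<le> 2 * np 0" using neumann_bound[OF Hp.hilb_axioms K, of "g - h"] gh by simp
    moreover have "np (g - h) \<ge> 0" using gh by (intro Hp.nrm_nonneg Hp.vecs_diff)
    ultimately have "np (g - h) = 0" by simp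
    then show ?thesis using Hp.nrm_eq_0[of "g - h"] gh by simp
  qed
  obtain g where g: "g \<in> Vp" "g + Kop p g = f" using neumann_inverse[OF Hp.hilb_axioms K f] by blast
  have eq: "Top p f = g" unfolding Top_def using f g uniq by (auto intro!: the_equality)
  show "Top p f \<in> Vp" "Top p f + Kop p (Top p f) = f" using g eq by auto
  show "Top p f = h" if "h \<in> Vp" "h + Kop p h = f" for h using uniq[OF that g] eq by simp
qed

lemma Top_ops: assumes p: "p \<in> dom" shows "Top p \<in> opp" "Npp (Top p) \<le> 2"
proof -
  note K = domD(3,4)[OF p]
  have b: "np (Top p f) \<le> 2 * np f" if "f \<in> Vp" for f
    using neumann_bound[OF Hp.hilb_axioms K Top_spec(1)[OF p that]] Top_spec(2)[OF p that] by simp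
  have add: "Top p (f + g) = Top p f + Top p g" if "f \<in> Vp" "g \<in> Vp" for f g
  proof (rule Top_spec(3)[OF p])
    have "Kop p (Top p f + Top p g) = Kop p (Top p f) + Kop p (Top p g)"
      using PP.ops_add[OF K(1)] Top_spec(1)[OF p] that by blast
    then have "Top p f + Top p g + Kop p (Top p f + Top p g) = (Top p f + Kop p (Top p f)) + (Top p g + Kop p (Top p g))"
      by (simp only: ac_simps)
    then show "Top p f + Top p g + Kop p (Top p f + Top p g) = f + g"
      unfolding Top_spec(2)[OF p that(1)] Top_spec(2)[OF p that(2)] .
  qed (use that Top_spec(1)[OF p] in auto)
  have sc: "Top p (c *\<^sub>C f) = c *\<^sub>C Top p f" if "f \<in> Vp" for c f
  proof (rule Top_spec(3)[OF p])
    show "c *\<^sub>C Top p f + Kop p (c *\<^sub>C Top p f) = c *\<^sub>C f"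
      using PP.ops_scale[OF K(1) Top_spec(1)[OF p that]] Top_spec(2)[OF p that]
      by (simp add: complex_vector.scale_right_distrib[symmetric])
  qed (use that Top_spec(1)[OF p] in auto)
  show "Top p \<in> opp" "Npp (Top p) \<le> 2"
    using PP.opsI[of "Top p" 2] b add sc Top_spec(1)[OF p] by (auto simp: Top_def)
qed

text \<open>\<open>UC_inverse\<close> with composition of operators as the product. Its identity
  results from applying \<open>Top q\<close> to
  \<open>f = (h + Kop q h) - (Kop q h - Kop p h)\<close> with \<open>h = Top p f\<close>.\<close>

lemma UC_Top: "UC opp Npp rsc k dom {Top}"
proof (rule UC_inverse[OF nbilinear_compose[OF Hp.hilb_axioms Hp.hilb_axioms Hp.hilb_axioms]])
  show "UC opp Npp rsc k dom {Kop}"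
    by (rule UC_refine[OF UC_Kop]) (auto simp: dom_def)
  fix p q assume p: "p \<in> dom" and q: "q \<in> dom"
  show "Top p \<in> opp" "Npp (Top p) \<le> 2" using Top_ops[OF p] by auto
  show "Top q - Top p = - rst (S s) (\<lambda>f. rst (S s) (\<lambda>f. Top q ((Kop q - Kop p) f)) (Top p f))"
  proof
    fix f
    show "(Top q - Top p) f = (- rst (S s) (\<lambda>f. rst (S s) (\<lambda>f. Top q ((Kop q - Kop p) f)) (Top p f))) f"
    proof (cases "f \<in> Vp")
      case True
      let ?g = "Top p f"
      have g: "?g \<in> Vp" "?g + Kop p ?g = f" using Top_spec(1,2)[OF p True] .
      have in': "Kop q ?g \<in> Vp" "Kop p ?g \<in> Vp" using PP.ops_in[OF domD(3)] p q g by auto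
      have "Top q (?g + Kop q ?g) = ?g" by (rule Top_spec(3)[OF q]) (use g in' in auto)
      moreover have "?g + Kop q ?g = (?g + Kop p ?g) + (Kop q ?g - Kop p ?g)" by simp
      then have "?g + Kop q ?g = f + (Kop q ?g - Kop p ?g)" unfolding g(2) .
      ultimately have "Top q f + Top q (Kop q ?g - Kop p ?g) = ?g"
        using PP.ops_add[OF Top_ops(1)[OF q] True, of "Kop q ?g - Kop p ?g"] in' by simp
      then show ?thesis using True g by (simp add: rst_def algebra_simps)
    qed (auto simp: Top_def rst_def)
  qed
qed

definition g :: "real \<times> 'x \<Rightarrow> 'a" where "g p = Top p \<phi>"

lemma g_in: "p \<in> dom \<Longrightarrow> g p \<in> Vp" unfolding g_def using Top_spec(1) \<phi>_Vp by blast

lemma g_eq: "p \<in> dom \<Longrightarrow> g p + \<iota> (snd p) (R0 (fst p) (g p)) = \<phi>"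
  using Top_spec(2)[of p \<phi>] \<phi>_Vp Kop_eq[OF g_in domD(1)] by (simp add: g_def)

lemma g_unique: "p \<in> dom \<Longrightarrow> f \<in> Vp \<Longrightarrow> f + \<iota> (snd p) (R0 (fst p) f) = \<phi> \<Longrightarrow> f = g p"
  unfolding g_def using Top_spec(3)[of p \<phi> f] \<phi>_Vp Kop_eq[of f p] domD(1)[of p] by simp

lemma R0_in: "l \<in> I \<Longrightarrow> f \<in> Vp \<Longrightarrow> R0 l f \<in> Vm" using PM.ops_in[OF R0_ops] by blast

text \<open>\<open>C (g p)\<close> solves the equation of \<open>g p\<close>, whose solution is
  unique.\<close>

lemma g_real: assumes p: "p \<in> dom" shows "C (g p) = g p"
proof (rule g_unique[OF p])
  show "C (g p) \<in> Vp" using conj_closed g_in[OF p] by blast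
  have r: "R0 (fst p) (g p) \<in> Vm" using R0_in domD(1)[OF p] g_in[OF p] by blast
  have "C (g p) + \<iota> (snd p) (R0 (fst p) (C (g p))) = C (g p) + C (\<iota> (snd p) (R0 (fst p) (g p)))"
    using C_R0[OF domD(1)[OF p] g_in[OF p]] C_\<iota>[OF r] by simp
  also have "\<dots> = C (g p + \<iota> (snd p) (R0 (fst p) (g p)))" using conj_add[OF g_in[OF p] \<iota>_in[OF r]] by simp
  finally show "C (g p) + \<iota> (snd p) (R0 (fst p) (C (g p))) = \<phi>" using g_eq[OF p] C\<phi> by simp
qed

lemma g_0: "l \<in> I \<Longrightarrow> \<bar>l - l0\<bar> < 1 \<Longrightarrow> g (l, 0) = \<phi>"
  using g_unique[of "(l, 0)" \<phi>] dom_0[of l] \<phi>_Vp \<iota>_scale[of "R0 l \<phi>" 0 0] R0_in[of l \<phi>] by simp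

text \<open>The pairings are real because \<open>g p\<close>, \<phi> and the \<open>e j\<close> are
  real, so the equations for the real parts are the full equations.\<close>

definition F :: "nat \<Rightarrow> real \<times> 'x \<Rightarrow> real" where
  "F i p = (case i of 0 \<Rightarrow> Re (pair (R0 (fst p) (g p)) \<phi>) - 1 | Suc j \<Rightarrow> Re (B (fst p) (g p) (e j)))"

text \<open>The number is bilinear in the operators \<open>A (fst p)\<close> and
  \<open>Top p\<close>, so the product rule \<open>UC_b\<close> applies.\<close>

lemma UC_matrix_element:
  assumes A: "UC opm Npm rsc k I {A}" and \<psi>: "\<psi> \<in> Vp"
  shows "NC k dom {\<lambda>p. Re (pair (A (fst p) (g p)) \<psi>)}"
proof -
  obtain K where K: "K > 0" "\<forall>f\<in>Vm. \<forall>g\<in>Vp. cmod (pair f g) \<le> K * nm f * np g" using pair_bound by blast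
  let ?b = "\<lambda>P Q. Re (pair (P (Q \<phi>)) \<psi>)"
  interpret M: nbilinear opm Npm rsc opp Npp rsc UNIV norm "(*\<^sub>R)" ?b "K * np \<phi> * np \<psi>"
  proof (intro nbilinear.intro nbilinear_axioms.intro PM.nspace_axioms PP.nspace_axioms nspace_norm)
    fix P Q assume P: "P \<in> opm" and Q: "Q \<in> opp"
    have Q\<phi>: "Q \<phi> \<in> Vp" using PP.ops_in[OF Q \<phi>_Vp] .
    have "norm (?b P Q) \<le> cmod (pair (P (Q \<phi>)) \<psi>)" using abs_Re_le_cmod by simp
    also have "\<dots> \<le> K * nm (P (Q \<phi>)) * np \<psi>" using K PM.ops_in[OF P Q\<phi>] \<psi> by blast
    also have "\<dots> \<le> K * (Npm P * (Npp Q * np \<phi>)) * np \<psi>"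
    proof (intro mult_right_mono mult_left_mono)
      have "nm (P (Q \<phi>)) \<le> Npm P * np (Q \<phi>)" by (rule PM.ops_bound[OF P Q\<phi>])
      also have "\<dots> \<le> Npm P * (Npp Q * np \<phi>)"
        using PP.ops_bound[OF Q \<phi>_Vp] PM.N_nonneg[OF P] by (intro mult_left_mono)
      finally show "nm (P (Q \<phi>)) \<le> Npm P * (Npp Q * np \<phi>)" .
    qed (use K \<psi> in auto)
    finally show "norm (?b P Q) \<le> K * np \<phi> * np \<psi> * Npm P * Npp Q" by (simp add: algebra_simps)
  next
    fix P P' Q assume "P \<in> opm" "P' \<in> opm" "Q \<in> opp"
    then show "?b (P + P') Q = ?b P Q + ?b P' Q"
      using pair_m_add_left PM.ops_in PP.ops_in \<phi>_Vp \<psi> by simp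
  next
    fix P Q Q' assume P: "P \<in> opm" and Q: "Q \<in> opp" "Q' \<in> opp"
    have in': "Q \<phi> \<in> Vp" "Q' \<phi> \<in> Vp" using PP.ops_in[OF _ \<phi>_Vp] Q by auto
    have "P ((Q + Q') \<phi>) = P (Q \<phi>) + P (Q' \<phi>)" using PM.ops_add[OF P in'] by simp
    then show "?b P (Q + Q') = ?b P Q + ?b P Q'"
      using pair_m_add_left[OF PM.ops_in[OF P in'(1)] PM.ops_in[OF P in'(2)] \<psi>] by simp
  next
    fix P Q r assume P: "P \<in> opm" and Q: "Q \<in> opp"
    have in': "Q \<phi> \<in> Vp" "P (Q \<phi>) \<in> Vm" using PP.ops_in[OF Q \<phi>_Vp] PM.ops_in[OF P] by auto
    show "?b (rsc r P) Q = r *\<^sub>R ?b P Q" "?b P (rsc r Q) = r *\<^sub>R ?b P Q"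
      using in' PM.ops_scale[OF P in'(1)] pair_m_scale_left[OF in'(2) \<psi>] by (simp_all add: rsc_def csc_def)
  qed (use K \<phi>_Vp \<psi> in auto)
  have "UC opm Npm rsc k dom ((\<lambda>f p. f (0 + fst p)) ` {A})"
    by (rule PM.UC_affine[OF bounded_linear_fst norm_fst_le' _ A]) (use domD(1) in \<open>auto simp: image_subset_iff\<close>)
  then have "NC k dom (fam2 ?b {\<lambda>p. A (fst p)} {Top})" using UC_Top by (intro M.UC_b) auto
  then show ?thesis
    by (rule UC_subset) (auto simp: fam2_def g_def)
qed

lemma UC_F: "NC k dom {F i}"
proof (cases i)
  case 0
  have "NC k dom ((\<lambda>a x. a) ` {- 1 :: real})" by (rule nspace.UC_const[OF nspace_norm, of _ 1]) auto
  then have "NC k dom (fam2 (+) {\<lambda>p. Re (pair (R0 (fst p) (g p)) \<phi>)} {\<lambda>x. - 1})"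
    by (intro nspace.UC_add[OF nspace_norm] UC_matrix_element[OF UC_R0 \<phi>_Vp]) simp
  then show ?thesis
    by (rule UC_subset) (auto simp: fam2_def F_def[abs_def] 0)
next
  case (Suc j)
  show ?thesis
  proof (rule UC_refine[OF UC_matrix_element[OF UC_\<Delta>0 ez_in[of j]] subset_refl])
    fix q assume "q \<in> {F i}"
    then show "\<exists>f\<in>{\<lambda>p. Re (pair (\<Delta>0 (fst p) (g p)) (e j))}. \<forall>x\<in>dom. q x = f x"
      using Suc g_in by (auto simp: F_def B_def \<Delta>0_def rst_def)
  qed
qed

section \<open>Derivatives of the equations at the unperturbed point\<close>

definition dir :: "nat \<Rightarrow> real \<times> 'x" where "dir i = (case i of 0 \<Rightarrow> (1, 0) | Suc j \<Rightarrow> (0, z j))"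

abbreviation "p0 \<equiv> (l0, 0 :: 'x)"

lemma p0_dom: "p0 \<in> dom" using dom_0[OF l0_in_I] by simp

lemma pair_\<phi>_\<phi>: "pair \<phi> \<phi> = 1"
  using pair_eq_hip[of \<phi> \<phi>] H0.ip_self[of \<phi>] \<phi>_norm by simp

text \<open>Without perturbation \<open>g\<close> is \<phi>, and \<open>R0_\<phi>\<close> and
  \<open>\<Delta>_\<phi>\<close> make the equations explicit.\<close>

lemma F_line: "l \<in> I \<Longrightarrow> \<bar>l - l0\<bar> < 1 \<Longrightarrow> F 0 (l, 0) = 1 / (l0 + 1 - l) - 1"
  "l \<in> I \<Longrightarrow> \<bar>l - l0\<bar> < 1 \<Longrightarrow> F (Suc j) (l, 0) = 0"
proof -
  assume l: "l \<in> I" "\<bar>l - l0\<bar> < 1"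
  have ne: "l \<noteq> l0 + 1" using l by auto
  show "F 0 (l, 0) = 1 / (l0 + 1 - l) - 1"
    unfolding F_def using g_0[OF l] R0_\<phi>[OF l(1) ne] pair_m_scale_left[of \<phi> \<phi> "of_real (1 / (l0 + 1 - l))"] \<phi>_Vp pair_\<phi>_\<phi>
    by (simp del: of_real_divide)
  show "F (Suc j) (l, 0) = 0"
    unfolding F_def B_def using g_0[OF l] \<Delta>_\<phi>[OF l(1) ne] pair_m_0_left ez_in by simp
qed

lemma F_p0: "F i p0 = 0"
  using F_line[OF l0_in_I] by (cases i) simp_all

lemma F_derivative: "\<exists>F'. (F i has_derivative F') (at p0)"
proof -
  obtain k' where k': "k = Suc k'" using k by (cases k) auto
  have "NC (Suc k') dom {F i}" using UC_F unfolding k' .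
  then obtain D' where "equidiff UNIV norm (*\<^sub>R) dom {F i} (\<lambda>f. f) D'" "NC k' dom (dfam {F i} D')"
    by (rule UC_SucE)
  then show ?thesis using equidiff_has_derivative_open[OF _ _ open_dom p0_dom] by blast
qed

lemma F'_lambda:
  assumes "(F i has_derivative F') (at p0)"
  shows "F' (1, 0) = (if i = 0 then 1 else 0)"
proof (rule has_derivative_direction[OF assms])
  show "min \<delta>\<^sub>1 (1/2) > 0" using \<delta>\<^sub>1 by simp
  fix t :: real assume t: "0 < t" "t < min \<delta>\<^sub>1 (1/2)"
  have tI: "l0 + t \<in> I" "\<bar>l0 + t - l0\<bar> < 1" using t by auto
  have eq: "p0 + t *\<^sub>R (1, 0) = (l0 + t, 0)" by simp
  show "\<bar>F i (p0 + t *\<^sub>R (1, 0)) - F i p0 - t * (if i = 0 then 1 else 0)\<bar> \<le> 2 * t\<^sup>2"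
  proof (cases i)
    case 0
    have "F i (p0 + t *\<^sub>R (1, 0)) - F i p0 - t * (if i = 0 then 1 else 0) = 1 / (1 - t) - 1 - t"
      unfolding eq F_p0 using F_line(1)[OF tI] 0 by (simp add: algebra_simps)
    \<comment> \<open>\<open>t < 1/2\<close> keeps \<open>1 - t\<close> above 1/2, whence the factor
      2 in the error bound.\<close>
    also have "\<dots> = t\<^sup>2 / (1 - t)" using t by (simp add: field_simps power2_eq_square)
    also have "\<bar>t\<^sup>2 / (1 - t)\<bar> \<le> t\<^sup>2 / (1/2)" using t by (simp, intro divide_left_mono[of "1/2", simplified]) auto
    finally show ?thesis by simp
  next
    case (Suc j)
    then show ?thesis unfolding eq F_p0 using F_line(2)[OF tI] by simp
  qed
qed

text \<open>Inserting the equation for \<open>g\<close> into itself gives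
  \<open>g = \<phi> - t K \<phi> + t\<^sup>2 K K g\<close> with \<open>K = Kop (l0, W)\<close>. In
  \<open>B l0 g (e j)\<close> the first term vanishes because \<open>\<Delta> l0 \<phi> = 0\<close>,
  the second is linear in \<open>t\<close> with coefficient \<open>\<beta> W (z j)\<close>, and the
  third is bounded by a multiple of \<open>t\<^sup>2\<close>.\<close>

lemma F'_W:
  assumes der: "(F (Suc j) has_derivative F') (at p0)"
  shows "F' (0, W) = \<beta> W (z j)"
proof -
  obtain K where K: "K > 0" "\<forall>f\<in>Vm. \<forall>g\<in>Vp. cmod (pair f g) \<le> K * nm f * np g" using pair_bound by blast
  define k1 where "k1 = Npp (Kop (l0, W))"
  have KW: "Kop (l0, W) \<in> opp" using Kop_ops l0_in_I by simp
  have k1: "k1 \<ge> 0" unfolding k1_def by (rule PP.N_nonneg[OF KW])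
  obtain r where r: "r > 0" "\<And>t. 0 < t \<Longrightarrow> t < r \<Longrightarrow> (l0, t *\<^sub>R W) \<in> dom"
  proof -
    have "isCont (\<lambda>t. (l0, t *\<^sub>R W)) 0" by (intro continuous_intros)
    then have "((\<lambda>t. (l0, t *\<^sub>R W)) \<longlongrightarrow> p0) (at (0::real))" by (simp add: isCont_def)
    then have "\<forall>\<^sub>F t in at (0::real). (l0, t *\<^sub>R W) \<in> dom" using topological_tendstoD open_dom p0_dom by blast
    then show ?thesis using that unfolding eventually_at by (auto simp: dist_real_def)
  qed
  let ?n = "Npm (\<Delta>0 l0)"
  have n0: "?n \<ge> 0" using PM.N_nonneg[OF \<Delta>0_ops[OF l0_in_I]] .
  show ?thesis
  proof (rule has_derivative_direction[OF der r(1)])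
    fix t :: real assume t: "0 < t" "t < r"
    let ?p = "(l0, t *\<^sub>R W)"
    have p: "?p \<in> dom" using r(2)[OF t] .
    have eq: "p0 + t *\<^sub>R (0, W) = ?p" by simp
    have Kt: "Kop ?p f = of_real t *\<^sub>C Kop (l0, W) f" if "f \<in> Vp" for f
      using Kop_eq[OF that, of ?p] Kop_eq[OF that, of "(l0, W)"] l0_in_I \<iota>_scale[OF R0_in[OF l0_in_I that]] by simp
    let ?K = "Kop (l0, W)" and ?t = "complex_of_real t"
    have gp: "g ?p \<in> Vp" using g_in[OF p] .
    \<comment> \<open>At \<open>l0\<close> the factor \<open>1 / (l0 + 1 - l)\<close> in
      \<open>R0_\<phi>\<close> is 1, so \<open>R0 l0\<close> fixes \<phi>.\<close>
    have K\<phi>: "?K \<phi> = \<iota> W \<phi>" using Kop_eq[OF \<phi>_Vp, of "(l0, W)"] l0_in_I R0_\<phi>[OF l0_in_I] by simp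
    have in': "?K (g ?p) \<in> Vp" "?K (?K (g ?p)) \<in> Vp" "?K \<phi> \<in> Vp" using PP.ops_in[OF KW] gp \<phi>_Vp by auto
    have g1: "g ?p + ?t *\<^sub>C ?K (g ?p) = \<phi>"
      using Top_spec(2)[OF p \<phi>_Vp] Kt[OF gp] by (simp add: g_def)
    have "?K \<phi> = ?K (g ?p + ?t *\<^sub>C ?K (g ?p))" by (simp only: g1)
    then have "?K \<phi> = ?K (g ?p) + ?t *\<^sub>C ?K (?K (g ?p))"
      using PP.ops_add[OF KW gp, of "?t *\<^sub>C ?K (g ?p)"] PP.ops_scale[OF KW in'(1)] in' by simp
    then have "?K (g ?p) = ?K \<phi> - ?t *\<^sub>C ?K (?K (g ?p))" by (simp add: algebra_simps)
    moreover have "g ?p = \<phi> - ?t *\<^sub>C ?K (g ?p)" using g1 by (simp add: algebra_simps)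
    ultimately have "g ?p = \<phi> - ?t *\<^sub>C (?K \<phi> - ?t *\<^sub>C ?K (?K (g ?p)))" by metis
    moreover have sub: "x - (a - b) = x + (- a + b)" for x a b :: 'a by simp
    ultimately have g2: "g ?p = \<phi> + ((- ?t) *\<^sub>C \<iota> W \<phi> + (?t * ?t) *\<^sub>C ?K (?K (g ?p)))"
      by (simp only: complex_vector.scale_right_diff_distrib complex_vector.scale_scale complex_vector.scale_minus_left K\<phi> sub)
    have "B l0 (g ?p) (e j) = B l0 \<phi> (e j) + ((- ?t) * B l0 (\<iota> W \<phi>) (e j) + (?t * ?t) * B l0 (?K (?K (g ?p))) (e j))"
      by (subst g2)
        (use in' \<phi>_Vp \<iota>\<phi>_in ez_in in \<open>simp only: B_add_left[OF l0_in_I] B_scale_left[OF l0_in_I] Hp.vecs_add Hp.vecs_scale\<close>)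
    also have "B l0 \<phi> (e j) = 0" unfolding B_def using \<Delta>_\<phi>[OF l0_in_I] pair_m_0_left ez_in by simp
    also have "B l0 (\<iota> W \<phi>) (e j) = - of_real (\<beta> W (z j))" using B_e[OF \<iota>\<phi>_in] B_\<beta> by simp
    finally have Bg: "Re (B l0 (g ?p) (e j)) = t * \<beta> W (z j) + t\<^sup>2 * Re (B l0 (?K (?K (g ?p))) (e j))"
      by (simp add: power2_eq_square)
    have "\<bar>Re (B l0 (?K (?K (g ?p))) (e j))\<bar> \<le> K * (?n * (k1 * (k1 * (2 * np \<phi>)))) * np (e j)"
    proof -
      have D: "\<Delta>0 l0 (?K (?K (g ?p))) = \<Delta> l0 (?K (?K (g ?p)))" using in' by (simp add: \<Delta>0_def rst_def)
      have "\<bar>Re (B l0 (?K (?K (g ?p))) (e j))\<bar> \<le> cmod (pair (\<Delta> l0 (?K (?K (g ?p)))) (e j))"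
        unfolding B_def by (rule abs_Re_le_cmod)
      also have "\<dots> \<le> K * nm (\<Delta> l0 (?K (?K (g ?p)))) * np (e j)" using K \<Delta>_in[OF l0_in_I in'(2)] ez_in by blast
      also have "\<dots> \<le> K * (?n * (k1 * (k1 * (2 * np \<phi>)))) * np (e j)"
      proof (intro mult_right_mono mult_left_mono)
        have 1: "nm (\<Delta> l0 (?K (?K (g ?p)))) \<le> ?n * np (?K (?K (g ?p)))"
          using PM.ops_bound[OF \<Delta>0_ops[OF l0_in_I] in'(2)] unfolding D .
        have 2: "np (?K (?K (g ?p))) \<le> k1 * np (?K (g ?p))" unfolding k1_def by (rule PP.ops_bound[OF KW in'(1)])
        have 3: "np (?K (g ?p)) \<le> k1 * np (g ?p)" unfolding k1_def by (rule PP.ops_bound[OF KW gp])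
        have "np (g ?p) \<le> Npp (Top ?p) * np \<phi>" unfolding g_def by (rule PP.ops_bound[OF Top_ops(1)[OF p] \<phi>_Vp])
        also have "\<dots> \<le> 2 * np \<phi>" using Top_ops(2)[OF p] \<phi>_Vp by (intro mult_right_mono) auto
        finally have 4: "np (g ?p) \<le> 2 * np \<phi>" .
        have "np (?K (?K (g ?p))) \<le> k1 * (k1 * (2 * np \<phi>))"
          using 2 mult_left_mono[OF order_trans[OF 3 mult_left_mono[OF 4 k1]] k1] by linarith
        then show "nm (\<Delta> l0 (?K (?K (g ?p)))) \<le> ?n * (k1 * (k1 * (2 * np \<phi>)))"
          using 1 mult_left_mono[OF _ n0] order_trans by blast
      qed (use K ez_in in auto)
      finally show ?thesis .
    qed
    then have "t\<^sup>2 * \<bar>Re (B l0 (?K (?K (g ?p))) (e j))\<bar> \<le> t\<^sup>2 * (K * (?n * (k1 * (k1 * (2 * np \<phi>)))) * np (e j))"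
      by (intro mult_left_mono) auto
    moreover have "F (Suc j) (p0 + t *\<^sub>R (0, W)) - F (Suc j) p0 - t * \<beta> W (z j) = t\<^sup>2 * Re (B l0 (?K (?K (g ?p))) (e j))"
      unfolding eq F_p0 using Bg by (simp add: F_def)
    ultimately show "\<bar>F (Suc j) (p0 + t *\<^sub>R (0, W)) - F (Suc j) p0 - t * \<beta> W (z j)\<bar>
       \<le> (K * (?n * (k1 * (k1 * (2 * np \<phi>)))) * np (e j)) * t\<^sup>2"
      by (simp add: abs_mult mult.commute)
  qed
qed

end

section \<open>Eigenvectors of the perturbed operator and zeros of the equations\<close>

context persistence
begin

text \<open>The eigenspace of \<open>H + W\<close>, with \<open>H\<close> recovered from
  \<open>T\<close> by subtracting the projection onto \<phi>.\<close>

definition ES :: "real \<Rightarrow> 'x \<Rightarrow> 'a set" where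
  "ES l W = eigenspace D (\<lambda>f. T f - ip0 f \<phi> *\<^sub>C \<phi> + \<iota> W f) (of_real l)"

lemma ES_iff: "u \<in> ES l W \<longleftrightarrow> u \<in> D \<and> T u - of_real l *\<^sub>C u = ip0 u \<phi> *\<^sub>C \<phi> - \<iota> W u"
proof -
  have "a - b + c = d \<longleftrightarrow> a - d = b - c" for a b c d :: 'a
    by (simp add: algebra_simps)
  then show ?thesis unfolding ES_def eigenspace_def by simp
qed

lemma ES_scale:
  assumes u: "u \<in> ES l W" shows "c *\<^sub>C u \<in> ES l W"
proof -
  have uD: "u \<in> D" and eq: "T u - of_real l *\<^sub>C u = ip0 u \<phi> *\<^sub>C \<phi> - \<iota> W u" using u by (auto simp: ES_iff)
  have um: "u \<in> Vm" and u0: "u \<in> V0" using uD by auto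
  have "T (c *\<^sub>C u) - of_real l *\<^sub>C c *\<^sub>C u = c *\<^sub>C (T u - of_real l *\<^sub>C u)"
    using A.T_scale[OF uD] by (simp add: complex_vector.scale_right_diff_distrib mult.commute)
  also have "\<dots> = ip0 (c *\<^sub>C u) \<phi> *\<^sub>C \<phi> - \<iota> W (c *\<^sub>C u)"
    unfolding eq using bounded_opsD(3)[OF \<iota>_bounded Hm.hilb_axioms um] H0.ip_scale_left[OF u0 \<phi>_in(1)]
    by (simp add: complex_vector.scale_right_diff_distrib)
  finally show ?thesis using uD by (simp add: ES_iff)
qed

lemma R_eq_if_\<Delta>_0:
  assumes "\<Delta> l f = 0" "f \<in> Vp" shows "R (-1) l f = R0 l f"
proof -
  have "R (-1) l f = R 1 l f" using assms(1) by (simp add: spectral_delta_def)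
  then have "R0 l f = (1/2 + 1/2) *\<^sub>C R (-1) l f"
    using assms(2) by (simp only: R0_def rst_def complex_vector.scale_left_distrib if_True)
  then show ?thesis by simp
qed

text \<open>Both boundary values map \<open>f = c \<phi> - W u\<close> to \<open>u\<close>, so the
  density annihilates \<open>f\<close>, and \<open>f\<close> solves the equation of
  \<open>c g\<close>. If \<open>c\<close> were 0, so would be \<open>u\<close>; division by
  \<open>c\<close> turns these facts into the equations for \<open>g\<close>, the normalization
  being \<open>ip0 u \<phi> = c\<close>.\<close>

lemma eigenvector_imp:
  assumes p: "p \<in> dom" and u: "u \<in> ES (fst p) (snd p)" "u \<noteq> 0"
  shows "u = ip0 u \<phi> *\<^sub>C R0 (fst p) (g p)" "F i p = 0"
proof -
  let ?l = "fst p" and ?W = "snd p" and ?c = "ip0 u \<phi>"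
  have l: "?l \<in> I" using domD(1)[OF p] .
  have uD: "u \<in> D" using u by (simp add: ES_iff)
  have um: "u \<in> Vm" using uD by auto
  define f where "f = ?c *\<^sub>C \<phi> - \<iota> ?W u"
  have f: "f \<in> Vp" unfolding f_def using \<phi>_Vp \<iota>_in[OF um] by auto
  have eq: "T u - of_real ?l *\<^sub>C u = f" using u unfolding f_def by (simp add: ES_iff)
  have R: "R 1 ?l f = u" "R (-1) ?l f = u" using R_shift[OF _ l uD eq f] by auto
  have \<Delta>f: "\<Delta> ?l f = 0" using R by (simp add: spectral_delta_def)
  have R0f: "R0 ?l f = u" using R_eq_if_\<Delta>_0[OF \<Delta>f f] R by simp
  have "f + Kop p f = ?c *\<^sub>C \<phi>" using Kop_eq[OF f l] R0f by (simp add: f_def)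
  then have "Top p (?c *\<^sub>C \<phi>) = f" using Top_spec(3)[OF p _ f] \<phi>_Vp by simp
  then have fg: "f = ?c *\<^sub>C g p"
    unfolding g_def using PP.ops_scale[OF Top_ops(1)[OF p] \<phi>_Vp] by simp
  note gp = g_in[OF p]
  show ug: "u = ?c *\<^sub>C R0 ?l (g p)" using R0f PM.ops_scale[OF R0_ops[OF l] gp] by (simp add: fg)
  then have c: "?c \<noteq> 0" using u(2) by auto
  have \<Delta>g: "\<Delta> ?l (g p) = 0" using \<Delta>f \<Delta>_scale[OF l gp] c by (simp add: fg)
  have "?c = pair (?c *\<^sub>C R0 ?l (g p)) \<phi>"
    using pair_eq_hip[of u \<phi>] uD ug by simp
  also have "\<dots> = ?c * pair (R0 ?l (g p)) \<phi>" by (rule pair_m_scale_left[OF R0_in[OF l gp] \<phi>_Vp])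
  finally have "pair (R0 ?l (g p)) \<phi> = 1" using c by simp
  then show "F i p = 0"
    using \<Delta>g pair_m_0_left ez_in by (cases i) (simp_all add: F_def B_def)
qed

text \<open>The equations of positive index give \<open>\<Delta> (fst p) (g p) = 0\<close>, and then
  \<open>B_quadratic\<close> and \<open>R_in_domain\<close> put \<open>R0 (fst p) (g p)\<close> into
  \<open>D\<close>. The equation of index 0 says that its component along \<phi> is 1, which turns
  \<open>g = \<phi> - W R0 g\<close> into the eigenvalue equation.\<close>

lemma eigenvector_if:
  assumes p: "p \<in> dom" and F: "\<And>i. i < Suc m \<Longrightarrow> F i p = 0"
    and d: "\<bar>fst p - l0\<bar> < d"
    and low: "\<And>x c. \<bar>x - l0\<bar> < d \<Longrightarrow> x \<in> I \<and> Re (B x (E c) (E c)) \<ge> (L2_set (\<lambda>i. cmod (c i)) {..<m})\<^sup>2 / 2"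
  shows "R0 (fst p) (g p) \<in> ES (fst p) (snd p)" "R0 (fst p) (g p) \<noteq> 0"
proof -
  let ?l = "fst p" and ?W = "snd p"
  have l: "?l \<in> I" using domD(1)[OF p] .
  note gp = g_in[OF p]
  have Bj: "B ?l (g p) (e j) = 0" if "j < m" for j
    using F[of "Suc j"] that B_real[OF l gp ez_in g_real[OF p] e_real] by (simp add: F_def complex_eq_iff)
  have \<Delta>g: "\<Delta> ?l (g p) = 0"
    by (rule \<Delta>_eq_0_if_orthogonal[OF l _ gp Bj]) (use low[OF d] in auto)
  \<comment> \<open>\<open>B_quadratic\<close> asks for the lower bound around \<open>fst p\<close>;
    this is the largest radius for which the interval around \<open>fst p\<close> stays within
    distance \<open>d\<close> of \<open>l0\<close>.\<close>
  have d': "d - \<bar>?l - l0\<bar> > 0" using d by simp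
  have low': "x \<in> I \<and> Re (B x (E c) (E c)) \<ge> (L2_set (\<lambda>i. cmod (c i)) {..<m})\<^sup>2 / 2" if "\<bar>x - ?l\<bar> < d - \<bar>?l - l0\<bar>" for x c
    by (rule low) (use that in linarith)
  obtain r c where r: "r > 0" "c \<ge> 0" "{?l - r..?l + r} \<subseteq> I" "\<forall>x\<in>{?l - r..?l + r}. Re (B x (g p) (g p)) \<le> c * (x - ?l)\<^sup>2"
    using B_quadratic[OF l gp \<Delta>g d' low'] by blast
  have RR: "R (-1) ?l (g p) = R0 ?l (g p)" by (rule R_eq_if_\<Delta>_0[OF \<Delta>g gp])
  have u: "R0 ?l (g p) \<in> D" "T (R0 ?l (g p)) - of_real ?l *\<^sub>C R0 ?l (g p) = g p"
    using R_in_domain[OF l gp r(1,3) r(4)[rule_format] r(2)] unfolding RR by auto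
  have "C (R0 ?l (g p)) = R0 ?l (g p)" using C_R0[OF l gp] g_real[OF p] by simp
  then have "Im (pair (R0 ?l (g p)) \<phi>) = 0" using pair_real[OF R0_in[OF l gp] \<phi>_Vp _ C\<phi>] by simp
  then have "pair (R0 ?l (g p)) \<phi> = 1" using F[of 0] by (simp add: F_def complex_eq_iff)
  then have ip: "ip0 (R0 ?l (g p)) \<phi> = 1" using pair_eq_hip[of "R0 ?l (g p)" \<phi>] u by simp
  have "g p = \<phi> - \<iota> ?W (R0 ?l (g p))" using g_eq[OF p] by (metis add_diff_cancel_right')
  then show "R0 ?l (g p) \<in> ES ?l ?W" using u ip by (simp add: ES_iff)
  show "R0 ?l (g p) \<noteq> 0" using ip by auto
qed

abbreviation "ev l W \<equiv> \<exists>u\<in>ES l W. u \<noteq> 0"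

lemma eigenvalue_iff:
  "\<exists>d>0. \<forall>p\<in>dom. \<bar>fst p - l0\<bar> < d \<longrightarrow> ev (fst p) (snd p) \<longleftrightarrow> (\<forall>i<Suc m. F i p = 0)"
proof -
  obtain d where d: "d > 0" "\<forall>x. \<bar>x - l0\<bar> < d \<longrightarrow> x \<in> I \<and> (\<forall>c. Re (B x (E c) (E c)) \<ge> (L2_set (\<lambda>i. cmod (c i)) {..<m})\<^sup>2 / 2)"
    using B_E_lower by blast
  have low: "x \<in> I \<and> Re (B x (E c) (E c)) \<ge> (L2_set (\<lambda>i. cmod (c i)) {..<m})\<^sup>2 / 2" if "\<bar>x - l0\<bar> < d" for x c
    using d(2) that by blast
  show ?thesis
  proof (intro exI[of _ d] conjI d(1) ballI impI)
    fix p assume p: "p \<in> dom" "\<bar>fst p - l0\<bar> < d"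
    show "ev (fst p) (snd p) \<longleftrightarrow> (\<forall>i<Suc m. F i p = 0)"
    proof
      assume "ev (fst p) (snd p)"
      then show "\<forall>i<Suc m. F i p = 0" using eigenvector_imp(2)[OF p(1)] by blast
    next
      assume "\<forall>i<Suc m. F i p = 0"
      then have F: "F i p = 0" if "i < Suc m" for i using that by blast
      show "ev (fst p) (snd p)" using eigenvector_if[OF p(1) F p(2) low] by blast
    qed
  qed
qed

text \<open>By \<open>eigenvector_imp\<close> every eigenvector is a multiple of the one vector
  \<open>R0 (fst p) (g p)\<close>.\<close>

lemma eigenspace_simple:
  assumes p: "p \<in> dom" and ev: "ev (fst p) (snd p)"
  shows "has_cdim (ES (fst p) (snd p)) 1"
proof -
  obtain u where u: "u \<in> ES (fst p) (snd p)" "u \<noteq> 0" using ev by blast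
  let ?v = "R0 (fst p) (g p)"
  have c: "ip0 u \<phi> \<noteq> 0" "?v \<noteq> 0" using eigenvector_imp(1)[OF p u] u(2) by auto
  have "?v = inverse (ip0 u \<phi>) *\<^sub>C u" by (subst eigenvector_imp(1)[OF p u]) (use c in simp)
  then have v: "?v \<in> ES (fst p) (snd p)" using ES_scale[OF u(1)] by simp
  have "ES (fst p) (snd p) = range (\<lambda>c. c *\<^sub>C ?v)"
  proof (intro equalityI subsetI)
    fix w assume w: "w \<in> ES (fst p) (snd p)"
    show "w \<in> range (\<lambda>c. c *\<^sub>C ?v)"
      by (cases "w = 0") (use eigenvector_imp(1)[OF p w] complex_vector.scale_zero_left in \<open>auto intro: range_eqI\<close>)
  qed (use ES_scale[OF v] in auto)
  then show ?thesis unfolding has_cdim_def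
    by (intro exI[of _ "{?v}"]) (use c complex_vector.span_singleton in \<open>auto simp: complex_vector.dependent_single\<close>)
qed

subsection \<open>The manifold\<close>

text \<open>The \<beta>-orthogonal projection along the span of the \<open>z j\<close>;
  \<open>\<pi> W\<close> is the free parameter of the chart.\<close>

definition \<pi> :: "'x \<Rightarrow> 'x" where "\<pi> W = W - (\<Sum>j<m. \<beta> W (z j) *\<^sub>R z j)"

lemma bounded_linear_\<beta>: "bounded_linear (\<lambda>V. \<beta> V W)"
proof -
  obtain K where "\<forall>V. \<bar>\<beta> V W\<bar> \<le> K * norm V" using \<beta>_bounded by blast
  then show ?thesis
    using \<beta>_linear[of W] by (intro bounded_linear_intro[where K = K]) (auto simp: linear_iff mult.commute)
qed

lemma continuous_\<beta> [continuous_intros]: "continuous_on A (\<lambda>V. \<beta> V W)"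
  by (rule bounded_linear.continuous_on[OF bounded_linear_\<beta> continuous_on_id])

lemma continuous_\<pi>: "continuous_on A \<pi>"
  unfolding \<pi>_def[abs_def] by (intro continuous_intros)

lemma \<beta>_combination:
  assumes "i < m" shows "\<beta> (\<Sum>j<m. a j *\<^sub>R z j) (z i) = a i"
proof -
  have "\<beta> (\<Sum>j<m. a j *\<^sub>R z j) (z i) = (\<Sum>j<m. a j * \<beta> (z j) (z i))"
    by (simp add: linear_sum[OF \<beta>_linear] \<beta>_scale_left)
  also have "\<dots> = (\<Sum>j<m. if j = i then a j else 0)" by (intro sum.cong) (auto simp: z assms)
  finally show ?thesis using assms by simp
qed

definition Y :: "'x set" where "Y = {W. \<forall>j<m. \<beta> W (z j) = 0}"

definition Z :: "'x set" where "Z = span (z ` {..<m})"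

lemma subspace_Y: "subspace Y"
  unfolding subspace_def Y_def using linear_0[OF \<beta>_linear] by (simp add: \<beta>_add_left \<beta>_scale_left)

lemma closed_Y: "closed Y"
proof -
  have "Y = (\<Inter>j\<in>{..<m}. {W. \<beta> W (z j) = 0})" by (auto simp: Y_def)
  then show ?thesis by (simp only:) (intro closed_INT ballI closed_Collect_eq continuous_intros)
qed

lemma \<pi>_in_Y: "\<pi> W \<in> Y"
  unfolding Y_def \<pi>_def by (simp add: linear_diff[OF \<beta>_linear] \<beta>_combination)

lemma \<pi>_plus: "W = \<pi> W + (\<Sum>j<m. \<beta> W (z j) *\<^sub>R z j)"
  by (simp add: \<pi>_def)

lemma combination_in_Z: "(\<Sum>j<m. a j *\<^sub>R z j) \<in> Z"
  unfolding Z_def by (intro span_sum span_scale span_base) auto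

lemma \<pi>_linear: "linear \<pi>"
  unfolding \<pi>_def[abs_def]
  by (rule linearI) (simp_all add: \<beta>_add_left \<beta>_scale_left scaleR_left_distrib sum.distrib scaleR_sum_right scaleR_right_diff_distrib)

lemma \<pi>_z: "i < m \<Longrightarrow> \<pi> (z i) = 0"
proof -
  assume i: "i < m"
  have "(\<Sum>j<m. \<beta> (z i) (z j) *\<^sub>R z j) = (\<Sum>j<m. if j = i then z j else 0)"
    by (intro sum.cong) (auto simp: z i)
  then show ?thesis using i by (simp add: \<pi>_def)
qed

lemma Y_Int_Z: "Y \<inter> Z = {0}"
proof -
  have "W = 0" if W: "W \<in> Y" "W \<in> Z" for W
  proof -
    have "\<pi> W = 0" by (rule linear_eq_0_on_span[OF \<pi>_linear _ W(2)[unfolded Z_def]]) (use \<pi>_z in auto)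
    then show ?thesis using W(1) by (simp add: \<pi>_def Y_def)
  qed
  then show ?thesis using subspace_0[OF subspace_Y] span_zero unfolding Z_def by blast
qed

lemma Z_dim: "has_rdim Z m"
proof -
  have inj: "inj_on z {..<m}"
  proof (rule inj_onI)
    fix i j assume "i \<in> {..<m}" "j \<in> {..<m}" "z i = z j"
    then show "i = j" using z[of i j] z[of j j] by (auto split: if_splits)
  qed
  have "independent (z ` {..<m})"
    unfolding dependent_def
  proof clarsimp
    fix i assume i: "i < m" and sp: "z i \<in> span (z ` {..<m} - {z i})"
    have "\<beta> (z i) (z i) = 0"
    proof (rule linear_eq_0_on_span[OF \<beta>_linear _ sp])
      fix x assume "x \<in> z ` {..<m} - {z i}"
      then show "\<beta> x (z i) = 0" using z i by auto
    qed
    then show False using z[OF i i] by simp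
  qed
  then show ?thesis
    unfolding has_rdim_def Z_def by (intro exI[of _ "z ` {..<m}"]) (simp add: card_image inj)
qed

lemma dir_sum: "(l, W) + (\<Sum>i<Suc m. t i *\<^sub>R dir i) = (l + t 0, W + (\<Sum>j<m. t (Suc j) *\<^sub>R z j))"
proof -
  have "(\<Sum>i<Suc m. t i *\<^sub>R dir i) = t 0 *\<^sub>R dir 0 + (\<Sum>j<m. t (Suc j) *\<^sub>R dir (Suc j))"
    by (rule sum.lessThan_Suc_shift)
  also have "(\<Sum>j<m. t (Suc j) *\<^sub>R dir (Suc j)) = (0, \<Sum>j<m. t (Suc j) *\<^sub>R z j)"
    by (simp add: dir_def sum_prod)
  finally show ?thesis by (simp add: dir_def)
qed

text \<open>The solution functions live on pairs of a spectral parameter and a perturbation. The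
  chart uses their slice at \<open>l0\<close>, which is smooth on an open subset of the whole
  perturbation space, and is then restricted to \<open>V\<close> and to directions in
  \<open>Y\<close>.\<close>

lemma Ck_on_chart:
  assumes U: "open (U :: (real \<times> 'x) set)" and \<tau>: "\<And>i. i < Suc m \<Longrightarrow> NC k U {\<tau> i}"
    and V: "V \<subseteq> {y. (l0, y) \<in> U}"
  shows "Ck_on k Y V (\<lambda>y. \<Sum>j<m. \<tau> (Suc j) (l0, y) *\<^sub>R z j)"
proof (rule Ck_on_if_UC)
  interpret M: nbilinear UNIV norm "(*\<^sub>R)" UNIV norm "(*\<^sub>R)" UNIV norm "(*\<^sub>R)" "(*\<^sub>R) :: real \<Rightarrow> 'x \<Rightarrow> 'x" 1
    by (rule nbilinear_scaleR)
  let ?U = "{y. (l0, y) \<in> U}"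
  have "open ((\<lambda>y. (l0, y)) -` U)" by (intro open_vimage U continuous_intros)
  then show "open ?U" by (simp add: vimage_def)
  have bl: "bounded_linear (\<lambda>y::'x. (0::real, y))"
    by (intro bounded_linear_Pair bounded_linear_zero bounded_linear_ident)
  have T: "NC k ?U (fam2 (*\<^sub>R) {\<lambda>y. \<tau> (Suc j) (l0, y)} {\<lambda>y. z j})" if j: "j < m" for j
  proof (rule M.UC_b)
    have "NC k ?U ((\<lambda>f y. f ((l0, 0) + (0, y))) ` {\<tau> (Suc j)})"
      by (rule nspace.UC_affine[OF nspace_norm bl _ _ \<tau>]) (use j in auto)
    then show "NC k ?U {\<lambda>y. \<tau> (Suc j) (l0, y)}" by simp
    have "NC k ?U ((\<lambda>a x. a) ` {z j})" by (rule nspace.UC_const[OF nspace_norm, of _ "norm (z j)"]) auto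
    then show "NC k ?U {\<lambda>y. z j}" by simp
  qed
  have "NC k ?U {\<lambda>y. \<Sum>j<m. h j y |h. \<forall>j\<in>{..<m}. h j \<in> fam2 (*\<^sub>R) {\<lambda>y. \<tau> (Suc j) (l0, y)} {\<lambda>y. z j}}"
    by (rule nspace.UC_sum[OF nspace_norm]) (use T in auto)
  then show "NC k ?U {\<lambda>y. \<Sum>j<m. \<tau> (Suc j) (l0, y) *\<^sub>R z j}"
  proof (rule UC_subset)
    have "(\<lambda>y. \<tau> (Suc j) (l0, y) *\<^sub>R z j) \<in> fam2 (*\<^sub>R) {\<lambda>y. \<tau> (Suc j) (l0, y)} {\<lambda>y. z j}" for j
      by (rule fam2I) auto
    then show "{\<lambda>y. \<Sum>j<m. \<tau> (Suc j) (l0, y) *\<^sub>R z j} \<subseteq>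
        {\<lambda>y. \<Sum>j<m. h j y |h. \<forall>j\<in>{..<m}. h j \<in> fam2 (*\<^sub>R) {\<lambda>y. \<tau> (Suc j) (l0, y)} {\<lambda>y. z j}}"
      by (auto intro!: exI[of _ "\<lambda>j y. \<tau> (Suc j) (l0, y) *\<^sub>R z j"])
  qed
qed (use V in auto)

text \<open>The triangular form required by \<open>implicit_system\<close> holds because the
  equations of positive index are constant along \<open>(1, 0)\<close> and the \<open>z j\<close>
  are orthonormal.\<close>

lemma solve_system:
  obtains U \<epsilon> \<tau> where "open U" "p0 \<in> U" "\<epsilon> > 0" "\<And>i. i < Suc m \<Longrightarrow> NC k U {\<tau> i}"
    "\<And>p i. p \<in> U \<Longrightarrow> i < Suc m \<Longrightarrow> \<bar>\<tau> i p\<bar> < \<epsilon>"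
    "\<And>p t. p \<in> U \<Longrightarrow> (\<And>i. i < Suc m \<Longrightarrow> \<bar>t i\<bar> < \<epsilon>) \<Longrightarrow> p + (\<Sum>i<Suc m. t i *\<^sub>R dir i) \<in> dom"
    "\<And>p t. p \<in> U \<Longrightarrow> (\<And>i. i < Suc m \<Longrightarrow> \<bar>t i\<bar> < \<epsilon>) \<Longrightarrow>
      ev (fst (p + (\<Sum>i<Suc m. t i *\<^sub>R dir i))) (snd (p + (\<Sum>i<Suc m. t i *\<^sub>R dir i))) \<longleftrightarrow> (\<forall>i<Suc m. t i = \<tau> i p)"
proof -
  obtain d where d: "d > 0" "\<forall>p\<in>dom. \<bar>fst p - l0\<bar> < d \<longrightarrow> ev (fst p) (snd p) \<longleftrightarrow> (\<forall>i<Suc m. F i p = 0)"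
    using eigenvalue_iff by (elim exE conjE) (rule that)
  define \<Omega> where "\<Omega> = dom \<inter> {p. \<bar>fst p - l0\<bar> < d}"
  have \<Omega>: "open \<Omega>" unfolding \<Omega>_def by (intro open_Int open_dom open_Collect_less continuous_intros)
  have p\<Omega>: "p0 \<in> \<Omega>" using p0_dom d(1) by (simp add: \<Omega>_def)
  obtain F' where F': "\<And>i. (F i has_derivative F' i) (at p0)" using F_derivative by metis
  have "\<exists>U \<epsilon> \<tau>. open U \<and> p0 \<in> U \<and> \<epsilon> > 0 \<and> (\<forall>i<Suc m. NC k U {\<tau> i}) \<and> (\<forall>p\<in>U. \<forall>i<Suc m. \<bar>\<tau> i p\<bar> < \<epsilon>) \<and>
    (\<forall>p\<in>U. \<forall>t. (\<forall>i<Suc m. \<bar>t i\<bar> < \<epsilon>) \<longrightarrow> p + (\<Sum>i<Suc m. t i *\<^sub>R dir i) \<in> \<Omega> \<and>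
      ((\<forall>i<Suc m. F i (p + (\<Sum>i<Suc m. t i *\<^sub>R dir i)) = 0) \<longleftrightarrow> (\<forall>i<Suc m. t i = \<tau> i p)))"
  proof (rule implicit_system[OF k \<Omega> p\<Omega> _ F_p0 F'])
    show "NC k \<Omega> {F i}" for i by (rule UC_refine[OF UC_F]) (auto simp: \<Omega>_def)
    show "F' i (dir i) \<noteq> 0" if "i < Suc m" for i
      using that F'_lambda[OF F', of i] F'_W[OF F'] z by (cases i) (auto simp: dir_def)
    show "F' i (dir j) = 0" if "i < Suc m" "j < i" for i j
      using that F'_lambda[OF F', of i] F'_W[OF F'] z by (cases i; cases j) (auto simp: dir_def)
  qed
  then obtain U \<epsilon> \<tau> where U: "open U" "p0 \<in> U" "\<epsilon> > 0" "\<forall>i<Suc m. NC k U {\<tau> i}" "\<forall>p\<in>U. \<forall>i<Suc m. \<bar>\<tau> i p\<bar> < \<epsilon>"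
    and sol: "\<forall>p\<in>U. \<forall>t. (\<forall>i<Suc m. \<bar>t i\<bar> < \<epsilon>) \<longrightarrow> p + (\<Sum>i<Suc m. t i *\<^sub>R dir i) \<in> \<Omega> \<and>
      ((\<forall>i<Suc m. F i (p + (\<Sum>i<Suc m. t i *\<^sub>R dir i)) = 0) \<longleftrightarrow> (\<forall>i<Suc m. t i = \<tau> i p))"
    by (elim exE conjE) (rule that)
  have s: "p + (\<Sum>i<Suc m. t i *\<^sub>R dir i) \<in> \<Omega> \<and>
      ((\<forall>i<Suc m. F i (p + (\<Sum>i<Suc m. t i *\<^sub>R dir i)) = 0) \<longleftrightarrow> (\<forall>i<Suc m. t i = \<tau> i p))"
    if "p \<in> U" "\<And>i. i < Suc m \<Longrightarrow> \<bar>t i\<bar> < \<epsilon>" for p t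
    using sol that by blast
  show thesis
  proof (rule that[of U \<epsilon> \<tau>])
    fix p t assume a: "p \<in> U" "\<And>i. i < Suc m \<Longrightarrow> \<bar>t i\<bar> < \<epsilon>"
    let ?q = "p + (\<Sum>i<Suc m. t i *\<^sub>R dir i)"
    note s = s[of p t, OF a]
    show "?q \<in> dom" using s by (simp only: \<Omega>_def Int_iff)
    show "ev (fst ?q) (snd ?q) \<longleftrightarrow> (\<forall>i<Suc m. t i = \<tau> i p)"
      using d(2)[rule_format, of ?q] s unfolding \<Omega>_def by blast
  qed (use U in auto)
qed

lemma persistence_manifold:
  "\<exists>\<delta>>0. \<exists>\<O>. open \<O> \<and> 0 \<in> \<O> \<and>
    Ck_manifold k m ({W. \<exists>l\<in>{l0 - \<delta><..<l0 + \<delta>}. ev l W} \<inter> \<O>) \<and>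
    (\<forall>W \<in> {W. \<exists>l\<in>{l0 - \<delta><..<l0 + \<delta>}. ev l W} \<inter> \<O>. \<exists>l.
       {\<mu> \<in> {l0 - \<delta><..<l0 + \<delta>}. ev \<mu> W} = {l} \<and> has_cdim (ES l W) 1)"
proof -
  obtain U \<epsilon> \<tau> where U: "open U" "p0 \<in> U" "\<epsilon> > 0" and \<tau>: "\<And>i. i < Suc m \<Longrightarrow> NC k U {\<tau> i}"
    and \<tau>e: "\<And>p i. p \<in> U \<Longrightarrow> i < Suc m \<Longrightarrow> \<bar>\<tau> i p\<bar> < \<epsilon>"
    and sol: "\<And>p t. p \<in> U \<Longrightarrow> (\<And>i. i < Suc m \<Longrightarrow> \<bar>t i\<bar> < \<epsilon>) \<Longrightarrow> p + (\<Sum>i<Suc m. t i *\<^sub>R dir i) \<in> dom"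
    "\<And>p t. p \<in> U \<Longrightarrow> (\<And>i. i < Suc m \<Longrightarrow> \<bar>t i\<bar> < \<epsilon>) \<Longrightarrow>
      ev (fst (p + (\<Sum>i<Suc m. t i *\<^sub>R dir i))) (snd (p + (\<Sum>i<Suc m. t i *\<^sub>R dir i))) \<longleftrightarrow> (\<forall>i<Suc m. t i = \<tau> i p)"
    using solve_system by blast
  \<comment> \<open>These conditions, with \<open>l\<close> within \<epsilon> of \<open>l0\<close>,
    make \<open>l - l0\<close> and the numbers \<open>\<beta> W (z j)\<close> admissible unknowns
    over the base point \<open>(l0, \<pi> W)\<close>. The same \<epsilon> serves as the \<delta> of
    the conclusion.\<close>
  define \<O> where "\<O> = {W. (l0, \<pi> W) \<in> U} \<inter> (\<Inter>j\<in>{..<m}. {W. \<bar>\<beta> W (z j)\<bar> < \<epsilon>})"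
  let ?J = "{l0 - \<epsilon><..<l0 + \<epsilon>}"
  let ?M = "{W. \<exists>l\<in>?J. ev l W}"
  have "open ((\<lambda>W. (l0, \<pi> W)) -` U)" by (intro open_vimage U(1) continuous_intros continuous_\<pi>)
  then have O: "open \<O>"
    unfolding \<O>_def by (intro open_Int open_INT ballI open_Collect_less continuous_intros) (auto simp: vimage_def)
  have O0: "0 \<in> \<O>" using U linear_0[OF \<pi>_linear] linear_0[OF \<beta>_linear] by (simp add: \<O>_def)
  have key: "(l, W) \<in> dom" "ev l W \<longleftrightarrow> l = l0 + \<tau> 0 (l0, \<pi> W) \<and> (\<forall>j<m. \<beta> W (z j) = \<tau> (Suc j) (l0, \<pi> W))"
    if W: "W \<in> \<O>" and l: "l \<in> ?J" for l W
  proof -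
    \<comment> \<open>The coordinates of \<open>(l, W)\<close> relative to the base point
      \<open>(l0, \<pi> W)\<close> along the directions \<open>dir i\<close>.\<close>
    define t where "t = case_nat (l - l0) (\<lambda>j. \<beta> W (z j))"
    have p: "(l0, \<pi> W) \<in> U" using W by (simp add: \<O>_def)
    have te: "\<bar>t i\<bar> < \<epsilon>" if "i < Suc m" for i using that W l by (cases i) (auto simp: t_def \<O>_def)
    have eq: "(l0, \<pi> W) + (\<Sum>i<Suc m. t i *\<^sub>R dir i) = (l, W)"
      unfolding dir_sum using \<pi>_plus[of W] by (simp add: t_def)
    have all: "(\<forall>i<Suc m. t i = \<tau> i q) \<longleftrightarrow> t 0 = \<tau> 0 q \<and> (\<forall>j<m. t (Suc j) = \<tau> (Suc j) q)" for q
      by (auto simp: less_Suc_eq_0_disj)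
    show "(l, W) \<in> dom" using sol(1)[of "(l0, \<pi> W)" t, OF p te] unfolding eq .
    have "ev l W \<longleftrightarrow> (\<forall>i<Suc m. t i = \<tau> i (l0, \<pi> W))" using sol(2)[of "(l0, \<pi> W)" t, OF p te] unfolding eq by simp
    then show "ev l W \<longleftrightarrow> l = l0 + \<tau> 0 (l0, \<pi> W) \<and> (\<forall>j<m. \<beta> W (z j) = \<tau> (Suc j) (l0, \<pi> W))"
      unfolding all by (auto simp: t_def)
  qed
  have \<tau>J: "l0 + \<tau> 0 (l0, \<pi> W) \<in> ?J" if "W \<in> \<O>" for W using \<tau>e[of "(l0, \<pi> W)" 0] that by (auto simp: \<O>_def)
  have M: "W \<in> ?M \<longleftrightarrow> (\<forall>j<m. \<beta> W (z j) = \<tau> (Suc j) (l0, \<pi> W))" if W: "W \<in> \<O>" for W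
  proof
    assume "W \<in> ?M"
    then have "\<exists>l\<in>?J. ev l W" unfolding mem_Collect_eq .
    then obtain l where l: "l \<in> ?J" "ev l W" by (rule bexE)
    show "\<forall>j<m. \<beta> W (z j) = \<tau> (Suc j) (l0, \<pi> W)" using l(2) unfolding key(2)[OF W l(1)] by (rule conjunct2)
  next
    assume "\<forall>j<m. \<beta> W (z j) = \<tau> (Suc j) (l0, \<pi> W)"
    then have "ev (l0 + \<tau> 0 (l0, \<pi> W)) W" unfolding key(2)[OF W \<tau>J[OF W]] by simp
    then show "W \<in> ?M" using \<tau>J[OF W] unfolding mem_Collect_eq by (rule bexI)
  qed
  define V where "V = Y \<inter> {y. (l0, y) \<in> U}"
  define h where "h = (\<lambda>y. \<Sum>j<m. \<tau> (Suc j) (l0, y) *\<^sub>R z j)"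
  \<comment> \<open>A single chart covers the whole manifold, with \<O> itself as its open set;
    hence the repeated intersection.\<close>
  have graph: "?M \<inter> \<O> \<inter> \<O> = (\<lambda>y. y + h y) ` V"
  proof (intro equalityI subsetI)
    fix W assume "W \<in> ?M \<inter> \<O> \<inter> \<O>"
    then have W: "W \<in> \<O>" "W \<in> ?M" by auto
    have "W = \<pi> W + h (\<pi> W)"
      using \<pi>_plus[of W] M[OF W(1)] W(2) by (simp add: h_def)
    moreover have "\<pi> W \<in> V" using \<pi>_in_Y W(1) by (simp add: V_def \<O>_def)
    ultimately show "W \<in> (\<lambda>y. y + h y) ` V" by blast
  next
    fix W assume "W \<in> (\<lambda>y. y + h y) ` V"
    then obtain y where y: "y \<in> V" and W: "W = y + h y" by blast
    have b: "\<beta> W (z j) = \<tau> (Suc j) (l0, y)" if "j < m" for j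
      using y that unfolding W h_def \<beta>_add_left by (simp add: \<beta>_combination V_def Y_def)
    have "\<pi> W = y" unfolding \<pi>_def using b by (simp add: W h_def)
    then have WO: "W \<in> \<O>" and "\<forall>j<m. \<beta> W (z j) = \<tau> (Suc j) (l0, \<pi> W)"
      using y b \<tau>e[of "(l0, y)"] by (auto simp: \<O>_def V_def)
    then have "W \<in> ?M" using M[OF WO] by simp
    then show "W \<in> ?M \<inter> \<O> \<inter> \<O>" using WO by (intro IntI)
  qed
  have manifold: "Ck_manifold k m (?M \<inter> \<O>)"
    unfolding Ck_manifold_def
  proof (intro ballI exI conjI)
    show "subspace Y" "closed Y" "has_rdim Z m" "Y \<inter> Z = {0}" "open \<O>"
      by (rule subspace_Y closed_Y Z_dim Y_Int_Z O)+
    show "\<forall>x. \<exists>y\<in>Y. \<exists>z\<in>Z. x = y + z" 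
    proof
      fix W
      show "\<exists>y\<in>Y. \<exists>z\<in>Z. W = y + z"
        by (rule bexI[OF _ \<pi>_in_Y[of W]], rule bexI[OF _ combination_in_Z], rule \<pi>_plus)
    qed
    have "open ((\<lambda>y. (l0, y)) -` U)" by (intro open_vimage U(1) continuous_intros)
    then show "openin (top_of_set Y) V" unfolding V_def by (auto simp: openin_open vimage_def)
    show "h ` V \<subseteq> Z" unfolding h_def by (intro image_subsetI combination_in_Z)
    show "Ck_on k Y V h" unfolding h_def by (rule Ck_on_chart[OF U(1) \<tau>]) (auto simp: V_def)
    show "?M \<inter> \<O> \<inter> \<O> = (\<lambda>y. y + h y) ` V" by (rule graph)
  qed auto
  have single: "\<exists>l. {\<mu> \<in> ?J. ev \<mu> W} = {l} \<and> has_cdim (ES l W) 1" if "W \<in> ?M \<inter> \<O>" for W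
  proof -
    let ?l = "l0 + \<tau> 0 (l0, \<pi> W)"
    have W: "W \<in> \<O>" "W \<in> ?M" using that by auto
    have 1: "ev ?l W" using key(2)[OF W(1) \<tau>J[OF W(1)]] M[OF W(1)] W(2) by blast
    have "{\<mu> \<in> ?J. ev \<mu> W} = {?l}"
    proof (intro equalityI subsetI)
      fix \<mu> assume "\<mu> \<in> {\<mu> \<in> ?J. ev \<mu> W}"
      then have "\<mu> \<in> ?J" "ev \<mu> W" by auto
      then show "\<mu> \<in> {?l}" using key(2)[OF W(1), of \<mu>] by blast
    next
      fix \<mu> assume "\<mu> \<in> {?l}"
      then show "\<mu> \<in> {\<mu> \<in> ?J. ev \<mu> W}" using 1 \<tau>J[OF W(1)] by blast
    qed
    moreover have "has_cdim (ES ?l W) 1"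
      using eigenspace_simple[OF key(1)[OF W(1) \<tau>J[OF W(1)]]] 1 by simp
    ultimately show ?thesis by blast
  qed
  show ?thesis
    by (rule exI[of _ \<epsilon>], rule conjI[OF U(3)], rule exI[of _ \<O>]) (use O O0 manifold single in blast)
qed

end

section \<open>Persistence of the embedded eigenvalue\<close>

text \<open>The rank one term is symmetric, so moving it to the other side of the adjoint relation
  reduces the adjoint of \<open>T'\<close> to that of \<open>T\<close>.\<close>

lemma (in sa_op) self_adjoint_plus_rank_one:
  assumes \<phi>: "\<phi> \<in> vecs X" and T': "\<And>f. f \<in> vecs X \<Longrightarrow> T' f = T f + ip f \<phi> *\<^sub>C \<phi>"
  shows "self_adjoint X D T'"
  unfolding self_adjoint_def
proof (intro conjI csubspace_D dense_D)
  show "clinear_on D T'"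
    unfolding clinear_on_def using \<phi> T_add T_scale
    by (simp add: T' ip_simps complex_vector.scale_left_distrib complex_vector.scale_right_distrib)
  show "T' ` D \<subseteq> vecs X" using T' \<phi> by auto
  have ip_T': "ip (T' f) g = ip (T f) g + ip f (ip g \<phi> *\<^sub>C \<phi>)" if "f \<in> D" "g \<in> vecs X" for f g
    using that \<phi> ip_cnj[of g \<phi>] by (simp add: T' ip_simps)
  show "adjoint_graph X D T' = (\<lambda>f. (f, T' f)) ` D"
  proof (intro equalityI subsetI)
    fix p assume "p \<in> adjoint_graph X D T'"
    then obtain g h where p: "p = (g, h)" and gh: "g \<in> vecs X" "h \<in> vecs X" "\<forall>f\<in>D. ip (T' f) g = ip f h"
      by (auto simp: adjoint_graph_def)
    let ?h = "h - ip g \<phi> *\<^sub>C \<phi>"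
    have "ip (T f) g = ip f ?h" if "f \<in> D" for f
    proof -
      have "ip (T f) g + ip f (ip g \<phi> *\<^sub>C \<phi>) = ip f h" using ip_T'[OF that gh(1)] gh(3) that by simp
      moreover have "ip f ?h = ip f h - ip f (ip g \<phi> *\<^sub>C \<phi>)" using that gh \<phi> by (intro ip_diff_right) auto
      ultimately show ?thesis by (metis add_diff_cancel_right')
    qed
    from adjointI[OF gh(1) _ this] have "g \<in> D" "T g = ?h" using gh \<phi> by auto
    then show "p \<in> (\<lambda>f. (f, T' f)) ` D" using gh by (auto simp: p T')
  next
    fix p assume "p \<in> (\<lambda>f. (f, T' f)) ` D"
    then obtain g where g: "g \<in> D" and p: "p = (g, T' g)" by blast
    have "ip (T' f) g = ip f (T' g)" if "f \<in> D" for f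
      using ip_T'[OF that D_in[OF g]] symmetric[OF that g] ip_add_right[of "T g" "ip g \<phi> *\<^sub>C \<phi>" f] that g \<phi>
      by (simp add: T')
    moreover have "T' g \<in> vecs X" using g \<phi> by (auto simp: T')
    ultimately show "p \<in> adjoint_graph X D T'" using g by (auto simp: p adjoint_graph_def)
  qed
qed

lemma (in hilb) orth_proj_span_unit:
  assumes \<phi>: "\<phi> \<in> vecs X" "nrm \<phi> = 1" and f: "f \<in> vecs X"
  shows "orth_proj X (range (\<lambda>c. c *\<^sub>C \<phi>)) f = ip f \<phi> *\<^sub>C \<phi>"
  unfolding orth_proj_def
proof (rule the_equality)
  have \<phi>\<phi>: "ip \<phi> \<phi> = 1" using ip_self[OF \<phi>(1)] \<phi>(2) by simp
  show "ip f \<phi> *\<^sub>C \<phi> \<in> range (\<lambda>c. c *\<^sub>C \<phi>) \<and> (\<forall>h\<in>range (\<lambda>c. c *\<^sub>C \<phi>). ip (f - ip f \<phi> *\<^sub>C \<phi>) h = 0)"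
    using \<phi> f by (auto simp: ip_simps \<phi>\<phi>)
  fix g assume g: "g \<in> range (\<lambda>c. c *\<^sub>C \<phi>) \<and> (\<forall>h\<in>range (\<lambda>c. c *\<^sub>C \<phi>). ip (f - g) h = 0)"
  then obtain c where c: "g = c *\<^sub>C \<phi>" by blast
  have "ip (f - g) (1 *\<^sub>C \<phi>) = 0" using g by blast
  then have "ip f \<phi> = c" using \<phi> f by (simp add: c ip_simps \<phi>\<phi>)
  then show "g = ip f \<phi> *\<^sub>C \<phi>" by (simp add: c)
qed

lemma has_cdim_1_eq_line:
  assumes "has_cdim V 1" "v \<in> V" "v \<noteq> 0"
  shows "V = range (\<lambda>c. c *\<^sub>C v)"
proof -
  obtain B where B: "card B = 1" "cspan B = V" using assms(1) unfolding has_cdim_def by blast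
  from B(1) obtain b where b: "B = {b}" by (rule card_1_singletonE)
  have V: "V = range (\<lambda>c. c *\<^sub>C b)" using B(2) unfolding b complex_vector.span_singleton ..
  obtain a where a: "v = a *\<^sub>C b" using assms(2) V by blast
  have "a \<noteq> 0" using assms(3) a by auto
  then have "c *\<^sub>C b = (c / a) *\<^sub>C v" for c by (simp add: a)
  moreover have "c *\<^sub>C v = (c * a) *\<^sub>C b" for c by (simp add: a)
  ultimately show ?thesis unfolding V by blast
qed

theorem theorem1:
  fixes S :: "real \<Rightarrow> 'a::complex_vector hspace"
    and pair :: "'a \<Rightarrow> 'a \<Rightarrow> complex"
    and C H P\<^sub>0 Hbar :: "'a \<Rightarrow> 'a"
    and D :: "'a set"
    and lam\<^sub>0 s\<^sub>1 s \<delta>\<^sub>1 :: real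
    and k m :: nat
    and \<iota> :: "'x::banach \<Rightarrow> 'a \<Rightarrow> 'a"
    and \<phi>\<^sub>0 :: 'a
  assumes scale: "hilbert_scale S pair C"
    and H_self_adjoint: "self_adjoint (S 0) D H"
    and H_real: "real_op (S 0) C D H"
    and isolated: "complex_of_real lam\<^sub>0 isolated_in point_spectrum D H"
    and finite_multiplicity: "\<exists>n. has_cdim (eigenspace D H (of_real lam\<^sub>0)) n"
    and embedded: "complex_of_real lam\<^sub>0 \<in> continuous_spectrum (S 0) D H"
    and eigenspace_regular: "eigenspace D H (of_real lam\<^sub>0) \<subseteq> (\<Inter>t\<in>{0..}. vecs (S t))"
    and P\<^sub>0_def: "P\<^sub>0 = orth_proj (S 0) (eigenspace D H (of_real lam\<^sub>0))"
    and Hbar_def: "Hbar = (\<lambda>f. H f + P\<^sub>0 f)"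
    and k_ge_1: "k \<ge> 1"
    and s\<^sub>1_nonneg: "s\<^sub>1 \<ge> 0"
    and lap: "\<forall>t>s\<^sub>1. \<exists>\<delta>>0. limiting_absorption k S D Hbar lam\<^sub>0 t \<delta>"
    and s_gt: "s > s\<^sub>1"
    and \<delta>\<^sub>1_pos: "\<delta>\<^sub>1 > 0"
    and lap_\<delta>\<^sub>1: "limiting_absorption k S D Hbar lam\<^sub>0 s \<delta>\<^sub>1"
    and perturbations: "perturbation_space S C s \<iota>"
    and multiplicity: "\<forall>lam\<in>{lam\<^sub>0 - \<delta>\<^sub>1<..<lam\<^sub>0 + \<delta>\<^sub>1}.
          has_cdim (spectral_delta S D Hbar s lam ` vecs (S s)) m"
    and simple: "simple_eigenvalue D H (of_real lam\<^sub>0)"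
    and eigenvector: "\<phi>\<^sub>0 \<in> eigenspace D H (of_real lam\<^sub>0)" "C \<phi>\<^sub>0 = \<phi>\<^sub>0" "hnorm (S 0) \<phi>\<^sub>0 = 1"
    and spanning: "cspan (range (\<lambda>W. spectral_delta S D Hbar s lam\<^sub>0 (\<iota> W \<phi>\<^sub>0)))
          = spectral_delta S D Hbar s lam\<^sub>0 ` vecs (S s)"
    and dim_ge: "\<exists>B :: 'x set. finite B \<and> card B = m \<and> independent B"
  shows "\<exists>\<delta>>0. \<exists>\<O>. open \<O> \<and> 0 \<in> \<O> \<and>
    Ck_manifold k m (persistence_set D H \<iota> lam\<^sub>0 \<delta> \<inter> \<O>) \<and>
    (\<forall>W \<in> persistence_set D H \<iota> lam\<^sub>0 \<delta> \<inter> \<O>. \<exists>lam.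
       {\<mu> \<in> {lam\<^sub>0 - \<delta><..<lam\<^sub>0 + \<delta>}.
          complex_of_real \<mu> \<in> point_spectrum D (\<lambda>f. H f + \<iota> W f)} = {lam} \<and>
       simple_eigenvalue D (\<lambda>f. H f + \<iota> W f) (of_real lam))"
proof -
  let ?E = "eigenspace D H (of_real lam\<^sub>0)"
  have s_pos: "s > 0" using s_gt s\<^sub>1_nonneg by simp
  interpret gelfand S pair C s by (intro gelfand.intro gelfand_axioms.intro scale s_pos)
  interpret H: sa_op "S 0" D H by unfold_locales (rule H_self_adjoint)
  have \<phi>_D: "\<phi>\<^sub>0 \<in> D" and H\<phi>: "H \<phi>\<^sub>0 = of_real lam\<^sub>0 *\<^sub>C \<phi>\<^sub>0"
    using eigenvector(1) by (auto simp: eigenspace_def)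
  have \<phi>_0: "\<phi>\<^sub>0 \<in> V0" using \<phi>_D by auto
  have \<phi>\<phi>: "ip0 \<phi>\<^sub>0 \<phi>\<^sub>0 = 1" using H0.ip_self[OF \<phi>_0] eigenvector(3) by simp
  then have "\<phi>\<^sub>0 \<noteq> 0" using H0.ip_0_left[OF \<phi>_0] by auto
  \<comment> \<open>Simplicity makes the eigenspace a line, which gives the projection the explicit
    rank one form used from here on.\<close>
  then have E: "?E = range (\<lambda>c. c *\<^sub>C \<phi>\<^sub>0)"
    using has_cdim_1_eq_line simple[unfolded simple_eigenvalue_def] eigenvector(1) by blast
  have P0: "P\<^sub>0 f = ip0 f \<phi>\<^sub>0 *\<^sub>C \<phi>\<^sub>0" if "f \<in> V0" for f
    unfolding P\<^sub>0_def E by (rule H0.orth_proj_span_unit[OF \<phi>_0 eigenvector(3) that])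
  then have Hbar: "Hbar f = H f + ip0 f \<phi>\<^sub>0 *\<^sub>C \<phi>\<^sub>0" if "f \<in> V0" for f
    using that by (simp add: Hbar_def)
  have Hbar_sa: "self_adjoint (S 0) D Hbar" by (rule H.self_adjoint_plus_rank_one[OF \<phi>_0 Hbar])
  have Hbar_real: "real_op (S 0) C D Hbar"
    unfolding real_op_def
  proof (intro conjI ballI)
    fix f assume f: "f \<in> D"
    have f0: "f \<in> V0" using f by auto
    have CH: "H (C f) = C (H f)" using H_real f unfolding real_op_def by blast
    have "ip0 (C f) \<phi>\<^sub>0 = cnj (ip0 f \<phi>\<^sub>0)" using conj_antiunitary[OF f0 \<phi>_0] eigenvector(2) by simp
    then have "Hbar (C f) = C (H f) + C (ip0 f \<phi>\<^sub>0 *\<^sub>C \<phi>\<^sub>0)"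
      using Hbar[OF conj_closed[OF f0]] CH conj_scale[OF \<phi>_0] eigenvector(2) by simp
    also have "\<dots> = C (Hbar f)"
      unfolding Hbar[OF f0] by (rule conj_add[symmetric, of _ 0]) (use f \<phi>_0 in auto)
    finally show "Hbar (C f) = C (Hbar f)" .
  qed (use H_real in \<open>auto simp: real_op_def\<close>)
  interpret lap S pair C s D Hbar lam\<^sub>0 \<delta>\<^sub>1 k
    by unfold_locales (rule Hbar_sa lap_\<delta>\<^sub>1 \<delta>\<^sub>1_pos)+
  interpret embedded S pair C s D Hbar lam\<^sub>0 \<delta>\<^sub>1 k \<phi>\<^sub>0 \<iota> m
  proof
    show "\<phi>\<^sub>0 \<in> Vp" using eigenspace_regular eigenvector(1) s_pos by auto
    show "Hbar \<phi>\<^sub>0 = of_real (lam\<^sub>0 + 1) *\<^sub>C \<phi>\<^sub>0"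
      using Hbar[OF \<phi>_0] H\<phi> \<phi>\<phi> by (simp add: complex_vector.scale_left_distrib)
  qed (use k_ge_1 Hbar_real \<phi>_D eigenvector perturbations multiplicity spanning in auto)
  obtain z where z: "\<forall>i<m. \<forall>j<m. \<beta> (z i) (z j) = (if i = j then 1 else 0)"
    using orthonormal_family[of m] by blast
  interpret persistence S pair C s D Hbar lam\<^sub>0 \<delta>\<^sub>1 k \<phi>\<^sub>0 \<iota> m z
    by unfold_locales (use z in blast)
  \<comment> \<open>The return from \<open>Hbar\<close> to \<open>H\<close>: on \<open>D\<close> the
    added projection term cancels against the one subtracted in \<open>ES\<close>.\<close>
  have ES: "eigenspace D (\<lambda>f. H f + \<iota> W f) (of_real l) = ES l W" for l W
    unfolding ES_def eigenspace_def using Hbar by auto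
  show ?thesis
    using persistence_manifold
    unfolding persistence_set_def point_spectrum_def simple_eigenvalue_def mem_Collect_eq ES .
qed

end
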